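(* Let $(E):0\to\mathscr B\to\mathscr E\to\mathscr A\to0$ be an extension of algebras with lifting $0\to\mathscr R\to\mathscr M\to\mathscr P\to0$. Let $\tau:F^{4n+1}_{\mathscr R}X(\widehat{\mathscr M})\to\mathbb C$ be a cocycle representing an element $[\tau]\in HP^0(\mathscr B)$, and take any $[g]\in K_1(\mathscr A)$. Then $$\langle[\tau],\mathrm{Ind}_E([g])\rangle=\sqrt{2\pi i}\,\langle E^*([\tau]),[g]\rangle .$$
   Context: Algebras are associative over $\mathbb C$, not necessarily unital; $\mathscr R^+=\mathscr R\oplus\mathbb C$ is the unitalization. An extension is a short exact sequence of algebras. $X$-complex: for an algebra $\mathscr R$, $\Omega^1\mathscr R$ is the bimodule of universal one-forms with differential $\mathbf d$, $\Omega^1\mathscr R_\natural=\Omega^1\mathscr R/[\mathscr R,\Omega^1\mathscr R]$, and $\natural x_0\mathbf dx_1$ is the class of $x_0\mathbf dx_1$. $X(\mathscr R)$ is the $\mathbb Z_2$-graded complex with even part $\mathscr R$, odd part $\Omega^1\mathscr R_\natural$, and boundary $\partial=\natural\mathbf d\oplus\overline b$, where $\natural\mathbf d(x)=\natural\mathbf dx$ and $\overline b(\natural x_0\mathbf dx_1)=[x_0,x_1]$. For a two-sided ideal $\mathscr J\subset\mathscr R$, define subcomplexes (even part; odd part) $F^{2n}_{\mathscr J}X(\mathscr R):\ \mathscr J^{n+1}+[\mathscr J^n,\mathscr R]\ ;\ \natural\mathscr J^n_{(+)}\mathbf d\mathscr R$, and $F^{2n+1}_{\mathscr J}X(\mathscr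 R):\ \mathscr J^{n+1}\ ;\ \natural(\mathscr J^{n+1}_{(+)}\mathbf d\mathscr R+\mathscr J^n_{(+)}\mathbf d\mathscr J)$, where $\mathscr J^n_{(+)}=\mathscr J^n$ for $n>0$ and $\mathscr R^+$ for $n\le0$ (and $\mathscr J^0=\mathscr R$). Completions $\widehat{\mathscr R}=\varprojlim_n\mathscr R/\mathscr J^n$, $X(\widehat{\mathscr R})=\varprojlim_nX(\mathscr R)/F^n_{\mathscr J}X(\mathscr R)$ are pro-objects; a linear map $X(\widehat{\mathscr R})\to\mathbb C$ is a linear map on $X(\mathscr R)$ vanishing on $F^k_{\mathscr J}X(\mathscr R)$ for some $k\gg0$. $T\mathscr A=\mathscr A\oplus\mathscr A^{\otimes2}\oplus\cdots$ is the non-unital tensor algebra, $J\mathscr A=\ker(T\mathscr A\to\mathscr A)$ (multiplication), $\widehat T\mathscr A$ the $J\mathscr A$-adic completion, and $HP^*(\mathscr A)=H^*(X(\widehat T\mathscr A))$. Lifting: $0\to\mathscr R\to\mathscr M\to\mathscr P\to0$ is a lifting of $(E)$ if there is a commutative diagram with exact rows $0\to\mathscr J\to\mathscr N\to\mathscr Q\to0$, $0\to\mathscr R\to\mathscr M\to\mathscr P\to0$, $0\to\mathscr B\to\mathscr E\to\mathscr A\to0$ and exact columns $0\to\mathscr J\to\mathscr R\to\mathscr B\to0$, $0\to\mathscr N\to\mathscr M\to\mathscr E\to0$, $0\to\mathscr Q\to\mathscr P\to\mathscr A\to0$, all being extensions of algebras. Put $\widehat{\mathscr M}=\varprojlim_n\mathscr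 M/\mathscr N^n$, $X(\widehat{\mathscr M})=\varprojlim_nX(\mathscr M)/F^n_{\mathscr N}X(\mathscr M)$, $F^n_{\mathscr R}X(\widehat{\mathscr M})=\varprojlim_kF^n_{\mathscr R}X(\mathscr M)/(F^n_{\mathscr R}X(\mathscr M)\cap F^k_{\mathscr N}X(\mathscr M))$, $\widetilde{\mathscr M}=\varprojlim_n\mathscr M/(\mathscr R+\mathscr N)^n$, $X(\widetilde{\mathscr M})=\varprojlim_nX(\widehat{\mathscr M})/F^n_{\mathscr R}X(\widehat{\mathscr M})$. A cocycle over $F^n_{\mathscr R}X(\widehat{\mathscr M})$ is a linear map $\tau:F^n_{\mathscr R}X(\widehat{\mathscr M})\to\mathbb C$ (that is, a linear map on $F^n_{\mathscr R}X(\mathscr M)$ vanishing on $F^n_{\mathscr R}X(\mathscr M)\cap F^k_{\mathscr N}X(\mathscr M)$ for some $k\gg0$) with $\tau\partial=0$; it has even degree if it is supported on the even part. Class in $HP^i(\mathscr B)$: let $T(\mathscr B:\mathscr E)=\ker(T\mathscr E\to T\mathscr A)$. By universality of tensor algebras there is a classifying homomorphism $T\mathscr E\to\mathscr M$ (unique up to homotopy) which pulls $\tau$ back to a class in $H^i(F^n_{T(\mathscr B:\mathscr E)}X(\widehat T\mathscr E))$, $n\ge1$; the latter group is identified with $HP^i(\mathscr B)$ through the (cohomology isomorphisms induced by the) inclusions $X(\widehat T\mathscr B)\to F^1_{T(\mathscr B:\mathscr E)}X(\widehat T\mathscr E)\supset F^n_{T(\mathscr B:\mathscr E)}X(\widehat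 T\mathscr E)$. The resulting class is $[\tau]$. The map $E^*$: choose any linear extension (renormalization) $\tau_R:X(\widehat{\mathscr M})\to\mathbb C$ of $\tau$; $\tau_R\partial$ vanishes on $F^n_{\mathscr R}X(\widehat{\mathscr M})$ and so descends to a cocycle over $X(\widetilde{\mathscr M})$. Choose a linear splitting $\sigma:\mathscr A\to\mathscr M$ of $\mathscr M\to\mathscr A$; the homomorphism $\sigma_*(a_1\otimes\cdots\otimes a_k)=\sigma(a_1)\cdots\sigma(a_k)$ induces $\widehat T\mathscr A\to\widetilde{\mathscr M}$. Then $E^*([\tau])\in HP^{i+1}(\mathscr A)$ is the class of $\tau_R\partial\circ\sigma_*:X(\widehat T\mathscr A)\to\mathbb C$ (independent of the choices). $K$-theory (algebraic): $GL_\infty(\mathscr A)=\varinjlim GL_N(\mathscr A)$ with $GL_N(\mathscr A)$ the group of invertible $g\in M_N(\mathscr A^+)$ with $g-1\in M_N(\mathscr A)$; $K_1(\mathscr A)$ is its abelianization. $K_0(\mathscr B)$ is the usual algebraic $K_0$ of a non-unital algebra, with elements $[e]-[p_N]$, $e\in M_\infty(\mathscr B^+)$ idempotent, $p_N=\mathrm{diag}(1_N,0)$, $e-p_N\in M_\infty(\mathscr B)$. Index map: for $g\in GL_N(\mathscr A)$ choose lifts $Q,P\in M_N(\mathscr E^+)$ of $g,g^{-1}$; set $G=\begin{pmatrix} Q & 1-QP \\ P Q-1 & P+P(1-QP) \end{pmatrix}$ (invertible); then $\mathrm{Ind}_E([g])=[G^{-1}p_NG]-[p_N]\in K_0(\mathscr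 B)$. Pairings (with $\mathrm{tr}$ the matrix trace and $\#$ the cup-product extending cocycles to matrices): for $\tau:F^{4n+1}_{\mathscr R}X(\widehat{\mathscr M})\to\mathbb C$ of even degree, $\langle[\tau],[e]-[p_N]\rangle=\tau\#\mathrm{tr}((\hat e-p_N)^{2n+1})$, where $\hat e\in M_\infty(\widehat{\mathscr R}^+)$ is any idempotent lifting $e$, $\widehat{\mathscr R}=\varprojlim_k\mathscr R/(\mathscr R\cap\mathscr N^k)$. For $\varphi:X(\widehat T\mathscr A)\to\mathbb C$ an odd cocycle, $\langle[\varphi],[g]\rangle=\frac1{\sqrt{2\pi i}}\,\varphi\#\mathrm{tr}(\natural\hat g^{-1}\mathbf d\hat g)$, where $\hat g\in GL_\infty(\widehat T\mathscr A)$ is any invertible lifting of $g$. *)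

theory Defs
  imports
    Complex_Main
    "HOL-Library.Poly_Mapping"
    "HOL-Algebra.Generated_Groups"
    "HOL-Algebra.Coset"
    "Jordan_Normal_Form.Matrix"
begin

section \<open>Complex algebras, not necessarily unital\<close>

class complex_vec = ab_group_add +
  fixes scaleC :: "complex \<Rightarrow> 'a \<Rightarrow> 'a"  (infixr \<open>*\<^sub>C\<close> 75)
  assumes scaleC_add_right: "c *\<^sub>C (x + y) = c *\<^sub>C x + c *\<^sub>C y"
    and scaleC_add_left: "(c + d) *\<^sub>C x = c *\<^sub>C x + d *\<^sub>C x"
    and scaleC_scaleC: "c *\<^sub>C d *\<^sub>C x = (c * d) *\<^sub>C x"
    and scaleC_one: "1 *\<^sub>C x = x"

interpretation cvec: vector_space "scaleC :: complex \<Rightarrow> 'a::complex_vec \<Rightarrow> 'a"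
  by unfold_locales (simp_all add: scaleC_add_right scaleC_add_left scaleC_scaleC scaleC_one)

class complex_alg = complex_vec + ring +
  assumes mult_scaleC_left: "(c *\<^sub>C x) * y = c *\<^sub>C (x * y)"
    and mult_scaleC_right: "x * (c *\<^sub>C y) = c *\<^sub>C (x * y)"

instantiation complex :: complex_alg
begin
definition "scaleC_complex = ((*) :: complex \<Rightarrow> complex \<Rightarrow> complex)"
instance by standard (simp_all add: scaleC_complex_def algebra_simps)
end

abbreviation clinear :: "('x::complex_vec \<Rightarrow> 'y::complex_vec) \<Rightarrow> bool"
  where "clinear \<equiv> Vector_Spaces.linear scaleC scaleC"

definition alg_hom :: "('x::complex_alg \<Rightarrow> 'y::complex_alg) \<Rightarrow> bool"
  where "alg_hom f \<longleftrightarrow> clinear f \<and> (\<forall>x y. f (x * y) = f x * f y)"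

definition extension :: "('i::complex_alg \<Rightarrow> 'x::complex_alg) \<Rightarrow> ('x \<Rightarrow> 'y::complex_alg) \<Rightarrow> bool"
  where "extension i p \<longleftrightarrow>
    alg_hom i \<and> alg_hom p \<and> inj i \<and> range i = {x. p x = 0} \<and> surj p"

definition lifting ::
  "('j::complex_alg \<Rightarrow> 'n::complex_alg) \<Rightarrow> ('n \<Rightarrow> 'q::complex_alg) \<Rightarrow>
   ('r::complex_alg \<Rightarrow> 'm::complex_alg) \<Rightarrow> ('m \<Rightarrow> 'p::complex_alg) \<Rightarrow>
   ('b::complex_alg \<Rightarrow> 'e::complex_alg) \<Rightarrow> ('e \<Rightarrow> 'a::complex_alg) \<Rightarrow>
   ('j \<Rightarrow> 'r) \<Rightarrow> ('r \<Rightarrow> 'b) \<Rightarrow> ('n \<Rightarrow> 'm) \<Rightarrow> ('m \<Rightarrow> 'e) \<Rightarrow> ('q \<Rightarrow> 'p) \<Rightarrow> ('p \<Rightarrow> 'a) \<Rightarrow> bool"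
  where "lifting jn nq rm mp be ea jr rb nm me qp pa \<longleftrightarrow>
    extension jn nq \<and> extension rm mp \<and> extension be ea \<and>
    extension jr rb \<and> extension nm me \<and> extension qp pa \<and>
    nm \<circ> jn = rm \<circ> jr \<and> qp \<circ> nq = mp \<circ> nm \<and>
    me \<circ> rm = be \<circ> rb \<and> pa \<circ> mp = ea \<circ> me"

subsection \<open>Unitalization\<close>

datatype 'a unitz = Unitz (alg_part: 'a) (scal_part: complex)

instantiation unitz :: (complex_alg) "{ring_1, complex_alg}"
begin
definition "0 = Unitz 0 0"
definition "1 = Unitz 0 1"
definition "x + y = Unitz (alg_part x + alg_part y) (scal_part x + scal_part y)"
definition "- x = Unitz (- alg_part x) (- scal_part x)"
definition "x - y = Unitz (alg_part x - alg_part y) (scal_part x - scal_part y)"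
definition "x * y = Unitz
  (alg_part x * alg_part y + scal_part y *\<^sub>C alg_part x + scal_part x *\<^sub>C alg_part y)
  (scal_part x * scal_part y)"
definition "c *\<^sub>C x = Unitz (c *\<^sub>C alg_part x) (c * scal_part x)"
instance
  by standard
    (auto simp: zero_unitz_def one_unitz_def plus_unitz_def uminus_unitz_def minus_unitz_def
      times_unitz_def scaleC_unitz_def algebra_simps mult_scaleC_left mult_scaleC_right
      scaleC_add_right scaleC_add_left scaleC_scaleC scaleC_one intro: unitz.expand)
end

definition of_alg :: "'a::complex_alg \<Rightarrow> 'a unitz"
  where "of_alg x = Unitz x 0"

definition unitz_map :: "('x \<Rightarrow> 'y) \<Rightarrow> 'x unitz \<Rightarrow> 'y unitz"
  where "unitz_map f x = Unitz (f (alg_part x)) (scal_part x)"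

section \<open>Free vector spaces\<close>

instantiation poly_mapping :: (type, complex_vec) complex_vec
begin
lift_definition scaleC_poly_mapping :: "complex \<Rightarrow> ('a \<Rightarrow>\<^sub>0 'b) \<Rightarrow> 'a \<Rightarrow>\<^sub>0 'b"
  is "\<lambda>c f k. c *\<^sub>C f k"
  by (rule finite_subset[rotated]) auto
instance
  by standard (transfer; simp add: fun_eq_iff scaleC_add_right scaleC_add_left scaleC_scaleC scaleC_one)+
end

abbreviation gen :: "'k \<Rightarrow> 'k \<Rightarrow>\<^sub>0 complex"
  where "gen k \<equiv> Poly_Mapping.single k 1"

definition lin_ext :: "('k \<Rightarrow> 'v::complex_vec) \<Rightarrow> ('k \<Rightarrow>\<^sub>0 complex) \<Rightarrow> 'v"
  where "lin_ext h f = (\<Sum>k\<in>Poly_Mapping.keys f. Poly_Mapping.lookup f k *\<^sub>C h k)"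

lemma lin_ext_superset:
  assumes "finite S" "Poly_Mapping.keys f \<subseteq> S"
  shows "lin_ext h f = (\<Sum>k\<in>S. Poly_Mapping.lookup f k *\<^sub>C h k)"
  unfolding lin_ext_def using assms
  by (intro sum.mono_neutral_left) (auto simp: in_keys_iff)

lemma lin_ext_add: "lin_ext h (f + g) = lin_ext h f + lin_ext h g"
proof -
  let ?S = "Poly_Mapping.keys f \<union> Poly_Mapping.keys g"
  have "Poly_Mapping.keys (f + g) \<subseteq> ?S" by (rule Poly_Mapping.keys_add)
  then show ?thesis
    by (simp add: lin_ext_superset[of ?S] lookup_add scaleC_add_left sum.distrib)
qed

lemma lookup_scaleC: "Poly_Mapping.lookup (c *\<^sub>C f) k = c *\<^sub>C Poly_Mapping.lookup f k"
  by transfer simp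

lemma lin_ext_scaleC: "lin_ext h (c *\<^sub>C f) = c *\<^sub>C lin_ext h f"
proof -
  have "Poly_Mapping.keys (c *\<^sub>C f) \<subseteq> Poly_Mapping.keys f"
    by (auto simp: in_keys_iff lookup_scaleC)
  then show ?thesis
    by (simp add: lin_ext_superset[of "Poly_Mapping.keys f"] lookup_scaleC cvec.scale_sum_right
        scaleC_complex_def)
qed

lemma clinear_lin_ext: "clinear (lin_ext h)"
  by unfold_locales (simp_all add: lin_ext_add lin_ext_scaleC)

lemma lin_ext_gen [simp]: "lin_ext h (gen k) = h k"
  by (simp add: lin_ext_def scaleC_one)

lemma lin_ext_gen_id: "lin_ext gen f = f"
proof (rule poly_mapping_eqI)
  fix k
  have "Poly_Mapping.lookup (lin_ext gen f) k =
      (\<Sum>i\<in>Poly_Mapping.keys f. Poly_Mapping.lookup f i * (1 when i = k))"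
    by (simp add: lin_ext_def lookup_sum lookup_scaleC scaleC_complex_def lookup_single)
  also have "\<dots> = (\<Sum>i\<in>Poly_Mapping.keys f. if i = k then Poly_Mapping.lookup f i else 0)"
    by (rule sum.cong) (auto simp: when_def)
  also have "\<dots> = Poly_Mapping.lookup f k"
    by (simp add: in_keys_iff)
  finally show "Poly_Mapping.lookup (lin_ext gen f) k = Poly_Mapping.lookup f k" .
qed

lemma span_gen: "f \<in> cvec.span (range gen)"
proof -
  have "lin_ext gen f \<in> cvec.span (range gen)"
    unfolding lin_ext_def by (intro cvec.span_sum cvec.span_scale cvec.span_base) auto
  then show ?thesis by (simp add: lin_ext_gen_id)
qed

lemma clinear_image_span:
  assumes "clinear h" "x \<in> cvec.span S" "\<And>s. s \<in> S \<Longrightarrow> h s \<in> cvec.span T"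
  shows "h x \<in> cvec.span T"
proof -
  interpret h: Vector_Spaces.linear scaleC scaleC h by fact
  have "h x \<in> h ` cvec.span S" using assms(2) by blast
  also have "\<dots> = cvec.span (h ` S)" by (simp add: h.span_image)
  also have "\<dots> \<subseteq> cvec.span T"
    by (rule cvec.span_minimal) (use assms(3) in auto)
  finally show ?thesis .
qed

section \<open>The \<open>X\<close>-complex\<close>

subsection \<open>Universal one-forms\<close>

text \<open>As a vector space, $\Omega^1 R = R^+ \otimes R$ with $x_0 \otimes x_1 = x_0\,\mathbf d x_1$;
  it is built as the free vector space on pairs modulo bilinearity.\<close>

definition bilin_gens :: "(('r::complex_alg unitz \<times> 'r) \<Rightarrow>\<^sub>0 complex) set"
  where "bilin_gens =
    {gen (x + x', y) - gen (x, y) - gen (x', y) | x x' y. True} \<union>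
    {gen (x, y + y') - gen (x, y) - gen (x, y') | x y y'. True} \<union>
    {gen (c *\<^sub>C x, y) - c *\<^sub>C gen (x, y) | c x y. True} \<union>
    {gen (x, c *\<^sub>C y) - c *\<^sub>C gen (x, y) | c x y. True}"

lemma equivp_span: "equivp (\<lambda>f g. f - g \<in> cvec.span S)"
proof (rule equivpI)
  show "reflp (\<lambda>f g. f - g \<in> cvec.span S)" by (simp add: reflp_def cvec.span_zero)
  show "symp (\<lambda>f g. f - g \<in> cvec.span S)"
    by (auto simp: symp_def dest: cvec.span_neg)
  show "transp (\<lambda>f g. f - g \<in> cvec.span S)"
    by (auto simp: transp_def dest: cvec.span_add)
qed

lemma span_quot_add: "a - b \<in> cvec.span S \<Longrightarrow> c - d \<in> cvec.span S \<Longrightarrow> (a + c) - (b + d) \<in> cvec.span S"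
  by (drule (1) cvec.span_add) (simp add: algebra_simps)

lemma span_quot_diff: "a - b \<in> cvec.span S \<Longrightarrow> c - d \<in> cvec.span S \<Longrightarrow> (a - c) - (b - d) \<in> cvec.span S"
  by (drule (1) cvec.span_diff) (simp add: algebra_simps)

lemma span_quot_neg: "a - b \<in> cvec.span S \<Longrightarrow> (- a) - (- b) \<in> cvec.span S"
  by (drule cvec.span_neg) (simp add: algebra_simps)

lemma span_quot_scale: "a - b \<in> cvec.span S \<Longrightarrow> c *\<^sub>C a - c *\<^sub>C b \<in> cvec.span S"
  by (drule cvec.span_scale[where c = c]) (simp add: cvec.scale_right_diff_distrib)

quotient_type (overloaded) 'r forms = "(('r::complex_alg unitz) \<times> 'r) \<Rightarrow>\<^sub>0 complex" /
  "\<lambda>f g. f - g \<in> cvec.span bilin_gens"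
  by (rule equivp_span)

instantiation forms :: (complex_alg) complex_vec
begin
lift_definition zero_forms :: "'a forms" is 0 .
lift_definition plus_forms :: "'a forms \<Rightarrow> 'a forms \<Rightarrow> 'a forms" is "(+)" by (rule span_quot_add)
lift_definition minus_forms :: "'a forms \<Rightarrow> 'a forms \<Rightarrow> 'a forms" is "(-)" by (rule span_quot_diff)
lift_definition uminus_forms :: "'a forms \<Rightarrow> 'a forms" is uminus by (rule span_quot_neg)
lift_definition scaleC_forms :: "complex \<Rightarrow> 'a forms \<Rightarrow> 'a forms" is scaleC by (rule span_quot_scale)
instance
  by standard (transfer; simp add: algebra_simps cvec.span_zero scaleC_add_right scaleC_add_left
      scaleC_scaleC scaleC_one)+
end

lift_definition form :: "'r::complex_alg unitz \<Rightarrow> 'r \<Rightarrow> 'r forms"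
  is "\<lambda>x0 x1. gen (x0, x1)" .

definition d_form :: "'r::complex_alg \<Rightarrow> 'r forms"
  where "d_form x = form 1 x"

lemma lin_ext_quot:
  assumes "f - g \<in> cvec.span S" "\<And>s. s \<in> S \<Longrightarrow> lin_ext h s \<in> cvec.span T"
  shows "lin_ext h f - lin_ext h g \<in> cvec.span T"
proof -
  interpret h: Vector_Spaces.linear scaleC scaleC "lin_ext h" by (rule clinear_lin_ext)
  show ?thesis using clinear_image_span[OF clinear_lin_ext assms] by (simp add: h.diff)
qed

lemma lin_ext_diff: "lin_ext h (f - g) = lin_ext h f - lin_ext h g"
proof -
  interpret h: Vector_Spaces.linear scaleC scaleC "lin_ext h" by (rule clinear_lin_ext)
  show ?thesis by (rule h.diff)
qed

lemma lin_ext_bilin_gens: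
  assumes "\<And>x x' y. h (x + x') y - h x y - h x' y \<in> cvec.span T"
    and "\<And>x y y'. h x (y + y') - h x y - h x y' \<in> cvec.span T"
    and "\<And>c x y. h (c *\<^sub>C x) y - c *\<^sub>C h x y \<in> cvec.span T"
    and "\<And>c x y. h x (c *\<^sub>C y) - c *\<^sub>C h x y \<in> cvec.span T"
    and "s \<in> bilin_gens"
  shows "lin_ext (\<lambda>(x, y). h x y) s \<in> cvec.span T"
  using assms unfolding bilin_gens_def
  by (auto simp: lin_ext_diff lin_ext_scaleC)

lemma bilin_gens_span:
  "gen (x + x', y) - gen (x, y) - gen (x', y) \<in> cvec.span bilin_gens"
  "gen (x, y + y') - gen (x, y) - gen (x, y') \<in> cvec.span bilin_gens"
  "gen (c *\<^sub>C x, y) - c *\<^sub>C gen (x, y) \<in> cvec.span bilin_gens"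
  "gen (x, c *\<^sub>C y) - c *\<^sub>C gen (x, y) \<in> cvec.span bilin_gens"
  unfolding bilin_gens_def by (rule cvec.span_base, blast)+

text \<open>Bimodule structure: $r(x_0\,\mathbf d x_1) = (r x_0)\,\mathbf d x_1$ and, by the Leibniz rule,
  $(x_0\,\mathbf d x_1) r = x_0\,\mathbf d(x_1 r) - x_0 x_1\,\mathbf d r$.\<close>

lift_definition lmul_form :: "'r::complex_alg \<Rightarrow> 'r forms \<Rightarrow> 'r forms"
  is "\<lambda>r. lin_ext (\<lambda>(x0, x1). gen (of_alg r * x0, x1))"
  apply (erule lin_ext_quot)
  apply (erule lin_ext_bilin_gens[rotated 4])
     apply (simp_all add: distrib_left mult_scaleC_right bilin_gens_span)
  done

lemma of_alg_add: "of_alg (x + y) = of_alg x + of_alg y"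
  and of_alg_scaleC: "of_alg (c *\<^sub>C x) = c *\<^sub>C of_alg x"
  and of_alg_mult: "of_alg (x * y) = of_alg x * of_alg y"
  by (simp_all add: of_alg_def plus_unitz_def scaleC_unitz_def times_unitz_def)

lift_definition rmul_form :: "'r::complex_alg \<Rightarrow> 'r forms \<Rightarrow> 'r forms"
  is "\<lambda>r. lin_ext (\<lambda>(x0, x1). gen (x0, x1 * r) - gen (x0 * of_alg x1, r))"
proof (erule lin_ext_quot, erule lin_ext_bilin_gens[rotated 4])
  fix r :: 'r and x x' :: "'r unitz" and y y' :: 'r and c :: complex
  let ?h = "\<lambda>x y. gen (x, y * r) - gen (x * of_alg y, r)"
  note * = cvec.span_diff[OF bilin_gens_span(1) bilin_gens_span(1)]
    cvec.span_diff[OF bilin_gens_span(2) bilin_gens_span(1)]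
    cvec.span_diff[OF bilin_gens_span(3) bilin_gens_span(3)]
    cvec.span_diff[OF bilin_gens_span(4) bilin_gens_span(3)]
  show "?h (x + x') y - ?h x y - ?h x' y \<in> cvec.span bilin_gens"
    using *(1)[of x x' "y * r" "x * of_alg y" "x' * of_alg y" r]
    by (simp add: algebra_simps)
  show "?h x (y + y') - ?h x y - ?h x y' \<in> cvec.span bilin_gens"
    using *(2)[of x "y * r" "y' * r" "x * of_alg y" "x * of_alg y'" r]
    by (simp add: algebra_simps of_alg_add)
  show "?h (c *\<^sub>C x) y - c *\<^sub>C ?h x y \<in> cvec.span bilin_gens"
    using *(3)[of c x "y * r" c "x * of_alg y" r]
    by (simp add: algebra_simps mult_scaleC_left cvec.scale_right_diff_distrib)
  show "?h x (c *\<^sub>C y) - c *\<^sub>C ?h x y \<in> cvec.span bilin_gens"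
    using *(4)[of x c "y * r" c "x * of_alg y" r]
    by (simp add: algebra_simps mult_scaleC_left mult_scaleC_right of_alg_scaleC
        cvec.scale_right_diff_distrib)
qed

lemma lmul_form_form: "lmul_form r (form x0 x1) = form (of_alg r * x0) x1"
  by transfer (simp add: cvec.span_zero)

lemma rmul_form_form: "rmul_form r (form x0 x1) = form x0 (x1 * r) - form (x0 * of_alg x1) r"
  by transfer (simp add: cvec.span_zero)

subsection \<open>Commutator quotient and boundary maps\<close>

definition commutator_plus :: "'r::complex_alg unitz \<Rightarrow> 'r \<Rightarrow> 'r"
  where "commutator_plus x0 x1 = alg_part (x0 * of_alg x1 - of_alg x1 * x0)"

lemma commutator_plus_eq: "commutator_plus x0 x1 = alg_part x0 * x1 - x1 * alg_part x0"
  by (simp add: commutator_plus_def of_alg_def times_unitz_def minus_unitz_def)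

lift_definition b_form :: "'r::complex_alg forms \<Rightarrow> 'r"
  is "lin_ext (\<lambda>(x0, x1). commutator_plus x0 x1)"
proof -
  fix f g :: "('r unitz \<times> 'r) \<Rightarrow>\<^sub>0 complex"
  assume "f - g \<in> cvec.span bilin_gens"
  then have "lin_ext (\<lambda>(x0, x1). commutator_plus x0 x1) f - lin_ext (\<lambda>(x0, x1). commutator_plus x0 x1) g
      \<in> cvec.span {}"
    by (rule lin_ext_quot, elim lin_ext_bilin_gens[rotated 4])
      (simp_all add: commutator_plus_eq plus_unitz_def scaleC_unitz_def algebra_simps
        mult_scaleC_left mult_scaleC_right cvec.scale_right_diff_distrib)
  then show "lin_ext (\<lambda>(x0, x1). commutator_plus x0 x1) f = lin_ext (\<lambda>(x0, x1). commutator_plus x0 x1) g"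
    by simp
qed

lemma clinear_b_form: "clinear b_form"
  by unfold_locales (transfer; simp add: lin_ext_add lin_ext_scaleC)+

lemma clinear_lmul_form: "clinear (lmul_form r)"
  by unfold_locales (transfer; simp add: lin_ext_add lin_ext_scaleC cvec.span_zero)+

lemma clinear_rmul_form: "clinear (rmul_form r)"
  by unfold_locales (transfer; simp add: lin_ext_add lin_ext_scaleC cvec.span_zero)+

lemma b_form_form: "b_form (form x0 x1) = commutator_plus x0 x1"
  by transfer simp

lemma span_form: "\<omega> \<in> cvec.span {form x0 x1 | x0 x1. True}"
proof (induction \<omega> rule: forms.abs_induct)
  case (1 f)
  have lin: "clinear abs_forms"
    by unfold_locales (simp_all add: plus_forms.abs_eq scaleC_forms.abs_eq)
  show ?case
  proof (rule clinear_image_span[OF lin span_gen])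
    fix s :: "('a unitz \<times> 'a) \<Rightarrow>\<^sub>0 complex"
    assume "s \<in> range gen"
    then obtain x0 x1 where "abs_forms s = form x0 x1"
      by (metis form.abs_eq imageE surj_pair)
    then show "abs_forms s \<in> cvec.span {form x0 x1 | x0 x1. True}"
      by (auto intro: cvec.span_base)
  qed
qed

lemma b_form_commutator: "b_form (lmul_form r \<omega>) = b_form (rmul_form r \<omega>)"
proof -
  interpret b: Vector_Spaces.linear scaleC scaleC b_form by (rule clinear_b_form)
  interpret l: Vector_Spaces.linear scaleC scaleC "lmul_form r" by (rule clinear_lmul_form)
  interpret r: Vector_Spaces.linear scaleC scaleC "rmul_form r" by (rule clinear_rmul_form)
  show ?thesis using span_form[of \<omega>]
  proof (induction rule: cvec.span_induct_alt)
    case base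
    show ?case by simp
  next
    case (step c x y)
    then obtain x0 x1 where "x = form x0 x1" by auto
    then have "b_form (lmul_form r x) = b_form (rmul_form r x)"
      by (simp add: lmul_form_form rmul_form_form b.diff b_form_form commutator_plus_eq
          of_alg_def times_unitz_def algebra_simps mult_scaleC_left mult_scaleC_right)
    with step show ?case by (simp add: l.add l.scale r.add r.scale b.add b.scale)
  qed
qed

lifting_forget forms.lifting

definition form_commutators :: "'r::complex_alg forms set"
  where "form_commutators = {lmul_form r \<omega> - rmul_form r \<omega> | r \<omega>. True}"

quotient_type (overloaded) 'r forms_nat = "'r::complex_alg forms" /
  "\<lambda>f g. f - g \<in> cvec.span form_commutators"
  by (rule equivp_span)

instantiation forms_nat :: (complex_alg) complex_vec
begin
lift_definition zero_forms_nat :: "'a forms_nat" is 0 .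
lift_definition plus_forms_nat :: "'a forms_nat \<Rightarrow> 'a forms_nat \<Rightarrow> 'a forms_nat" is "(+)" by (rule span_quot_add)
lift_definition minus_forms_nat :: "'a forms_nat \<Rightarrow> 'a forms_nat \<Rightarrow> 'a forms_nat" is "(-)" by (rule span_quot_diff)
lift_definition uminus_forms_nat :: "'a forms_nat \<Rightarrow> 'a forms_nat" is uminus by (rule span_quot_neg)
lift_definition scaleC_forms_nat :: "complex \<Rightarrow> 'a forms_nat \<Rightarrow> 'a forms_nat" is scaleC by (rule span_quot_scale)
instance
  by standard (transfer; simp add: algebra_simps cvec.span_zero scaleC_add_right scaleC_add_left
      scaleC_scaleC scaleC_one)+
end

lift_definition nat_proj :: "'r::complex_alg forms \<Rightarrow> 'r forms_nat"
  is "\<lambda>\<omega>. \<omega>" .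

abbreviation nat_form :: "'r::complex_alg unitz \<Rightarrow> 'r \<Rightarrow> 'r forms_nat"
  where "nat_form x0 x1 \<equiv> nat_proj (form x0 x1)"

definition nat_d :: "'r::complex_alg \<Rightarrow> 'r forms_nat"
  where "nat_d x = nat_proj (d_form x)"

lift_definition b_bar :: "'r::complex_alg forms_nat \<Rightarrow> 'r"
  is b_form
proof -
  fix f g :: "'r forms"
  interpret b: Vector_Spaces.linear scaleC scaleC "b_form :: 'r forms \<Rightarrow> 'r" by (rule clinear_b_form)
  assume "f - g \<in> cvec.span form_commutators"
  then have "b_form (f - g) \<in> cvec.span {}"
    by (rule clinear_image_span[OF clinear_b_form])
      (auto simp: form_commutators_def b.diff b_form_commutator)
  then show "b_form f = b_form g" by (simp add: b.diff)
qed

lemma b_bar_form: "b_bar (nat_form x0 x1) = alg_part x0 * x1 - x1 * alg_part x0"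
  by transfer (simp add: b_form_form commutator_plus_eq)

subsection \<open>The adic filtration\<close>

fun ideal_pow :: "'r::complex_alg set \<Rightarrow> nat \<Rightarrow> 'r set"
  where
    "ideal_pow J 0 = UNIV"
  | "ideal_pow J (Suc 0) = J"
  | "ideal_pow J (Suc (Suc n)) = cvec.span {x * y | x y. x \<in> ideal_pow J (Suc n) \<and> y \<in> J}"

definition ideal_pow_plus :: "'r::complex_alg set \<Rightarrow> nat \<Rightarrow> 'r unitz set"
  where "ideal_pow_plus J n = (if n = 0 then UNIV else of_alg ` ideal_pow J n)"

definition nat_forms_on :: "'r::complex_alg unitz set \<Rightarrow> 'r set \<Rightarrow> 'r forms_nat set"
  where "nat_forms_on S T = cvec.span {nat_form x y | x y. x \<in> S \<and> y \<in> T}"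

definition F_even :: "'r::complex_alg set \<Rightarrow> nat \<Rightarrow> 'r set"
  where "F_even J m =
    (let n = m div 2 in
     if even m
     then cvec.span (ideal_pow J (n + 1) \<union> {x * y - y * x | x y. x \<in> ideal_pow J n})
     else ideal_pow J (n + 1))"

definition F_odd :: "'r::complex_alg set \<Rightarrow> nat \<Rightarrow> 'r forms_nat set"
  where "F_odd J m =
    (let n = m div 2 in
     if even m
     then nat_forms_on (ideal_pow_plus J n) UNIV
     else cvec.span (nat_forms_on (ideal_pow_plus J (n + 1)) UNIV \<union> nat_forms_on (ideal_pow_plus J n) J))"

text \<open>Odd part of the chain map induced by an algebra homomorphism \<open>\<rho>\<close>. It is computed on a
  representative; for homomorphisms the result does not depend on it, see \<open>X_odd_map_form\<close> below.\<close>

definition X_odd_map :: "('r \<Rightarrow> 's) \<Rightarrow> 'r::complex_alg forms_nat \<Rightarrow> 's::complex_alg forms_nat"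
  where "X_odd_map \<rho> \<omega> =
    lin_ext (\<lambda>(x0, x1). nat_form (unitz_map \<rho> x0) (\<rho> x1)) (rep_forms (rep_forms_nat \<omega>))"

section \<open>Tensor algebra\<close>

datatype 'a word = Word (letters: "'a list")

instantiation word :: (type) monoid_add
begin
definition "0 = Word []"
definition "u + v = Word (letters u @ letters v)"
instance by standard (auto simp: zero_word_def plus_word_def)
end

text \<open>The ring structure on \<^typ>\<open>'a word \<Rightarrow>\<^sub>0 complex\<close> is that of the free unital algebra on the set
  \<^typ>\<open>'a\<close>. The non-unital tensor algebra is the span of the non-empty words modulo multilinearity;
  the word with letters $a_1, \dots, a_k$ represents $a_1 \otimes \dots \otimes a_k$.\<close>

definition multilin_gens :: "('a::complex_vec word \<Rightarrow>\<^sub>0 complex) set"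
  where "multilin_gens =
    {gen (u + Word [x + y] + v) - gen (u + Word [x] + v) - gen (u + Word [y] + v) | u v x y. True} \<union>
    {gen (u + Word [c *\<^sub>C x] + v) - c *\<^sub>C gen (u + Word [x] + v) | u v c x. True}"

definition nonempty_words :: "('a word \<Rightarrow>\<^sub>0 complex) set"
  where "nonempty_words = cvec.span {gen w | w. w \<noteq> 0}"

definition tensor_rel :: "('a::complex_vec word \<Rightarrow>\<^sub>0 complex) \<Rightarrow> ('a word \<Rightarrow>\<^sub>0 complex) \<Rightarrow> bool"
  where "tensor_rel f g \<longleftrightarrow> f \<in> nonempty_words \<and> g \<in> nonempty_words \<and> f - g \<in> cvec.span multilin_gens"


lemma scaleC_single: "c *\<^sub>C Poly_Mapping.single k d = Poly_Mapping.single k (c * d :: complex)"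
  by (rule poly_mapping_eqI) (simp add: lookup_scaleC scaleC_complex_def lookup_single when_def)

lemma scaleC_eq_times:
  fixes f :: "'k::monoid_add \<Rightarrow>\<^sub>0 complex"
  shows "c *\<^sub>C f = Poly_Mapping.single 0 c * f" and "c *\<^sub>C f = f * Poly_Mapping.single 0 c"
proof -
  have "c *\<^sub>C f = Poly_Mapping.single 0 c * f \<and> c *\<^sub>C f = f * Poly_Mapping.single 0 c"
    using span_gen[of f]
  proof (induction rule: cvec.span_induct_alt)
    case base
    show ?case by simp
  next
    case (step d x y)
    then obtain k where "x = gen k" by auto
    then have "c *\<^sub>C d *\<^sub>C x = Poly_Mapping.single 0 c * (d *\<^sub>C x) \<and>
        c *\<^sub>C d *\<^sub>C x = (d *\<^sub>C x) * Poly_Mapping.single 0 c"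
      by (simp add: scaleC_single mult_single mult.commute)
    with step show ?case by (simp only: scaleC_add_right distrib_left distrib_right) metis
  qed
  then show "c *\<^sub>C f = Poly_Mapping.single 0 c * f" "c *\<^sub>C f = f * Poly_Mapping.single 0 c" by auto
qed

lemma scaleC_times_left: "(c *\<^sub>C f) * g = c *\<^sub>C (f * (g :: 'k::monoid_add \<Rightarrow>\<^sub>0 complex))"
  by (simp add: scaleC_eq_times(1) mult.assoc)

lemma scaleC_times_right: "f * (c *\<^sub>C g) = c *\<^sub>C (f * (g :: 'k::monoid_add \<Rightarrow>\<^sub>0 complex))"
  by (simp add: scaleC_eq_times(2) mult.assoc)

lemma clinear_times_left: "clinear (\<lambda>f. f * (g :: 'k::monoid_add \<Rightarrow>\<^sub>0 complex))"
  by unfold_locales (simp_all add: distrib_right scaleC_times_left)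

lemma clinear_times_right: "clinear ((*) (f :: 'k::monoid_add \<Rightarrow>\<^sub>0 complex))"
  by unfold_locales (simp_all add: distrib_left scaleC_times_right)

lemma span_times:
  fixes x y :: "'k::monoid_add \<Rightarrow>\<^sub>0 complex"
  assumes "x \<in> cvec.span S" "y \<in> cvec.span T"
    and "\<And>s t. s \<in> S \<Longrightarrow> t \<in> T \<Longrightarrow> s * t \<in> cvec.span U"
  shows "x * y \<in> cvec.span U"
proof (rule clinear_image_span[OF clinear_times_left assms(1)])
  fix s assume "s \<in> S"
  then show "s * y \<in> cvec.span U"
    using clinear_image_span[OF clinear_times_right assms(2)] assms(3) by blast
qed

lemma gen_times: "gen u * gen v = gen (u + v)"
  by (simp add: mult_single)

lemma word_add_nonzero: "u \<noteq> 0 \<Longrightarrow> u + v \<noteq> (0 :: 'a word)"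
  by (cases u) (simp add: zero_word_def plus_word_def)

lemma nonempty_words_times:
  "f \<in> nonempty_words \<Longrightarrow> g \<in> nonempty_words \<Longrightarrow> f * g \<in> nonempty_words"
  unfolding nonempty_words_def
  by (erule (1) span_times)
    (use gen_times word_add_nonzero in \<open>blast intro: cvec.span_base\<close>)

lemma multilin_times_left: "f \<in> cvec.span multilin_gens \<Longrightarrow> f * g \<in> cvec.span multilin_gens"
proof (erule span_times[OF _ span_gen[of g]])
  fix s t :: "'a word \<Rightarrow>\<^sub>0 complex"
  assume "s \<in> multilin_gens" "t \<in> range gen"
  then have "s * t \<in> multilin_gens"
    unfolding multilin_gens_def
    by (auto simp: left_diff_distrib gen_times scaleC_times_left add.assoc) blast+
  then show "s * t \<in> cvec.span multilin_gens" by (rule cvec.span_base)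
qed

lemma multilin_times_right: "g \<in> cvec.span multilin_gens \<Longrightarrow> f * g \<in> cvec.span multilin_gens"
proof (erule span_times[OF span_gen[of f]])
  fix s t :: "'a word \<Rightarrow>\<^sub>0 complex"
  assume "s \<in> range gen" "t \<in> multilin_gens"
  then have "s * t \<in> multilin_gens"
    unfolding multilin_gens_def
    by (auto simp: right_diff_distrib gen_times scaleC_times_right add.assoc[symmetric]) blast+
  then show "s * t \<in> cvec.span multilin_gens" by (rule cvec.span_base)
qed

lemma part_equivp_tensor_rel: "part_equivp tensor_rel"
proof (rule part_equivpI)
  show "\<exists>x. tensor_rel x x"
    by (rule exI[of _ 0]) (simp add: tensor_rel_def nonempty_words_def cvec.span_zero)
  show "symp tensor_rel"
    by (auto simp: symp_def tensor_rel_def dest: cvec.span_neg)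
  show "transp tensor_rel"
    by (auto simp: transp_def tensor_rel_def dest: cvec.span_add)
qed

quotient_type (overloaded) 'a tensor = "'a::complex_vec word \<Rightarrow>\<^sub>0 complex" / partial: tensor_rel
  by (rule part_equivp_tensor_rel)

instantiation tensor :: (complex_vec) complex_alg
begin
lift_definition zero_tensor :: "'a tensor" is 0
  by (simp add: tensor_rel_def nonempty_words_def cvec.span_zero)
lift_definition plus_tensor :: "'a tensor \<Rightarrow> 'a tensor \<Rightarrow> 'a tensor" is "(+)"
  unfolding tensor_rel_def nonempty_words_def
  by (intro conjI span_quot_add cvec.span_add; blast)
lift_definition minus_tensor :: "'a tensor \<Rightarrow> 'a tensor \<Rightarrow> 'a tensor" is "(-)"
  unfolding tensor_rel_def nonempty_words_def
  by (blast intro: span_quot_diff cvec.span_diff)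
lift_definition uminus_tensor :: "'a tensor \<Rightarrow> 'a tensor" is uminus
  unfolding tensor_rel_def nonempty_words_def
  by (intro conjI span_quot_neg cvec.span_neg; blast)
lift_definition scaleC_tensor :: "complex \<Rightarrow> 'a tensor \<Rightarrow> 'a tensor" is scaleC
  unfolding tensor_rel_def nonempty_words_def
  by (intro conjI span_quot_scale cvec.span_scale; blast)
lift_definition times_tensor :: "'a tensor \<Rightarrow> 'a tensor \<Rightarrow> 'a tensor" is "(*)"
proof -
  fix f f' g g' :: "'a word \<Rightarrow>\<^sub>0 complex"
  assume *: "tensor_rel f f'" "tensor_rel g g'"
  have "f * g - f' * g' = (f - f') * g + f' * (g - g')" by (simp add: algebra_simps)
  also have "\<dots> \<in> cvec.span multilin_gens"
    using * unfolding tensor_rel_def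
    by (intro cvec.span_add multilin_times_left multilin_times_right) auto
  finally show "tensor_rel (f * g) (f' * g')"
    using * by (simp add: tensor_rel_def nonempty_words_times)
qed
instance
proof -
  have refl: "tensor_rel f f \<longleftrightarrow> f \<in> nonempty_words" for f :: "'a word \<Rightarrow>\<^sub>0 complex"
    by (simp add: tensor_rel_def cvec.span_zero)
  have clos: "0 \<in> (nonempty_words :: ('a word \<Rightarrow>\<^sub>0 complex) set)"
    "f + g \<in> nonempty_words" "f - g \<in> nonempty_words" "- f \<in> nonempty_words"
    "c *\<^sub>C f \<in> nonempty_words"
    if "f \<in> nonempty_words" "g \<in> nonempty_words" for f g :: "'a word \<Rightarrow>\<^sub>0 complex" and c
    using that unfolding nonempty_words_def
    by (auto intro: cvec.span_zero cvec.span_add cvec.span_diff cvec.span_neg cvec.span_scale)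
  show "OFCLASS('a tensor, complex_alg_class)"
    by standard
      (transfer; simp add: refl clos nonempty_words_times add_ac mult.assoc distrib_left distrib_right
        scaleC_add_right scaleC_add_left scaleC_scaleC scaleC_one scaleC_times_left scaleC_times_right)+
qed
end

fun word_prod :: "'x::complex_alg list \<Rightarrow> 'x"
  where
    "word_prod [] = 0"
  | "word_prod [x] = x"
  | "word_prod (x # y # xs) = x * word_prod (y # xs)"

text \<open>The homomorphism $a_1 \otimes \dots \otimes a_k \mapsto f(a_1) \cdots f(a_k)$, for linear \<open>f\<close>.\<close>

definition tensor_ext :: "('a \<Rightarrow> 'x) \<Rightarrow> 'a::complex_vec tensor \<Rightarrow> 'x::complex_alg"
  where "tensor_ext f t = lin_ext (\<lambda>w. word_prod (map f (letters w))) (rep_tensor t)"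

lift_definition tensor_of :: "'a::complex_vec \<Rightarrow> 'a tensor" is "\<lambda>a. gen (Word [a])"
  by (auto simp: tensor_rel_def nonempty_words_def zero_word_def cvec.span_zero intro!: cvec.span_base)

text \<open>The next facts confirm that the maps defined through representatives are the intended ones.\<close>

lemma lin_ext_eq:
  assumes "f - g \<in> cvec.span S" "\<And>s. s \<in> S \<Longrightarrow> lin_ext h s = 0"
  shows "lin_ext h f = lin_ext h g"
proof -
  have "lin_ext h f - lin_ext h g \<in> cvec.span {}"
    by (rule lin_ext_quot[OF assms(1)]) (simp add: assms(2))
  then show ?thesis by simp
qed

lemma word_prod_insert:
  assumes "clinear f"
  shows "word_prod (us @ f (x + y) # vs) = word_prod (us @ f x # vs) + word_prod (us @ f y # vs)"
    and "word_prod (us @ f (c *\<^sub>C x) # vs) = c *\<^sub>C word_prod (us @ f x # vs)"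
proof -
  interpret f: Vector_Spaces.linear scaleC scaleC f by fact
  have add: "word_prod ((a + b) # vs) = word_prod (a # vs) + word_prod (b # vs)" for a b
    by (cases vs) (simp_all add: distrib_right)
  have scale: "word_prod ((c *\<^sub>C a) # vs) = c *\<^sub>C word_prod (a # vs)" for a
    by (cases vs) (simp_all add: mult_scaleC_left)
  have step: "word_prod (u # us @ a # vs) = u * word_prod (us @ a # vs)" for u us a
    by (cases us) simp_all
  show "word_prod (us @ f (x + y) # vs) = word_prod (us @ f x # vs) + word_prod (us @ f y # vs)"
    by (induction us) (simp_all add: step add f.add distrib_left)
  show "word_prod (us @ f (c *\<^sub>C x) # vs) = c *\<^sub>C word_prod (us @ f x # vs)"
    by (induction us) (simp_all add: step scale f.scale mult_scaleC_right)
qed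

lemma word_prod_append:
  "us \<noteq> [] \<Longrightarrow> vs \<noteq> [] \<Longrightarrow> word_prod (us @ vs) = word_prod us * word_prod vs"
proof (induction us)
  case (Cons u us)
  then show ?case by (cases us; cases vs) (simp_all add: mult.assoc)
qed simp

lemma tensor_ext_abs:
  assumes "clinear f" "h \<in> nonempty_words"
  shows "tensor_ext f (abs_tensor h) = lin_ext (\<lambda>w. word_prod (map f (letters w))) h"
proof -
  have "tensor_rel h h" using assms(2) by (simp add: tensor_rel_def cvec.span_zero)
  then have "tensor_rel (rep_tensor (abs_tensor h)) h"
    by (rule Quotient3_rep_abs[OF Quotient3_tensor])
  then have "rep_tensor (abs_tensor h) - h \<in> cvec.span multilin_gens"
    by (simp add: tensor_rel_def)
  then show ?thesis
    unfolding tensor_ext_def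
    by (rule lin_ext_eq)
      (auto simp: multilin_gens_def lin_ext_diff lin_ext_scaleC plus_word_def
        word_prod_insert[OF assms(1)])
qed

lemma tensor_ext_of: "clinear f \<Longrightarrow> tensor_ext f (tensor_of a) = f a"
  by (subst tensor_of.abs_eq, subst tensor_ext_abs)
    (auto simp: nonempty_words_def zero_word_def intro!: cvec.span_base)

lemma alg_hom_tensor_ext:
  assumes "clinear f"
  shows "alg_hom (tensor_ext f)"
proof -
  let ?h = "lin_ext (\<lambda>w. word_prod (map f (letters w)))"
  have abs: "\<exists>h. h \<in> nonempty_words \<and> t = abs_tensor h" for t :: "'a tensor"
  proof -
    have "tensor_rel (rep_tensor t) (rep_tensor t)" "abs_tensor (rep_tensor t) = t"
      by (rule Quotient3_rep_reflp[OF Quotient3_tensor], rule Quotient3_abs_rep[OF Quotient3_tensor])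
    then show ?thesis by (metis tensor_rel_def)
  qed
  have mult: "?h (g * h) = ?h g * ?h h" if "g \<in> nonempty_words" "h \<in> nonempty_words" for g h
  proof -
    have 1: "?h (gen v * h) = ?h (gen v) * ?h h" if v: "v \<noteq> 0" for v
      using \<open>h \<in> nonempty_words\<close> unfolding nonempty_words_def
    proof (induction rule: cvec.span_induct_alt)
      case base
      show ?case by (simp add: lin_ext_def)
    next
      case (step c x y)
      then obtain w where w: "x = gen w" "w \<noteq> 0" by auto
      have "word_prod (map f (letters (v + w))) = word_prod (map f (letters v)) * word_prod (map f (letters w))"
        using v w by (cases v; cases w) (auto simp: plus_word_def zero_word_def word_prod_append)
      then show ?case using step w
        by (simp add: distrib_left scaleC_times_right lin_ext_add lin_ext_scaleC gen_times
            mult_scaleC_right)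
    qed
    show ?thesis using \<open>g \<in> nonempty_words\<close> unfolding nonempty_words_def
    proof (induction rule: cvec.span_induct_alt)
      case base
      show ?case by (simp add: lin_ext_def)
    next
      case (step c x y)
      then have "?h (x * h) = ?h x * ?h h" using 1 by auto
      with step show ?case
        by (simp add: distrib_right scaleC_times_left lin_ext_add lin_ext_scaleC mult_scaleC_left)
    qed
  qed
  have refl: "tensor_rel g g" if "g \<in> nonempty_words" for g :: "'a word \<Rightarrow>\<^sub>0 complex"
    using that by (simp add: tensor_rel_def cvec.span_zero)
  have clos: "g + h \<in> nonempty_words" "c *\<^sub>C g \<in> nonempty_words"
    if "g \<in> nonempty_words" "h \<in> nonempty_words" for g h :: "'a word \<Rightarrow>\<^sub>0 complex" and c
    using that unfolding nonempty_words_def by (auto intro: cvec.span_add cvec.span_scale)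
  have "tensor_ext f (s + t) = tensor_ext f s + tensor_ext f t \<and>
      tensor_ext f (c *\<^sub>C s) = c *\<^sub>C tensor_ext f s \<and>
      tensor_ext f (s * t) = tensor_ext f s * tensor_ext f t" for s t c
  proof -
    obtain g h where gh: "g \<in> nonempty_words" "s = abs_tensor g" "h \<in> nonempty_words" "t = abs_tensor h"
      using abs by metis
    then have "s + t = abs_tensor (g + h)" "c *\<^sub>C s = abs_tensor (c *\<^sub>C g)" "s * t = abs_tensor (g * h)"
      by (simp_all add: plus_tensor.abs_eq scaleC_tensor.abs_eq times_tensor.abs_eq refl)
    then show ?thesis using gh
      by (simp add: tensor_ext_abs[OF assms] clos nonempty_words_times lin_ext_add lin_ext_scaleC mult)
  qed
  then show ?thesis
    unfolding alg_hom_def by (intro conjI allI; unfold_locales?) auto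
qed

lemma abs_rep_forms: "abs_forms (rep_forms \<omega>) = \<omega>"
  by (rule Quotient3_abs_rep[OF Quotient3_forms])

lemma abs_rep_forms_nat: "nat_proj (rep_forms_nat \<omega>) = \<omega>"
  by (simp add: nat_proj.abs_eq Quotient3_abs_rep[OF Quotient3_forms_nat])

lemma clinear_nat_proj: "clinear nat_proj"
  by unfold_locales (transfer; simp add: cvec.span_zero)+

lemma clinear_abs_forms: "clinear abs_forms"
  by unfold_locales (simp_all add: plus_forms.abs_eq scaleC_forms.abs_eq)

lemma form_bilin:
  "form (x + x') y = form x y + form x' y"
  "form x (y + y') = form x y + form x y'"
  "form (c *\<^sub>C x) y = c *\<^sub>C form x y"
  "form x (c *\<^sub>C y) = c *\<^sub>C form x y"
  using bilin_gens_span(1)[of x x' y] bilin_gens_span(2)[of x y y']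
    bilin_gens_span(3)[of c x y] bilin_gens_span(4)[of x c y]
  by (simp_all add: form.abs_eq plus_forms.abs_eq scaleC_forms.abs_eq forms.abs_eq_iff diff_diff_add)

lemma X_odd_map_form:
  assumes "alg_hom \<rho>"
  shows "X_odd_map \<rho> (nat_form x0 x1) = nat_form (unitz_map \<rho> x0) (\<rho> x1)"
proof -
  interpret \<rho>: Vector_Spaces.linear scaleC scaleC \<rho> using assms by (simp add: alg_hom_def)
  interpret np: Vector_Spaces.linear scaleC scaleC nat_proj by (rule clinear_nat_proj)
  have \<rho>m: "\<rho> (x * y) = \<rho> x * \<rho> y" for x y using assms by (simp add: alg_hom_def)
  have um: "unitz_map \<rho> (x + y) = unitz_map \<rho> x + unitz_map \<rho> y"
    "unitz_map \<rho> (c *\<^sub>C x) = c *\<^sub>C unitz_map \<rho> x"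
    "unitz_map \<rho> (x * y) = unitz_map \<rho> x * unitz_map \<rho> y"
    "unitz_map \<rho> (of_alg r) = of_alg (\<rho> r)" for x y c r
    by (simp_all add: unitz_map_def plus_unitz_def scaleC_unitz_def times_unitz_def of_alg_def
        \<rho>.add \<rho>.scale \<rho>m)
  let ?h = "lin_ext (\<lambda>(x0, x1). nat_form (unitz_map \<rho> x0) (\<rho> x1))"
  define H where "H \<omega> = ?h (rep_forms \<omega>)" for \<omega>
  have H_abs: "H (abs_forms f) = ?h f" for f
  proof -
    have "rep_forms (abs_forms f) - f \<in> cvec.span bilin_gens"
      by (metis abs_rep_forms forms.abs_eq_iff)
    then show ?thesis unfolding H_def
      by (rule lin_ext_eq)
        (auto simp: bilin_gens_def lin_ext_diff lin_ext_scaleC um \<rho>.add \<rho>.scale form_bilin np.add np.scale)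
  qed
  have H_lin: "clinear H"
  proof -
    have "H (\<omega> + \<eta>) = H \<omega> + H \<eta>" "H (c *\<^sub>C \<omega>) = c *\<^sub>C H \<omega>" for \<omega> \<eta> c
    proof -
      obtain f g where fg: "\<omega> = abs_forms f" "\<eta> = abs_forms g"
        using abs_rep_forms[of \<omega>] abs_rep_forms[of \<eta>] by metis
      show "H (\<omega> + \<eta>) = H \<omega> + H \<eta>"
        unfolding fg plus_forms.abs_eq H_abs by (rule lin_ext_add)
      show "H (c *\<^sub>C \<omega>) = c *\<^sub>C H \<omega>"
        unfolding fg scaleC_forms.abs_eq H_abs by (rule lin_ext_scaleC)
    qed
    then show ?thesis by unfold_locales auto
  qed
  interpret H: Vector_Spaces.linear scaleC scaleC H by (rule H_lin)
  have H_form: "H (form x y) = nat_form (unitz_map \<rho> x) (\<rho> y)" for x y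
    by (simp add: form.abs_eq H_abs)
  have nat_eq: "nat_proj (lmul_form r \<omega>) = nat_proj (rmul_form r \<omega>)" for r \<omega>
    unfolding nat_proj.abs_eq forms_nat.abs_eq_iff
    by (rule cvec.span_base) (auto simp: form_commutators_def)
  have comm: "H (lmul_form r \<omega>) = H (rmul_form r \<omega>)" for r \<omega>
  proof -
    interpret l: Vector_Spaces.linear scaleC scaleC "lmul_form r" by (rule clinear_lmul_form)
    interpret r: Vector_Spaces.linear scaleC scaleC "rmul_form r" by (rule clinear_rmul_form)
    show ?thesis using span_form[of \<omega>]
    proof (induction rule: cvec.span_induct_alt)
      case base
      show ?case by simp
    next
      case (step c x y)
      then obtain x0 x1 where x: "x = form x0 x1" by auto
      have "H (lmul_form r x) = nat_proj (lmul_form (\<rho> r) (form (unitz_map \<rho> x0) (\<rho> x1)))"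
        by (simp add: x lmul_form_form H_form um)
      also have "\<dots> = nat_proj (rmul_form (\<rho> r) (form (unitz_map \<rho> x0) (\<rho> x1)))"
        by (rule nat_eq)
      also have "\<dots> = H (rmul_form r x)"
        by (simp add: x rmul_form_form H_form H.diff np.diff um \<rho>m)
      finally show ?case using step by (simp add: l.add l.scale r.add r.scale H.add H.scale)
    qed
  qed
  have "rep_forms_nat (nat_form x0 x1) - form x0 x1 \<in> cvec.span form_commutators"
    by (metis abs_rep_forms_nat nat_proj.abs_eq forms_nat.abs_eq_iff)
  then have "H (rep_forms_nat (nat_form x0 x1) - form x0 x1) \<in> cvec.span {}"
    by (rule clinear_image_span[OF H_lin]) (auto simp: form_commutators_def H.diff comm)
  then have "H (rep_forms_nat (nat_form x0 x1)) = H (form x0 x1)" by (simp add: H.diff)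
  then show ?thesis by (simp add: X_odd_map_def H_form flip: H_def)
qed

definition tensor_mult :: "'a::complex_alg tensor \<Rightarrow> 'a"
  where "tensor_mult = tensor_ext id"

definition tensor_map :: "('a::complex_vec \<Rightarrow> 'b::complex_vec) \<Rightarrow> 'a tensor \<Rightarrow> 'b tensor"
  where "tensor_map f = tensor_ext (tensor_of \<circ> f)"

definition J_tensor :: "'a::complex_alg tensor set"
  where "J_tensor = {t. tensor_mult t = 0}"

text \<open>The ideal $T(B:E)$, for the quotient map \<open>p\<close> from $E$ to $A$.\<close>

definition T_ker :: "('e::complex_alg \<Rightarrow> 'a::complex_alg) \<Rightarrow> 'e tensor set"
  where "T_ker p = {t. tensor_map p t = 0}"

section \<open>Cochains and periodic cyclic cohomology\<close>

text \<open>A cochain on the completion of a subspace \<open>S\<close> with respect to a decreasing filtration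
  \<open>I\<close> is linear on \<open>S\<close> and vanishes on some \<open>S \<inter> I k\<close>; its values outside \<open>S\<close> are irrelevant.\<close>

definition cochain :: "'v::complex_vec set \<Rightarrow> (nat \<Rightarrow> 'v set) \<Rightarrow> ('v \<Rightarrow> complex) \<Rightarrow> bool"
  where "cochain S I f \<longleftrightarrow>
    (\<forall>x\<in>S. \<forall>y\<in>S. f (x + y) = f x + f y) \<and>
    (\<forall>c. \<forall>x\<in>S. f (c *\<^sub>C x) = c * f x) \<and>
    (\<exists>k. \<forall>x\<in>S \<inter> I k. f x = 0)"

text \<open>A cocycle of even degree over $F^m_R X(\widehat M)$, where $\widehat M$ is the
  \<open>N\<close>-adic completion: it is given by its even component, the odd one being zero, so that
  $\tau\partial = 0$ says that $\tau\overline b$ vanishes on the odd part of $F^m_R X(M)$.\<close>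

definition even_cocycle :: "'m::complex_alg set \<Rightarrow> 'm set \<Rightarrow> nat \<Rightarrow> ('m \<Rightarrow> complex) \<Rightarrow> bool"
  where "even_cocycle R N m \<tau> \<longleftrightarrow>
    cochain (F_even R m) (F_even N) \<tau> \<and> (\<forall>\<omega>\<in>F_odd R m. \<tau> (b_bar \<omega>) = 0)"

definition HP0_cocycles :: "('a::complex_alg tensor \<Rightarrow> complex) set"
  where "HP0_cocycles = {f. cochain UNIV (F_even J_tensor) f \<and> (\<forall>\<omega>. f (b_bar \<omega>) = 0)}"

definition HP0_rel :: "(('a::complex_alg tensor \<Rightarrow> complex) \<times> ('a tensor \<Rightarrow> complex)) set"
  where "HP0_rel = {(f, g). f \<in> HP0_cocycles \<and> g \<in> HP0_cocycles \<and>
    (\<exists>h. cochain UNIV (F_odd J_tensor) h \<and> (\<forall>x. f x - g x = h (nat_d x)))}"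

definition HP0 :: "('a::complex_alg tensor \<Rightarrow> complex) set set"
  where "HP0 = HP0_cocycles // HP0_rel"

definition HP1_cocycles :: "('a::complex_alg tensor forms_nat \<Rightarrow> complex) set"
  where "HP1_cocycles = {f. cochain UNIV (F_odd J_tensor) f \<and> (\<forall>x. f (nat_d x) = 0)}"

definition HP1_rel :: "(('a::complex_alg tensor forms_nat \<Rightarrow> complex) \<times> ('a tensor forms_nat \<Rightarrow> complex)) set"
  where "HP1_rel = {(f, g). f \<in> HP1_cocycles \<and> g \<in> HP1_cocycles \<and>
    (\<exists>h. cochain UNIV (F_even J_tensor) h \<and> (\<forall>\<omega>. f \<omega> - g \<omega> = h (b_bar \<omega>)))}"

definition HP1 :: "('a::complex_alg tensor forms_nat \<Rightarrow> complex) set set"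
  where "HP1 = HP1_cocycles // HP1_rel"

section \<open>The class of a cocycle and the boundary map\<close>

text \<open>Throughout, \<open>be\<close> and \<open>ea\<close> are the maps $B \to E \to A$ of the extension, \<open>me\<close> is $M \to E$,
  and \<open>R\<close>, \<open>N\<close> are the images of the ideals of the lifting in $M$.\<close>

definition classifying_hom ::
  "('e::complex_alg \<Rightarrow> 'a::complex_alg) \<Rightarrow> 'm::complex_alg set \<Rightarrow> ('m \<Rightarrow> 'e) \<Rightarrow> ('e tensor \<Rightarrow> 'm) \<Rightarrow> bool"
  where "classifying_hom ea R me \<rho> \<longleftrightarrow>
    alg_hom \<rho> \<and> (\<forall>t. me (\<rho> t) = tensor_mult t) \<and> \<rho> ` T_ker ea \<subseteq> R"

text \<open>\<open>\<beta>\<close> is the class of \<open>\<tau>\<close>: the pull-back of \<open>\<tau>\<close> along a classifying homomorphism is cohomologous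
  over $F^m_{T(B:E)}X(\widehat TE)$ to the restriction of a cocycle \<open>\<psi>\<close> over
  $F^1_{T(B:E)}X(\widehat TE)$ whose restriction to $X(\widehat TB)$ has class \<open>\<beta>\<close>.\<close>

definition represents ::
  "('b::complex_alg \<Rightarrow> 'e::complex_alg) \<Rightarrow> ('e \<Rightarrow> 'a::complex_alg) \<Rightarrow> 'm::complex_alg set \<Rightarrow> 'm set \<Rightarrow>
   ('m \<Rightarrow> 'e) \<Rightarrow> nat \<Rightarrow> ('m \<Rightarrow> complex) \<Rightarrow> ('b tensor \<Rightarrow> complex) set \<Rightarrow> bool"
  where "represents be ea R N me m \<tau> \<beta> \<longleftrightarrow>
    1 \<le> m \<and> even_cocycle R N m \<tau> \<and> \<beta> \<in> HP0 \<and>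
    (\<exists>\<rho> \<psi> \<theta>. classifying_hom ea R me \<rho> \<and>
      even_cocycle (T_ker ea) J_tensor 1 \<psi> \<and>
      cochain (F_odd (T_ker ea) m) (F_odd J_tensor) \<theta> \<and>
      (\<forall>x\<in>F_even (T_ker ea) m. \<tau> (\<rho> x) - \<psi> x = \<theta> (nat_d x)) \<and>
      (\<lambda>t. \<psi> (tensor_map be t)) \<in> \<beta>)"

definition renormalization ::
  "'m::complex_alg set \<Rightarrow> 'm set \<Rightarrow> nat \<Rightarrow> ('m \<Rightarrow> complex) \<Rightarrow> ('m \<Rightarrow> complex) \<Rightarrow> bool"
  where "renormalization R N m \<tau> \<tau>R \<longleftrightarrow>
    cochain UNIV (F_even N) \<tau>R \<and> (\<forall>x\<in>F_even R m. \<tau>R x = \<tau> x)"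

definition boundary_cochain ::
  "('a::complex_vec \<Rightarrow> 'm::complex_alg) \<Rightarrow> ('m \<Rightarrow> complex) \<Rightarrow> 'a tensor forms_nat \<Rightarrow> complex"
  where "boundary_cochain \<sigma> \<tau>R \<omega> = \<tau>R (b_bar (X_odd_map (tensor_ext \<sigma>) \<omega>))"

text \<open>As usual for maps on quotients, the value of $E^*$ is the union of the classes obtained from
  all possible choices (of \<open>\<tau>\<close> in the class \<open>\<beta>\<close>, renormalization \<open>\<tau>R\<close>, splitting \<open>\<sigma>\<close>); these
  classes coincide. Since \<open>\<tau>\<close> is even, so is \<open>\<tau>R\<close>.\<close>

definition E_star ::
  "('b::complex_alg \<Rightarrow> 'e::complex_alg) \<Rightarrow> ('e \<Rightarrow> 'a::complex_alg) \<Rightarrow> 'm::complex_alg set \<Rightarrow> 'm set \<Rightarrow>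
   ('m \<Rightarrow> 'e) \<Rightarrow> ('b tensor \<Rightarrow> complex) set \<Rightarrow> ('a tensor forms_nat \<Rightarrow> complex) set"
  where "E_star be ea R N me \<beta> =
    \<Union>{HP1_rel `` {boundary_cochain \<sigma> \<tau>R} | m \<tau> \<tau>R \<sigma>.
      represents be ea R N me m \<tau> \<beta> \<and> renormalization R N m \<tau> \<tau>R \<and>
      clinear \<sigma> \<and> (\<forall>a. ea (me (\<sigma> a)) = a)}"

section \<open>Algebraic K-theory\<close>

definition mat_in :: "'x::complex_alg set \<Rightarrow> 'x unitz mat \<Rightarrow> bool"
  where "mat_in S X \<longleftrightarrow> elements_mat X \<subseteq> of_alg ` S"

definition p_mat :: "nat \<Rightarrow> nat \<Rightarrow> 'x::complex_alg unitz mat"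
  where "p_mat N K = mat K K (\<lambda>(i, j). if i = j \<and> i < N then 1 else 0)"

definition GL :: "nat \<Rightarrow> 'x::complex_alg unitz mat set"
  where "GL N = {g \<in> carrier_mat N N. invertible_mat g \<and> mat_in UNIV (g - 1\<^sub>m N)}"

definition stable_class :: "'x::complex_alg unitz mat \<Rightarrow> 'x unitz mat set"
  where "stable_class g = {h \<in> (\<Union>N. GL N).
    \<exists>k l. diag_block_mat [g, 1\<^sub>m k] = diag_block_mat [h, 1\<^sub>m l]}"

text \<open>The direct limit of the groups \<^term>\<open>GL N\<close>; an element is the class of a matrix under
  stabilization, and products are computed on representatives of equal size.\<close>

definition GL_inf :: "'x::complex_alg unitz mat set monoid"
  where "GL_inf = \<lparr>carrier = stable_class ` (\<Union>N. GL N),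
    monoid.mult = (\<lambda>X Y. \<Union>{stable_class (g * h) | N g h. g \<in> X \<inter> GL N \<and> h \<in> Y \<inter> GL N}),
    one = stable_class (1\<^sub>m 0)\<rparr>"

definition K1 :: "'x::complex_alg unitz mat set set monoid"
  where "K1 = GL_inf Mod (derived GL_inf (carrier GL_inf))"

definition idempotents :: "'x::ring_1 mat set"
  where "idempotents = {e. square_mat e \<and> e * e = e}"

definition mvn_equiv :: "'x::ring_1 mat \<Rightarrow> 'x mat \<Rightarrow> bool"
  where "mvn_equiv e f \<longleftrightarrow>
    (\<exists>u\<in>carrier_mat (dim_row e) (dim_row f). \<exists>v\<in>carrier_mat (dim_row f) (dim_row e).
      u * v = e \<and> v * u = f)"

text \<open>Grothendieck group of the monoid of idempotent matrices over a unital ring: the pair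
  \<open>(e, f)\<close> stands for $[e] - [f]$.\<close>

definition K0_rel :: "(('x::ring_1 mat \<times> 'x mat) \<times> ('x mat \<times> 'x mat)) set"
  where "K0_rel = {((e, f), (e', f')).
    e \<in> idempotents \<and> f \<in> idempotents \<and> e' \<in> idempotents \<and> f' \<in> idempotents \<and>
    (\<exists>h\<in>idempotents. mvn_equiv (diag_block_mat [e, f', h]) (diag_block_mat [e', f, h]))}"

definition K0_unital :: "('x::ring_1 mat \<times> 'x mat) set set"
  where "K0_unital = (idempotents \<times> idempotents) // K0_rel"

text \<open>$K_0$ of a non-unital algebra is the kernel of $K_0(B^+) \to K_0(\mathbb C)$.\<close>

definition K0 :: "('b::complex_alg unitz mat \<times> 'b unitz mat) set set"
  where "K0 = {x \<in> K0_unital. \<forall>(e, f)\<in>x.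
    ((map_mat scal_part e, map_mat scal_part f), (0\<^sub>m 0 0, 0\<^sub>m 0 0)) \<in> K0_rel}"

text \<open>\<open>Q\<close>, \<open>P\<close> lift \<open>g\<close>, \<open>g'\<close> = $g^{-1}$, and \<open>G'\<close> = $G^{-1}$; the idempotent $G^{-1} p_N G$ has entries in
  the image of $B^+$. As for $E^*$, the class is the union over all choices.\<close>

definition Ind ::
  "('b::complex_alg \<Rightarrow> 'e::complex_alg) \<Rightarrow> ('e \<Rightarrow> 'a::complex_alg) \<Rightarrow> 'a unitz mat set set \<Rightarrow>
   ('b unitz mat \<times> 'b unitz mat) set"
  where "Ind be ea \<kappa> =
    \<Union>{K0_rel `` {(e, p_mat N (N + N))} | N g g' Q P G G' e.
      g \<in> \<Union>\<kappa> \<and> g \<in> GL N \<and> g' \<in> carrier_mat N N \<and> inverts_mat g g' \<and> inverts_mat g' g \<and>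
      Q \<in> carrier_mat N N \<and> map_mat (unitz_map ea) Q = g \<and>
      P \<in> carrier_mat N N \<and> map_mat (unitz_map ea) P = g' \<and>
      G = four_block_mat Q (1\<^sub>m N - Q * P) (P * Q - 1\<^sub>m N) (P + P * (1\<^sub>m N - Q * P)) \<and>
      G' \<in> carrier_mat (N + N) (N + N) \<and> inverts_mat G G' \<and> inverts_mat G' G \<and>
      e \<in> carrier_mat (N + N) (N + N) \<and>
      map_mat (unitz_map be) e = G' * p_mat N (N + N) * G}"

section \<open>Pairings\<close>

text \<open>A $K \times K$ matrix over the unitalization of $\varprojlim_k R/I_k$ is given by a coherent
  sequence of representatives; an equation between such matrices is a congruence modulo
  \<open>I k\<close> for each \<open>k\<close>.\<close>

definition pro_mat :: "(nat \<Rightarrow> 'x::complex_alg set) \<Rightarrow> nat \<Rightarrow> (nat \<Rightarrow> 'x unitz mat) \<Rightarrow> bool"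
  where "pro_mat I K X \<longleftrightarrow> (\<forall>k. X k \<in> carrier_mat K K \<and> mat_in (I k) (X (Suc k) - X k))"

definition idempotent_lift ::
  "('r::complex_alg \<Rightarrow> 'm::complex_alg) \<Rightarrow> ('r \<Rightarrow> 'b::complex_alg) \<Rightarrow> 'm set \<Rightarrow> nat \<Rightarrow>
   'b unitz mat \<Rightarrow> (nat \<Rightarrow> 'r unitz mat) \<Rightarrow> bool"
  where "idempotent_lift rm rb N K e X \<longleftrightarrow>
    (let I = (\<lambda>k. rm -` ideal_pow N k) in
     pro_mat I K X \<and> (\<forall>k. mat_in (I k) (X k * X k - X k)) \<and>
     (\<forall>k. map_mat (unitz_map rb) (X (Suc k)) = e))"

definition even_trace :: "('x::complex_alg \<Rightarrow> complex) \<Rightarrow> 'x unitz mat \<Rightarrow> complex"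
  where "even_trace \<tau> X = (\<Sum>i<dim_row X. \<tau> (alg_part (X $$ (i, i))))"

text \<open>A cochain is evaluated on a point of the completion through representatives of sufficiently
  high index. The pairings are computed from all choices of representatives and liftings, on which
  they do not depend.\<close>

definition HP0_K0_pairing ::
  "('b::complex_alg \<Rightarrow> 'e::complex_alg) \<Rightarrow> ('e \<Rightarrow> 'a::complex_alg) \<Rightarrow> ('r::complex_alg \<Rightarrow> 'm::complex_alg) \<Rightarrow>
   ('r \<Rightarrow> 'b) \<Rightarrow> 'm set \<Rightarrow> ('m \<Rightarrow> 'e) \<Rightarrow>
   ('b tensor \<Rightarrow> complex) set \<Rightarrow> ('b unitz mat \<times> 'b unitz mat) set \<Rightarrow> complex"
  where "HP0_K0_pairing be ea rm rb N me \<beta> x = the_elem {c. \<exists>n \<tau> l K e X.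
    represents be ea (range rm) N me (4 * n + 1) \<tau> \<beta> \<and>
    l \<le> K \<and> e \<in> carrier_mat K K \<and> e * e = e \<and> mat_in UNIV (e - p_mat l K) \<and> (e, p_mat l K) \<in> x \<and>
    idempotent_lift rm rb N K e X \<and>
    (\<forall>\<^sub>F k in sequentially. c = even_trace (\<tau> \<circ> rm) ((X k - p_mat l K) ^\<^sub>m (2 * n + 1)))}"

text \<open>\<open>X\<close> is an invertible lifting of \<open>g\<close> over the completed tensor algebra and \<open>Y\<close> is its inverse.\<close>

definition invertible_lift ::
  "nat \<Rightarrow> 'a::complex_alg unitz mat \<Rightarrow> (nat \<Rightarrow> 'a tensor unitz mat) \<Rightarrow> (nat \<Rightarrow> 'a tensor unitz mat) \<Rightarrow> bool"
  where "invertible_lift K g X Y \<longleftrightarrow>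
    (let I = ideal_pow J_tensor in
     pro_mat I K X \<and> pro_mat I K Y \<and>
     (\<forall>k. mat_in UNIV (X k - 1\<^sub>m K) \<and> mat_in UNIV (Y k - 1\<^sub>m K)) \<and>
     (\<forall>k. mat_in (I k) (X k * Y k - 1\<^sub>m K) \<and> mat_in (I k) (Y k * X k - 1\<^sub>m K)) \<and>
     (\<forall>k. map_mat (unitz_map tensor_mult) (X (Suc k)) = g))"

text \<open>The value of $\varphi \# \mathrm{tr}$ on $\natural Y \mathbf d X$; note that $\mathbf d$ vanishes on scalars.\<close>

definition odd_trace ::
  "('x::complex_alg forms_nat \<Rightarrow> complex) \<Rightarrow> 'x unitz mat \<Rightarrow> 'x unitz mat \<Rightarrow> complex"
  where "odd_trace \<phi> Y X =
    (\<Sum>i<dim_row Y. \<Sum>j<dim_col Y. \<phi> (nat_form (Y $$ (i, j)) (alg_part (X $$ (j, i)))))"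

text \<open>\<^term>\<open>csqrt\<close> is the principal branch of the square root.\<close>

definition HP1_K1_pairing ::
  "('a::complex_alg tensor forms_nat \<Rightarrow> complex) set \<Rightarrow> 'a unitz mat set set \<Rightarrow> complex"
  where "HP1_K1_pairing \<alpha> \<kappa> = the_elem {c. \<exists>\<phi> K g X Y.
    \<phi> \<in> \<alpha> \<and> g \<in> \<Union>\<kappa> \<and> g \<in> GL K \<and> invertible_lift K g X Y \<and>
    (\<forall>\<^sub>F k in sequentially. c = 1 / csqrt (2 * complex_of_real pi * \<i>) * odd_trace \<phi> (Y k) (X k))}"

end

theory Submission
  imports Defs
begin

text \<open>Let $I = R + N$, and let $T = \tau_R$ be a renormalization of \<open>\<tau>\<close>. Since \<open>T\<close> vanishes on a power
  $N^K$, it is a trace on the ideal $S = R^{2n+1} + N^K$, which contains a power of \<open>I\<close>. A matrix \<open>q\<close> over \<open>M\<close>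
  that is invertible modulo \<open>I\<close> therefore has an inverse \<open>p\<close> modulo \<open>S\<close> (by a finite Neumann series), and the
  trace property of \<open>T\<close> on \<open>S\<close> shows that $\mathrm{ind}(q) = T(1 - pq) - T(1 - qp)$ does not depend on \<open>p\<close>, is
  additive under composition and depends only on \<open>q\<close> modulo \<open>I\<close>. The same holds for maps between idempotents,
  which may be idempotent only modulo $N^K$.

  If $Q'$, $P'$ are the images in \<open>M\<close> of an invertible lift of \<open>g\<close> to $\widehat T A$ and of its inverse, then the
  odd pairing is $T([P', Q']) = - \mathrm{ind}(Q')$. If \<open>e\<close> lifts the idempotent $G^{-1} p_N G$, then
  $T((e - p_N)^{2n+1})$ is the index of $p_N e$ as a map from \<open>e\<close> to $p_N$; modulo \<open>I\<close> this map is a conjugate of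
  the parametrix of $Q'$, so both pairings are $- \mathrm{ind}(Q')$. The index descends to $K_1(A)$ because it is
  a homomorphism on invertible matrices over \<open>A\<close>.

  That the common value depends only on the class of \<open>\<tau>\<close> is seen by lifting the idempotent to $\widehat T B$:
  there it becomes the value of a trace, and exact cochains vanish on it by the Leibniz rule.\<close>

section \<open>The index relative to an ideal\<close>

text \<open>The degree 4n+1 enters only through two trace identities for \<open>T\<close>, one for
  each summand of the odd part of the filtration: elements of R^(2n+1) commute under
  \<open>T\<close> with all of M, and elements of R^(2n) (of M^+ if n = 0) commute under
  \<open>T\<close> with elements of R. The first makes the index well defined, but expresses the
  index of a pair of idempotents through a power of their difference with large exponent 2J+1. The
  second lowers that exponent, two at a time, to the 2n+1 of the pairing. Outside these ideals T(xy)
  and T(yx) may differ, so a cyclic permutation is allowed only when a factor is known to lie in the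
  right ideal; hence remainders of parametrices are followed throughout, not the maps themselves.
  Both pairings and E^* are read off from the set of all admissible choices, so one computation is
  not enough: cocycles of different degree and different liftings must give one and the same number.
  The factor in the theorem cancels the normalization of the odd pairing.\<close>

definition ring_ideal :: "'w::ring set \<Rightarrow> bool"
  where "ring_ideal C \<longleftrightarrow> 0 \<in> C \<and> (\<forall>x\<in>C. \<forall>y\<in>C. x - y \<in> C) \<and>
    (\<forall>x\<in>C. \<forall>y. x * y \<in> C \<and> y * x \<in> C)"

lemma ring_idealD:
  assumes "ring_ideal C"
  shows "0 \<in> C" "x \<in> C \<Longrightarrow> y \<in> C \<Longrightarrow> x - y \<in> C" "x \<in> C \<Longrightarrow> y \<in> C \<Longrightarrow> x + y \<in> C"
    "x \<in> C \<Longrightarrow> - x \<in> C" "x \<in> C \<Longrightarrow> x * y \<in> C" "x \<in> C \<Longrightarrow> y * x \<in> C"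
proof -
  have zero: "0 \<in> C" and diff: "\<And>x y. x \<in> C \<Longrightarrow> y \<in> C \<Longrightarrow> x - y \<in> C"
    using assms by (auto simp: ring_ideal_def)
  then have neg: "- x \<in> C" if "x \<in> C" for x using that by (metis diff_0)
  show "x \<in> C \<Longrightarrow> y \<in> C \<Longrightarrow> x + y \<in> C" using diff[OF _ neg, of x y] by simp
  show "0 \<in> C" "x \<in> C \<Longrightarrow> y \<in> C \<Longrightarrow> x - y \<in> C" "x \<in> C \<Longrightarrow> - x \<in> C" by fact+
  show "x \<in> C \<Longrightarrow> x * y \<in> C" "x \<in> C \<Longrightarrow> y * x \<in> C" using assms by (auto simp: ring_ideal_def)
qed

text \<open>Elements \<open>e\<close>, \<open>f\<close> that are idempotent modulo \<open>Z\<close> stand for projective modules, \<open>q\<close> for a map from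
  \<open>e\<close> to \<open>f\<close> and \<open>p\<close> for a parametrix of \<open>q\<close> modulo \<open>S\<close>. The functional \<open>T\<close> is a trace only on \<open>S\<close>.\<close>

locale index_setting =
  fixes T :: "'w::ring_1 \<Rightarrow> complex" and Z S I :: "'w set" and J :: nat
  assumes T_add: "T (x + y) = T x + T y"
    and Z: "ring_ideal Z" and S: "ring_ideal S" and I: "ring_ideal I"
    and Z_sub: "Z \<subseteq> S" and S_sub: "S \<subseteq> I"
    and T_Z: "z \<in> Z \<Longrightarrow> T z = 0"
    and T_trace: "s \<in> S \<Longrightarrow> T (s * w) = T (w * s)"
    and J_pos: "0 < J" and I_pow: "u \<in> I \<Longrightarrow> u ^ J \<in> S"
begin

lemma T_zero: "T 0 = 0" using T_Z Z by (simp add: ring_ideal_def)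
lemma T_diff: "T (x - y) = T x - T y" using T_add[of "x - y" y] by simp

section \<open>Congruence modulo \<open>Z\<close>\<close>

definition approx :: "'w \<Rightarrow> 'w \<Rightarrow> bool"  (infix \<open>\<approx>\<close> 50)
  where "x \<approx> y \<longleftrightarrow> x - y \<in> Z"

lemmas Z_simps = ring_idealD[OF Z]

lemma approx_refl [simp]: "x \<approx> x" by (simp add: approx_def Z_simps)
lemma approx_sym: "x \<approx> y \<Longrightarrow> y \<approx> x" using Z_simps(4)[of "x - y"] by (simp add: approx_def)
lemma approx_trans [trans]: "x \<approx> y \<Longrightarrow> y \<approx> z \<Longrightarrow> x \<approx> z"
  using Z_simps(3)[of "x - y" "y - z"] by (simp add: approx_def)
lemma approx_add: "x \<approx> x' \<Longrightarrow> y \<approx> y' \<Longrightarrow> x + y \<approx> x' + y'"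
  using Z_simps(3)[of "x - x'" "y - y'"] by (simp add: approx_def algebra_simps)
lemma approx_diff: "x \<approx> x' \<Longrightarrow> y \<approx> y' \<Longrightarrow> x - y \<approx> x' - y'"
  using Z_simps(2)[of "x - x'" "y - y'"] by (simp add: approx_def algebra_simps)
lemma approx_mult: "x \<approx> x' \<Longrightarrow> y \<approx> y' \<Longrightarrow> x * y \<approx> x' * y'"
  using Z_simps(3)[OF Z_simps(5)[of "x - x'" y] Z_simps(6)[of "y - y'" x']]
  by (simp add: approx_def algebra_simps)
lemma approx_mult_l: "y \<approx> y' \<Longrightarrow> x * y \<approx> x * y'" by (simp add: approx_mult)
lemma approx_mult_r: "x \<approx> x' \<Longrightarrow> x * y \<approx> x' * y" by (simp add: approx_mult)
lemma approx_power: "x \<approx> y \<Longrightarrow> x ^ n \<approx> y ^ n"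
  by (induction n) (auto intro: approx_mult)
lemma T_approx: "x \<approx> y \<Longrightarrow> T x = T y"
  using T_Z[of "x - y"] by (simp add: approx_def T_diff)

lemma approx_in: "x \<approx> y \<Longrightarrow> ring_ideal C \<Longrightarrow> Z \<subseteq> C \<Longrightarrow> y \<in> C \<Longrightarrow> x \<in> C"
  using ring_idealD(3)[of C "x - y" y] by (auto simp: approx_def)

section \<open>Parametrices and the index of a map between approximate idempotents\<close>

definition fred :: "'w set \<Rightarrow> 'w \<Rightarrow> 'w \<Rightarrow> 'w \<Rightarrow> 'w \<Rightarrow> bool"
  where "fred C e f q p \<longleftrightarrow> e * e \<approx> e \<and> f * f \<approx> f \<and> f * q \<approx> q \<and> q * e \<approx> q \<and> e * p \<approx> p \<and> p * f \<approx> p \<and>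
    e - p * q \<in> C \<and> f - q * p \<in> C"

text \<open>A relation, because a parametrix need not exist; its value is unique by
  \<open>parametrix_unique\<close>. The sign is kernel minus cokernel: for a quasi-inverse
  \<open>p\<close> the elements \<open>e - p * q\<close> and \<open>f - q * p\<close> are the
  projections onto the two.\<close>

definition has_ind :: "'w \<Rightarrow> 'w \<Rightarrow> 'w \<Rightarrow> complex \<Rightarrow> bool"
  where "has_ind e f q c \<longleftrightarrow> (\<exists>p. fred S e f q p \<and> c = T (e - p * q) - T (f - q * p))"

lemma fred_sym: "fred C e f q p \<Longrightarrow> fred C f e p q"
  by (auto simp: fred_def)

lemma fred_mono: "fred C e f q p \<Longrightarrow> C \<subseteq> D \<Longrightarrow> fred D e f q p"
  by (auto simp: fred_def)

text \<open>With u = e - pq and v = f - qp one has qu = vq modulo \<open>Z\<close>, so the partial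
  sums (1 + u + ... + u^n) p are again parametrices, with remainders u^(n+1) and v^(n+1). The second
  conclusion is the resulting formula for the index by powers of the remainders. The pair of ideals
  is kept general: it is used from \<open>I\<close> to \<open>S\<close> and from nilpotent
  remainders to \<open>Z\<close>.\<close>

lemma fred_improve:
  assumes fr: "fred C e f q p" and D: "ring_ideal D" "Z \<subseteq> D" and "0 < j"
    and pow: "\<And>u. u \<in> C \<Longrightarrow> u ^ j \<in> D"
  shows "\<exists>p'. fred D e f q p' \<and> T (e - p' * q) - T (f - q * p') = T ((e - p * q) ^ j) - T ((f - q * p) ^ j)"
proof -
  let ?u = "e - p * q" and ?v = "f - q * p"
  note fr' = fr[unfolded fred_def]
  have ue: "?u * e \<approx> ?u"
    using fr' approx_diff[OF _ approx_mult_l, of "e * e" e "q * e" q p] by (simp add: algebra_simps)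
  have eu: "e * ?u \<approx> ?u"
    using fr' approx_diff[OF _ approx_mult_r, of "e * e" e "e * p" p q] by (simp add: algebra_simps)
  have vf: "?v * f \<approx> ?v"
    using fr' approx_diff[OF _ approx_mult_l, of "f * f" f "p * f" p q] by (simp add: algebra_simps)
  have qu: "q * ?u \<approx> ?v * q"
    using fr' approx_diff[OF approx_trans[OF _ approx_sym], of "q * e" q "f * q" "q * p * q" "q * p * q"]
    by (simp add: algebra_simps)
  have qui: "q * ?u ^ i \<approx> ?v ^ i * q" for i
  proof (induction i)
    case (Suc i)
    have "q * ?u ^ Suc i = q * ?u * ?u ^ i" by (simp add: mult.assoc)
    also have "\<dots> \<approx> ?v * q * ?u ^ i" by (rule approx_mult_r[OF qu])
    also have "\<dots> \<approx> ?v * (?v ^ i * q)" using approx_mult_l[OF Suc, of ?v] by (simp add: mult.assoc)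
    finally show ?case by (simp add: mult.assoc)
  qed simp
  have uie: "?u ^ Suc i * e \<approx> ?u ^ Suc i" for i
    using approx_mult_l[OF ue, of "?u ^ i"] by (simp add: mult.assoc power_Suc2 del: power_Suc)
  have eui: "e * ?u ^ Suc i \<approx> ?u ^ Suc i" for i
    using approx_mult_r[OF eu, of "?u ^ i"] by (simp add: mult.assoc)
  have vif: "?v ^ Suc i * f \<approx> ?v ^ Suc i" for i
    using approx_mult_l[OF vf, of "?v ^ i"] by (simp add: mult.assoc power_Suc2 del: power_Suc)
  define P where "P n = (\<Sum>i\<le>n. ?u ^ i * p)" for n
  have P: "e - P n * q \<approx> ?u ^ Suc n \<and> f - q * P n \<approx> ?v ^ Suc n \<and> e * P n \<approx> P n \<and> P n * f \<approx> P n" for n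
  proof (induction n)
    case 0
    then show ?case using fr' by (simp add: P_def)
  next
    case (Suc n)
    have PS: "P (Suc n) = P n + ?u ^ Suc n * p" by (simp add: P_def)
    \<comment> \<open>The new summand contributes u^(n+1) p q = u^(n+1) (e - u).\<close>
    have "e - P (Suc n) * q = (e - P n * q) - (?u ^ Suc n * e - ?u ^ Suc n * ?u)"
      by (simp add: PS algebra_simps)
    also have "\<dots> \<approx> ?u ^ Suc n - (?u ^ Suc n - ?u ^ Suc n * ?u)"
      by (intro approx_diff uie approx_refl conjunct1[OF Suc])
    also have "\<dots> = ?u ^ Suc (Suc n)" by (simp add: power_Suc2 del: power_Suc)
    finally have 1: "e - P (Suc n) * q \<approx> ?u ^ Suc (Suc n)" .
    have "f - q * P (Suc n) = (f - q * P n) - q * ?u ^ Suc n * p"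
      by (simp add: PS algebra_simps)
    also have "\<dots> \<approx> ?v ^ Suc n - ?v ^ Suc n * q * p"
      using Suc by (intro approx_diff approx_mult_r qui) auto
    also have "\<dots> = ?v ^ Suc n - (?v ^ Suc n * f - ?v ^ Suc n * ?v)" by (simp add: algebra_simps)
    also have "\<dots> \<approx> ?v ^ Suc n - (?v ^ Suc n - ?v ^ Suc n * ?v)"
      by (intro approx_diff vif approx_refl)
    also have "\<dots> = ?v ^ Suc (Suc n)" by (simp add: power_Suc2 del: power_Suc)
    finally have 2: "f - q * P (Suc n) \<approx> ?v ^ Suc (Suc n)" .
    have 3: "e * P (Suc n) \<approx> P (Suc n)"
      using approx_add[OF conjunct1[OF conjunct2[OF conjunct2[OF Suc]]] approx_mult_r[OF eui[of n], of p]]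
      by (simp add: PS distrib_left mult.assoc)
    have pf: "p * f \<approx> p" using fr' by simp
    have 4: "P (Suc n) * f \<approx> P (Suc n)"
      using approx_add[OF conjunct2[OF conjunct2[OF conjunct2[OF Suc]]] approx_mult_l[OF pf, of "?u ^ Suc n"]]
      by (simp add: PS distrib_right mult.assoc)
    show ?case using 1 2 3 4 by blast
  qed
  obtain n where n: "j = Suc n" using \<open>0 < j\<close> gr0_implies_Suc by blast
  have "?u ^ j \<in> D" "?v ^ j \<in> D" using fr' pow by auto
  then have "fred D e f q (P n)"
    using P[of n] fr' approx_in[OF _ D, of "e - P n * q"] approx_in[OF _ D, of "f - q * P n"]
    by (auto simp: fred_def n simp del: power_Suc)
  moreover have "T (e - P n * q) = T (?u ^ j)" "T (f - q * P n) = T (?v ^ j)"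
    using P[of n] by (auto simp: n intro!: T_approx simp del: power_Suc)
  ultimately show ?thesis by auto
qed

text \<open>For two parametrices, s = p' - p is congruent to p' (f - qp) - (e - p'q) p and therefore
  lies in \<open>S\<close>. The two values differ by T(sq) - T(qs), which vanishes by the trace
  property.\<close>

lemma parametrix_unique:
  assumes "fred S e f q p" "fred S e f q p'"
  shows "T (e - p * q) - T (f - q * p) = T (e - p' * q) - T (f - q * p')"
proof -
  let ?s = "p' - p"
  have "?s \<approx> p' * f - e * p" using assms by (intro approx_diff approx_sym[of _ p] approx_sym[of _ p'])
      (auto simp: fred_def intro: approx_sym)
  also have "\<dots> = p' * (f - q * p) - (e - p' * q) * p" by (simp add: algebra_simps)
  finally have "?s \<approx> p' * (f - q * p) - (e - p' * q) * p" .
  moreover have "p' * (f - q * p) - (e - p' * q) * p \<in> S"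
    using assms by (auto simp: fred_def intro!: ring_idealD(2)[OF S] ring_idealD(6)[OF S, of "f - _"] ring_idealD(5)[OF S, of "e - _"])
  ultimately have "?s \<in> S" using approx_in[OF _ S Z_sub] by blast
  then have "T (?s * q) = T (q * ?s)" by (rule T_trace)
  then show ?thesis by (simp add: T_diff algebra_simps)
qed

lemma has_ind_unique: "has_ind e f q c \<Longrightarrow> has_ind e f q c' \<Longrightarrow> c = c'"
  by (auto simp: has_ind_def dest: parametrix_unique)

lemma has_ind_power:
  assumes "fred I e f q p"
  shows "has_ind e f q (T ((e - p * q) ^ J) - T ((f - q * p) ^ J))"
  using fred_improve[OF assms S Z_sub J_pos I_pow] by (metis has_ind_def)

lemma has_ind_inverse:
  assumes "has_ind e f q c"
  obtains p where "has_ind f e p (- c)" "e * p \<approx> p" "p * f \<approx> p" "e - p * q \<in> S" "f - q * p \<in> S"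
proof -
  obtain p where p: "fred S e f q p" "c = T (e - p * q) - T (f - q * p)"
    using assms by (auto simp: has_ind_def)
  then have "has_ind f e p (- c)"
    using fred_sym[OF p(1)] by (auto simp: has_ind_def intro!: exI[of _ q])
  with p(1) show thesis by (intro that) (auto simp: fred_def)
qed

lemma has_indD:
  assumes "has_ind e f q c"
  shows "e * e \<approx> e" "f * f \<approx> f" "f * q \<approx> q" "q * e \<approx> q"
  using assms by (auto simp: has_ind_def fred_def)

text \<open>A parametrix of the composite is the composite of the parametrices in reverse order.
  With u1, v1, u2, v2 the four remainders, its remainders are u1 + p1 u2 q1 and v2 + q2 v1 p2.
  Moving u2 and v1 cyclically, which is legitimate as they lie in \<open>S\<close>, gives T(u2) -
  T(u2 v1) and T(v1) - T(u2 v1) for the extra terms; the mixed term cancels.\<close>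

lemma has_ind_comp:
  assumes "has_ind e f q\<^sub>1 c\<^sub>1" "has_ind f h q\<^sub>2 c\<^sub>2"
  shows "has_ind e h (q\<^sub>2 * q\<^sub>1) (c\<^sub>1 + c\<^sub>2)"
proof -
  obtain p\<^sub>1 p\<^sub>2 where fr: "fred S e f q\<^sub>1 p\<^sub>1" "fred S f h q\<^sub>2 p\<^sub>2"
    and c: "c\<^sub>1 = T (e - p\<^sub>1 * q\<^sub>1) - T (f - q\<^sub>1 * p\<^sub>1)" "c\<^sub>2 = T (f - p\<^sub>2 * q\<^sub>2) - T (h - q\<^sub>2 * p\<^sub>2)"
    using assms by (auto simp: has_ind_def)
  note fr1 = fr(1)[unfolded fred_def] and fr2 = fr(2)[unfolded fred_def]
  let ?u\<^sub>1 = "e - p\<^sub>1 * q\<^sub>1" and ?v\<^sub>1 = "f - q\<^sub>1 * p\<^sub>1" and ?u\<^sub>2 = "f - p\<^sub>2 * q\<^sub>2" and ?v\<^sub>2 = "h - q\<^sub>2 * p\<^sub>2"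
  have fq1: "f * q\<^sub>1 \<approx> q\<^sub>1" and fp2: "f * p\<^sub>2 \<approx> p\<^sub>2" and ff: "f * f \<approx> f" and p2h: "p\<^sub>2 * h \<approx> p\<^sub>2"
    and ep1: "e * p\<^sub>1 \<approx> p\<^sub>1" and q2f: "q\<^sub>2 * f \<approx> q\<^sub>2" and q1e: "q\<^sub>1 * e \<approx> q\<^sub>1" and hq2: "h * q\<^sub>2 \<approx> q\<^sub>2"
    and p1f: "p\<^sub>1 * f \<approx> p\<^sub>1"
    using fr1 fr2 by auto
  have "e - (p\<^sub>1 * p\<^sub>2) * (q\<^sub>2 * q\<^sub>1) = e - p\<^sub>1 * (f * q\<^sub>1) + p\<^sub>1 * (?u\<^sub>2 * q\<^sub>1)"
    by (simp add: algebra_simps)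
  also have "\<dots> \<approx> e - p\<^sub>1 * q\<^sub>1 + p\<^sub>1 * (?u\<^sub>2 * q\<^sub>1)"
    by (intro approx_add approx_diff approx_mult_l fq1 approx_refl)
  finally have u: "e - (p\<^sub>1 * p\<^sub>2) * (q\<^sub>2 * q\<^sub>1) \<approx> ?u\<^sub>1 + p\<^sub>1 * (?u\<^sub>2 * q\<^sub>1)" .
  have "h - (q\<^sub>2 * q\<^sub>1) * (p\<^sub>1 * p\<^sub>2) = h - q\<^sub>2 * (f * p\<^sub>2) + q\<^sub>2 * (?v\<^sub>1 * p\<^sub>2)"
    by (simp add: algebra_simps)
  also have "\<dots> \<approx> h - q\<^sub>2 * p\<^sub>2 + q\<^sub>2 * (?v\<^sub>1 * p\<^sub>2)"
    by (intro approx_add approx_diff approx_mult_l fp2 approx_refl)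
  finally have v: "h - (q\<^sub>2 * q\<^sub>1) * (p\<^sub>1 * p\<^sub>2) \<approx> ?v\<^sub>2 + q\<^sub>2 * (?v\<^sub>1 * p\<^sub>2)" .
  have mem: "?u\<^sub>1 \<in> S" "?u\<^sub>2 \<in> S" "?v\<^sub>1 \<in> S" "?v\<^sub>2 \<in> S" using fr1 fr2 by auto
  have "fred S e h (q\<^sub>2 * q\<^sub>1) (p\<^sub>1 * p\<^sub>2)"
    unfolding fred_def
  proof (intro conjI)
    show "e * e \<approx> e" "h * h \<approx> h" using fr1 fr2 by auto
    show "h * (q\<^sub>2 * q\<^sub>1) \<approx> q\<^sub>2 * q\<^sub>1" using approx_mult_r[OF hq2, of q\<^sub>1] by (simp add: mult.assoc)
    show "q\<^sub>2 * q\<^sub>1 * e \<approx> q\<^sub>2 * q\<^sub>1" using approx_mult_l[OF q1e, of q\<^sub>2] by (simp add: mult.assoc)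
    show "e * (p\<^sub>1 * p\<^sub>2) \<approx> p\<^sub>1 * p\<^sub>2" using approx_mult_r[OF ep1, of p\<^sub>2] by (simp add: mult.assoc)
    show "p\<^sub>1 * p\<^sub>2 * h \<approx> p\<^sub>1 * p\<^sub>2" using approx_mult_l[OF p2h, of p\<^sub>1] by (simp add: mult.assoc)
    show "e - p\<^sub>1 * p\<^sub>2 * (q\<^sub>2 * q\<^sub>1) \<in> S"
      by (rule approx_in[OF u S Z_sub]) (intro ring_idealD[OF S] mem)
    show "h - q\<^sub>2 * q\<^sub>1 * (p\<^sub>1 * p\<^sub>2) \<in> S"
      by (rule approx_in[OF v S Z_sub]) (intro ring_idealD[OF S] mem)
  qed
  moreover have "T (p\<^sub>1 * (?u\<^sub>2 * q\<^sub>1)) = T (?u\<^sub>2) - T (?u\<^sub>2 * ?v\<^sub>1)"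
  proof -
    have "T (p\<^sub>1 * (?u\<^sub>2 * q\<^sub>1)) = T (?u\<^sub>2 * q\<^sub>1 * p\<^sub>1)"
      by (rule T_trace[symmetric]) (intro ring_idealD[OF S] mem)
    also have "?u\<^sub>2 * q\<^sub>1 * p\<^sub>1 = (f * f - p\<^sub>2 * (q\<^sub>2 * f)) - ?u\<^sub>2 * ?v\<^sub>1" by (simp add: algebra_simps)
    also have "T \<dots> = T (?u\<^sub>2 - ?u\<^sub>2 * ?v\<^sub>1)"
      by (intro T_approx approx_diff approx_refl ff approx_mult_l q2f)
    finally show ?thesis by (simp add: T_diff)
  qed
  moreover have "T (q\<^sub>2 * (?v\<^sub>1 * p\<^sub>2)) = T (?v\<^sub>1) - T (?u\<^sub>2 * ?v\<^sub>1)"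
  proof -
    have "T (q\<^sub>2 * (?v\<^sub>1 * p\<^sub>2)) = T (?v\<^sub>1 * p\<^sub>2 * q\<^sub>2)"
      by (rule T_trace[symmetric]) (intro ring_idealD[OF S] mem)
    also have "?v\<^sub>1 * p\<^sub>2 * q\<^sub>2 = (f * f - q\<^sub>1 * (p\<^sub>1 * f)) - ?v\<^sub>1 * ?u\<^sub>2" by (simp add: algebra_simps)
    also have "T \<dots> = T (?v\<^sub>1 - ?v\<^sub>1 * ?u\<^sub>2)"
      by (intro T_approx approx_diff approx_refl ff approx_mult_l p1f)
    also have "\<dots> = T ?v\<^sub>1 - T (?u\<^sub>2 * ?v\<^sub>1)" by (simp add: T_diff T_trace[OF mem(3)])
    finally show ?thesis .
  qed
  ultimately show ?thesis
    unfolding has_ind_def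
    by (intro exI[of _ "p\<^sub>1 * p\<^sub>2"]) (simp add: T_approx[OF u] T_approx[OF v] T_add c)
qed

text \<open>Here \<open>e\<close> itself is a parametrix modulo \<open>I\<close>, and both
  remainders are congruent to \<open>e - w\<close>, so the two power traces cancel.\<close>

lemma has_ind_near_one:
  assumes ee: "e * e \<approx> e" and ew: "e * w \<approx> w" and we: "w * e \<approx> w" and near: "e - w \<in> I"
  shows "has_ind e e w 0"
proof -
  have u: "e - e * w \<approx> e - w" and v: "e - w * e \<approx> e - w"
    using ew we by (auto intro: approx_diff)
  have sub: "Z \<subseteq> I" using Z_sub S_sub by blast
  have "fred I e e w e"
    using ee ew we near approx_in[OF u I sub] approx_in[OF v I sub] by (simp add: fred_def)
  from has_ind_power[OF this] T_approx[OF approx_power[OF approx_trans[OF u approx_sym[OF v]], of J]]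
  show ?thesis by simp
qed

text \<open>An algebraic replacement for homotopy invariance: if \<open>p\<close> is a parametrix of
  \<open>q\<close>, of index -c, then q'p is an endomorphism of \<open>f\<close> close to the
  identity and has index 0; by additivity the index of q' is c.\<close>

lemma has_ind_perturb:
  assumes q: "has_ind e f q c" and q': "f * q' \<approx> q'" "q' * e \<approx> q'" and near: "q - q' \<in> I"
  shows "has_ind e f q' c"
proof -
  obtain p where p: "has_ind f e p (- c)" "e * p \<approx> p" "p * f \<approx> p" "e - p * q \<in> S" "f - q * p \<in> S"
    using has_ind_inverse[OF q] .
  have "(e - p * q) + p * (q - q') \<in> I" "(f - q * p) + (q - q') * p \<in> I"
    using p(4,5) S_sub ring_idealD(5,6)[OF I near] by (auto intro!: ring_idealD(3)[OF I])
  then have "e - p * q' \<in> I" and fq: "f - q' * p \<in> I" by (simp_all add: algebra_simps)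
  then have "fred I e f q' p" using p(2,3) q' has_indD[OF q] by (simp add: fred_def)
  then obtain c' where c': "has_ind e f q' c'" using has_ind_power by blast
  have "f * (q' * p) \<approx> q' * p" "q' * p * f \<approx> q' * p"
    using approx_mult_r[OF q'(1), of p] approx_mult_l[OF p(3), of q'] by (simp_all add: mult.assoc)
  then have "has_ind f f (q' * p) 0"
    using fq has_indD(2)[OF q] by (intro has_ind_near_one)
  moreover have "has_ind f f (q' * p) (- c + c')" using has_ind_comp[OF p(1) c'] .
  ultimately have "- c + c' = 0" using has_ind_unique by blast
  with c' show ?thesis by simp
qed

text \<open>When the remainders are nilpotent modulo \<open>Z\<close>, the Neumann series produces
  an inverse modulo \<open>Z\<close>, and \<open>T\<close> vanishes on both new remainders.\<close>

lemma has_ind_nilpotent: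
  assumes "fred C e f q p" "0 < j" "\<And>u. u \<in> C \<Longrightarrow> u ^ j \<in> Z"
  shows "has_ind e f q 0"
proof -
  have mem: "e - p * q \<in> C" "f - q * p \<in> C" using assms(1) by (auto simp: fred_def)
  obtain p' where p': "fred Z e f q p'"
    and eq: "T (e - p' * q) - T (f - q * p') = T ((e - p * q) ^ j) - T ((f - q * p) ^ j)"
    using fred_improve[OF assms(1) Z subset_refl assms(2,3)] by auto
  have "T (e - p' * q) - T (f - q * p') = 0"
    unfolding eq using assms(3) mem by (simp add: T_Z)
  then show ?thesis using fred_mono[OF p' Z_sub] by (auto simp: has_ind_def)
qed

text \<open>The classical identities for a pair of projections, in particular that the square of the
  difference commutes with both. They hold only modulo \<open>Z\<close>, so each error is displayed
  as a combination of the defects \<open>e * e - e\<close> and \<open>f * f - f\<close>.\<close>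

lemma diff_idempotents:
  assumes ee: "e * e \<approx> e" and ff: "f * f \<approx> f"
  shows "(e - f)\<^sup>2 * e \<approx> e - e * f * e" "(e - f)\<^sup>2 * f \<approx> f - f * e * f"
    "e * (e - f)\<^sup>2 \<approx> e - e * f * e" "f * (e - f)\<^sup>2 \<approx> f - f * e * f"
    "(e - f) - (e - f) ^ 3 \<approx> e * f * e - f * e * f"
proof -
  have "(e - f)\<^sup>2 * e - (e - e * f * e) = ((e * e - e) * e + (e * e - e)) - (e * (f * e) - e * (f * e))
     - f * (e * e - e) + (f * f - f) * e"
    by (simp add: power2_eq_square algebra_simps)
  also have "\<dots> \<in> Z" using ee ff unfolding approx_def by (auto intro!: Z_simps(2,3) Z_simps(5)[of "_ - _"] Z_simps(6)[of "_ - _"] simp: Z_simps(1))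
  finally show "(e - f)\<^sup>2 * e \<approx> e - e * f * e" by (simp add: approx_def)
  have "(e - f)\<^sup>2 * f - (f - f * e * f) = ((f * f - f) * f + (f * f - f)) - e * (f * f - f) + (e * e - e) * f"
    by (simp add: power2_eq_square algebra_simps)
  also have "\<dots> \<in> Z" using ee ff unfolding approx_def by (auto intro!: Z_simps(2,3) Z_simps(5)[of "_ - _"] Z_simps(6)[of "_ - _"])
  finally show "(e - f)\<^sup>2 * f \<approx> f - f * e * f" by (simp add: approx_def)
  have "e * (e - f)\<^sup>2 - (e - e * f * e) = (e * (e * e - e) + (e * e - e)) - (e * e - e) * f + e * (f * f - f)"
    by (simp add: power2_eq_square algebra_simps)
  also have "\<dots> \<in> Z" using ee ff unfolding approx_def by (auto intro!: Z_simps(2,3) Z_simps(5)[of "_ - _"] Z_simps(6)[of "_ - _"])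
  finally show "e * (e - f)\<^sup>2 \<approx> e - e * f * e" by (simp add: approx_def)
  have "f * (e - f)\<^sup>2 - (f - f * e * f) = (f * (f * f - f) + (f * f - f)) - (f * f - f) * e + f * (e * e - e)"
    by (simp add: power2_eq_square algebra_simps)
  also have "\<dots> \<in> Z" using ee ff unfolding approx_def by (auto intro!: Z_simps(2,3) Z_simps(5)[of "_ - _"] Z_simps(6)[of "_ - _"])
  finally show "f * (e - f)\<^sup>2 \<approx> f - f * e * f" by (simp add: approx_def)
  have "(e - f) ^ 3 = (e - f)\<^sup>2 * e - (e - f)\<^sup>2 * f"
    by (simp add: power3_eq_cube power2_eq_square algebra_simps)
  also have "\<dots> \<approx> (e - e * f * e) - (f - f * e * f)"
    by (rule approx_diff) fact+
  finally have "(e - f) - (e - f) ^ 3 \<approx> (e - f) - ((e - e * f * e) - (f - f * e * f))"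
    by (rule approx_diff[OF approx_refl])
  then show "(e - f) - (e - f) ^ 3 \<approx> e * f * e - f * e * f" by (simp add: algebra_simps)
qed

lemma diff_idempotents_commute:
  assumes ee: "e * e \<approx> e" and ff: "f * f \<approx> f"
  shows "(e - f) ^ (2 * i) * e \<approx> e * (e - f) ^ (2 * i)" "(e - f) ^ (2 * i) * f \<approx> f * (e - f) ^ (2 * i)"
proof -
  have *: "x ^ i * y \<approx> y * x ^ i" if "x * y \<approx> y * x" for x y
  proof (induction i)
    case (Suc i)
    have "x ^ Suc i * y = x * (x ^ i * y)" by (simp add: mult.assoc)
    also have "\<dots> \<approx> x * (y * x ^ i)" by (rule approx_mult_l[OF Suc])
    also have "\<dots> = x * y * x ^ i" by (simp add: mult.assoc)
    also have "\<dots> \<approx> y * x * x ^ i" by (rule approx_mult_r[OF that])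
    finally show ?case by (simp add: mult.assoc)
  qed simp
  note d = diff_idempotents[OF ee ff]
  show "(e - f) ^ (2 * i) * e \<approx> e * (e - f) ^ (2 * i)" "(e - f) ^ (2 * i) * f \<approx> f * (e - f) ^ (2 * i)"
    unfolding power_mult
    by (rule *, rule approx_trans[OF d(1) approx_sym[OF d(3)]])
      (rule *, rule approx_trans[OF d(2) approx_sym[OF d(4)]])
qed

text \<open>The parametrix of fe is ef, with remainders e - efe = d^2 e and f - fef = d^2 f for d =
  e - f. Since d^2 commutes with \<open>e\<close> and \<open>f\<close>, the \<open>J\<close>-th
  powers are d^(2J) e and d^(2J) f, and their difference is d^(2J+1).\<close>

lemma has_ind_idempotents:
  assumes ee: "e * e \<approx> e" and ff: "f * f \<approx> f" and near: "e - f \<in> I"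
  shows "has_ind e f (f * e) (T ((e - f) ^ (2 * J + 1)))"
proof -
  let ?d = "e - f"
  note d = diff_idempotents[OF ee ff]
  have sub: "Z \<subseteq> I" using Z_sub S_sub by blast
  have "e - (e * f) * (f * e) \<approx> e - e * f * e" "f - (f * e) * (e * f) \<approx> f - f * e * f"
    using approx_mult_l[OF approx_mult_r[OF ff, of e], of e] approx_mult_l[OF approx_mult_r[OF ee, of f], of f]
    by (auto intro!: approx_diff simp: mult.assoc)
  then have u: "e - (e * f) * (f * e) \<approx> ?d\<^sup>2 * e" and v: "f - (f * e) * (e * f) \<approx> ?d\<^sup>2 * f"
    by (auto intro: approx_trans approx_sym[OF d(1)] approx_sym[OF d(2)])
  have "?d\<^sup>2 * e \<in> I" "?d\<^sup>2 * f \<in> I"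
    using near by (auto simp: power2_eq_square intro!: ring_idealD(5)[OF I])
  then have "e - (e * f) * (f * e) \<in> I" "f - (f * e) * (e * f) \<in> I"
    using approx_in[OF u I sub] approx_in[OF v I sub] by auto
  then have "fred I e f (f * e) (e * f)"
    using ee ff approx_mult_r[OF ff, of e] approx_mult_l[OF ee, of f]
      approx_mult_r[OF ee, of f] approx_mult_l[OF ff, of e]
    by (simp add: fred_def mult.assoc)
  from has_ind_power[OF this]
  have "has_ind e f (f * e) (T ((e - (e * f) * (f * e)) ^ J) - T ((f - (f * e) * (e * f)) ^ J))" .
  \<comment> \<open>The successor matters: for exponent 0 the two sides would be 1 and
    \<open>y\<close>.\<close>
  moreover have pow: "(x * y) ^ Suc i \<approx> x ^ Suc i * y" if yy: "y * y \<approx> y" and xy: "y * x \<approx> x * y" for x y i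
  proof (induction i)
    case (Suc i)
    have "(x * y) ^ Suc (Suc i) = x * y * (x * y) ^ Suc i" by simp
    also have "\<dots> \<approx> x * y * (x ^ Suc i * y)" by (rule approx_mult_l[OF Suc])
    also have "\<dots> = x * (y * x ^ Suc i) * y" by (simp add: mult.assoc)
    also have "\<dots> \<approx> x * (x ^ Suc i * y) * y"
    proof (intro approx_mult_r approx_mult_l)
      show "y * x ^ n \<approx> x ^ n * y" for n
      proof (induction n)
        case (Suc n)
        have "y * x ^ Suc n = y * x * x ^ n" by (simp add: mult.assoc)
        also have "\<dots> \<approx> x * y * x ^ n" by (rule approx_mult_r[OF xy])
        also have "\<dots> \<approx> x * (x ^ n * y)" using approx_mult_l[OF Suc, of x] by (simp add: mult.assoc)
        finally show ?case by (simp add: mult.assoc)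
      qed simp
    qed
    also have "\<dots> = x ^ Suc (Suc i) * (y * y)" by (simp add: mult.assoc)
    also have "\<dots> \<approx> x ^ Suc (Suc i) * y" by (rule approx_mult_l[OF yy])
    finally show ?case .
  qed simp
  obtain j where j: "J = Suc j" using J_pos gr0_implies_Suc by blast
  have "T ((e - (e * f) * (f * e)) ^ J) = T ((?d\<^sup>2) ^ J * e)"
    using approx_trans[OF approx_power[OF u] pow[OF ee approx_trans[OF d(3) approx_sym[OF d(1)]]]]
    by (intro T_approx) (simp only: j)
  moreover have "T ((f - (f * e) * (e * f)) ^ J) = T ((?d\<^sup>2) ^ J * f)"
    using approx_trans[OF approx_power[OF v] pow[OF ff approx_trans[OF d(4) approx_sym[OF d(2)]]]]
    by (intro T_approx) (simp only: j)
  moreover have "(?d\<^sup>2) ^ J * e - (?d\<^sup>2) ^ J * f = ?d ^ (2 * J + 1)"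
    by (simp only: power_mult power_add power_one_right right_diff_distrib)
  ultimately show ?thesis by (metis T_diff)
qed

text \<open>Each step uses $d - d^3 = efe - fef = e(fd) + (de)f$ for the difference \<open>d\<close> of the idempotents.\<close>

lemma odd_power_step:
  assumes ee: "e * e \<approx> e" and ff: "f * f \<approx> f"
    and tr: "\<And>x y. x \<in> X \<Longrightarrow> y \<in> Y \<Longrightarrow> T (x * y) = T (y * x)"
    and mem: "(e - f) ^ (2 * i) * e \<in> X" "f * (e - f) ^ (2 * i) \<in> X" "f * (e - f) \<in> Y" "(e - f) * e \<in> Y"
  shows "T ((e - f) ^ (2 * i + 3)) = T ((e - f) ^ (2 * i + 1))"
proof -
  let ?d = "e - f" and ?D = "(e - f) ^ (2 * i)"
  note com = diff_idempotents_commute[OF ee ff, of i]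
  have dD: "?D * (?d * x) = ?d * (?D * x)" for x
    by (simp only: power_commutes flip: mult.assoc)
  have "?d ^ (2 * i + 1) - ?d ^ (2 * i + 3) = ?D * (?d - ?d ^ 3)"
    by (simp only: power_add power_one_right right_diff_distrib)
  also have "\<dots> \<approx> ?D * (e * f * e - f * e * f)" by (rule approx_mult_l[OF diff_idempotents(5)[OF ee ff]])
  also have "\<dots> \<approx> ?D * (e * (f * ?d) + ?d * e * f)"
  proof (rule approx_mult_l)
    have "(e * f * e - f * e * f) - (e * (f * ?d) + ?d * e * f) = e * (f * f - f) - (e * e - e) * f"
      by (simp add: algebra_simps)
    also have "\<dots> \<in> Z" using ee ff unfolding approx_def by (auto intro!: Z_simps(2) Z_simps(5)[of "_ - _"] Z_simps(6)[of "_ - _"])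
    finally show "e * f * e - f * e * f \<approx> e * (f * ?d) + ?d * e * f" by (simp add: approx_def)
  qed
  also have "\<dots> = (?D * e) * (f * ?d) + ?D * (?d * e * f)" by (simp add: algebra_simps)
  also have "\<dots> \<approx> (?D * e) * (f * ?d) + (?d * e) * (f * ?D)"
  proof (rule approx_add[OF approx_refl])
    have "?D * (?d * e * f) = ?d * (?D * e) * f" by (simp only: mult.assoc dD)
    also have "\<dots> \<approx> ?d * (e * ?D) * f" by (rule approx_mult_r[OF approx_mult_l[OF com(1)]])
    also have "\<dots> = ?d * e * (?D * f)" by (simp add: mult.assoc)
    also have "\<dots> \<approx> ?d * e * (f * ?D)" by (rule approx_mult_l[OF com(2)])
    finally show "?D * (?d * e * f) \<approx> ?d * e * (f * ?D)" .
  qed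
  finally have "T (?d ^ (2 * i + 1) - ?d ^ (2 * i + 3)) = T ((?D * e) * (f * ?d) + (?d * e) * (f * ?D))"
    by (rule T_approx)
  then have "T (?d ^ (2 * i + 1)) - T (?d ^ (2 * i + 3)) = T (?D * e * (f * ?d)) + T (?d * e * (f * ?D))"
    by (simp only: T_diff T_add)
  moreover have "T (?D * e * (f * ?d)) = T (f * ?d * (?D * e))" by (rule tr[OF mem(1,3)])
  moreover have "T (?d * e * (f * ?D)) = T (f * ?D * (?d * e))" by (rule tr[OF mem(2,4), symmetric])
  moreover have "f * ?D * (?d * e) = f * ?d * (?D * e)" by (simp only: mult.assoc dD)
  ultimately have eq: "T (?d ^ (2 * i + 1)) - T (?d ^ (2 * i + 3)) = T (f * ?d * (?D * e)) + T (f * ?d * (?D * e))"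
    by simp
  \<comment> \<open>Both halves have been turned into the same trace, and it vanishes: after moving
    the even power past \<open>e\<close> it contains f (e - f) e, which is 0 for
    idempotents.\<close>
  have "f * ?d * (?D * e) \<approx> f * ?d * (e * ?D)" by (rule approx_mult_l[OF com(1)])
  also have "\<dots> = (f * ?d * e) * ?D" by (simp add: mult.assoc)
  also have "\<dots> \<approx> 0 * ?D"
  proof (rule approx_mult_r)
    have "f * ?d * e - 0 = f * (e * e - e) - (f * f - f) * e" by (simp add: algebra_simps)
    also have "\<dots> \<in> Z" using ee ff unfolding approx_def by (auto intro!: Z_simps(2) Z_simps(5)[of "_ - _"] Z_simps(6)[of "_ - _"])
    finally show "f * ?d * e \<approx> 0" by (simp add: approx_def)
  qed
  finally have "T (f * ?d * (?D * e)) = T (0 * ?D)" by (rule T_approx)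
  with eq show ?thesis by (simp add: T_zero)
qed

end

section \<open>Ideals of complex algebras\<close>

lemma alg_homD:
  assumes "alg_hom f"
  shows "f (x + y) = f x + f y" "f (x - y) = f x - f y" "f (- x) = - f x" "f 0 = 0"
    "f (c *\<^sub>C x) = c *\<^sub>C f x" "f (x * y) = f x * f y"
proof -
  interpret f: Vector_Spaces.linear scaleC scaleC f using assms by (simp add: alg_hom_def)
  show "f (x + y) = f x + f y" "f (x - y) = f x - f y" "f (- x) = - f x" "f 0 = 0"
    "f (c *\<^sub>C x) = c *\<^sub>C f x" by (rule f.add f.diff f.neg f.zero f.scale)+
  show "f (x * y) = f x * f y" using assms by (simp add: alg_hom_def)
qed

lemma clinear_mult: "clinear (\<lambda>x. x * y)" "clinear ((*) (y :: 'x::complex_alg))"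
  by (unfold_locales; simp add: distrib_left distrib_right mult_scaleC_left mult_scaleC_right)+

definition alg_ideal :: "'x::complex_alg set \<Rightarrow> bool"
  where "alg_ideal J \<longleftrightarrow> cvec.subspace J \<and> (\<forall>x\<in>J. \<forall>y. x * y \<in> J \<and> y * x \<in> J)"

lemma alg_idealD:
  assumes "alg_ideal J"
  shows "cvec.subspace J" "x \<in> J \<Longrightarrow> x * y \<in> J" "x \<in> J \<Longrightarrow> y * x \<in> J" "0 \<in> J"
    "x \<in> J \<Longrightarrow> y \<in> J \<Longrightarrow> x + y \<in> J" "x \<in> J \<Longrightarrow> y \<in> J \<Longrightarrow> x - y \<in> J" "x \<in> J \<Longrightarrow> c *\<^sub>C x \<in> J"
  using assms by (auto simp: alg_ideal_def cvec.subspace_0 cvec.subspace_add cvec.subspace_diff cvec.subspace_scale)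

lemma alg_ideal_UNIV: "alg_ideal UNIV"
  by (simp add: alg_ideal_def)

lemma alg_ideal_kernel: "alg_hom f \<Longrightarrow> alg_ideal {x. f x = 0}"
  by (auto simp: alg_ideal_def cvec.subspace_def alg_homD)

lemma alg_ideal_pow: "alg_ideal J \<Longrightarrow> alg_ideal (ideal_pow J n)"
proof (induction J n rule: ideal_pow.induct)
  case (1 J)
  show ?case by (simp add: alg_ideal_UNIV)
next
  case (3 J n)
  let ?S = "{x * y | x y. x \<in> ideal_pow J (Suc n) \<and> y \<in> J}"
  have "s * z \<in> cvec.span ?S \<and> z * s \<in> cvec.span ?S" if "s \<in> ?S" for s z
  proof -
    obtain x y where s: "s = x * y" "x \<in> ideal_pow J (Suc n)" "y \<in> J" using \<open>s \<in> ?S\<close> by blast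
    have "x * (y * z) \<in> ?S" using s(2) alg_idealD(2)[OF 3(2) s(3)] by blast
    moreover have "(z * x) * y \<in> ?S" using s(3) alg_idealD(3)[OF 3(1)[OF 3(2)] s(2)] by blast
    ultimately show ?thesis by (simp add: s(1) mult.assoc cvec.span_base)
  qed
  then have "x * z \<in> cvec.span ?S \<and> z * x \<in> cvec.span ?S" if "x \<in> cvec.span ?S" for x z
    by (intro conjI clinear_image_span[OF clinear_mult(1) that] clinear_image_span[OF clinear_mult(2) that]) blast+
  then show ?case by (simp add: alg_ideal_def)
qed simp

lemma ideal_pow_Suc: "alg_ideal J \<Longrightarrow> x \<in> ideal_pow J n \<Longrightarrow> y \<in> J \<Longrightarrow> x * y \<in> ideal_pow J (Suc n)"
  by (cases n) (auto simp: alg_idealD intro: cvec.span_base)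

text \<open>An induction principle that hides the special treatment of exponents 0 and 1 in
  \<open>ideal_pow\<close>. The case n = 0 is excluded because the first power is J itself, while
  the zeroth is the whole algebra.\<close>

lemma ideal_pow_Suc_subset:
  assumes "0 < n" "cvec.subspace V" "\<And>x y. x \<in> ideal_pow J n \<Longrightarrow> y \<in> J \<Longrightarrow> x * y \<in> V"
  shows "ideal_pow J (Suc n) \<subseteq> V"
proof -
  obtain k where n: "n = Suc k" using assms(1) gr0_implies_Suc by blast
  show ?thesis unfolding n ideal_pow.simps
    by (rule cvec.span_minimal) (use assms(2,3) in \<open>auto simp: n\<close>)
qed

lemma ideal_pow_mult:
  assumes J: "alg_ideal J"
  shows "x \<in> ideal_pow J a \<Longrightarrow> y \<in> ideal_pow J b \<Longrightarrow> x * y \<in> ideal_pow J (a + b)"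
proof (induction b arbitrary: y)
  case 0
  then show ?case using alg_idealD(2)[OF alg_ideal_pow[OF J]] by simp
next
  case (Suc b)
  show ?case
  proof (cases "b = 0")
    case True
    then show ?thesis using Suc.prems ideal_pow_Suc[OF J] by simp
  next
    case False
    have "ideal_pow J (Suc b) \<subseteq> {y. x * y \<in> ideal_pow J (a + Suc b)}"
    proof (rule ideal_pow_Suc_subset)
      show "cvec.subspace {y. x * y \<in> ideal_pow J (a + Suc b)}"
        using alg_idealD[OF alg_ideal_pow[OF J]]
        by (auto simp: cvec.subspace_def distrib_left mult_scaleC_right)
      fix u v assume "u \<in> ideal_pow J b" "v \<in> J"
      then have "(x * u) * v \<in> ideal_pow J (Suc (a + b))"
        using Suc by (intro ideal_pow_Suc[OF J]) auto
      then show "u * v \<in> {y. x * y \<in> ideal_pow J (a + Suc b)}" by (simp add: mult.assoc)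
    qed (use False in simp)
    then show ?thesis using Suc.prems by blast
  qed
qed

lemma ideal_pow_antimono:
  assumes J: "alg_ideal J" and "m \<le> n"
  shows "ideal_pow J n \<subseteq> ideal_pow J m"
proof -
  have "ideal_pow J (Suc k) \<subseteq> ideal_pow J k" for k
  proof (cases "k = 0")
    case False
    then show ?thesis
      by (intro ideal_pow_Suc_subset alg_idealD(1)) (use J in \<open>auto simp: alg_ideal_pow alg_idealD(2)\<close>)
  qed simp
  then show ?thesis using \<open>m \<le> n\<close> by (rule lift_Suc_antimono_le)
qed

definition ideal_sum :: "'x::complex_alg set \<Rightarrow> 'x set \<Rightarrow> 'x set"
  where "ideal_sum A B = {a + b | a b. a \<in> A \<and> b \<in> B}"

lemma ideal_sumI: "a \<in> A \<Longrightarrow> b \<in> B \<Longrightarrow> a + b \<in> ideal_sum A B"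
  by (auto simp: ideal_sum_def)

lemma alg_ideal_sum:
  assumes "alg_ideal A" "alg_ideal B"
  shows "alg_ideal (ideal_sum A B)"
  unfolding alg_ideal_def
proof (intro conjI ballI allI)
  show "cvec.subspace (ideal_sum A B)"
    unfolding ideal_sum_def by (intro cvec.subspace_sums alg_idealD(1) assms)
  fix x y assume "x \<in> ideal_sum A B"
  then obtain a b where "x = a + b" "a \<in> A" "b \<in> B" by (auto simp: ideal_sum_def)
  then show "x * y \<in> ideal_sum A B" "y * x \<in> ideal_sum A B"
    using assms by (simp_all add: distrib_left distrib_right ideal_sumI alg_idealD(2,3))
qed

lemma ideal_sum_upper:
  "alg_ideal A \<Longrightarrow> alg_ideal B \<Longrightarrow> A \<subseteq> ideal_sum A B"
  "alg_ideal A \<Longrightarrow> alg_ideal B \<Longrightarrow> B \<subseteq> ideal_sum A B"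
  using ideal_sumI[of _ A 0 B] ideal_sumI[of 0 A _ B] by (auto simp: alg_idealD(4))

text \<open>The pigeonhole principle: a product of k factors from R + N with at most a-1 factors in
  R and at most b-1 in N would have at most a+b-2 < k factors.\<close>

lemma ideal_pow_sum:
  assumes R: "alg_ideal R" and N: "alg_ideal N"
  shows "a + b \<le> Suc k \<Longrightarrow> ideal_pow (ideal_sum R N) k \<subseteq> ideal_sum (ideal_pow R a) (ideal_pow N b)"
proof (induction k arbitrary: a b)
  case 0
  then have "a = 0 \<or> b = 0" by linarith
  then have "ideal_sum (ideal_pow R a) (ideal_pow N b) = UNIV"
    using ideal_sum_upper[OF alg_ideal_pow[OF R, of a] alg_ideal_pow[OF N, of b]] by auto
  then show ?case by simp
next
  case (Suc k)
  note pows = alg_ideal_pow[OF R, of a] alg_ideal_pow[OF N, of b]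
  show ?case
  proof (cases "a = 0 \<or> b = 0")
    case True
    then have "ideal_sum (ideal_pow R a) (ideal_pow N b) = UNIV"
      using ideal_sum_upper[OF pows] by auto
    then show ?thesis by simp
  next
    case False
    then obtain a' b' where ab: "a = Suc a'" "b = Suc b'" by (auto simp: gr0_conv_Suc)
    show ?thesis
    proof (cases "k = 0")
      case True
      with Suc.prems ab have "a = 1" "b = 1" by auto
      then show ?thesis using True by simp
    next
      case False
      show ?thesis
      proof (rule ideal_pow_Suc_subset)
        show "cvec.subspace (ideal_sum (ideal_pow R a) (ideal_pow N b))"
          by (intro alg_idealD(1) alg_ideal_sum pows)
        fix x y assume x: "x \<in> ideal_pow (ideal_sum R N) k" and y: "y \<in> ideal_sum R N"
        obtain r n where y: "y = r + n" "r \<in> R" "n \<in> N" using y by (auto simp: ideal_sum_def)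
        \<comment> \<open>Two decompositions of the same \<open>x\<close>: the one with a weaker
          demand on R is multiplied by the part \<open>r\<close> of the last factor, the one with a
          weaker demand on N by the part \<open>n\<close>.\<close>
        have "x \<in> ideal_sum (ideal_pow R a') (ideal_pow N b)" "x \<in> ideal_sum (ideal_pow R a) (ideal_pow N b')"
          using Suc.IH[of a' b] Suc.IH[of a b'] Suc.prems ab x by auto
        then obtain r1 n1 r2 n2 where x: "x = r1 + n1" "r1 \<in> ideal_pow R a'" "n1 \<in> ideal_pow N b"
          "x = r2 + n2" "r2 \<in> ideal_pow R a" "n2 \<in> ideal_pow N b'" unfolding ideal_sum_def by blast
        have "x * y = (r1 + n1) * r + (r2 + n2) * n" using x y by (simp add: distrib_left)
        also have "\<dots> = (r1 * r + r2 * n) + (n1 * r + n2 * n)" by (simp add: distrib_right)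
        also have "\<dots> \<in> ideal_sum (ideal_pow R a) (ideal_pow N b)"
        proof -
          have "r1 * r + r2 * n \<in> ideal_pow R a"
            using ideal_pow_Suc[OF R x(2) y(2)] alg_idealD(2)[OF pows(1) x(5)]
            by (intro alg_idealD(5)[OF pows(1)]) (auto simp: ab)
          moreover have "n1 * r + n2 * n \<in> ideal_pow N b"
            using ideal_pow_Suc[OF N x(6) y(3)] alg_idealD(2)[OF pows(2) x(3)]
            by (intro alg_idealD(5)[OF pows(2)]) (auto simp: ab)
          ultimately show ?thesis by (rule ideal_sumI)
        qed
        finally show "x * y \<in> ideal_sum (ideal_pow R a) (ideal_pow N b)" .
      qed (use False in simp)
    qed
  qed
qed

lemma alg_hom_ideal_pow:
  assumes h: "alg_hom h" and "h ` J \<subseteq> K" "alg_ideal K"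
  shows "h ` ideal_pow J n \<subseteq> ideal_pow K n"
proof (induction n)
  case (Suc n)
  show ?case
  proof (cases "n = 0")
    case False
    have "ideal_pow J (Suc n) \<subseteq> {x. h x \<in> ideal_pow K (Suc n)}"
    proof (rule ideal_pow_Suc_subset)
      show "cvec.subspace {x. h x \<in> ideal_pow K (Suc n)}"
        using alg_idealD[OF alg_ideal_pow[OF assms(3), of "Suc n"]]
        by (auto simp: cvec.subspace_def alg_homD[OF h])
      fix x y assume "x \<in> ideal_pow J n" "y \<in> J"
      then show "x * y \<in> {x. h x \<in> ideal_pow K (Suc n)}"
        using Suc assms(2) ideal_pow_Suc[OF assms(3), of "h x" n "h y"] by (auto simp: alg_homD[OF h])
    qed (use False in simp)
    then show ?thesis by blast
  qed (use assms in simp)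
qed simp

lemma extension_ideal:
  assumes "extension i p"
  shows "alg_hom i" "alg_hom p" "inj i" "range i = {x. p x = 0}" "surj p" "alg_ideal (range i)"
  using assms alg_ideal_kernel[of p] by (auto simp: extension_def)

section \<open>The adic filtration of the X-complex\<close>

text \<open>Turns vanishing of a cochain on a step of the filtration into vanishing on a power of
  the ideal, which is what the ring calculus can handle.\<close>

lemma ideal_pow_F_even:
  assumes "alg_ideal J"
  shows "ideal_pow J (Suc k) \<subseteq> F_even J k"
proof -
  have "ideal_pow J (Suc k) \<subseteq> ideal_pow J (k div 2 + 1)" by (rule ideal_pow_antimono[OF assms]) simp
  then show ?thesis by (auto simp: F_even_def Let_def intro: cvec.span_base)
qed

lemma subspace_F_even: "alg_ideal J \<Longrightarrow> cvec.subspace (F_even J k)"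
  by (simp add: F_even_def Let_def alg_idealD(1) alg_ideal_pow)

lemma subspace_F_odd: "cvec.subspace (F_odd J k)"
  by (simp add: F_odd_def Let_def nat_forms_on_def)

lemma F_even_Suc_subset:
  assumes J: "alg_ideal J"
  shows "F_even J (Suc m) \<subseteq> F_even J m"
proof (cases "even m")
  case True
  then have "F_even J (Suc m) = ideal_pow J (m div 2 + 1)" by (simp add: F_even_def Let_def)
  then show ?thesis using True by (auto simp: F_even_def Let_def intro: cvec.span_base)
next
  case False
  let ?n = "m div 2"
  have pow: "alg_ideal (ideal_pow J (?n + 1))" by (rule alg_ideal_pow[OF J])
  have "F_even J (Suc m) = cvec.span (ideal_pow J (?n + 1 + 1) \<union> {x * y - y * x | x y. x \<in> ideal_pow J (?n + 1)})"
    using False by (simp add: F_even_def Let_def)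
  also have "\<dots> \<subseteq> ideal_pow J (?n + 1)"
  proof (rule cvec.span_minimal[OF _ alg_idealD(1)[OF pow]], safe)
    show "x \<in> ideal_pow J (?n + 1)" if "x \<in> ideal_pow J (?n + 1 + 1)" for x
      using that ideal_pow_antimono[OF J, of "?n + 1" "?n + 1 + 1"] by auto
    show "x * y - y * x \<in> ideal_pow J (?n + 1)" if "x \<in> ideal_pow J (?n + 1)" for x y
      using that by (intro alg_idealD(6)[OF pow] alg_idealD(2,3)[OF pow])
  qed
  finally show ?thesis using False by (simp add: F_even_def Let_def)
qed

lemma ideal_pow_plus_antimono: "alg_ideal J \<Longrightarrow> m \<le> n \<Longrightarrow> ideal_pow_plus J n \<subseteq> ideal_pow_plus J m"
  using ideal_pow_antimono[of J m n] by (auto simp: ideal_pow_plus_def)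

lemma nat_forms_on_mono: "S \<subseteq> S' \<Longrightarrow> T \<subseteq> T' \<Longrightarrow> nat_forms_on S T \<subseteq> nat_forms_on S' T'"
  unfolding nat_forms_on_def by (rule cvec.span_mono) blast

lemma F_odd_Suc_subset:
  assumes J: "alg_ideal J"
  shows "F_odd J (Suc m) \<subseteq> F_odd J m"
proof (cases "even m")
  case True
  let ?n = "m div 2"
  have "F_odd J (Suc m) = cvec.span (nat_forms_on (ideal_pow_plus J (?n + 1)) UNIV \<union> nat_forms_on (ideal_pow_plus J ?n) J)"
    using True by (simp add: F_odd_def Let_def)
  also have "\<dots> \<subseteq> nat_forms_on (ideal_pow_plus J ?n) UNIV"
    by (intro cvec.span_minimal Un_least nat_forms_on_mono ideal_pow_plus_antimono[OF J])
      (auto simp: nat_forms_on_def)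
  finally show ?thesis using True by (simp add: F_odd_def Let_def)
next
  case False
  then show ?thesis by (auto simp: F_odd_def Let_def intro!: cvec.span_base)
qed

lemma F_even_antimono: "alg_ideal J \<Longrightarrow> m \<le> n \<Longrightarrow> F_even J n \<subseteq> F_even J m"
  using F_even_Suc_subset by (rule lift_Suc_antimono_le)

lemma F_odd_antimono: "alg_ideal J \<Longrightarrow> m \<le> n \<Longrightarrow> F_odd J n \<subseteq> F_odd J m"
  using F_odd_Suc_subset by (rule lift_Suc_antimono_le)

section \<open>Extension of linear functionals\<close>

interpretation cpair: vector_space_pair "scaleC :: complex \<Rightarrow> 'a::complex_vec \<Rightarrow> 'a"
  "scaleC :: complex \<Rightarrow> 'b::complex_vec \<Rightarrow> 'b"
  by unfold_locales

text \<open>The functional is extended by zero along \<open>U\<close>, consistently because it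
  vanishes on the intersection of \<open>V\<close> and \<open>U\<close>, and then to the whole space
  by means of a linear projection onto V + U.\<close>

lemma extend_functional:
  fixes f :: "'v::complex_vec \<Rightarrow> complex"
  assumes V: "cvec.subspace V" and U: "cvec.subspace U"
    and add: "\<And>x y. x \<in> V \<Longrightarrow> y \<in> V \<Longrightarrow> f (x + y) = f x + f y"
    and scale: "\<And>c x. x \<in> V \<Longrightarrow> f (c *\<^sub>C x) = c * f x"
    and zero: "\<And>x. x \<in> V \<Longrightarrow> x \<in> U \<Longrightarrow> f x = 0"
  obtains g where "clinear g" "\<And>x. x \<in> V \<Longrightarrow> g x = f x" "\<And>x. x \<in> U \<Longrightarrow> g x = 0"
proof -
  note sub = cvec.subspace_add[OF V] cvec.subspace_diff[OF V] cvec.subspace_scale[OF V]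
    cvec.subspace_add[OF U] cvec.subspace_diff[OF U] cvec.subspace_scale[OF U]
    cvec.subspace_0[OF V] cvec.subspace_0[OF U]
  let ?W = "{v + u | v u. v \<in> V \<and> u \<in> U}"
  have W: "cvec.subspace ?W" by (rule cvec.subspace_sums[OF V U])
  have f_diff: "f (x - y) = f x - f y" if "x \<in> V" "y \<in> V" for x y
    using add[of "x - y" y] that sub(2) by simp
  \<comment> \<open>A value for w = v + u read off from any decomposition; the next fact shows that
    the choice is immaterial.\<close>
  define g0 where "g0 w = f (SOME v. v \<in> V \<and> w - v \<in> U)" for w
  have g0: "g0 w = f v" if "v \<in> V" "w - v \<in> U" for v w
  proof -
    define v' where "v' = (SOME v. v \<in> V \<and> w - v \<in> U)"
    have v': "v' \<in> V" "w - v' \<in> U"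
      unfolding v'_def using someI[of "\<lambda>v. v \<in> V \<and> w - v \<in> U" v] that by auto
    have "(w - v') - (w - v) \<in> U" by (rule sub(5)[OF v'(2) that(2)])
    then have "v - v' \<in> U" by simp
    then have "f (v - v') = 0" by (rule zero[OF sub(2)[OF that(1) v'(1)]])
    then show ?thesis using f_diff[OF that(1) v'(1)] by (simp add: g0_def v'_def)
  qed
  \<comment> \<open>A left inverse of the identity on V + U with range in V + U is a projection onto
    it.\<close>
  have "\<exists>P. range P \<subseteq> ?W \<and> clinear P \<and> (\<forall>v\<in>?W. P (id v) = v)"
    by (rule cpair.linear_exists_left_inverse_on) (auto simp: W cvec.linear_id[unfolded id_def] id_def)
  then obtain P where P: "range P \<subseteq> ?W" "clinear P" "\<And>w. w \<in> ?W \<Longrightarrow> P w = w" by auto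
  interpret P: Vector_Spaces.linear scaleC scaleC P by fact
  have W_dec: "\<exists>v\<in>V. P w - v \<in> U" for w
  proof -
    have "P w \<in> ?W" using P(1) by blast
    then show ?thesis by force
  qed
  have "clinear (g0 \<circ> P)"
  proof unfold_locales
    fix x y :: 'v and c :: complex
    obtain v1 v2 where v: "v1 \<in> V" "P x - v1 \<in> U" "v2 \<in> V" "P y - v2 \<in> U" using W_dec by metis
    have "P (x + y) - (v1 + v2) \<in> U" using sub(4)[OF v(2,4)] by (simp add: P.add algebra_simps)
    from g0[OF sub(1)[OF v(1,3)] this] show "(g0 \<circ> P) (x + y) = (g0 \<circ> P) x + (g0 \<circ> P) y"
      by (simp add: g0[OF v(1,2)] g0[OF v(3,4)] add[OF v(1,3)])
    have "P (c *\<^sub>C x) - c *\<^sub>C v1 \<in> U"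
      using sub(6)[OF v(2), of c] by (simp add: P.scale cvec.scale_right_diff_distrib)
    from g0[OF sub(3)[OF v(1)] this] show "(g0 \<circ> P) (c *\<^sub>C x) = c *\<^sub>C (g0 \<circ> P) x"
      by (simp add: g0[OF v(1,2)] scale[OF v(1)] scaleC_complex_def)
  qed
  moreover have "(g0 \<circ> P) x = f x" if "x \<in> V" for x
  proof -
    have "x \<in> ?W" using that sub(8) by force
    then show ?thesis using P(3) g0[OF that] sub(8) by simp
  qed
  moreover have "(g0 \<circ> P) x = 0" if "x \<in> U" for x
  proof -
    have "x \<in> ?W" using that sub(7) by force
    then show ?thesis using P(3) g0[OF sub(7), of x] that zero[OF sub(7,8)] by simp
  qed
  ultimately show ?thesis by (rule that)
qed

lemma clinear_functionalD:
  fixes g :: "'v::complex_vec \<Rightarrow> complex"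
  assumes "clinear g"
  shows "g (x + y) = g x + g y" "g (x - y) = g x - g y" "g 0 = 0" "g (c *\<^sub>C x) = c * g x" "g (sum h A) = (\<Sum>a\<in>A. g (h a))"
proof -
  interpret g: Vector_Spaces.linear scaleC scaleC g by fact
  show "g (x + y) = g x + g y" "g (x - y) = g x - g y" "g 0 = 0" "g (c *\<^sub>C x) = c * g x" "g (sum h A) = (\<Sum>a\<in>A. g (h a))"
    by (simp_all add: g.add g.diff g.zero g.scale g.sum scaleC_complex_def)
qed

lemma cochain_UNIV: "cochain UNIV F g \<longleftrightarrow> clinear g \<and> (\<exists>k. \<forall>x\<in>F k. g x = 0)"
proof
  assume "cochain UNIV F g"
  then show "clinear g \<and> (\<exists>k. \<forall>x\<in>F k. g x = 0)"
    unfolding cochain_def by (intro conjI) (unfold_locales, auto simp: scaleC_complex_def)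
qed (auto simp: cochain_def clinear_functionalD)

text \<open>The source of renormalizations. It also replaces cochains over a step of the filtration
  by linear functionals on the whole space, so that traces over arbitrary matrices make
  sense.\<close>

lemma extend_cochain:
  assumes "cochain V F f" "cvec.subspace V" "\<And>k. cvec.subspace (F k)"
  obtains g where "cochain UNIV F g" "\<And>x. x \<in> V \<Longrightarrow> g x = f x"
proof -
  obtain k where "\<forall>x\<in>V \<inter> F k. f x = 0" using assms(1) by (auto simp: cochain_def)
  then obtain g where "clinear g" "\<And>x. x \<in> V \<Longrightarrow> g x = f x" "\<And>x. x \<in> F k \<Longrightarrow> g x = 0"
    using extend_functional[of V "F k" f] assms by (auto simp: cochain_def)
  then show ?thesis by (intro that[of g]) (auto simp: cochain_UNIV)
qed

section \<open>Calculus of one-forms\<close>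

lemma nat_form_bilin:
  "nat_form (x + x') y = nat_form x y + nat_form x' y"
  "nat_form x (y + y') = nat_form x y + nat_form x y'"
  "nat_form (c *\<^sub>C x) y = c *\<^sub>C nat_form x y"
  "nat_form x (c *\<^sub>C y) = c *\<^sub>C nat_form x y"
proof -
  interpret np: Vector_Spaces.linear scaleC scaleC nat_proj by (rule clinear_nat_proj)
  show "nat_form (x + x') y = nat_form x y + nat_form x' y"
    "nat_form x (y + y') = nat_form x y + nat_form x y'"
    "nat_form (c *\<^sub>C x) y = c *\<^sub>C nat_form x y"
    "nat_form x (c *\<^sub>C y) = c *\<^sub>C nat_form x y"
    by (simp_all add: form_bilin np.add np.scale)
qed

text \<open>The Leibniz rule for x d(yz), followed by moving \<open>z\<close> cyclically to the
  front of the term x (dy) z, which is possible in the commutator quotient.\<close>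

lemma nat_form_Leibniz:
  "nat_form x (y * z) = nat_form (x * of_alg y) z + nat_form (of_alg z * x) y"
proof -
  interpret np: Vector_Spaces.linear scaleC scaleC nat_proj by (rule clinear_nat_proj)
  have "nat_proj (lmul_form z (form x y)) = nat_proj (rmul_form z (form x y))"
    unfolding nat_proj.abs_eq forms_nat.abs_eq_iff
    by (rule cvec.span_base) (auto simp: form_commutators_def)
  then show ?thesis by (simp add: lmul_form_form rmul_form_form np.diff algebra_simps)
qed

lemma clinear_b_bar: "clinear b_bar"
proof -
  interpret b: Vector_Spaces.linear scaleC scaleC b_form by (rule clinear_b_form)
  show ?thesis by unfold_locales (transfer; simp add: b.add b.scale)+
qed

text \<open>Naturality of the boundary. Since \<open>X_odd_map\<close> is evaluated on the
  representative chosen by the quotient, the boundary is computed term by term on that same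
  representative.\<close>

lemma b_bar_X_odd_map:
  assumes h: "alg_hom h"
  shows "b_bar (X_odd_map h \<omega>) = h (b_bar \<omega>)"
proof -
  define f where "f = rep_forms (rep_forms_nat \<omega>)"
  interpret b: Vector_Spaces.linear scaleC scaleC "b_bar :: 'b forms_nat \<Rightarrow> 'b" by (rule clinear_b_bar)
  interpret h: Vector_Spaces.linear scaleC scaleC h using h by (simp add: alg_hom_def)
  interpret bf: Vector_Spaces.linear scaleC scaleC "b_form :: 'a forms \<Rightarrow> 'a" by (rule clinear_b_form)
  interpret ab: Vector_Spaces.linear scaleC scaleC "abs_forms :: _ \<Rightarrow> 'a forms" by (rule clinear_abs_forms)
  have "b_bar \<omega> = b_form (abs_forms (lin_ext gen f))"
    by (metis abs_rep_forms_nat abs_rep_forms b_bar.abs_eq nat_proj.abs_eq lin_ext_gen_id f_def)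
  also have "\<dots> = (\<Sum>k\<in>Poly_Mapping.keys f. Poly_Mapping.lookup f k *\<^sub>C b_form (abs_forms (gen k)))"
    by (simp add: lin_ext_def ab.sum ab.scale bf.sum bf.scale)
  finally have "h (b_bar \<omega>) = (\<Sum>k\<in>Poly_Mapping.keys f. Poly_Mapping.lookup f k *\<^sub>C h (b_form (abs_forms (gen k))))"
    by (simp add: h.sum h.scale)
  also have "(\<lambda>k. h (b_form (abs_forms (gen k)))) =
      (\<lambda>k. b_bar ((\<lambda>(x0, x1). nat_form (unitz_map h x0) (h x1)) k))"
    by (auto simp: fun_eq_iff b_bar_form b_form_form commutator_plus_eq alg_homD[OF h] unitz_map_def
        simp flip: form.abs_eq)
  finally show ?thesis by (simp add: X_odd_map_def lin_ext_def f_def b.sum b.scale)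
qed

lemma b_bar_nat_d: "b_bar (nat_d x) = 0"
  by (simp add: nat_d_def d_form_def b_bar_form one_unitz_def)

text \<open>Repeated use of the Leibniz rule on a product of b+1 elements of J leaves one of them
  under the differential and collects the others in the coefficient, so the class of d(J^(b+1)) lies
  in J^b dJ.\<close>

lemma nat_form_ideal_pow:
  assumes J: "alg_ideal J"
  shows "x \<in> ideal_pow_plus J a \<Longrightarrow> y \<in> ideal_pow J (Suc b) \<Longrightarrow>
    nat_form x y \<in> nat_forms_on (ideal_pow_plus J (a + b)) J"
proof (induction b arbitrary: a x y)
  case 0
  then show ?case by (auto simp: nat_forms_on_def intro!: cvec.span_base)
next
  case (Suc b)
  interpret np: Vector_Spaces.linear scaleC scaleC nat_proj by (rule clinear_nat_proj)
  let ?V = "nat_forms_on (ideal_pow_plus J (a + Suc b)) J"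
  have sub: "cvec.subspace ?V" by (simp add: nat_forms_on_def)
  have prod: "u * v \<in> ideal_pow_plus J (m + n)" 
    if uv: "u \<in> ideal_pow_plus J m" "v \<in> ideal_pow_plus J n" "0 < m + n" for u v m n
  proof -
    have e: "of_alg p * v = of_alg (p * alg_part v + scal_part v *\<^sub>C p)" 
         "v * of_alg p = of_alg (alg_part v * p + scal_part v *\<^sub>C p)" for p and v :: "'a unitz"
      by (simp_all add: of_alg_def times_unitz_def)
    consider "m = 0" "0 < n" | "n = 0" "0 < m" | "0 < m" "0 < n" using uv(3) by linarith
    then show ?thesis
    proof cases
      case 1
      with uv obtain p where "v = of_alg p" "p \<in> ideal_pow J n" by (auto simp: ideal_pow_plus_def)
      then show ?thesis using 1 alg_idealD[OF alg_ideal_pow[OF J, of n]] by (auto simp: ideal_pow_plus_def e)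
    next
      case 2
      with uv obtain p where "u = of_alg p" "p \<in> ideal_pow J m" by (auto simp: ideal_pow_plus_def)
      then show ?thesis using 2 alg_idealD[OF alg_ideal_pow[OF J, of m]] by (auto simp: ideal_pow_plus_def e)
    next
      case 3
      with uv show ?thesis
        by (auto simp: ideal_pow_plus_def ideal_pow_mult[OF J] simp flip: of_alg_mult)
    qed
  qed
  have "ideal_pow J (Suc (Suc b)) \<subseteq> {y. nat_form x y \<in> ?V}"
  proof (rule ideal_pow_Suc_subset)
    show "cvec.subspace {y. nat_form x y \<in> ?V}"
      using sub nat_form_bilin(4)[of x 0 0]
      by (auto simp: cvec.subspace_def nat_form_bilin)
    fix u v assume u: "u \<in> ideal_pow J (Suc b)" and v: "v \<in> J"
    have "x * of_alg u \<in> ideal_pow_plus J (a + Suc b)"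
      using Suc.prems(1) u by (intro prod) (auto simp: ideal_pow_plus_def)
    then have 1: "nat_form (x * of_alg u) v \<in> ?V"
      using v by (auto simp: nat_forms_on_def intro!: cvec.span_base)
    \<comment> \<open>The cyclic rule puts \<open>v\<close> into the coefficient, so the induction
      hypothesis is needed with a+1 in place of \<open>a\<close>; this is why \<open>a\<close> is
      generalized.\<close>
    have "of_alg v * x \<in> ideal_pow_plus J (Suc 0 + a)"
      using Suc.prems(1) v by (intro prod) (auto simp: ideal_pow_plus_def)
    then have 2: "nat_form (of_alg v * x) u \<in> ?V"
      using Suc.IH[of "of_alg v * x" "Suc a" u] u by simp
    show "u * v \<in> {y. nat_form x y \<in> ?V}"
      using cvec.subspace_add[OF sub 1 2] by (simp add: nat_form_Leibniz)
  qed simp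
  then show ?case using Suc.prems by blast
qed

section \<open>Infinite matrices with finitely many entries\<close>

text \<open>Matrices of all sizes share one type, so that idempotents of different sizes and the
  rectangular matrices between them are elements of a single ring, as the index calculus
  demands.\<close>

typedef (overloaded) 'x fmat = "{f :: nat \<Rightarrow> nat \<Rightarrow> 'x::zero. \<exists>n. \<forall>i j. n \<le> i \<or> n \<le> j \<longrightarrow> f i j = 0}"
  morphisms entry Abs_fmat
  by (rule exI[of _ "\<lambda>_ _. 0"]) simp

setup_lifting type_definition_fmat

lemma fmat_eqI: "(\<And>i j. entry x i j = entry y i j) \<Longrightarrow> x = y"
  by (simp add: entry_inject[symmetric] fun_eq_iff)

definition bounded_by :: "'x::zero fmat \<Rightarrow> nat \<Rightarrow> bool"
  where "bounded_by x n \<longleftrightarrow> (\<forall>i j. n \<le> i \<or> n \<le> j \<longrightarrow> entry x i j = 0)"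

lemma ex_bounded: "\<exists>n. bounded_by x n"
  using entry[of x] by (simp add: bounded_by_def)

lemma bounded_by_mono: "bounded_by x m \<Longrightarrow> m \<le> n \<Longrightarrow> bounded_by x n"
  by (auto simp: bounded_by_def)

lemma ex_bounded2: obtains n where "bounded_by x n" "bounded_by y n"
proof -
  obtain a b where "bounded_by x a" "bounded_by y b" using ex_bounded by metis
  then show ?thesis using that[of "max a b"] bounded_by_mono max.cobounded1 max.cobounded2 by metis
qed

lemma entry_Abs: "(\<And>i j. n \<le> i \<or> n \<le> j \<Longrightarrow> f i j = 0) \<Longrightarrow> entry (Abs_fmat f) = f"
  by (rule Abs_fmat_inverse) auto

instantiation fmat :: (complex_alg) complex_alg
begin
lift_definition zero_fmat :: "'a fmat" is "\<lambda>_ _. 0" by simp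
lift_definition plus_fmat :: "'a fmat \<Rightarrow> 'a fmat \<Rightarrow> 'a fmat" is "\<lambda>f g i j. f i j + g i j"
proof -
  fix f g :: "nat \<Rightarrow> nat \<Rightarrow> 'a"
  assume "\<exists>n. \<forall>i j. n \<le> i \<or> n \<le> j \<longrightarrow> f i j = 0" "\<exists>n. \<forall>i j. n \<le> i \<or> n \<le> j \<longrightarrow> g i j = 0"
  then obtain m n where "\<forall>i j. m \<le> i \<or> m \<le> j \<longrightarrow> f i j = 0" "\<forall>i j. n \<le> i \<or> n \<le> j \<longrightarrow> g i j = 0"
    by blast
  then show "\<exists>n. \<forall>i j. n \<le> i \<or> n \<le> j \<longrightarrow> f i j + g i j = 0"
    by (intro exI[of _ "max m n"]) auto
qed
lift_definition uminus_fmat :: "'a fmat \<Rightarrow> 'a fmat" is "\<lambda>f i j. - f i j" by auto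
lift_definition minus_fmat :: "'a fmat \<Rightarrow> 'a fmat \<Rightarrow> 'a fmat" is "\<lambda>f g i j. f i j - g i j"
proof -
  fix f g :: "nat \<Rightarrow> nat \<Rightarrow> 'a"
  assume "\<exists>n. \<forall>i j. n \<le> i \<or> n \<le> j \<longrightarrow> f i j = 0" "\<exists>n. \<forall>i j. n \<le> i \<or> n \<le> j \<longrightarrow> g i j = 0"
  then obtain m n where "\<forall>i j. m \<le> i \<or> m \<le> j \<longrightarrow> f i j = 0" "\<forall>i j. n \<le> i \<or> n \<le> j \<longrightarrow> g i j = 0"
    by blast
  then show "\<exists>n. \<forall>i j. n \<le> i \<or> n \<le> j \<longrightarrow> f i j - g i j = 0"
    by (intro exI[of _ "max m n"]) auto
qed
lift_definition scaleC_fmat :: "complex \<Rightarrow> 'a fmat \<Rightarrow> 'a fmat" is "\<lambda>c f i j. c *\<^sub>C f i j" by auto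
text \<open>Summing over the nonzero entries of a row gives a finite index set without the choice of
  a bound; \<open>entry_times\<close> passes to any bound of the left factor.\<close>

lift_definition times_fmat :: "'a fmat \<Rightarrow> 'a fmat \<Rightarrow> 'a fmat"
  is "\<lambda>f g i j. \<Sum>k | f i k \<noteq> 0. f i k * g k j"
proof -
  fix f g :: "nat \<Rightarrow> nat \<Rightarrow> 'a"
  assume "\<exists>n. \<forall>i j. n \<le> i \<or> n \<le> j \<longrightarrow> f i j = 0" "\<exists>n. \<forall>i j. n \<le> i \<or> n \<le> j \<longrightarrow> g i j = 0"
  then obtain m n where "\<forall>i j. m \<le> i \<or> m \<le> j \<longrightarrow> f i j = 0" "\<forall>i j. n \<le> i \<or> n \<le> j \<longrightarrow> g i j = 0"
    by blast
  then show "\<exists>n. \<forall>i j. n \<le> i \<or> n \<le> j \<longrightarrow> (\<Sum>k | f i k \<noteq> 0. f i k * g k j) = 0"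
    by (intro exI[of _ "max m n"] allI impI sum.neutral) auto
qed

lemma entry_times:
  assumes "bounded_by x n"
  shows "entry (x * y) i j = (\<Sum>k<n. entry x i k * entry y k j)"
  unfolding times_fmat.rep_eq using assms
  by (intro sum.mono_neutral_left) (auto simp: bounded_by_def not_less[symmetric])

instance
proof
  fix x y z :: "'a fmat" and c d :: complex
  note e = zero_fmat.rep_eq plus_fmat.rep_eq uminus_fmat.rep_eq minus_fmat.rep_eq scaleC_fmat.rep_eq
  show "x + y + z = x + (y + z)" "x + y = y + x" "0 + x = x" "- x + x = 0" "x - y = x + - y"
    "c *\<^sub>C (x + y) = c *\<^sub>C x + c *\<^sub>C y" "(c + d) *\<^sub>C x = c *\<^sub>C x + d *\<^sub>C x"
    "c *\<^sub>C d *\<^sub>C x = (c * d) *\<^sub>C x" "1 *\<^sub>C x = x"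
    by (rule fmat_eqI; simp add: e scaleC_add_right scaleC_add_left scaleC_scaleC scaleC_one)+
  obtain n where n: "bounded_by x n" "bounded_by y n" by (rule ex_bounded2)
  have xy: "bounded_by (x + y) n" "bounded_by (c *\<^sub>C x) n"
    using n by (auto simp: bounded_by_def e)
  have xyp: "bounded_by (x * y) n"
    using n by (auto simp: bounded_by_def entry_times[OF n(1)])
  show "x * y * z = x * (y * z)"
  proof (rule fmat_eqI)
    fix i j
    have "entry (x * y * z) i j = (\<Sum>k<n. \<Sum>l<n. entry x i l * entry y l k * entry z k j)"
      by (simp add: entry_times[OF xyp] entry_times[OF n(1)] sum_distrib_right)
    also have "\<dots> = (\<Sum>l<n. \<Sum>k<n. entry x i l * (entry y l k * entry z k j))"
      by (subst sum.swap) (simp add: mult.assoc)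
    also have "\<dots> = entry (x * (y * z)) i j"
      by (simp add: entry_times[OF n(1)] entry_times[OF n(2)] sum_distrib_left)
    finally show "entry (x * y * z) i j = entry (x * (y * z)) i j" .
  qed
  show "(x + y) * z = x * z + y * z"
    by (rule fmat_eqI) (simp add: e entry_times[OF xy(1)] entry_times[OF n(1)] entry_times[OF n(2)]
        distrib_right sum.distrib)
  show "x * (y + z) = x * y + x * z"
    by (rule fmat_eqI) (simp add: e entry_times[OF n(1)] distrib_left sum.distrib)
  show "c *\<^sub>C x * y = c *\<^sub>C (x * y)"
    by (rule fmat_eqI) (simp add: e entry_times[OF xy(2)] entry_times[OF n(1)] mult_scaleC_left
        cvec.scale_sum_right)
  show "x * c *\<^sub>C y = c *\<^sub>C (x * y)"
    by (rule fmat_eqI) (simp add: e entry_times[OF n(1)] mult_scaleC_right cvec.scale_sum_right)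
qed
end

lemmas entry_simps = zero_fmat.rep_eq plus_fmat.rep_eq uminus_fmat.rep_eq minus_fmat.rep_eq scaleC_fmat.rep_eq

lemma unitz_simps:
  "alg_part 0 = 0" "alg_part 1 = 0" "alg_part (x + y) = alg_part x + alg_part y"
  "alg_part (x - y) = alg_part x - alg_part y" "alg_part (- x) = - alg_part x"
  "alg_part (c *\<^sub>C x) = c *\<^sub>C alg_part x"
  "alg_part (x * y) = alg_part x * alg_part y + scal_part y *\<^sub>C alg_part x + scal_part x *\<^sub>C alg_part y"
  "scal_part 0 = 0" "scal_part 1 = 1" "scal_part (x + y) = scal_part x + scal_part y"
  "scal_part (x - y) = scal_part x - scal_part y" "scal_part (- x) = - scal_part x"
  "scal_part (c *\<^sub>C x) = c * scal_part x" "scal_part (x * y) = scal_part x * scal_part y"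
  "alg_part (of_alg a) = a" "scal_part (of_alg a) = 0"
  by (simp_all add: zero_unitz_def one_unitz_def plus_unitz_def minus_unitz_def uminus_unitz_def
      scaleC_unitz_def times_unitz_def of_alg_def)

lemma unitz_eqI: "alg_part x = alg_part y \<Longrightarrow> scal_part x = scal_part y \<Longrightarrow> x = y"
  by (rule unitz.expand) simp

lemma alg_part_sum: "alg_part (sum f A) = (\<Sum>a\<in>A. alg_part (f a))"
  by (induction A rule: infinite_finite_induct) (simp_all add: unitz_simps)

lemma scal_part_sum: "scal_part (sum f A) = (\<Sum>a\<in>A. scal_part (f a))"
  by (induction A rule: infinite_finite_induct) (simp_all add: unitz_simps)

lemma of_alg_image_iff: "x \<in> of_alg ` A \<longleftrightarrow> alg_part x \<in> A \<and> scal_part x = 0"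
  by (cases x) (auto simp: of_alg_def)

text \<open>The unital algebra $\mathbb C \oplus M_\infty(\mathscr A^+)$; its elements with vanishing scalar part are the
  matrices with entries in $\mathscr A^+$.\<close>

type_synonym 'x imat = "'x unitz fmat unitz"

definition mat_on :: "'x::complex_alg set \<Rightarrow> 'x imat set"
  where "mat_on A = {w. scal_part w = 0 \<and> (\<forall>i j. entry (alg_part w) i j \<in> of_alg ` A)}"

lemma mat_on_mono: "A \<subseteq> B \<Longrightarrow> mat_on A \<subseteq> mat_on B"
  by (auto simp: mat_on_def of_alg_image_iff)

lemma ring_ideal_mat_on:
  fixes A :: "'x::complex_alg set"
  assumes A: "alg_ideal A"
  shows "ring_ideal (mat_on A)"
  unfolding ring_ideal_def
proof (intro conjI ballI allI)
  note sum_mem = cvec.subspace_sum[OF alg_idealD(1)[OF A]]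
  show "0 \<in> mat_on A"
    using alg_idealD(4)[OF A] by (auto simp: mat_on_def unitz_simps entry_simps of_alg_image_iff)
  fix x assume x: "x \<in> mat_on A"
  show "x - y \<in> mat_on A" if "y \<in> mat_on A" for y
    using x that alg_idealD(6)[OF A] by (simp add: mat_on_def unitz_simps entry_simps of_alg_image_iff)
  fix y :: "'x imat"
  obtain n where n: "bounded_by (alg_part x) n" "bounded_by (alg_part y) n" by (rule ex_bounded2)
  have x': "alg_part (entry (alg_part x) i j) \<in> A" "scal_part (entry (alg_part x) i j) = 0" "scal_part x = 0" for i j
    using x by (auto simp: mat_on_def of_alg_image_iff)
  note cl = alg_idealD(2,3,5,7)[OF A]
  show "x * y \<in> mat_on A" "y * x \<in> mat_on A"
    using n x' by (auto simp: mat_on_def unitz_simps entry_simps of_alg_image_iff entry_times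
        alg_part_sum scal_part_sum intro!: cl(3,4) sum_mem intro: cl(1,2))
qed

lemma mat_on_mult:
  assumes x: "x \<in> mat_on A" and y: "y \<in> mat_on B" and C: "cvec.subspace C"
    and prod: "\<And>a b. a \<in> A \<Longrightarrow> b \<in> B \<Longrightarrow> a * b \<in> C"
  shows "x * y \<in> mat_on C"
proof -
  obtain n where n: "bounded_by (alg_part x) n" "bounded_by (alg_part y) n" by (rule ex_bounded2)
  show ?thesis using x y n prod
    by (auto simp: mat_on_def unitz_simps entry_simps of_alg_image_iff entry_times
        alg_part_sum scal_part_sum intro!: cvec.subspace_sum[OF C])
qed

text \<open>Restricted to positive exponents because the zeroth power is the unit, whose scalar part
  is nonzero.\<close>

lemma mat_on_power:
  assumes J: "alg_ideal J" and x: "x \<in> mat_on J"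
  shows "x ^ Suc k \<in> mat_on (ideal_pow J (Suc k))"
proof (induction k)
  case (Suc k)
  have "x ^ Suc k * x \<in> mat_on (ideal_pow J (Suc (Suc k)))"
    by (rule mat_on_mult[OF Suc x alg_idealD(1)[OF alg_ideal_pow[OF J]]]) (rule ideal_pow_Suc[OF J])
  then show ?case by (simp only: power_Suc2[of x "Suc k"])
qed (use x in simp)

text \<open>The cup product of \<open>T\<close> with the matrix trace. Scalar parts are discarded,
  both that of \<open>w\<close> and those of the diagonal entries, so in particular the adjoined
  unit has trace 0.\<close>

definition mtrace :: "('x::complex_alg \<Rightarrow> 'v::comm_monoid_add) \<Rightarrow> 'x imat \<Rightarrow> 'v"
  where "mtrace T w = (\<Sum>i | entry (alg_part w) i i \<noteq> 0. T (alg_part (entry (alg_part w) i i)))"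

lemma mtrace_bounded:
  assumes "T 0 = 0" "bounded_by (alg_part w) n"
  shows "mtrace T w = (\<Sum>i<n. T (alg_part (entry (alg_part w) i i)))"
  unfolding mtrace_def using assms
  by (intro sum.mono_neutral_left) (auto simp: bounded_by_def not_less[symmetric] unitz_simps)

locale additive_map =
  fixes T :: "'x::complex_alg \<Rightarrow> 'v::ab_group_add"
  assumes add: "T (x + y) = T x + T y"
begin

lemma zero: "T 0 = 0" using add[of 0 0] by simp
lemma sum: "T (sum f A) = (\<Sum>a\<in>A. T (f a))"
  by (induction A rule: infinite_finite_induct) (simp_all add: add zero)

lemma mtrace_add: "mtrace T (x + y) = mtrace T x + mtrace T y"
proof -
  obtain n where n: "bounded_by (alg_part x) n" "bounded_by (alg_part y) n" by (rule ex_bounded2)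
  moreover from n have "bounded_by (alg_part (x + y)) n" by (auto simp: bounded_by_def unitz_simps entry_simps)
  ultimately show ?thesis
    by (simp add: mtrace_bounded[where n = n] zero unitz_simps entry_simps add sum.distrib)
qed

lemma mtrace_vanish:
  assumes "w \<in> mat_on A" "\<And>a. a \<in> A \<Longrightarrow> T a = 0"
  shows "mtrace T w = 0"
  unfolding mtrace_def using assms by (intro sum.neutral) (auto simp: mat_on_def of_alg_image_iff)

text \<open>The double sum is commuted entry by entry; the scalar part of \<open>x\<close>
  contributes equally to both products. The entries of \<open>x\<close> range over a set in the
  unitalization, so that both the whole algebra and the coefficients \<open>ideal_pow_plus\<close>
  are covered.\<close>

lemma mtrace_commute:
  assumes y: "y \<in> mat_on B" and x: "\<And>i j. entry (alg_part x) i j \<in> A"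
    and tr: "\<And>a b. a \<in> A \<Longrightarrow> b \<in> B \<Longrightarrow> T (alg_part (a * of_alg b)) = T (alg_part (of_alg b * a))"
  shows "mtrace T (x * y) = mtrace T (y * x)"
proof -
  obtain n where n: "bounded_by (alg_part x) n" "bounded_by (alg_part y) n" by (rule ex_bounded2)
  let ?x = "alg_part x" and ?y = "alg_part y"
  have sy: "scal_part y = 0" using y by (simp add: mat_on_def)
  have eq: "x * y = of_alg (?x * ?y) + of_alg (scal_part x *\<^sub>C ?y)"
    "y * x = of_alg (?y * ?x) + of_alg (scal_part x *\<^sub>C ?y)"
    by (rule unitz_eqI; simp add: unitz_simps sy)+
  have b: "bounded_by (?x * ?y) n" "bounded_by (?y * ?x) n"
    using n by (auto simp: bounded_by_def entry_times[OF n(1)] entry_times[OF n(2)])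
  have "mtrace T (of_alg (?x * ?y)) = (\<Sum>i<n. \<Sum>k<n. T (alg_part (entry ?x i k * entry ?y k i)))"
    using b by (simp add: mtrace_bounded[where n = n] zero unitz_simps(15) entry_times[OF n(1)] alg_part_sum sum)
  also have "\<dots> = (\<Sum>i<n. \<Sum>k<n. T (alg_part (entry ?y k i * entry ?x i k)))"
  proof (intro sum.cong refl)
    fix i k
    obtain b where "entry ?y k i = of_alg b" "b \<in> B" using y by (force simp: mat_on_def)
    then show "T (alg_part (entry ?x i k * entry ?y k i)) = T (alg_part (entry ?y k i * entry ?x i k))"
      using tr[OF x] by simp
  qed
  also have "\<dots> = (\<Sum>k<n. \<Sum>i<n. T (alg_part (entry ?y k i * entry ?x i k)))" by (rule sum.swap)
  also have "\<dots> = mtrace T (of_alg (?y * ?x))"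
    using b by (simp add: mtrace_bounded[where n = n] zero unitz_simps(15) entry_times[OF n(2)] alg_part_sum sum)
  finally show ?thesis by (simp add: eq mtrace_add)
qed

end

definition fmat_map :: "('x::zero \<Rightarrow> 'y::zero) \<Rightarrow> 'x fmat \<Rightarrow> 'y fmat"
  where "fmat_map h x = Abs_fmat (\<lambda>i j. h (entry x i j))"

lemma entry_fmat_map:
  assumes "h 0 = 0"
  shows "entry (fmat_map h x) i j = h (entry x i j)"
proof -
  obtain n where "bounded_by x n" using ex_bounded by blast
  then show ?thesis unfolding fmat_map_def
    by (subst entry_Abs[of n]) (auto simp: bounded_by_def assms)
qed

definition imat_map :: "('x \<Rightarrow> 'y) \<Rightarrow> 'x::complex_alg imat \<Rightarrow> 'y::complex_alg imat"
  where "imat_map h = unitz_map (fmat_map (unitz_map h))"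

lemma unitz_map_hom:
  assumes "alg_hom h"
  shows "unitz_map h (x + y) = unitz_map h x + unitz_map h y"
    "unitz_map h (x - y) = unitz_map h x - unitz_map h y"
    "unitz_map h (x * y) = unitz_map h x * unitz_map h y"
    "unitz_map h 0 = 0" "unitz_map h 1 = 1" "unitz_map h (c *\<^sub>C x) = c *\<^sub>C unitz_map h x"
    "unitz_map h (- x) = - unitz_map h x" "unitz_map h (of_alg a) = of_alg (h a)"
    "unitz_map h (sum g A) = (\<Sum>a\<in>A. unitz_map h (g a))"
proof -
  show add: "unitz_map h (x + y) = unitz_map h x + unitz_map h y" and zero: "unitz_map h 0 = 0" for x y
    by (rule unitz_eqI; simp add: unitz_map_def unitz_simps alg_homD[OF assms])+
  show "unitz_map h (sum g A) = (\<Sum>a\<in>A. unitz_map h (g a))"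
    by (induction A rule: infinite_finite_induct) (simp_all add: add zero)
qed (rule unitz_eqI; simp add: unitz_map_def unitz_simps alg_homD[OF assms])+

lemma alg_part_imat_map:
  assumes "alg_hom h"
  shows "entry (alg_part (imat_map h x)) i j = unitz_map h (entry (alg_part x) i j)"
    "scal_part (imat_map h x) = scal_part x"
  by (simp_all add: imat_map_def unitz_map_def[of "fmat_map _"] entry_fmat_map unitz_map_hom[OF assms])

lemma imat_eqI:
  "scal_part x = scal_part y \<Longrightarrow> (\<And>i j. entry (alg_part x) i j = entry (alg_part y) i j) \<Longrightarrow> x = y"
  by (intro unitz_eqI fmat_eqI)

lemma imat_map_hom:
  assumes h: "alg_hom h"
  shows "imat_map h (x + y) = imat_map h x + imat_map h y"
    "imat_map h (x - y) = imat_map h x - imat_map h y"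
    "imat_map h (x * y) = imat_map h x * imat_map h y"
    "imat_map h 0 = 0" "imat_map h 1 = 1" "imat_map h (x ^ n) = imat_map h x ^ n"
proof -
  show "imat_map h (x + y) = imat_map h x + imat_map h y" "imat_map h (x - y) = imat_map h x - imat_map h y"
    "imat_map h 0 = 0" and one: "imat_map h 1 = 1"
    by (rule imat_eqI; simp add: alg_part_imat_map[OF h] unitz_simps entry_simps unitz_map_hom[OF h])+
  show mult: "imat_map h (x * y) = imat_map h x * imat_map h y" for x y
  proof (rule imat_eqI)
    fix i j
    obtain n where n: "bounded_by (alg_part x) n" using ex_bounded by blast
    then have "bounded_by (alg_part (imat_map h x)) n"
      by (simp add: bounded_by_def alg_part_imat_map[OF h] unitz_map_hom[OF h])
    then show "entry (alg_part (imat_map h (x * y))) i j = entry (alg_part (imat_map h x * imat_map h y)) i j"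
      using n by (simp add: alg_part_imat_map[OF h] unitz_simps entry_simps unitz_map_hom[OF h] entry_times)
  qed (simp add: alg_part_imat_map[OF h] unitz_simps)
  show "imat_map h (x ^ n) = imat_map h x ^ n"
    by (induction n) (simp_all add: one mult)
qed

lemma imat_map_comp:
  assumes "alg_hom g" "alg_hom h" "alg_hom (g \<circ> h)"
  shows "imat_map g (imat_map h x) = imat_map (g \<circ> h) x"
  by (rule imat_eqI) (simp_all add: alg_part_imat_map assms unitz_map_def)

lemma imat_map_eq_0_iff:
  assumes h: "alg_hom h"
  shows "imat_map h x = 0 \<longleftrightarrow> x \<in> mat_on {a. h a = 0}"
proof
  assume "imat_map h x = 0"
  then have "scal_part (imat_map h x) = 0" "\<And>i j. entry (alg_part (imat_map h x)) i j = 0"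
    by (simp_all add: unitz_simps entry_simps)
  then show "x \<in> mat_on {a. h a = 0}"
    by (auto simp: alg_part_imat_map[OF h] mat_on_def of_alg_image_iff unitz_map_def zero_unitz_def)
next
  assume "x \<in> mat_on {a. h a = 0}"
  then show "imat_map h x = 0"
    by (intro imat_eqI) (auto simp: alg_part_imat_map[OF h] mat_on_def of_alg_image_iff
        unitz_map_def unitz_simps entry_simps zero_unitz_def)
qed

lemma imat_map_eq_iff:
  assumes h: "alg_hom h"
  shows "imat_map h x = imat_map h y \<longleftrightarrow> x - y \<in> mat_on {a. h a = 0}"
  using imat_map_eq_0_iff[OF h, of "x - y"] by (simp add: imat_map_hom[OF h])

lemma imat_map_mat_on: "alg_hom h \<Longrightarrow> x \<in> mat_on A \<Longrightarrow> h ` A \<subseteq> B \<Longrightarrow> imat_map h x \<in> mat_on B"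
  by (auto simp: mat_on_def alg_part_imat_map of_alg_image_iff unitz_map_def)

lemma imat_map_surj:
  assumes h: "alg_hom h" and "surj h"
  obtains x where "imat_map h x = y"
proof -
  \<comment> \<open>The section is normalized at 0, since otherwise the lifted matrix would have
    infinitely many nonzero entries.\<close>
  define s where "s b = (if b = 0 then 0 else inv_into UNIV h b)" for b
  have s: "h (s b) = b" for b using assms by (simp add: s_def surj_f_inv_f alg_homD)
  have "s 0 = 0" by (simp add: s_def)
  then have "unitz_map s 0 = 0" by (simp add: unitz_map_def zero_unitz_def)
  then have "imat_map h (unitz_map (fmat_map (unitz_map s)) y) = y"
    by (intro imat_eqI) (simp_all add: alg_part_imat_map[OF h] unitz_map_def[of "fmat_map _"]
        entry_fmat_map unitz_map_def[of h] unitz_map_def[of s] s)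
  then show ?thesis by (rule that)
qed

lemma mtrace_imat_map:
  assumes "alg_hom h" "T 0 = 0"
  shows "mtrace T (imat_map h x) = mtrace (T \<circ> h) x"
proof -
  obtain n where n: "bounded_by (alg_part x) n" using ex_bounded by blast
  then have "bounded_by (alg_part (imat_map h x)) n"
    by (simp add: bounded_by_def alg_part_imat_map assms unitz_map_hom)
  with n show ?thesis
    by (simp add: mtrace_bounded[where n = n] assms alg_homD[OF assms(1)] alg_part_imat_map unitz_map_def)
qed

subsection \<open>Embedding of finite matrices\<close>

definition of_mat :: "'x::complex_alg unitz mat \<Rightarrow> 'x imat"
  where "of_mat X = of_alg (Abs_fmat (\<lambda>i j. if i < dim_row X \<and> j < dim_col X then X $$ (i, j) else 0))"

lemma of_mat_parts:
  "entry (alg_part (of_mat X)) i j = (if i < dim_row X \<and> j < dim_col X then X $$ (i, j) else 0)"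
  "scal_part (of_mat X) = 0"
proof -
  have "entry (Abs_fmat (\<lambda>i j. if i < dim_row X \<and> j < dim_col X then X $$ (i, j) else 0)) =
      (\<lambda>i j. if i < dim_row X \<and> j < dim_col X then X $$ (i, j) else 0)"
    by (rule entry_Abs[of "max (dim_row X) (dim_col X)"]) auto
  then show "entry (alg_part (of_mat X)) i j = (if i < dim_row X \<and> j < dim_col X then X $$ (i, j) else 0)"
    "scal_part (of_mat X) = 0"
    by (simp_all add: of_mat_def unitz_simps)
qed

lemma of_mat_bounded: "dim_row X \<le> n \<Longrightarrow> dim_col X \<le> n \<Longrightarrow> bounded_by (alg_part (of_mat X)) n"
  by (auto simp: bounded_by_def of_mat_parts)

lemma of_mat_add: "X \<in> carrier_mat m n \<Longrightarrow> Y \<in> carrier_mat m n \<Longrightarrow> of_mat (X + Y) = of_mat X + of_mat Y"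
  by (rule imat_eqI) (auto simp: of_mat_parts unitz_simps entry_simps)

lemma of_mat_diff: "X \<in> carrier_mat m n \<Longrightarrow> Y \<in> carrier_mat m n \<Longrightarrow> of_mat (X - Y) = of_mat X - of_mat Y"
  by (rule imat_eqI) (auto simp: of_mat_parts unitz_simps entry_simps)

lemma of_mat_zero: "of_mat (0\<^sub>m m n) = 0"
  by (rule imat_eqI) (auto simp: of_mat_parts unitz_simps entry_simps)

lemma of_mat_mult:
  assumes "X \<in> carrier_mat l m" "Y \<in> carrier_mat m n"
  shows "of_mat (X * Y) = of_mat X * of_mat Y"
proof (rule imat_eqI)
  fix i j
  let ?n = "max l m"
  have "entry (alg_part (of_mat X * of_mat Y)) i j =
      (\<Sum>k<?n. entry (alg_part (of_mat X)) i k * entry (alg_part (of_mat Y)) k j)"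
    using assms by (subst entry_times[symmetric]) (auto simp: unitz_simps of_mat_parts(2) intro!: of_mat_bounded)
  also have "\<dots> = (\<Sum>k<m. entry (alg_part (of_mat X)) i k * entry (alg_part (of_mat Y)) k j)"
    using assms by (intro sum.mono_neutral_right) (auto simp: of_mat_parts)
  also have "\<dots> = entry (alg_part (of_mat (X * Y))) i j"
    using assms by (auto simp: of_mat_parts scalar_prod_def atLeast0LessThan intro!: sum.cong sum.neutral)
  finally show "entry (alg_part (of_mat (X * Y))) i j = entry (alg_part (of_mat X * of_mat Y)) i j" by simp
qed (simp add: of_mat_parts unitz_simps)

lemma of_mat_inject:
  assumes "X \<in> carrier_mat m n" "Y \<in> carrier_mat m n" "of_mat X = of_mat Y"
  shows "X = Y"
proof (rule eq_matI)
  fix i j assume "i < dim_row Y" "j < dim_col Y"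
  then show "X $$ (i, j) = Y $$ (i, j)"
    using assms of_mat_parts(1)[of X i j] of_mat_parts(1)[of Y i j] by auto
qed (use assms in auto)

lemma of_mat_power:
  assumes "X \<in> carrier_mat n n"
  shows "of_mat (X ^\<^sub>m Suc k) = of_mat X ^ Suc k"
proof (induction k)
  case 0
  show ?case using assms by simp
next
  case (Suc k)
  have "of_mat (X ^\<^sub>m Suc (Suc k)) = of_mat (X ^\<^sub>m Suc k) * of_mat X"
    unfolding pow_mat.simps(2)[of X "Suc k"] by (rule of_mat_mult[OF pow_carrier_mat[OF assms] assms])
  then show ?case by (simp only: Suc power_Suc2[of _ "Suc k"])
qed

lemma mtrace_of_mat:
  assumes "X \<in> carrier_mat n n" "T 0 = 0"
  shows "mtrace T (of_mat X) = (\<Sum>i<n. T (alg_part (X $$ (i, i))))"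
  using assms by (simp add: mtrace_bounded[of T _ n] of_mat_bounded of_mat_parts)

lemma even_trace_of_mat:
  "X \<in> carrier_mat n n \<Longrightarrow> T 0 = 0 \<Longrightarrow> even_trace T X = mtrace T (of_mat X)"
  by (subst mtrace_of_mat) (auto simp: even_trace_def)

lemma mat_in_iff:
  assumes "0 \<in> A"
  shows "mat_in A X \<longleftrightarrow> of_mat X \<in> mat_on A"
proof
  assume "mat_in A X"
  then have "X $$ (i, j) \<in> of_alg ` A" if "i < dim_row X" "j < dim_col X" for i j
    using that elements_matI[of X "dim_row X" "dim_col X" i j] by (auto simp: mat_in_def)
  then show "of_mat X \<in> mat_on A"
    using assms by (auto simp: mat_on_def of_mat_parts of_alg_image_iff unitz_simps)
next
  assume "of_mat X \<in> mat_on A"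
  then have "entry (alg_part (of_mat X)) i j \<in> of_alg ` A" for i j by (simp add: mat_on_def)
  then have "X $$ (i, j) \<in> of_alg ` A" if "i < dim_row X" "j < dim_col X" for i j
    using that by (metis of_mat_parts(1))
  then show "mat_in A X" by (auto simp: mat_in_def elements_mat_def)
qed

lemma imat_map_of_mat:
  assumes "alg_hom h"
  shows "imat_map h (of_mat X) = of_mat (map_mat (unitz_map h) X)"
  by (rule imat_eqI) (auto simp: alg_part_imat_map[OF assms] of_mat_parts unitz_map_hom[OF assms])

lemma map_mat_p_mat: "alg_hom h \<Longrightarrow> map_mat (unitz_map h) (p_mat N K) = p_mat N K"
  by (rule eq_matI) (auto simp: p_mat_def unitz_map_hom)

lemma p_mat_carrier: "p_mat N K \<in> carrier_mat K K"
  by (simp add: p_mat_def)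

lemma of_mat_p_mat: "N \<le> K \<Longrightarrow> of_mat (p_mat N K) = of_mat (1\<^sub>m N)"
  by (rule imat_eqI) (auto simp: of_mat_parts p_mat_def)

section \<open>Functoriality of the tensor algebra\<close>

lemma alg_hom_comp: "alg_hom f \<Longrightarrow> alg_hom g \<Longrightarrow> alg_hom (g \<circ> f)"
  unfolding alg_hom_def by (auto intro: Vector_Spaces.linear_compose)

lemma clinear_tensor_of: "clinear tensor_of"
proof unfold_locales
  fix x y :: 'a and c :: complex
  have *: "gen (Word [a]) \<in> nonempty_words" for a :: 'a
    unfolding nonempty_words_def by (rule cvec.span_base) (auto simp: zero_word_def)
  have **: "gen (Word [a]) + gen (Word [b]) \<in> nonempty_words" "c *\<^sub>C gen (Word [a]) \<in> nonempty_words" for a b :: 'a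
    using *[of a] *[of b] unfolding nonempty_words_def by (auto intro: cvec.span_add cvec.span_scale)
  have "gen (0 + Word [x + y] + 0) - gen (0 + Word [x] + 0) - gen (0 + Word [y] + 0) \<in> cvec.span multilin_gens"
    by (rule cvec.span_base) (unfold multilin_gens_def, blast)
  moreover have "gen (u + Word [c *\<^sub>C x] + v) - c *\<^sub>C gen (u + Word [x] + v) \<in> multilin_gens" for u v
    unfolding multilin_gens_def by blast
  then have "gen (0 + Word [c *\<^sub>C x] + 0) - c *\<^sub>C gen (0 + Word [x] + 0) \<in> cvec.span multilin_gens"
    by (rule cvec.span_base)
  ultimately have "tensor_rel (gen (Word [x + y])) (gen (Word [x]) + gen (Word [y]))"
    "tensor_rel (gen (Word [c *\<^sub>C x])) (c *\<^sub>C gen (Word [x]))"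
    using * ** by (simp_all add: tensor_rel_def diff_diff_add)
  then have "abs_tensor (gen (Word [x + y])) = abs_tensor (gen (Word [x]) + gen (Word [y]))"
    "abs_tensor (gen (Word [c *\<^sub>C x])) = abs_tensor (c *\<^sub>C gen (Word [x]))"
    by (auto intro: Quotient3_rel_abs[OF Quotient3_tensor])
  moreover have "tensor_rel (gen (Word [a])) (gen (Word [a]))" for a :: 'a
    using * by (simp add: tensor_rel_def cvec.span_zero)
  ultimately show "tensor_of (x + y) = tensor_of x + tensor_of y" "tensor_of (c *\<^sub>C x) = c *\<^sub>C tensor_of x"
    by (simp_all add: tensor_of.abs_eq plus_tensor.abs_eq scaleC_tensor.abs_eq)
qed

text \<open>The uniqueness half of the universal property of the tensor algebra: nonempty words are
  products of letters and span.\<close>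

lemma alg_hom_tensor_eq:
  fixes f g :: "'a::complex_vec tensor \<Rightarrow> 'x::complex_alg"
  assumes f: "alg_hom f" and g: "alg_hom g" and eq: "\<And>a. f (tensor_of a) = g (tensor_of a)"
  shows "f t = g t"
proof -
  have refl: "tensor_rel h h" if "h \<in> nonempty_words" for h :: "'a word \<Rightarrow>\<^sub>0 complex"
    using that by (simp add: tensor_rel_def cvec.span_zero)
  have nonempty: "gen w \<in> nonempty_words" if "w \<noteq> 0" for w :: "'a word"
    unfolding nonempty_words_def by (rule cvec.span_base) (use that in blast)
  have word: "f (abs_tensor (gen (Word (a # as)))) = g (abs_tensor (gen (Word (a # as))))" for a as
  proof (induction as arbitrary: a)
    case Nil
    then show ?case using eq by (simp add: tensor_of.abs_eq)
  next
    case (Cons b as)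
    have "abs_tensor (gen (Word (a # b # as))) = tensor_of a * abs_tensor (gen (Word (b # as)))"
      unfolding tensor_of.abs_eq
      by (subst times_tensor.abs_eq) (auto intro!: refl nonempty simp: gen_times plus_word_def zero_word_def)
    then show ?case using Cons eq by (simp add: alg_homD(6)[OF f] alg_homD(6)[OF g])
  qed
  have "h \<in> nonempty_words \<and> f (abs_tensor h) = g (abs_tensor h)" if "h \<in> nonempty_words" for h
    using that[unfolded nonempty_words_def]
  proof (induction rule: cvec.span_induct_alt)
    case base
    have "abs_tensor 0 = (0 :: 'a tensor)" by (simp add: zero_tensor.abs_eq)
    then show ?case by (simp add: alg_homD(4)[OF f] alg_homD(4)[OF g] nonempty_words_def cvec.span_zero)
  next
    case (step c x y)
    then obtain w where w: "x = gen w" "w \<noteq> 0" by auto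
    then obtain a as where "w = Word (a # as)" by (cases w; cases "letters w") (auto simp: zero_word_def)
    then have fx: "f (abs_tensor x) = g (abs_tensor x)" using word w by simp
    have mem: "x \<in> nonempty_words" "c *\<^sub>C x \<in> nonempty_words" "y \<in> nonempty_words"
      using step(2) nonempty[OF w(2)] by (auto simp: w nonempty_words_def intro: cvec.span_scale)
    then have "c *\<^sub>C x + y \<in> nonempty_words" by (simp add: nonempty_words_def cvec.span_add)
    moreover
    have "abs_tensor (c *\<^sub>C x + y) = c *\<^sub>C abs_tensor x + abs_tensor y"
      using mem by (simp add: plus_tensor.abs_eq[symmetric] scaleC_tensor.abs_eq[symmetric] refl)
    ultimately show ?case
      using step fx by (simp add: alg_homD[OF f] alg_homD[OF g])
  qed
  moreover obtain h where "h \<in> nonempty_words" "t = abs_tensor h"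
  proof -
    have "tensor_rel (rep_tensor t) (rep_tensor t)" "abs_tensor (rep_tensor t) = t"
      by (rule Quotient3_rep_reflp[OF Quotient3_tensor], rule Quotient3_abs_rep[OF Quotient3_tensor])
    then show ?thesis using that by (metis tensor_rel_def)
  qed
  ultimately show ?thesis by blast
qed

lemma alg_hom_tensor_mult: "alg_hom tensor_mult"
  unfolding tensor_mult_def by (rule alg_hom_tensor_ext) (simp add: cvec.linear_id[unfolded id_def] id_def)

lemma tensor_mult_of: "tensor_mult (tensor_of a) = a"
  unfolding tensor_mult_def by (subst tensor_ext_of) (simp_all add: cvec.linear_id[unfolded id_def] id_def)

lemma surj_tensor_mult: "surj tensor_mult"
  using tensor_mult_of by (metis surjI)

lemma alg_ideal_J_tensor: "alg_ideal J_tensor"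
  unfolding J_tensor_def by (rule alg_ideal_kernel[OF alg_hom_tensor_mult])

lemma tensor_map:
  assumes "clinear f"
  shows "alg_hom (tensor_map f)" "tensor_map f (tensor_of a) = tensor_of (f a)"
proof -
  have lin: "clinear (tensor_of \<circ> f)" by (rule Vector_Spaces.linear_compose[OF assms clinear_tensor_of])
  show "alg_hom (tensor_map f)" "tensor_map f (tensor_of a) = tensor_of (f a)"
    unfolding tensor_map_def by (rule alg_hom_tensor_ext[OF lin], simp add: tensor_ext_of[OF lin])
qed

lemma alg_ideal_T_ker: "alg_hom p \<Longrightarrow> alg_ideal (T_ker p)"
  unfolding T_ker_def by (rule alg_ideal_kernel, rule tensor_map(1)) (simp add: alg_hom_def)

lemma tensor_mult_map:
  assumes f: "alg_hom f"
  shows "tensor_mult (tensor_map f t) = f (tensor_mult t)"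
proof -
  have f': "clinear f" using f by (simp add: alg_hom_def)
  have "(tensor_mult \<circ> tensor_map f) t = (f \<circ> tensor_mult) t"
    by (rule alg_hom_tensor_eq[OF alg_hom_comp[OF tensor_map(1)[OF f'] alg_hom_tensor_mult]
          alg_hom_comp[OF alg_hom_tensor_mult f]])
      (simp add: tensor_map(2)[OF f'] tensor_mult_of)
  then show ?thesis by simp
qed

text \<open>Used for B to E to A, where it says that T B lands in the ideal T(B:E).\<close>

lemma tensor_map_comp_zero:
  assumes f: "clinear f" and g: "clinear g" and zero: "\<And>a. g (f a) = 0"
  shows "tensor_map g (tensor_map f t) = 0"
proof -
  interpret to: Vector_Spaces.linear scaleC scaleC tensor_of by (rule clinear_tensor_of)
  have z: "alg_hom (\<lambda>_. 0)" unfolding alg_hom_def by (intro conjI allI; unfold_locales?) auto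
  have "(tensor_map g \<circ> tensor_map f) t = (\<lambda>_. 0) t"
    by (rule alg_hom_tensor_eq[OF alg_hom_comp[OF tensor_map(1)[OF f] tensor_map(1)[OF g]] z])
      (simp add: tensor_map(2)[OF f] tensor_map(2)[OF g] zero to.zero)
  then show ?thesis by simp
qed

section \<open>Vanishing of exact cochains on idempotents\<close>

text \<open>\<open>\<Theta> x y\<close> stands for a functional on x dy that is cyclic. Then the
  value at 1, d^(2n+1) is 2n+1 times the value at d^(2n), d. With d = e - p only the part at
  \<open>e\<close> is left, and d^(2n) commutes with \<open>e\<close>; the classical argument behind
  e (de) e = 0 then gives zero.\<close>

lemma Leibniz_odd_power:
  fixes \<Theta> :: "'w::ring_1 \<Rightarrow> 'w \<Rightarrow> complex"
  assumes Z: "ring_ideal Z"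
    and add: "\<And>x x' y. \<Theta> (x + x') y = \<Theta> x y + \<Theta> x' y" "\<And>x y y'. \<Theta> x (y + y') = \<Theta> x y + \<Theta> x y'"
    and Leibniz: "\<And>x y z. \<Theta> x (y * z) = \<Theta> (x * y) z + \<Theta> (z * x) y"
    and vanish: "\<And>x y. x \<in> Z \<Longrightarrow> \<Theta> x y = 0" "\<And>x y. y \<in> Z \<Longrightarrow> \<Theta> x y = 0"
    and e: "e * e - e \<in> Z" and p: "p * p = p" and \<Theta>p: "\<And>x. \<Theta> x p = 0"
  shows "\<Theta> 1 ((e - p) ^ (2 * n + 1)) = 0"
proof -
  \<comment> \<open>With the zero functional and equal ideals the locale is merely the calculus of
    congruences modulo \<open>Z\<close>.\<close>
  interpret index_setting "\<lambda>_. 0" Z Z Z 1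
    by unfold_locales (auto simp: Z)
  have cong: "\<Theta> x y = \<Theta> x' y" "\<Theta> y x = \<Theta> y x'" if "x \<approx> x'" for x x' y
    using add(1)[of "x - x'" x' y] add(2)[of y "x - x'" x'] vanish that by (auto simp: approx_def)
  let ?d = "e - p"
  have diff: "\<Theta> x (y - y') = \<Theta> x y - \<Theta> x y'" for x y y' using add(2)[of x "y - y'" y'] by simp
  have power: "\<Theta> (x ^ a) (x ^ Suc b) = of_nat (Suc b) * \<Theta> (x ^ (a + b)) x" for x a b
  proof (induction b arbitrary: a)
    case (Suc b)
    have "\<Theta> (x ^ a) (x ^ Suc (Suc b)) = \<Theta> (x ^ a * x) (x ^ Suc b) + \<Theta> (x ^ Suc b * x ^ a) x"
      using Leibniz[of "x ^ a" x "x ^ Suc b"] by simp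
    also have "x ^ a * x = x ^ Suc a" by (rule power_Suc2[symmetric])
    also have "x ^ Suc b * x ^ a = x ^ (a + Suc b)" by (metis power_add add.commute)
    also have "\<Theta> (x ^ Suc a) (x ^ Suc b) = of_nat (Suc b) * \<Theta> (x ^ (a + Suc b)) x"
      using Suc[of "Suc a"] by simp
    finally show ?case by (simp add: algebra_simps)
  qed simp
  have "\<Theta> 1 (?d ^ (2 * n + 1)) = of_nat (2 * n + 1) * \<Theta> (?d ^ (2 * n)) ?d"
    using power[of ?d 0 "2 * n"] by simp
  \<comment> \<open>From e = e^2 the Leibniz rule gives the value at x, e as the sum of those at xe,
    e and ex, e. For x = ae both summands equal the left side, so it is zero.\<close>
  moreover have "\<Theta> a e = 0" if "a * e \<approx> e * a" for a
  proof -
    have ee: "e * e \<approx> e" using e by (simp add: approx_def)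
    have 1: "\<Theta> x e = \<Theta> (x * e) e + \<Theta> (e * x) e" for x
      using Leibniz[of x e e] cong(2)[OF ee, of x] by simp
    have "e * (a * e) \<approx> a * e"
      using approx_trans[OF approx_mult_r[OF approx_sym[OF that], of e] approx_trans[OF _ approx_refl]]
        approx_mult_l[OF ee, of a] by (simp add: mult.assoc approx_trans)
    moreover have "a * e * e \<approx> a * e" using approx_mult_l[OF ee, of a] by (simp add: mult.assoc)
    ultimately have "\<Theta> (a * e) e = \<Theta> (a * e) e + \<Theta> (a * e) e" using 1[of "a * e"] cong(1) by metis
    then have "\<Theta> (a * e) e = 0" by simp
    then show ?thesis using 1[of a] cong(1)[OF that, of e] by simp
  qed
  then have "\<Theta> (?d ^ (2 * n)) ?d = 0"
    using diff_idempotents_commute(1)[of e p n] e p by (simp add: diff \<Theta>p approx_def)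
  ultimately show ?thesis by simp
qed

text \<open>The functional x dy on matrices, the sum of g over x_ik dy_ki. Indexing by the nonzero
  entries of \<open>y\<close> keeps the sum finite and loses nothing.\<close>

definition trace_form :: "('x::complex_alg forms_nat \<Rightarrow> complex) \<Rightarrow> 'x unitz fmat \<Rightarrow> 'x unitz fmat \<Rightarrow> complex"
  where "trace_form g x y = (\<Sum>(i, k) | entry y k i \<noteq> 0. g (nat_form (entry x i k) (alg_part (entry y k i))))"

context
  fixes g :: "'x::complex_alg forms_nat \<Rightarrow> complex"
  assumes g: "clinear g"
begin

lemma nat_form_zero: "nat_form x 0 = 0" "nat_form 0 y = 0"
  using nat_form_bilin(2)[of x 0 0] nat_form_bilin(1)[of 0 0 y] by simp_all

lemma nat_form_sum:
  "nat_form x (sum f A) = (\<Sum>a\<in>A. nat_form x (f a))" "nat_form (sum h A) y = (\<Sum>a\<in>A. nat_form (h a) y)"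
  by (induction A rule: infinite_finite_induct; simp add: nat_form_bilin nat_form_zero)+

lemma nat_form_Leibniz_unitz:
  "nat_form x (alg_part (y * z)) = nat_form (x * y) (alg_part z) + nat_form (z * x) (alg_part y)"
proof -
  have y: "x * y = x * of_alg (alg_part y) + scal_part y *\<^sub>C x"
    and z: "z * x = of_alg (alg_part z) * x + scal_part z *\<^sub>C x"
    by (rule unitz_eqI; simp add: unitz_simps algebra_simps)+
  show ?thesis
    unfolding y z by (simp add: unitz_simps nat_form_bilin nat_form_Leibniz algebra_simps)
qed

lemma trace_form_bounded:
  assumes "bounded_by y n"
  shows "trace_form g x y = (\<Sum>i<n. \<Sum>k<n. g (nat_form (entry x i k) (alg_part (entry y k i))))"
proof -
  have "trace_form g x y = (\<Sum>(i, k)\<in>{..<n} \<times> {..<n}. g (nat_form (entry x i k) (alg_part (entry y k i))))"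
    unfolding trace_form_def using assms
    by (intro sum.mono_neutral_left)
      (auto simp: bounded_by_def not_less[symmetric] unitz_simps nat_form_zero clinear_functionalD[OF g])
  then show ?thesis by (simp add: sum.cartesian_product)
qed

lemma trace_form_bilin:
  "trace_form g (x + x') y = trace_form g x y + trace_form g x' y"
  "trace_form g x (y + y') = trace_form g x y + trace_form g x y'"
  "trace_form g (c *\<^sub>C x) y = c * trace_form g x y"
  "trace_form g x (c *\<^sub>C y) = c * trace_form g x y"
proof -
  obtain n where n: "bounded_by y n" "bounded_by y' n" by (rule ex_bounded2)
  then have n': "bounded_by (y + y') n" "bounded_by (c *\<^sub>C y) n" by (auto simp: bounded_by_def entry_simps)
  show "trace_form g (x + x') y = trace_form g x y + trace_form g x' y"
    "trace_form g x (y + y') = trace_form g x y + trace_form g x y'"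
    "trace_form g (c *\<^sub>C x) y = c * trace_form g x y"
    "trace_form g x (c *\<^sub>C y) = c * trace_form g x y"
    by (simp_all add: trace_form_bounded[OF n(1)] trace_form_bounded[OF n(2)] trace_form_bounded[OF n'(1)]
        trace_form_bounded[OF n'(2)] entry_simps unitz_simps nat_form_bilin
        clinear_functionalD[OF g] sum.distrib sum_distrib_left)
qed

text \<open>Entrywise this is \<open>nat_form_Leibniz_unitz\<close>; what remains is to reorder the
  triple sums until the inner index belongs to a matrix product.\<close>

lemma trace_form_Leibniz:
  "trace_form g x (y * z) = trace_form g (x * y) z + trace_form g (z * x) y"
proof -
  obtain a b where "bounded_by x a" and b: "bounded_by y b" "bounded_by z b" using ex_bounded ex_bounded2 by metis
  define n where "n = max a b"
  have n: "bounded_by x n" "bounded_by y n" "bounded_by z n"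
    using \<open>bounded_by x a\<close> b by (auto simp: n_def intro: bounded_by_mono)
  then have yz: "bounded_by (y * z) n" by (auto simp: bounded_by_def entry_times[OF n(2)])
  have "trace_form g x (y * z) = (\<Sum>i<n. \<Sum>k<n. \<Sum>l<n.
      g (nat_form (entry x i k * entry y k l) (alg_part (entry z l i))) +
      g (nat_form (entry z l i * entry x i k) (alg_part (entry y k l))))"
    by (simp add: trace_form_bounded[OF yz] entry_times[OF n(2)] alg_part_sum nat_form_sum
        clinear_functionalD[OF g] nat_form_Leibniz_unitz)
  also have "\<dots> = (\<Sum>i<n. \<Sum>k<n. \<Sum>l<n. g (nat_form (entry x i k * entry y k l) (alg_part (entry z l i)))) +
      (\<Sum>i<n. \<Sum>k<n. \<Sum>l<n. g (nat_form (entry z l i * entry x i k) (alg_part (entry y k l))))"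
    by (simp add: sum.distrib)
  also have "(\<Sum>i<n. \<Sum>k<n. \<Sum>l<n. g (nat_form (entry x i k * entry y k l) (alg_part (entry z l i)))) =
      (\<Sum>i<n. \<Sum>l<n. \<Sum>k<n. g (nat_form (entry x i k * entry y k l) (alg_part (entry z l i))))"
    by (rule sum.cong[OF refl], rule sum.swap)
  also have "\<dots> = trace_form g (x * y) z"
    by (simp add: trace_form_bounded[OF n(3)] entry_times[OF n(1)] nat_form_sum clinear_functionalD[OF g])
  also have "(\<Sum>i<n. \<Sum>k<n. \<Sum>l<n. g (nat_form (entry z l i * entry x i k) (alg_part (entry y k l)))) =
      (\<Sum>k<n. \<Sum>i<n. \<Sum>l<n. g (nat_form (entry z l i * entry x i k) (alg_part (entry y k l))))"
    by (rule sum.swap)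
  also have "\<dots> = (\<Sum>k<n. \<Sum>l<n. \<Sum>i<n. g (nat_form (entry z l i * entry x i k) (alg_part (entry y k l))))"
    by (rule sum.cong[OF refl], rule sum.swap)
  also have "\<dots> = (\<Sum>l<n. \<Sum>k<n. \<Sum>i<n. g (nat_form (entry z l i * entry x i k) (alg_part (entry y k l))))"
    by (rule sum.swap)
  also have "\<dots> = trace_form g (z * x) y"
    by (simp add: trace_form_bounded[OF n(2)] entry_times[OF n(3)] nat_form_sum clinear_functionalD[OF g])
  finally show ?thesis .
qed

lemma additive_nat_d: "additive_map (\<lambda>a. g (nat_d a))"
  by unfold_locales (simp add: nat_d_def d_form_def nat_form_bilin clinear_functionalD[OF g])

lemma mtrace_nat_d_mult:
  "mtrace (\<lambda>a. g (nat_d a)) (of_alg (y * z)) = trace_form g y z + trace_form g z y"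
proof -
  obtain n where n: "bounded_by y n" "bounded_by z n" by (rule ex_bounded2)
  then have yz: "bounded_by (y * z) n" by (auto simp: bounded_by_def entry_times[OF n(1)])
  have "mtrace (\<lambda>a. g (nat_d a)) (of_alg (y * z)) =
      (\<Sum>i<n. g (nat_d (alg_part (entry (alg_part (of_alg (y * z))) i i))))"
    by (rule mtrace_bounded[where T = "\<lambda>a. g (nat_d a)", OF additive_map.zero[OF additive_nat_d]])
      (simp add: unitz_simps(15) yz)
  also have "\<dots> = (\<Sum>i<n. \<Sum>k<n. g (nat_form (entry y i k) (alg_part (entry z k i))) +
        g (nat_form (entry z k i) (alg_part (entry y i k))))"
    by (simp add: unitz_simps(15) entry_times[OF n(1)] alg_part_sum additive_map.sum[OF additive_nat_d])
      (simp add: nat_d_def d_form_def clinear_functionalD[OF g] nat_form_Leibniz_unitz[of 1, simplified])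
  also have "\<dots> = trace_form g y z + (\<Sum>i<n. \<Sum>k<n. g (nat_form (entry z k i) (alg_part (entry y i k))))"
    by (simp add: trace_form_bounded[OF n(2)] sum.distrib)
  also have "(\<Sum>i<n. \<Sum>k<n. g (nat_form (entry z k i) (alg_part (entry y i k)))) = trace_form g z y"
    by (subst sum.swap) (simp add: trace_form_bounded[OF n(1)])
  finally show ?thesis .
qed

text \<open>Exact cochains do not see idempotents. The matrix \<open>p\<close> has scalar entries,
  so dp = 0 and \<open>Leibniz_odd_power\<close> applies to the functional x dy.\<close>

lemma mtrace_nat_d_vanish:
  assumes J: "alg_ideal J" and zero: "\<And>\<omega>. \<omega> \<in> F_odd J k \<Longrightarrow> g \<omega> = 0"
    and e: "e * e - e \<in> mat_on (ideal_pow J (Suc (Suc k)))"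
    and p: "p * p = p" "\<And>i j. alg_part (entry (alg_part p) i j) = 0"
  shows "mtrace (\<lambda>a. g (nat_d a)) ((e - p) ^ (2 * n + 1)) = 0"
proof -
  interpret F: additive_map "\<lambda>a. g (nat_d a)" by (rule additive_nat_d)
  let ?tr = "mtrace (\<lambda>a. g (nat_d a))"
  \<comment> \<open>The second term accounts for the adjoined unit: its coefficient multiplies the
    trace of dy.\<close>
  define \<Theta> where "\<Theta> x y = trace_form g (alg_part x) (alg_part y) + scal_part x * ?tr (of_alg (alg_part y))"
    for x y :: "'x imat"
  \<comment> \<open>Forms with coefficients in J^(k+1) lie in the k-th step, where \<open>g\<close>
    vanishes. The hypothesis on \<open>e\<close> has one exponent more, because d(J^(k+2)) is only
    known to lie in J^(k+1) dJ.\<close>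
  let ?V = "nat_forms_on (ideal_pow_plus J (Suc k)) UNIV"
  have "?V \<subseteq> F_odd J k"
  proof -
    have "?V \<subseteq> nat_forms_on (ideal_pow_plus J (k div 2)) UNIV" "?V \<subseteq> nat_forms_on (ideal_pow_plus J (k div 2 + 1)) UNIV"
      by (intro nat_forms_on_mono ideal_pow_plus_antimono[OF J]; simp)+
    then show ?thesis by (auto simp: F_odd_def Let_def intro: cvec.span_base)
  qed
  then have gV: "g \<omega> = 0" if "\<omega> \<in> ?V" for \<omega> using that zero by blast
  have tr_scale: "?tr (of_alg (c *\<^sub>C y)) = c * ?tr (of_alg y)" for c y
  proof -
    obtain n where "bounded_by y n" using ex_bounded by blast
    moreover from this have "bounded_by (c *\<^sub>C y) n" by (simp add: bounded_by_def entry_simps)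
    ultimately show ?thesis
      by (simp add: mtrace_bounded[where T = "\<lambda>a. g (nat_d a)" and n = n, OF F.zero] unitz_simps(15) unitz_simps(6) entry_simps)
        (simp add: nat_d_def d_form_def nat_form_bilin clinear_functionalD[OF g] sum_distrib_left)
  qed
  have of_add: "of_alg (a + b) = of_alg a + of_alg b" for a b :: "'x unitz fmat" by (rule of_alg_add)
  have "?tr (of_alg (alg_part ((e - p) ^ (2 * n + 1)))) = \<Theta> 1 ((e - p) ^ (2 * n + 1))"
    by (simp add: \<Theta>_def unitz_simps trace_form_def entry_simps nat_form_zero clinear_functionalD[OF g])
  also have "\<dots> = 0"
  proof (rule Leibniz_odd_power[OF ring_ideal_mat_on])
    show "alg_ideal (ideal_pow J (Suc (Suc k)))" by (rule alg_ideal_pow[OF J])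
    show "\<Theta> (x + x') y = \<Theta> x y + \<Theta> x' y" "\<Theta> x (y + y') = \<Theta> x y + \<Theta> x y'" for x x' y y'
      by (simp_all add: \<Theta>_def unitz_simps trace_form_bilin of_add F.mtrace_add algebra_simps)
    show "\<Theta> x (y * z) = \<Theta> (x * y) z + \<Theta> (z * x) y" for x y z
      by (simp add: \<Theta>_def unitz_simps trace_form_bilin of_add F.mtrace_add tr_scale mtrace_nat_d_mult
          trace_form_Leibniz algebra_simps)
    show "\<Theta> x y = 0" if x: "x \<in> mat_on (ideal_pow J (Suc (Suc k)))" for x y
    proof -
      have "g (nat_form (entry (alg_part x) i l) b) = 0" for i l b
      proof (rule gV)
        have "entry (alg_part x) i l \<in> of_alg ` ideal_pow J (Suc (Suc k))" using x by (simp add: mat_on_def)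
        then have "entry (alg_part x) i l \<in> ideal_pow_plus J (Suc k)"
          using ideal_pow_antimono[OF J, of "Suc k" "Suc (Suc k)"] by (auto simp: ideal_pow_plus_def simp del: ideal_pow.simps)
        then show "nat_form (entry (alg_part x) i l) b \<in> ?V"
          by (auto simp: nat_forms_on_def intro!: cvec.span_base)
      qed
      then show ?thesis using x by (simp add: \<Theta>_def trace_form_def mat_on_def)
    qed
    show "\<Theta> x y = 0" if y: "y \<in> mat_on (ideal_pow J (Suc (Suc k)))" for x y
    proof -
      have "g (nat_form a (alg_part (entry (alg_part y) i l))) = 0" for i l a
      proof (rule gV)
        have "alg_part (entry (alg_part y) i l) \<in> ideal_pow J (Suc (Suc k))"
          using y by (auto simp: mat_on_def of_alg_image_iff simp del: ideal_pow.simps)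
        from nat_form_ideal_pow[OF J _ this, of a 0] nat_forms_on_mono[OF subset_refl subset_UNIV, of "ideal_pow_plus J (Suc k)" J]
        show "nat_form a (alg_part (entry (alg_part y) i l)) \<in> ?V" by (auto simp: ideal_pow_plus_def simp del: ideal_pow.simps)
      qed
      then show ?thesis by (simp add: \<Theta>_def trace_form_def mtrace_def unitz_simps(15) nat_d_def d_form_def)
    qed
    show "\<Theta> x p = 0" for x
      by (simp add: \<Theta>_def trace_form_def mtrace_def unitz_simps(15) p nat_form_zero clinear_functionalD[OF g]
          nat_d_def d_form_def)
  qed (use e p in auto)
  also have "?tr (of_alg (alg_part w)) = ?tr w" for w :: "'x imat" by (simp add: mtrace_def unitz_simps(15))
  finally show ?thesis by simp
qed

end

section \<open>Lifting idempotents and invertible matrices\<close>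

lemma map_mat_lift:
  assumes "surj h" "Y \<in> carrier_mat m n"
  obtains X where "X \<in> carrier_mat m n" "map_mat (unitz_map h) X = Y"
proof -
  have "unitz_map h (unitz_map (inv_into UNIV h) y) = y" for y
    by (simp add: unitz_map_def surj_f_inv_f[OF assms(1)])
  then have "map_mat (unitz_map h) (map_mat (unitz_map (inv_into UNIV h)) Y) = Y"
    by (intro eq_matI) auto
  then show ?thesis using assms(2) by (intro that[of "map_mat (unitz_map (inv_into UNIV h)) Y"]) auto
qed

lemma imat_map_mat_on_UNIV:
  assumes "alg_hom h"
  shows "imat_map h x \<in> mat_on UNIV \<longleftrightarrow> x \<in> mat_on UNIV"
  by (simp add: mat_on_def alg_part_imat_map[OF assms] of_alg_image_iff unitz_map_def)

lemma mat_on_pow_le: "alg_ideal J \<Longrightarrow> m \<le> n \<Longrightarrow> x \<in> mat_on (ideal_pow J n) \<Longrightarrow> x \<in> mat_on (ideal_pow J m)"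
  using mat_on_mono[OF ideal_pow_antimono] by blast

lemma mat_on_square:
  assumes J: "alg_ideal J" and u: "u \<in> mat_on (ideal_pow J (Suc k))"
  shows "u * u \<in> mat_on (ideal_pow J (Suc (Suc k)))"
proof -
  have "u * u \<in> mat_on (ideal_pow J (Suc k + Suc k))"
    by (rule mat_on_mult[OF u u alg_idealD(1)[OF alg_ideal_pow[OF J]]]) (rule ideal_pow_mult[OF J])
  then show ?thesis by (rule mat_on_pow_le[OF J, rotated]) simp
qed

text \<open>Iterating Y to 3 Y^2 - 2 Y^3, written as Y + u - 2uY with the defect u = Y^2 - Y. The
  correction lies in the same power of the ideal as the defect, so the iterates are coherent and all
  lift \<open>e\<close>.\<close>

lemma ex_idempotent_lift:
  fixes h :: "'x::complex_alg \<Rightarrow> 'y::complex_alg"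
  assumes h: "alg_hom h" "surj h" and e: "e \<in> carrier_mat K K" "e * e = e"
  defines "J \<equiv> {x. h x = 0}"
  obtains X where "pro_mat (ideal_pow J) K X" "\<And>k. mat_in (ideal_pow J k) (X k * X k - X k)"
    "\<And>k. map_mat (unitz_map h) (X k) = e"
proof -
  have J: "alg_ideal J" unfolding J_def by (rule alg_ideal_kernel[OF h(1)])
  note ri = ring_idealD[OF ring_ideal_mat_on[OF alg_ideal_pow[OF J]]]
  have zero: "0 \<in> ideal_pow J k" for k by (rule alg_idealD(4)[OF alg_ideal_pow[OF J]])
  obtain X0 where X0: "X0 \<in> carrier_mat K K" "map_mat (unitz_map h) X0 = e"
    using map_mat_lift[OF h(2) e(1)] .
  define step where "step Y = (Y + (Y * Y - Y)) - ((Y * Y - Y) * Y + (Y * Y - Y) * Y)" for Y :: "'x unitz mat"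
  define X where "X k = (step ^^ k) X0" for k
  have c: "X k \<in> carrier_mat K K" for k
    by (induction k) (auto simp: X_def X0 step_def)
  define y where "y k = of_mat (X k)" for k
  define u where "u k = y k * y k - y k" for k
  have y_Suc: "y (Suc k) = y k + u k - (u k * y k + u k * y k)" for k
  proof -
    have XX: "X k * X k \<in> carrier_mat K K" "X k * X k - X k \<in> carrier_mat K K"
      "(X k * X k - X k) * X k \<in> carrier_mat K K" using c[of k] by auto
    have u_eq: "of_mat (X k * X k - X k) = u k"
      by (simp add: of_mat_diff[OF XX(1) c] of_mat_mult[OF c c] u_def y_def)
    have "X (Suc k) = step (X k)" by (simp add: X_def)
    then have "y (Suc k) = of_mat (X k + (X k * X k - X k)) - of_mat ((X k * X k - X k) * X k + (X k * X k - X k) * X k)"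
      unfolding y_def step_def by (simp only:, intro of_mat_diff[of _ K K]) (use c XX in auto)
    then show ?thesis
      by (simp add: of_mat_add[OF c XX(2)] of_mat_add[OF XX(3,3)] of_mat_mult[OF XX(2) c] u_eq flip: y_def)
  qed
  have u_in: "u k \<in> mat_on (ideal_pow J (Suc k))" for k
  proof (induction k)
    case 0
    have "imat_map h (of_mat X0) * imat_map h (of_mat X0) = imat_map h (of_mat X0)"
      by (simp add: imat_map_of_mat[OF h(1)] X0 e(2) flip: of_mat_mult[OF e(1) e(1)])
    then have "imat_map h (u 0) = 0" by (simp add: u_def y_def X_def imat_map_hom[OF h(1)])
    then show ?case by (simp add: imat_map_eq_0_iff[OF h(1)] J_def)
  next
    case (Suc k)
    have uy: "u k * y k = y k * u k" by (simp add: u_def algebra_simps)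
    \<comment> \<open>The new defect is 4 u^3 - 3 u^2, hence divisible by u^2 and at least one order
      better.\<close>
    have "u (Suc k) = u k * u k * (u k + u k + u k + u k) - (u k * u k + u k * u k + u k * u k)"
    proof -
      define a b where "a = y k" and "b = u k"
      have aa: "a * a = a + b" and ba: "b * a = a * b" using uy by (simp_all add: a_def b_def u_def)
      have "u (Suc k) = (a + b - (b * a + b * a)) * (a + b - (b * a + b * a)) - (a + b - (b * a + b * a))"
        by (simp add: u_def[of "Suc k"] y_Suc a_def b_def)
      also have "\<dots> = b * b * (b + b + b + b) - (b * b + b * b + b * b)"
      proof -
        have aax: "a * (a * x) = a * x + b * x" and bax: "b * (a * x) = a * (b * x)" for x
          using aa ba by (simp_all add: distrib_right flip: mult.assoc)
        show ?thesis
          by (simp add: algebra_simps aa ba aax bax)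
      qed
      finally show ?thesis by (simp add: b_def)
    qed
    moreover have "\<dots> \<in> mat_on (ideal_pow J (Suc (Suc k)))"
      by (intro ri(2) ri(3) ri(5) mat_on_square[OF J Suc])
    ultimately show ?case by simp
  qed
  show ?thesis
  proof (rule that[of X])
    show "mat_in (ideal_pow J k) (X k * X k - X k)" for k
    proof -
      have "of_mat (X k * X k - X k) = u k"
        using c[of k] by (subst of_mat_diff[of _ K K]) (auto simp: u_def y_def of_mat_mult[OF c c])
      then show ?thesis
        unfolding mat_in_iff[OF zero] using mat_on_pow_le[OF J _ u_in[of k], of k] by simp
    qed
    show "map_mat (unitz_map h) (X k) = e" for k
    proof (rule of_mat_inject)
      show "of_mat (map_mat (unitz_map h) (X k)) = of_mat e"
      proof (induction k)
        case 0
        then show ?case by (simp add: X_def X0)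
      next
        case (Suc k)
        have "imat_map h (u k) = 0"
          using mat_on_pow_le[OF J _ u_in[of k], of 1] by (simp add: imat_map_eq_0_iff[OF h(1)] J_def)
        then have "imat_map h (y (Suc k)) = imat_map h (y k)" by (simp add: y_Suc imat_map_hom[OF h(1)])
        then show ?case using Suc by (simp add: y_def imat_map_of_mat[OF h(1)])
      qed
    qed (use c e in auto)
    show "pro_mat (ideal_pow J) K X"
      unfolding pro_mat_def
    proof (intro allI conjI c)
      fix k
      have "y (Suc k) - y k = u k - (u k * y k + u k * y k)" by (simp add: y_Suc)
      also have "\<dots> \<in> mat_on (ideal_pow J (Suc k))"
        by (intro ri(2) ri(3) ri(5) u_in)
      finally have "y (Suc k) - y k \<in> mat_on (ideal_pow J k)" by (rule mat_on_pow_le[OF J, rotated]) simp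
      then show "mat_in (ideal_pow J k) (X (Suc k) - X k)"
        by (simp add: mat_in_iff[OF zero] of_mat_diff[OF c c] y_def)
    qed
  qed
qed

text \<open>Any lift \<open>X\<close> of g is invertible in the completion, so it may be taken
  constant. Its inverse is found by Newton iteration Y to 2Y - YXY, under which the defects 1 - XY
  and 1 - YX are squared.\<close>

lemma ex_invertible_lift:
  fixes h :: "'x::complex_alg \<Rightarrow> 'y::complex_alg"
  assumes h: "alg_hom h" "surj h" and g: "g \<in> carrier_mat K K" "g' \<in> carrier_mat K K"
    "g * g' = 1\<^sub>m K" "g' * g = 1\<^sub>m K" and g_in: "mat_in UNIV (g - 1\<^sub>m K)"
  defines "J \<equiv> {x. h x = 0}"
  obtains X Y where "pro_mat (ideal_pow J) K (\<lambda>_. X)" "pro_mat (ideal_pow J) K Y"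
    "mat_in UNIV (X - 1\<^sub>m K)" "\<And>k. mat_in UNIV (Y k - 1\<^sub>m K)"
    "\<And>k. mat_in (ideal_pow J k) (X * Y k - 1\<^sub>m K)" "\<And>k. mat_in (ideal_pow J k) (Y k * X - 1\<^sub>m K)"
    "map_mat (unitz_map h) X = g"
proof -
  have J: "alg_ideal J" unfolding J_def by (rule alg_ideal_kernel[OF h(1)])
  note ri = ring_idealD[OF ring_ideal_mat_on[OF alg_ideal_pow[OF J]]]
  note rU = ring_idealD[OF ring_ideal_mat_on[OF alg_ideal_UNIV]]
  have zero: "0 \<in> ideal_pow J k" for k by (rule alg_idealD(4)[OF alg_ideal_pow[OF J]])
  obtain X where X: "X \<in> carrier_mat K K" "map_mat (unitz_map h) X = g"
    using map_mat_lift[OF h(2) g(1)] .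
  obtain Y0 where Y0: "Y0 \<in> carrier_mat K K" "map_mat (unitz_map h) Y0 = g'"
    using map_mat_lift[OF h(2) g(2)] .
  define Y where "Y k = ((\<lambda>Y. Y + Y - Y * X * Y) ^^ k) Y0" for k
  have c: "Y k \<in> carrier_mat K K" for k
    by (induction k) (use X(1) in \<open>auto simp: Y_def Y0\<close>)
  have one: "(1\<^sub>m K :: 'x unitz mat) \<in> carrier_mat K K" by simp
  define x where "x = of_mat X"
  define y where "y k = of_mat (Y k)" for k
  define I :: "'x imat" where "I = of_mat (1\<^sub>m K)"
  have y_Suc: "y (Suc k) = y k + y k - y k * x * y k" for k
  proof -
    have "Y (Suc k) = Y k + Y k - Y k * X * Y k" by (simp add: Y_def)
    moreover have "of_mat (Y k + Y k - Y k * X * Y k) = of_mat (Y k + Y k) - of_mat (Y k * X * Y k)"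
      by (rule of_mat_diff[of _ K K]) (use c[of k] X(1) in auto)
    moreover have "of_mat (Y k * X * Y k) = of_mat (Y k * X) * of_mat (Y k)"
      by (rule of_mat_mult[of _ K K _ K]) (use c[of k] X(1) in auto)
    ultimately show ?thesis
      by (simp add: y_def x_def of_mat_add[OF c c] of_mat_mult[OF c X(1)])
  qed
  have I: "I * I = I" "I * x = x" "x * I = x" "I * y k = y k" "y k * I = y k" for k
    using of_mat_mult[OF one one] of_mat_mult[OF one X(1)] of_mat_mult[OF X(1) one] X(1)
      of_mat_mult[OF one c, of k] of_mat_mult[OF c one, of k] c[of k]
    by (simp_all add: I_def x_def y_def)
  have hI: "imat_map h I = of_mat (1\<^sub>m K)"
    unfolding I_def imat_map_of_mat[OF h(1)]
    by (rule arg_cong[of _ _ of_mat], rule eq_matI) (auto simp: unitz_map_hom[OF h(1)])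
  have hx: "imat_map h x = of_mat g" and hy: "imat_map h (y 0) = of_mat g'"
    by (simp_all add: x_def y_def Y_def imat_map_of_mat[OF h(1)] X Y0)
  have u_in: "I - x * y k \<in> mat_on (ideal_pow J (Suc k)) \<and> I - y k * x \<in> mat_on (ideal_pow J (Suc k))" for k
  proof (induction k)
    case 0
    have "imat_map h (I - x * y 0) = 0" "imat_map h (I - y 0 * x) = 0"
      using of_mat_mult[OF g(1,2)] of_mat_mult[OF g(2,1)]
      by (simp_all add: imat_map_hom[OF h(1)] hI hx hy g(3,4))
    then show ?case by (simp add: imat_map_eq_0_iff[OF h(1)] J_def)
  next
    case (Suc k)
    have Il: "I * (x * z) = x * z" "x * (I * z) = x * z" "I * (y k * z) = y k * z" "y k * (I * z) = y k * z" for z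
      by (simp_all add: I flip: mult.assoc)
    have "I - x * y (Suc k) = (I - x * y k) * (I - x * y k)" "I - y (Suc k) * x = (I - y k * x) * (I - y k * x)"
      by (simp_all add: y_Suc algebra_simps I Il)
    then show ?case using mat_on_square[OF J] Suc by simp
  qed
  have lower: "w \<in> mat_on (ideal_pow J (Suc k)) \<Longrightarrow> w \<in> mat_on (ideal_pow J k)"
    "w \<in> mat_on (ideal_pow J (Suc k)) \<Longrightarrow> w \<in> mat_on UNIV" for w k
    using mat_on_pow_le[OF J, of k "Suc k"] mat_on_pow_le[OF J, of 0 "Suc k"] by auto
  \<comment> \<open>Membership over the whole algebra only concerns scalar parts, which
    \<open>h\<close> does not change; it can therefore be checked on g.\<close>
  have x_in: "x - I \<in> mat_on UNIV"
  proof -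
    have "of_mat g - of_mat (1\<^sub>m K) \<in> mat_on UNIV"
      using g_in by (simp add: mat_in_iff of_mat_diff[OF g(1)])
    then have "imat_map h (x - I) \<in> mat_on UNIV" by (simp add: imat_map_hom[OF h(1)] hx hI)
    then show ?thesis by (simp add: imat_map_mat_on_UNIV[OF h(1)])
  qed
  have y_in: "y k - I \<in> mat_on UNIV" for k
  proof -
    have "y k - I = - ((I - y k * x) + y k * (x - I))" by (simp add: algebra_simps I)
    also have "\<dots> \<in> mat_on UNIV"
      by (intro rU(4) rU(3) rU(6) x_in lower(2)[OF conjunct2[OF u_in[of k]]])
    finally show ?thesis .
  qed
  show ?thesis
  proof (rule that[of X Y])
    show "mat_in UNIV (X - 1\<^sub>m K)" "mat_in UNIV (Y k - 1\<^sub>m K)" for k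
      using x_in y_in by (simp_all add: mat_in_iff of_mat_diff[OF X(1) one] of_mat_diff[OF c one] x_def y_def I_def)
    show "pro_mat (ideal_pow J) K (\<lambda>_. X)"
      unfolding pro_mat_def using X(1) ri(1) by (simp add: mat_in_iff[OF zero] of_mat_diff[OF X(1) X(1)] of_mat_zero)
    show "map_mat (unitz_map h) X = g" by (rule X)
    fix k
    have XY: "X * Y k \<in> carrier_mat K K" "Y k * X \<in> carrier_mat K K" using X(1) c[of k] by auto
    have "- (I - x * y k) \<in> mat_on (ideal_pow J k)" "- (I - y k * x) \<in> mat_on (ideal_pow J k)"
      by (rule ri(4)[OF lower(1)[OF conjunct1[OF u_in]]], rule ri(4)[OF lower(1)[OF conjunct2[OF u_in]]])
    then show "mat_in (ideal_pow J k) (X * Y k - 1\<^sub>m K)" "mat_in (ideal_pow J k) (Y k * X - 1\<^sub>m K)"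
      by (simp_all add: mat_in_iff[OF zero] of_mat_diff[OF XY(1) one] of_mat_diff[OF XY(2) one]
          of_mat_mult[OF X(1) c] of_mat_mult[OF c X(1)] x_def y_def I_def)
  next
    show "pro_mat (ideal_pow J) K Y"
      unfolding pro_mat_def
    proof (intro allI conjI c)
      fix k
      have "y (Suc k) - y k = y k * (I - x * y k)" by (simp add: y_Suc algebra_simps I)
      also have "\<dots> \<in> mat_on (ideal_pow J k)" using ri(6)[OF lower(1)[OF conjunct1[OF u_in[of k]]]] .
      finally show "mat_in (ideal_pow J k) (Y (Suc k) - Y k)"
        by (simp add: mat_in_iff[OF zero] of_mat_diff[OF c c] y_def)
    qed
  qed
qed

section \<open>The stable general linear group\<close>

lemma diag_block_one:
  "diag_block_mat [g, 1\<^sub>m k] =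
    four_block_mat g (0\<^sub>m (dim_row g) k) (0\<^sub>m k (dim_col g)) (1\<^sub>m k)"
  by (simp only: diag_block_mat.simps(2)[of g "[1\<^sub>m k]"] diag_block_mat_singleton Let_def index_one_mat)

lemma diag_block_one_mult:
  fixes g h :: "'a::semiring_1 mat"
  assumes "g \<in> carrier_mat n n" "h \<in> carrier_mat n n"
  shows "diag_block_mat [g, 1\<^sub>m k] * diag_block_mat [h, 1\<^sub>m k] = diag_block_mat [g * h, 1\<^sub>m k]"
  unfolding diag_block_one using assms
  by (subst mult_four_block_mat[of _ n n _ k _ k _ _ n _ k])
    (auto simp: left_mult_one_mat[of _ k k] left_add_zero_mat[of _ k k])

text \<open>The infinite matrix diag(g, 1, 1, ...), whose tail of ones is supplied by the adjoined
  unit; enlarging g by an identity block does not change it.\<close>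

definition stabilize :: "'x::complex_alg unitz mat \<Rightarrow> 'x imat"
  where "stabilize g = 1 + of_mat (g - 1\<^sub>m (dim_row g))"

lemma stabilize_eq: "g \<in> carrier_mat n n \<Longrightarrow> stabilize g = 1 - of_mat (1\<^sub>m n) + of_mat g"
  by (auto simp: stabilize_def of_mat_diff[of _ n n])

lemma of_mat_one_absorb:
  assumes "g \<in> carrier_mat n n"
  shows "of_mat (1\<^sub>m n) * of_mat g = of_mat g" "of_mat g * of_mat (1\<^sub>m n) = of_mat g"
  using of_mat_mult[of "1\<^sub>m n" n n g n] of_mat_mult[of g n n "1\<^sub>m n" n] assms by auto

lemma stabilize_mult:
  assumes "g \<in> carrier_mat n n" "h \<in> carrier_mat n n"
  shows "stabilize (g * h) = stabilize g * stabilize h"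
proof -
  have gh: "g * h \<in> carrier_mat n n" using assms by simp
  show ?thesis
    unfolding stabilize_eq[OF assms(1)] stabilize_eq[OF assms(2)] stabilize_eq[OF gh]
    by (simp add: algebra_simps of_mat_one_absorb[OF assms(1)] of_mat_one_absorb[OF assms(2)]
        of_mat_one_absorb[of "1\<^sub>m n"] of_mat_mult[OF assms])
qed

lemma stabilize_one: "stabilize (1\<^sub>m n) = 1"
  by (subst stabilize_eq[of _ n]) auto

lemma stabilize_inject:
  assumes "g \<in> carrier_mat n n" "h \<in> carrier_mat n n" "stabilize g = stabilize h"
  shows "g = h"
  using assms of_mat_inject by (auto simp: stabilize_eq)

lemma stabilize_diag_block:
  assumes "g \<in> carrier_mat n n"
  shows "stabilize (diag_block_mat [g, 1\<^sub>m k]) = stabilize g"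
proof -
  have c: "diag_block_mat [g, 1\<^sub>m k] \<in> carrier_mat (n + k) (n + k)"
    unfolding diag_block_one using assms by (intro four_block_carrier_mat) auto
  have "of_mat (diag_block_mat [g, 1\<^sub>m k] - 1\<^sub>m (n + k)) = of_mat (g - 1\<^sub>m n)"
    unfolding diag_block_one using assms
    by (intro imat_eqI) (auto simp: of_mat_parts)
  then show ?thesis using assms c by (auto simp: stabilize_def)
qed

lemma GL_carrier: "g \<in> GL n \<Longrightarrow> g \<in> carrier_mat n n"
  by (simp add: GL_def)

lemma GL_inverse:
  assumes "g \<in> GL n"
  obtains g' where "g' \<in> GL n" "g * g' = 1\<^sub>m n" "g' * g = 1\<^sub>m n"
proof -
  have g: "g \<in> carrier_mat n n" and "invertible_mat g" and g_in: "mat_in UNIV (g - 1\<^sub>m n)"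
    using assms by (auto simp: GL_def)
  then obtain g' where g': "g * g' = 1\<^sub>m n" "g' * g = 1\<^sub>m (dim_row g')"
    by (auto simp: invertible_mat_def inverts_mat_def)
  have "dim_row g' = n" using g arg_cong[OF g'(2), of dim_col] by simp
  moreover have "dim_col g' = n" using arg_cong[OF g'(1), of dim_col] by simp
  ultimately have g'c: "g' \<in> carrier_mat n n" by auto
  have one: "(1\<^sub>m n :: 'a unitz mat) \<in> carrier_mat n n" by simp
  have "of_mat g * of_mat g' = of_mat (1\<^sub>m n)" by (simp add: g' flip: of_mat_mult[OF g g'c])
  then have "of_mat (g' - 1\<^sub>m n) = - (of_mat (g - 1\<^sub>m n) * of_mat g')"
    by (simp add: of_mat_diff[OF g'c one] of_mat_diff[OF g one] left_diff_distrib of_mat_one_absorb[OF g'c])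
  also have "\<dots> \<in> mat_on UNIV"
    using g_in by (intro ring_idealD(4,5)[OF ring_ideal_mat_on[OF alg_ideal_UNIV]]) (simp add: mat_in_iff)
  finally have "mat_in UNIV (g' - 1\<^sub>m n)" by (simp add: mat_in_iff)
  then have "g' \<in> GL n"
    using g g' g'c by (auto simp: GL_def invertible_mat_def inverts_mat_def)
  then show ?thesis using g' g'c by (intro that) auto
qed

lemma GL_diag_block:
  assumes "g \<in> GL n"
  shows "diag_block_mat [g, 1\<^sub>m k] \<in> GL (n + k)"
proof -
  have g: "g \<in> carrier_mat n n" and g_in: "mat_in UNIV (g - 1\<^sub>m n)"
    using assms by (auto simp: GL_def)
  obtain g' where g'_GL: "g' \<in> GL n" and g': "g * g' = 1\<^sub>m n" "g' * g = 1\<^sub>m n"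
    using GL_inverse[OF assms] .
  note g'c = GL_carrier[OF g'_GL]
  have c: "diag_block_mat [g, 1\<^sub>m k] \<in> carrier_mat (n + k) (n + k)" "diag_block_mat [g', 1\<^sub>m k] \<in> carrier_mat (n + k) (n + k)"
    unfolding diag_block_one using g g'c by (intro four_block_carrier_mat; auto)+
  have one: "diag_block_mat [1\<^sub>m n, 1\<^sub>m k] = (1\<^sub>m (n + k) :: 'a unitz mat)"
    unfolding diag_block_one by simp
  have "diag_block_mat [g, 1\<^sub>m k] * diag_block_mat [g', 1\<^sub>m k] = 1\<^sub>m (n + k)"
    "diag_block_mat [g', 1\<^sub>m k] * diag_block_mat [g, 1\<^sub>m k] = 1\<^sub>m (n + k)"
    using diag_block_one_mult[OF g g'c] diag_block_one_mult[OF g'c g] g' g'c by (simp_all add: one del: diag_block_mat.simps)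
  then have "invertible_mat (diag_block_mat [g, 1\<^sub>m k])"
    using c by (auto simp: invertible_mat_def inverts_mat_def simp del: diag_block_mat.simps intro!: exI[of _ "diag_block_mat [g', 1\<^sub>m k]"])
  moreover have "mat_in UNIV (diag_block_mat [g, 1\<^sub>m k] - 1\<^sub>m (n + k))"
  proof -
    have "of_mat (diag_block_mat [g, 1\<^sub>m k] - 1\<^sub>m (n + k)) = stabilize (diag_block_mat [g, 1\<^sub>m k]) - 1"
      using c by (simp add: stabilize_def del: diag_block_mat.simps)
    also have "\<dots> = of_mat (g - 1\<^sub>m n)"
      unfolding stabilize_diag_block[OF g] using g by (simp add: stabilize_def)
    finally show ?thesis using g_in by (simp add: mat_in_iff del: diag_block_mat.simps)
  qed
  ultimately show ?thesis using c by (simp add: GL_def)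
qed

text \<open>Identifies stable classes with the fibres of \<open>stabilize\<close>, so that the
  direct limit becomes a group of units of one ring.\<close>

lemma stable_class_eq:
  assumes g: "g \<in> GL n"
  shows "stable_class g = {h \<in> (\<Union>N. GL N). stabilize h = stabilize g}"
proof (rule equalityI; rule subsetI)
  fix h assume "h \<in> stable_class g"
  then obtain m k l where h: "h \<in> GL m" "diag_block_mat [g, 1\<^sub>m k] = diag_block_mat [h, 1\<^sub>m l]"
    by (auto simp: stable_class_def simp del: diag_block_mat.simps)
  then have "stabilize h = stabilize g"
    using stabilize_diag_block[OF GL_carrier[OF g], of k] stabilize_diag_block[OF GL_carrier[OF h(1)], of l]
    by simp
  then show "h \<in> {h \<in> (\<Union>N. GL N). stabilize h = stabilize g}" using h by blast
next
  fix h assume "h \<in> {h \<in> (\<Union>N. GL N). stabilize h = stabilize g}"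
  then obtain m where h: "h \<in> GL m" "stabilize h = stabilize g" by blast
  have c: "diag_block_mat [g, 1\<^sub>m m] \<in> carrier_mat (n + m) (n + m)"
    "diag_block_mat [h, 1\<^sub>m n] \<in> carrier_mat (n + m) (n + m)"
    using GL_carrier[OF GL_diag_block[OF g, of m]] GL_carrier[OF GL_diag_block[OF h(1), of n]]
    by (simp_all add: add.commute del: diag_block_mat.simps)
  then have "diag_block_mat [g, 1\<^sub>m m] = diag_block_mat [h, 1\<^sub>m n]"
    by (rule stabilize_inject)
      (simp add: stabilize_diag_block[OF GL_carrier[OF g]] stabilize_diag_block[OF GL_carrier[OF h(1)]] h(2)
        del: diag_block_mat.simps)
  then show "h \<in> stable_class g" using h(1) unfolding stable_class_def by blast
qed

section \<open>The direct limit of the general linear groups as a group of units\<close>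

abbreviation GL_image :: "'x::complex_alg imat set"
  where "GL_image \<equiv> stabilize ` (\<Union>N. GL N)"

definition stable_fiber :: "'x::complex_alg imat \<Rightarrow> 'x unitz mat set"
  where "stable_fiber v = {h \<in> (\<Union>N. GL N). stabilize h = v}"

lemma carrier_GL_inf: "carrier GL_inf = stable_fiber ` GL_image"
proof -
  have "stable_class ` (\<Union>N. GL N) = (\<lambda>g. stable_fiber (stabilize g)) ` (\<Union>N. GL N)"
    by (rule image_cong) (auto simp: stable_fiber_def stable_class_eq)
  then show ?thesis by (simp add: GL_inf_def image_image)
qed

lemma GL_common_size:
  assumes "v \<in> GL_image" "w \<in> GL_image"
  obtains N g h where "g \<in> GL N" "h \<in> GL N" "stabilize g = v" "stabilize h = w"
proof -
  obtain m n g h where gh: "g \<in> GL m" "v = stabilize g" "h \<in> GL n" "w = stabilize h" using assms by auto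
  show ?thesis
    using GL_diag_block[OF gh(1), of n] GL_diag_block[OF gh(3), of m]
      stabilize_diag_block[OF GL_carrier[OF gh(1)], of n] stabilize_diag_block[OF GL_carrier[OF gh(3)], of m]
    by (intro that[of "diag_block_mat [g, 1\<^sub>m n]" "m + n" "diag_block_mat [h, 1\<^sub>m m]"])
      (simp_all add: gh add.commute del: diag_block_mat.simps)
qed

lemma GL_mult:
  assumes "g \<in> GL n" "h \<in> GL n"
  shows "g * h \<in> GL n"
proof -
  note c = GL_carrier[OF assms(1)] GL_carrier[OF assms(2)]
  obtain g' h' where i: "g' \<in> GL n" "g * g' = 1\<^sub>m n" "g' * g = 1\<^sub>m n" "h' \<in> GL n" "h * h' = 1\<^sub>m n" "h' * h = 1\<^sub>m n"
    using GL_inverse assms by metis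
  note c' = GL_carrier[OF i(1)] GL_carrier[OF i(4)]
  have "g * h * (h' * g') = g * (h * h') * g'" "h' * g' * (g * h) = h' * (g' * g) * h"
    using c c' by (simp_all add: assoc_mult_mat[of _ n n _ n _ n])
  then have "g * h * (h' * g') = 1\<^sub>m n" "h' * g' * (g * h) = 1\<^sub>m n" using i c c' by simp_all
  then have "invertible_mat (g * h)"
    using c c' by (auto simp: invertible_mat_def inverts_mat_def intro!: exI[of _ "h' * g'"])
  moreover have "of_mat (g * h - 1\<^sub>m n) = of_mat (g - 1\<^sub>m n) * of_mat h + of_mat (h - 1\<^sub>m n)"
    using c by (simp add: of_mat_diff[of _ n n] of_mat_mult[of _ n n _ n] left_diff_distrib of_mat_one_absorb)
  then have "mat_in UNIV (g * h - 1\<^sub>m n)"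
    using assms by (auto simp: mat_in_iff GL_def intro!: ring_idealD(3,5)[OF ring_ideal_mat_on[OF alg_ideal_UNIV]])
  ultimately show ?thesis using c by (simp add: GL_def)
qed

lemma GL_image_mult:
  assumes "v \<in> GL_image" "w \<in> GL_image"
  shows "v * w \<in> GL_image"
proof -
  obtain N g h where gh: "g \<in> GL N" "h \<in> GL N" "stabilize g = v" "stabilize h = w"
    using GL_common_size[OF assms] .
  then have "v * w = stabilize (g * h)" by (simp add: stabilize_mult[OF GL_carrier GL_carrier])
  then show ?thesis using GL_mult[OF gh(1,2)] by blast
qed

lemma GL_one: "1\<^sub>m n \<in> GL n"
  by (auto simp: GL_def invertible_mat_def inverts_mat_def mat_in_iff of_mat_diff[of _ n n]
      ring_idealD(1)[OF ring_ideal_mat_on[OF alg_ideal_UNIV]] intro!: exI[of _ "1\<^sub>m n"])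

lemma GL_image_inverse:
  assumes "v \<in> GL_image"
  obtains w where "w \<in> GL_image" "v * w = 1" "w * v = 1"
proof -
  obtain n g where g: "g \<in> GL n" "v = stabilize g" using assms by auto
  obtain g' where g': "g' \<in> GL n" "g * g' = 1\<^sub>m n" "g' * g = 1\<^sub>m n" using GL_inverse[OF g(1)] .
  show ?thesis
    using g' stabilize_mult[OF GL_carrier[OF g(1)] GL_carrier[OF g'(1)]]
      stabilize_mult[OF GL_carrier[OF g'(1)] GL_carrier[OF g(1)]]
    by (intro that[of "stabilize g'"]) (auto simp: g stabilize_one)
qed

lemma mult_GL_inf:
  assumes "v \<in> GL_image" "w \<in> GL_image"
  shows "stable_fiber v \<otimes>\<^bsub>GL_inf\<^esub> stable_fiber w = stable_fiber (v * w)"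
proof -
  have eq: "stable_class (g * h) = stable_fiber (v * w)"
    if gh: "g \<in> stable_fiber v \<inter> GL N" "h \<in> stable_fiber w \<inter> GL N" for N g h
  proof -
    have "g \<in> GL N" "h \<in> GL N" "stabilize g = v" "stabilize h = w" using gh by (auto simp: stable_fiber_def)
    then show ?thesis
      using stable_class_eq[OF GL_mult[of g N h]] stabilize_mult[OF GL_carrier[of g N] GL_carrier[of h N]]
      by (simp add: stable_fiber_def)
  qed
  obtain N g h where "g \<in> GL N" "h \<in> GL N" "stabilize g = v" "stabilize h = w"
    using GL_common_size[OF assms] .
  then have gh: "g \<in> stable_fiber v \<inter> GL N" "h \<in> stable_fiber w \<inter> GL N" by (auto simp: stable_fiber_def)
  have "{stable_class (g * h) | N g h. g \<in> stable_fiber v \<inter> GL N \<and> h \<in> stable_fiber w \<inter> GL N} = {stable_fiber (v * w)}"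
    using eq gh by blast
  then show ?thesis by (simp add: GL_inf_def)
qed

lemma one_GL_inf: "\<one>\<^bsub>GL_inf\<^esub> = stable_fiber 1"
  using stable_class_eq[OF GL_one[of 0]] by (simp add: GL_inf_def stable_fiber_def stabilize_one)

lemma one_in_GL_image: "1 \<in> GL_image"
  using GL_one[of 0] stabilize_one[of 0] by (metis UN_I UNIV_I imageI)

lemma group_GL_inf: "group GL_inf"
proof (rule groupI)
  show "\<one>\<^bsub>GL_inf\<^esub> \<in> carrier GL_inf"
    using one_in_GL_image by (auto simp: carrier_GL_inf one_GL_inf)
  fix x y z :: "'a unitz mat set"
  assume "x \<in> carrier GL_inf"
  then obtain u where x: "x = stable_fiber u" "u \<in> GL_image" by (auto simp: carrier_GL_inf)
  show "\<one>\<^bsub>GL_inf\<^esub> \<otimes>\<^bsub>GL_inf\<^esub> x = x"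
    using mult_GL_inf[OF one_in_GL_image x(2)] by (simp add: x one_GL_inf)
  obtain u' where u': "u' \<in> GL_image" "u' * u = 1" using GL_image_inverse[OF x(2)] by metis
  then show "\<exists>y\<in>carrier GL_inf. y \<otimes>\<^bsub>GL_inf\<^esub> x = \<one>\<^bsub>GL_inf\<^esub>"
    using mult_GL_inf[OF u'(1) x(2)] by (intro bexI[of _ "stable_fiber u'"]) (simp_all add: x one_GL_inf carrier_GL_inf)
  assume "y \<in> carrier GL_inf"
  then obtain v where y: "y = stable_fiber v" "v \<in> GL_image" by (auto simp: carrier_GL_inf)
  show "x \<otimes>\<^bsub>GL_inf\<^esub> y \<in> carrier GL_inf"
    unfolding x y mult_GL_inf[OF x(2) y(2)] carrier_GL_inf by (intro imageI GL_image_mult x y)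
  assume "z \<in> carrier GL_inf"
  then obtain w where z: "z = stable_fiber w" "w \<in> GL_image" by (auto simp: carrier_GL_inf)
  show "x \<otimes>\<^bsub>GL_inf\<^esub> y \<otimes>\<^bsub>GL_inf\<^esub> z = x \<otimes>\<^bsub>GL_inf\<^esub> (y \<otimes>\<^bsub>GL_inf\<^esub> z)"
    unfolding x y z by (simp only: mult_GL_inf GL_image_mult x y z mult.assoc)
qed

text \<open>An additive function with complex values vanishes on commutators, hence on the derived
  subgroup, and so is constant on each of its cosets. An element of \<open>K1\<close> is such a
  coset of stable classes, and its union consists of the representing matrices.\<close>

lemma additive_on_K1:
  fixes \<chi> :: "'a::complex_alg imat \<Rightarrow> complex"
  assumes \<chi>: "\<And>v w. v \<in> GL_image \<Longrightarrow> w \<in> GL_image \<Longrightarrow> \<chi> (v * w) = \<chi> v + \<chi> w"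
    and \<kappa>: "\<kappa> \<in> carrier K1" and g: "g \<in> \<Union>\<kappa>" "h \<in> \<Union>\<kappa>"
  shows "\<chi> (stabilize g) = \<chi> (stabilize h)"
proof -
  interpret G: group "GL_inf :: 'a unitz mat set monoid" by (rule group_GL_inf)
  \<comment> \<open>The choice of a matrix in the stable class is harmless, as
    \<open>stabilize\<close> is constant there.\<close>
  define f where "f x = \<chi> (stabilize (SOME g. g \<in> x))" for x :: "'a unitz mat set"
  have f_fiber: "f (stable_fiber v) = \<chi> v" if v: "v \<in> GL_image" for v
  proof -
    obtain g where "g \<in> stable_fiber v" using v by (auto simp: stable_fiber_def)
    then have "(SOME g. g \<in> stable_fiber v) \<in> stable_fiber v" by (rule someI)
    then show ?thesis by (simp add: f_def stable_fiber_def)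
  qed
  have f_mult: "f (x \<otimes>\<^bsub>GL_inf\<^esub> y) = f x + f y" if xy: "x \<in> carrier GL_inf" "y \<in> carrier GL_inf" for x y
  proof -
    obtain v w where "x = stable_fiber v" "v \<in> GL_image" "y = stable_fiber w" "w \<in> GL_image"
      using xy unfolding carrier_GL_inf by blast
    then show ?thesis by (simp only: mult_GL_inf f_fiber GL_image_mult \<chi>)
  qed
  have f_one: "f \<one>\<^bsub>GL_inf\<^esub> = 0" using f_mult[OF G.one_closed G.one_closed] by simp
  have f_inv: "f (inv\<^bsub>GL_inf\<^esub> x) = - f x" if "x \<in> carrier GL_inf" for x
    using f_mult[OF that G.inv_closed[OF that]] f_one that by (simp add: add_eq_0_iff)
  let ?D = "derived GL_inf (carrier GL_inf)"
  have f_derived: "d \<in> carrier GL_inf \<and> f d = 0" if "d \<in> ?D" for d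
    using that unfolding derived_def
  proof (induction rule: generate.induct)
    case (incl h)
    then show ?case by (auto simp: f_mult f_inv)
  next
    case (inv h)
    then have "h \<in> carrier GL_inf \<and> f h = 0" by (auto simp: f_mult f_inv)
    then show ?case by (simp add: f_inv)
  next
    case (eng h1 h2)
    then show ?case by (simp add: f_mult)
  qed (simp add: f_one)
  obtain a where a: "a \<in> carrier GL_inf" "\<kappa> = ?D #>\<^bsub>GL_inf\<^esub> a"
    using \<kappa> by (auto simp: K1_def FactGroup_def RCOSETS_def)
  have "\<chi> (stabilize g) = f a" if g: "g \<in> \<Union>\<kappa>" for g
  proof -
    obtain d where d: "d \<in> ?D" "g \<in> d \<otimes>\<^bsub>GL_inf\<^esub> a" using g by (auto simp: a r_coset_def)
    then have "d \<otimes>\<^bsub>GL_inf\<^esub> a \<in> carrier GL_inf" "f (d \<otimes>\<^bsub>GL_inf\<^esub> a) = f a"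
      using f_derived[OF d(1)] a by (auto simp: f_mult)
    then obtain v where v: "d \<otimes>\<^bsub>GL_inf\<^esub> a = stable_fiber v" "v \<in> GL_image" "f (stable_fiber v) = f a"
      unfolding carrier_GL_inf by (metis (no_types, lifting) imageE)
    then have "stabilize g = v" using d(2) by (simp add: stable_fiber_def)
    then show ?thesis using v f_fiber by simp
  qed
  then show ?thesis using g by metis
qed

lemma ex_in_K1_class:
  assumes "\<kappa> \<in> carrier K1"
  obtains N g where "g \<in> \<Union>\<kappa>" "g \<in> GL N"
proof -
  interpret G: group "GL_inf :: 'a unitz mat set monoid" by (rule group_GL_inf)
  obtain a where a: "a \<in> carrier GL_inf" "\<kappa> = derived GL_inf (carrier GL_inf) #>\<^bsub>GL_inf\<^esub> a"
    using assms by (auto simp: K1_def FactGroup_def RCOSETS_def)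
  have "\<one>\<^bsub>GL_inf\<^esub> \<in> derived GL_inf (carrier GL_inf)" unfolding derived_def by (rule generate.one)
  then have "\<one>\<^bsub>GL_inf\<^esub> \<otimes>\<^bsub>GL_inf\<^esub> a \<in> \<kappa>" by (auto simp: a(2) r_coset_def)
  then have "a \<in> \<kappa>" using a by simp
  moreover obtain v where v: "a = stable_fiber v" "v \<in> GL_image" using a by (auto simp: carrier_GL_inf)
  then obtain N g where "g \<in> GL N" "stabilize g = v" by auto
  then have "g \<in> a" by (auto simp: v stable_fiber_def)
  ultimately show ?thesis using \<open>g \<in> GL N\<close> by (intro that[of g N]) auto
qed

section \<open>The index map\<close>

lemma map_mat_unitz:
  assumes h: "alg_hom h"
  shows "A \<in> carrier_mat l m \<Longrightarrow> B \<in> carrier_mat m n \<Longrightarrow>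
      map_mat (unitz_map h) (A * B) = map_mat (unitz_map h) A * map_mat (unitz_map h) B"
    "A \<in> carrier_mat l m \<Longrightarrow> C \<in> carrier_mat l m \<Longrightarrow>
      map_mat (unitz_map h) (A + C) = map_mat (unitz_map h) A + map_mat (unitz_map h) C"
    "A \<in> carrier_mat l m \<Longrightarrow> C \<in> carrier_mat l m \<Longrightarrow>
      map_mat (unitz_map h) (A - C) = map_mat (unitz_map h) A - map_mat (unitz_map h) C"
    "map_mat (unitz_map h) (1\<^sub>m n) = 1\<^sub>m n"
proof -
  assume "A \<in> carrier_mat l m" "B \<in> carrier_mat m n"
  then show "map_mat (unitz_map h) (A * B) = map_mat (unitz_map h) A * map_mat (unitz_map h) B"
    using of_mat_mult[of A l m B n] of_mat_mult[of "map_mat (unitz_map h) A" l m "map_mat (unitz_map h) B" n]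
    by (intro of_mat_inject[of _ l n]) (simp_all add: imat_map_hom[OF h] flip: imat_map_of_mat[OF h])
qed (rule eq_matI; auto simp: unitz_map_hom[OF h])+

definition index_matrix :: "nat \<Rightarrow> 'x::ring_1 mat \<Rightarrow> 'x mat \<Rightarrow> 'x mat"
  where "index_matrix N Q P =
    four_block_mat Q (1\<^sub>m N - Q * P) (P * Q - 1\<^sub>m N) (P + P * (1\<^sub>m N - Q * P))"

lemma map_index_matrix:
  assumes h: "alg_hom h" and Q: "Q \<in> carrier_mat N N" "map_mat (unitz_map h) Q = g"
    and P: "P \<in> carrier_mat N N" "map_mat (unitz_map h) P = g'"
    and gg': "g * g' = 1\<^sub>m N" "g' * g = 1\<^sub>m N"
  shows "map_mat (unitz_map h) (index_matrix N Q P) = four_block_mat g (0\<^sub>m N N) (0\<^sub>m N N) g'"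
proof -
  have g: "g \<in> carrier_mat N N" "g' \<in> carrier_mat N N" using Q P by auto
  have c: "Q * P \<in> carrier_mat N N" "P * Q \<in> carrier_mat N N" "1\<^sub>m N - Q * P \<in> carrier_mat N N"
    "P * (1\<^sub>m N - Q * P) \<in> carrier_mat N N" "P * Q - 1\<^sub>m N \<in> carrier_mat N N" using Q P by auto
  have "map_mat (unitz_map h) (1\<^sub>m N - Q * P) = 0\<^sub>m N N" "map_mat (unitz_map h) (P * Q - 1\<^sub>m N) = 0\<^sub>m N N"
    using c Q P gg'
    by (simp_all add: map_mat_unitz(3)[OF h, of _ N N] map_mat_unitz(4)[OF h] map_mat_unitz(1)[OF h, of _ N N _ N] g)
  moreover have "map_mat (unitz_map h) (P + P * (1\<^sub>m N - Q * P)) = g' + g' * map_mat (unitz_map h) (1\<^sub>m N - Q * P)"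
    using c P by (simp add: map_mat_unitz(2)[OF h, of _ N N] map_mat_unitz(1)[OF h, of _ N N _ N])
  ultimately show ?thesis
    unfolding index_matrix_def
    by (subst map_four_block_mat[of _ N N _ N _ N]) (use c Q P g in auto)
qed

text \<open>The inverse is explicit, and each block of the two products is a polynomial identity in
  two noncommuting variables.\<close>

lemma index_matrix_inverse:
  fixes Q P :: "'x::complex_alg unitz mat"
  assumes Q: "Q \<in> carrier_mat N N" and P: "P \<in> carrier_mat N N"
  obtains G' where "G' \<in> carrier_mat (N + N) (N + N)" "inverts_mat (index_matrix N Q P) G'"
    "inverts_mat G' (index_matrix N Q P)"
proof -
  define V W P2 where "V = 1\<^sub>m N - Q * P" and "W = P * Q - 1\<^sub>m N" and "P2 = P + P * V"
  have c: "V \<in> carrier_mat N N" "W \<in> carrier_mat N N" "P2 \<in> carrier_mat N N"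
    using Q P by (auto simp: V_def W_def P2_def)
  note Q = Q and P = P
  have one: "(1\<^sub>m N :: 'x unitz mat) \<in> carrier_mat N N" by simp
  define q p I where "q = of_mat Q" and "p = of_mat P" and "I = of_mat (1\<^sub>m N :: 'x unitz mat)"
  have QP: "Q * P \<in> carrier_mat N N" "P * Q \<in> carrier_mat N N" "P * V \<in> carrier_mat N N" using Q P c by auto
  have v: "of_mat V = I - q * p" "of_mat W = p * q - I" "of_mat P2 = p + p * (I - q * p)"
  proof -
    show V: "of_mat V = I - q * p" and "of_mat W = p * q - I"
      by (simp_all add: V_def W_def I_def q_def p_def of_mat_diff[OF one QP(1)] of_mat_diff[OF QP(2) one]
          of_mat_mult[OF Q P] of_mat_mult[OF P Q])
    show "of_mat P2 = p + p * (I - q * p)"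
      unfolding P2_def of_mat_add[OF P QP(3)] of_mat_mult[OF P c(1)] V by (simp add: p_def)
  qed
  have I: "I * I = I" "I * q = q" "q * I = q" "I * p = p" "p * I = p"
    by (simp_all add: I_def q_def p_def of_mat_one_absorb[OF Q] of_mat_one_absorb[OF P] of_mat_one_absorb[OF one])
  have Il: "I * (q * x) = q * x" "I * (p * x) = p * x" "q * (I * x) = q * x" "p * (I * x) = p * x" for x
    by (simp_all add: I flip: mult.assoc)
  \<comment> \<open>Checked after embedding into \<open>imat\<close>, where ring simplification is
    available for matrices.\<close>
  have b: "Q * P2 + V * V = 1\<^sub>m N" "Q * W + V * Q = 0\<^sub>m N N" "W * P2 + P2 * V = 0\<^sub>m N N" "W * W + P2 * Q = 1\<^sub>m N"
  proof -
    have *: "A * B + C * D = X" if "A \<in> carrier_mat N N" "B \<in> carrier_mat N N" "C \<in> carrier_mat N N"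
      "D \<in> carrier_mat N N" "X \<in> carrier_mat N N" "of_mat A * of_mat B + of_mat C * of_mat D = of_mat X"
    for A B C D X :: "'x unitz mat"
      using that by (intro of_mat_inject[of _ N N]) (auto simp: of_mat_add[of _ N N] of_mat_mult[of _ N N _ N])
    show "Q * P2 + V * V = 1\<^sub>m N" "Q * W + V * Q = 0\<^sub>m N N" "W * P2 + P2 * V = 0\<^sub>m N N" "W * W + P2 * Q = 1\<^sub>m N"
      by (rule *; use c Q P in \<open>simp add: v algebra_simps I Il of_mat_zero flip: q_def p_def I_def\<close>)+
  qed
  have G: "index_matrix N Q P = four_block_mat Q V W P2" by (simp add: index_matrix_def V_def W_def P2_def)
  \<comment> \<open>The diagonal blocks of G are exchanged with each other, and so are the
    off-diagonal ones.\<close>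
  define G' where "G' = four_block_mat P2 W V Q"
  have "index_matrix N Q P * G' = four_block_mat (1\<^sub>m N) (0\<^sub>m N N) (0\<^sub>m N N) (1\<^sub>m N)"
    unfolding G G'_def using b by (subst mult_four_block_mat[OF Q c(1,2,3) c(3,2,1) Q]) simp
  moreover have "G' * index_matrix N Q P = four_block_mat (1\<^sub>m N) (0\<^sub>m N N) (0\<^sub>m N N) (1\<^sub>m N)"
  proof -
    have "P2 * Q + W * W = 1\<^sub>m N" "P2 * V + W * P2 = 0\<^sub>m N N" "V * Q + Q * W = 0\<^sub>m N N" "V * V + Q * P2 = 1\<^sub>m N"
      using b comm_add_mat[of "P2 * Q" N N "W * W"] comm_add_mat[of "P2 * V" N N "W * P2"]
        comm_add_mat[of "V * Q" N N "Q * W"] comm_add_mat[of "V * V" N N "Q * P2"] c Q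
      by simp_all
    then show ?thesis
      unfolding G G'_def by (subst mult_four_block_mat[OF c(3,2,1) Q Q c(1,2,3)]) simp
  qed
  moreover have "G' \<in> carrier_mat (N + N) (N + N)" "index_matrix N Q P \<in> carrier_mat (N + N) (N + N)"
    unfolding G'_def G using c Q by (auto intro: four_block_carrier_mat)
  ultimately show ?thesis by (intro that[of G']) (auto simp: inverts_mat_def)
qed

lemma p_mat_four_block: "p_mat N (N + N) = four_block_mat (1\<^sub>m N) (0\<^sub>m N N) (0\<^sub>m N N) (0\<^sub>m N N)"
  by (rule eq_matI) (auto simp: p_mat_def)

lemma p_mat_idempotent: "N \<le> K \<Longrightarrow> p_mat N K * p_mat N K = (p_mat N K :: 'x::complex_alg unitz mat)"
  by (rule of_mat_inject[of _ K K])
    (simp_all add: p_mat_carrier mult_carrier_mat[OF p_mat_carrier p_mat_carrier] of_mat_mult[OF p_mat_carrier p_mat_carrier] of_mat_p_mat of_mat_one_absorb)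

lemma map_index_inverse:
  assumes h: "alg_hom h" and G: "G \<in> carrier_mat (N + N) (N + N)" "G' \<in> carrier_mat (N + N) (N + N)"
    and inv: "inverts_mat G G'"
    and g: "g \<in> carrier_mat N N" "g' \<in> carrier_mat N N" "g' * g = 1\<^sub>m N" "g * g' = 1\<^sub>m N"
    and mapG: "map_mat (unitz_map h) G = four_block_mat g (0\<^sub>m N N) (0\<^sub>m N N) g'"
  shows "map_mat (unitz_map h) G' = four_block_mat g' (0\<^sub>m N N) (0\<^sub>m N N) g"
proof -
  let ?G = "map_mat (unitz_map h) G" and ?G' = "map_mat (unitz_map h) G'"
  let ?D = "four_block_mat g' (0\<^sub>m N N) (0\<^sub>m N N) g"
  have D: "?D \<in> carrier_mat (N + N) (N + N)" using g by (intro four_block_carrier_mat)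
  have GG': "G * G' = 1\<^sub>m (N + N)" using inv G by (simp add: inverts_mat_def)
  have "?G * ?G' = 1\<^sub>m (N + N)"
    using map_mat_unitz(1)[OF h G] map_mat_unitz(4)[OF h] GG' by metis
  moreover have "?D * ?G = 1\<^sub>m (N + N)"
    unfolding mapG using g by (subst mult_four_block_mat[of _ N N _ N _ N _ _ N _ N]) auto
  ultimately show ?thesis
    using assoc_mult_mat[of ?D "N + N" "N + N" ?G "N + N" ?G' "N + N"] D G by auto
qed

lemma map_index_idempotent:
  assumes h: "alg_hom h" and G: "G \<in> carrier_mat (N + N) (N + N)" "G' \<in> carrier_mat (N + N) (N + N)"
    and inv: "inverts_mat G G'"
    and g: "g \<in> carrier_mat N N" "g' \<in> carrier_mat N N" "g' * g = 1\<^sub>m N" "g * g' = 1\<^sub>m N"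
    and mapG: "map_mat (unitz_map h) G = four_block_mat g (0\<^sub>m N N) (0\<^sub>m N N) g'"
  shows "map_mat (unitz_map h) (G' * p_mat N (N + N) * G) = p_mat N (N + N)"
proof -
  note mapG' = map_index_inverse[OF h G inv g mapG]
  have "map_mat (unitz_map h) (G' * p_mat N (N + N) * G) =
      map_mat (unitz_map h) G' * p_mat N (N + N) * map_mat (unitz_map h) G"
    unfolding map_mat_unitz(1)[OF h mult_carrier_mat[OF G(2) p_mat_carrier] G(1)]
      map_mat_unitz(1)[OF h G(2) p_mat_carrier] map_mat_p_mat[OF h] ..
  also have "\<dots> = p_mat N (N + N)"
    unfolding mapG mapG' p_mat_four_block using g
    by (subst mult_four_block_mat[of _ N N _ N _ N _ _ N _ N], auto)+
  finally show ?thesis .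
qed

text \<open>Over A the matrix G becomes block diagonal, so the conjugate of p_N becomes p_N again.
  The algebra parts of its entries are therefore killed by \<open>ea\<close> and come from
  B.\<close>

lemma ex_Ind_data:
  assumes ext: "extension be ea" and g: "g \<in> GL N" "g \<in> \<Union>\<kappa>"
  obtains g' Q P G' e where "g' \<in> carrier_mat N N" "inverts_mat g g'" "inverts_mat g' g"
    "Q \<in> carrier_mat N N" "map_mat (unitz_map ea) Q = g" "P \<in> carrier_mat N N" "map_mat (unitz_map ea) P = g'"
    "G' \<in> carrier_mat (N + N) (N + N)" "inverts_mat (index_matrix N Q P) G'" "inverts_mat G' (index_matrix N Q P)"
    "e \<in> carrier_mat (N + N) (N + N)" "map_mat (unitz_map be) e = G' * p_mat N (N + N) * index_matrix N Q P"
proof -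
  note E = extension_ideal[OF ext]
  note ea = E(2) and surj = E(5)
  obtain g' where g': "g' \<in> GL N" "g * g' = 1\<^sub>m N" "g' * g = 1\<^sub>m N" using GL_inverse[OF g(1)] .
  note gc = GL_carrier[OF g(1)] GL_carrier[OF g'(1)]
  obtain Q where Q: "Q \<in> carrier_mat N N" "map_mat (unitz_map ea) Q = g"
    using map_mat_lift[OF surj gc(1)] .
  obtain P where P: "P \<in> carrier_mat N N" "map_mat (unitz_map ea) P = g'"
    using map_mat_lift[OF surj gc(2)] .
  obtain G' where G': "G' \<in> carrier_mat (N + N) (N + N)" "inverts_mat (index_matrix N Q P) G'"
    "inverts_mat G' (index_matrix N Q P)" using index_matrix_inverse[OF Q(1) P(1)] .
  let ?G = "index_matrix N Q P" and ?p = "p_mat N (N + N)"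
  have G: "?G \<in> carrier_mat (N + N) (N + N)"
    unfolding index_matrix_def using Q P by (intro four_block_carrier_mat) auto
  note mG = map_index_matrix[OF ea Q P g'(2,3)]
  define x where "x = G' * ?p * ?G"
  have x: "x \<in> carrier_mat (N + N) (N + N)" unfolding x_def by (rule mult_carrier_mat[OF mult_carrier_mat[OF G'(1) p_mat_carrier] G])
  have mx: "map_mat (unitz_map ea) x = p_mat N (N + N)"
    unfolding x_def by (rule map_index_idempotent[OF ea G G'(1,2) gc g'(3,2) mG])
  have range: "\<exists>b. be b = alg_part (x $$ (i, j))" if "i < N + N" "j < N + N" for i j
  proof -
    have "unitz_map ea (x $$ (i, j)) = p_mat N (N + N) $$ (i, j)"
      using mx x that by (metis carrier_matD index_map_mat(1))
    then have "ea (alg_part (x $$ (i, j))) = 0"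
      using that by (auto simp: unitz_map_def p_mat_def zero_unitz_def one_unitz_def split: if_splits)
    then show ?thesis using E(4) by (metis (mono_tags, lifting) imageE mem_Collect_eq)
  qed
  define e where "e = mat (N + N) (N + N) (\<lambda>(i, j). Unitz (SOME b. be b = alg_part (x $$ (i, j))) (scal_part (x $$ (i, j))))"
  have "map_mat (unitz_map be) e = x"
  proof (rule eq_matI)
    fix i j assume "i < dim_row x" "j < dim_col x"
    then have ij: "i < N + N" "j < N + N" using x by auto
    have "be (SOME b. be b = alg_part (x $$ (i, j))) = alg_part (x $$ (i, j))"
      using someI_ex[OF range[OF ij]] .
    then show "map_mat (unitz_map be) e $$ (i, j) = x $$ (i, j)"
      using ij by (simp add: e_def unitz_map_def)
  qed (use x in \<open>auto simp: e_def\<close>)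
  moreover have "e \<in> carrier_mat (N + N) (N + N)" by (simp add: e_def)
  ultimately show ?thesis
    using gc g' Q P G' by (intro that[of g' Q P G' e]) (auto simp: inverts_mat_def x_def)
qed

section \<open>The index pairing of a lifted extension\<close>

lemma alg_hom_zero: "alg_hom (\<lambda>_. 0)"
  unfolding alg_hom_def by (intro conjI allI; unfold_locales?) auto


locale lifted_extension =
  fixes be :: "'b::complex_alg \<Rightarrow> 'e::complex_alg" and ea :: "'e \<Rightarrow> 'a::complex_alg"
    and rm :: "'r::complex_alg \<Rightarrow> 'm::complex_alg" and rb :: "'r \<Rightarrow> 'b" and me :: "'m \<Rightarrow> 'e" and N :: "'m set"
  assumes ext: "extension be ea" and rm: "alg_hom rm" "inj rm" "alg_ideal (range rm)"
    and rb: "alg_hom rb" "surj rb" and me: "alg_hom me" "surj me" and N_eq: "N = {x. me x = 0}"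
    and square: "me (rm r) = be (rb r)"
begin

abbreviation "R \<equiv> range rm"

lemmas be = extension_ideal(1,3)[OF ext] and ea = extension_ideal(2,5)[OF ext]

lemma ea_be: "ea (be b) = 0"
  using extension_ideal(4)[OF ext] by blast

lemma N_ideal: "alg_ideal N"
  unfolding N_eq by (rule alg_ideal_kernel[OF me(1)])

lemma RN_ideal: "alg_ideal (ideal_sum R N)"
  by (rule alg_ideal_sum[OF rm(3) N_ideal])

text \<open>An element of M that dies in A maps into the image of B in E; lifting that element of B
  to R and subtracting leaves an element of N. Thus invertibility over A is invertibility modulo R +
  N.\<close>

lemma kernel_RN: "{x. (ea \<circ> me) x = 0} = ideal_sum R N"
proof (intro equalityI subsetI)
  fix x assume "x \<in> {x. (ea \<circ> me) x = 0}"
  then obtain b where "me x = be b" using extension_ideal(4)[OF ext] by auto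
  also obtain r where "b = rb r" using rb(2) by (metis surjD)
  finally have "x - rm r \<in> N" by (simp add: N_eq alg_homD[OF me(1)] square)
  from ideal_sumI[of "rm r" R, OF _ this] show "x \<in> ideal_sum R N" by simp
next
  fix x assume "x \<in> ideal_sum R N"
  then show "x \<in> {x. (ea \<circ> me) x = 0}"
    by (auto simp: ideal_sum_def N_eq alg_homD[OF me(1)] square ea_be alg_homD(4)[OF ea(1)])
qed

definition \<pi>E :: "'m imat \<Rightarrow> 'e imat" where "\<pi>E = imat_map me"
definition \<pi>A :: "'m imat \<Rightarrow> 'a imat" where "\<pi>A = imat_map (ea \<circ> me)"
definition \<iota>E :: "'b imat \<Rightarrow> 'e imat" where "\<iota>E = imat_map be"
text \<open>Keeps only the scalar parts: the composite of B^+ to C to M^+ on matrices. For an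
  idempotent over B^+ it supplies the reference idempotent, which is p_N in the standard
  case.\<close>

definition sM :: "'b imat \<Rightarrow> 'm imat" where "sM = imat_map (\<lambda>_. 0)"

lemmas ea_me = alg_hom_comp[OF me(1) ea(1)]
lemmas \<pi>E_hom = imat_map_hom[OF me(1), folded \<pi>E_def]
lemmas \<pi>A_hom = imat_map_hom[OF ea_me, folded \<pi>A_def]
lemmas \<iota>E_hom = imat_map_hom[OF be(1), folded \<iota>E_def]
lemma sM_hom: "sM (x + y) = sM x + sM y" "sM (x - y) = sM x - sM y" "sM (x * y) = sM x * sM y"
  by (simp_all add: sM_def imat_map_hom[OF alg_hom_zero])

lemma \<pi>E_eq_iff: "\<pi>E x = \<pi>E y \<longleftrightarrow> x - y \<in> mat_on N"
  using imat_map_eq_iff[OF me(1)] by (simp add: \<pi>E_def N_eq)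

lemma \<pi>A_eq_iff: "\<pi>A x = \<pi>A y \<longleftrightarrow> x - y \<in> mat_on (ideal_sum R N)"
  using imat_map_eq_iff[OF ea_me] kernel_RN by (simp add: \<pi>A_def)

lemma \<pi>E_surj: obtains x where "\<pi>E x = y"
  using imat_map_surj[OF me] unfolding \<pi>E_def by blast

lemma \<pi>A_surj: obtains x where "\<pi>A x = y"
proof -
  have "surj (ea \<circ> me)" using me(2) ea(2) by (rule comp_surj)
  from imat_map_surj[OF ea_me this] show ?thesis using that unfolding \<pi>A_def by blast
qed

lemma \<pi>A_\<pi>E: "\<pi>A x = imat_map ea (\<pi>E x)"
  by (simp add: \<pi>A_def \<pi>E_def imat_map_comp[OF ea(1) me(1) ea_me])

lemma \<pi>E_eq_imp_\<pi>A_eq: "\<pi>E x = \<pi>E y \<Longrightarrow> \<pi>A x = \<pi>A y"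
  by (simp add: \<pi>A_\<pi>E)

lemma ea_\<iota>E: "imat_map ea (\<iota>E w) = imat_map (\<lambda>_. 0) w"
  unfolding \<iota>E_def using alg_hom_comp[OF be(1) ea(1)]
  by (simp add: imat_map_comp[OF ea(1) be(1)] o_def ea_be)

lemma \<pi>A_sM: "\<pi>A (sM w) = imat_map (\<lambda>_. 0) w"
proof -
  have "alg_hom ((ea \<circ> me) \<circ> (\<lambda>_::'b. 0))" by (rule alg_hom_comp[OF alg_hom_zero ea_me])
  from imat_map_comp[OF ea_me alg_hom_zero this] show ?thesis
    by (simp add: \<pi>A_def sM_def o_def alg_homD(4)[OF ea(1)] alg_homD(4)[OF me(1)])
qed

end

text \<open>\<open>T_R\<close> and \<open>T_R2\<close> are the cocycle condition on the two summands
  of the odd part of F^(4n+1), and \<open>K\<close> is a power of N killed by the renormalization;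
  \<open>renormalized_intro\<close> derives them.\<close>

locale renormalized = lifted_extension be ea rm rb me N
  for be :: "'b::complex_alg \<Rightarrow> 'e::complex_alg" and ea :: "'e \<Rightarrow> 'a::complex_alg"
    and rm :: "'r::complex_alg \<Rightarrow> 'm::complex_alg" and rb :: "'r \<Rightarrow> 'b" and me :: "'m \<Rightarrow> 'e" and N :: "'m set" +
  fixes n :: nat and K :: nat and T :: "'m \<Rightarrow> complex"
  assumes T_lin: "clinear T" and K_pos: "0 < K" and T_N: "x \<in> ideal_pow N K \<Longrightarrow> T x = 0"
    and T_R: "x \<in> ideal_pow (range rm) (2 * n + 1) \<Longrightarrow> T (x * y) = T (y * x)"
    and T_R2: "u \<in> ideal_pow_plus (range rm) (2 * n) \<Longrightarrow> y \<in> range rm \<Longrightarrow>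
      T (alg_part (u * of_alg y)) = T (alg_part (of_alg y * u))"
begin

section \<open>The index setting of matrices over M\<close>

definition "SI = ideal_sum (ideal_pow R (2 * n + 1)) (ideal_pow N K)"
text \<open>Large enough for \<open>ideal_pow_sum\<close>: a product of that many factors from R + N
  has 2n+1 factors in R or \<open>K\<close> factors in N.\<close>

definition "J = 2 * n + 1 + K"
definition "t = mtrace T"

lemma SI_ideal: "alg_ideal SI"
  unfolding SI_def by (intro alg_ideal_sum alg_ideal_pow rm(3) N_ideal)

lemma SI_sub: "ideal_pow N K \<subseteq> SI" "ideal_pow R (2 * n + 1) \<subseteq> SI" "SI \<subseteq> ideal_sum R N"
proof -
  show "ideal_pow N K \<subseteq> SI" "ideal_pow R (2 * n + 1) \<subseteq> SI"
    unfolding SI_def by (rule ideal_sum_upper(2)[OF alg_ideal_pow[OF rm(3)] alg_ideal_pow[OF N_ideal]],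
        rule ideal_sum_upper(1)[OF alg_ideal_pow[OF rm(3)] alg_ideal_pow[OF N_ideal]])
  show "SI \<subseteq> ideal_sum R N"
    using ideal_pow_antimono[OF rm(3), of 1 "2 * n + 1"] ideal_pow_antimono[OF N_ideal, of 1 K] K_pos
    by (auto simp: SI_def ideal_sum_def) blast
qed

lemma ideal_pow_SI: "ideal_pow (ideal_sum R N) J \<subseteq> SI"
  unfolding SI_def J_def by (rule ideal_pow_sum[OF rm(3) N_ideal]) simp

lemma additive_T: "additive_map T"
  by unfold_locales (rule clinear_functionalD(1)[OF T_lin])

lemma T_SI: "s \<in> SI \<Longrightarrow> T (s * y) = T (y * s)"
proof -
  assume "s \<in> SI"
  then obtain r z where s: "s = r + z" "r \<in> ideal_pow R (2 * n + 1)" "z \<in> ideal_pow N K"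
    by (auto simp: SI_def ideal_sum_def)
  have "T (z * y) = 0" "T (y * z) = 0"
    using alg_idealD(2,3)[OF alg_ideal_pow[OF N_ideal]] s(3) by (auto intro!: T_N)
  then show ?thesis
    by (simp add: s(1) distrib_left distrib_right clinear_functionalD[OF T_lin] T_R[OF s(2)])
qed

sublocale index_setting t "mat_on (ideal_pow N K)" "mat_on SI" "mat_on (ideal_sum R N)" J
proof
  interpret additive_map T by (rule additive_T)
  show "t (x + y) = t x + t y" for x y unfolding t_def by (rule mtrace_add)
  show "ring_ideal (mat_on (ideal_pow N K))" "ring_ideal (mat_on SI)" "ring_ideal (mat_on (ideal_sum R N))"
    by (intro ring_ideal_mat_on alg_ideal_pow N_ideal SI_ideal RN_ideal)+
  show "mat_on (ideal_pow N K) \<subseteq> mat_on SI" "mat_on SI \<subseteq> mat_on (ideal_sum R N)"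
    by (intro mat_on_mono SI_sub)+
  show "t z = 0" if "z \<in> mat_on (ideal_pow N K)" for z
    unfolding t_def by (rule mtrace_vanish[OF that T_N])
  show "t (s * w) = t (w * s)" if "s \<in> mat_on SI" for s w
    unfolding t_def
  proof (rule mtrace_commute[OF that UNIV_I, symmetric])
    fix a and b assume "b \<in> SI"
    then show "T (alg_part (a * of_alg b)) = T (alg_part (of_alg b * a))"
      by (simp add: unitz_simps clinear_functionalD[OF T_lin] T_SI[of b "alg_part a"])
  qed
  show "0 < J" by (simp add: J_def)
  show "u ^ J \<in> mat_on SI" if "u \<in> mat_on (ideal_sum R N)" for u
    using mat_on_power[OF RN_ideal that, of "J - 1"] mat_on_mono[OF ideal_pow_SI] by (auto simp: J_def)
qed

notation approx (infix \<open>\<approx>\<close> 50)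

lemma Z_sub_N: "mat_on (ideal_pow N K) \<subseteq> mat_on N"
  using ideal_pow_antimono[OF N_ideal, of 1 K] K_pos by (intro mat_on_mono) simp

text \<open>A map that becomes an isomorphism over E has remainders over N, and these are nilpotent
  modulo N^K.\<close>

lemma has_ind_iso_mod_N:
  assumes "e * e \<approx> e" "f * f \<approx> f" "f * q \<approx> q" "q * e \<approx> q" "e * p \<approx> p" "p * f \<approx> p"
    and "\<pi>E (p * q) = \<pi>E e" "\<pi>E (q * p) = \<pi>E f"
  shows "has_ind e f q 0"
proof (rule has_ind_nilpotent)
  show "fred (mat_on N) e f q p"
    using assms by (simp add: fred_def \<pi>E_eq_iff[symmetric])
  show "u ^ K \<in> mat_on (ideal_pow N K)" if "u \<in> mat_on N" for u
    using mat_on_power[OF N_ideal that, of "K - 1"] K_pos by simp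
qed (rule K_pos)

lemma has_ind_perturb_\<pi>A:
  assumes "has_ind e f q c" "f * q' \<approx> q'" "q' * e \<approx> q'" "\<pi>A q = \<pi>A q'"
  shows "has_ind e f q' c"
  by (rule has_ind_perturb[OF assms(1-3)]) (use assms(4) in \<open>simp add: \<pi>A_eq_iff\<close>)

lemma ex_has_ind:
  assumes "e * e \<approx> e" "f * f \<approx> f" "f * q \<approx> q" "q * e \<approx> q" "e * p \<approx> p" "p * f \<approx> p"
    and "\<pi>A (p * q) = \<pi>A e" "\<pi>A (q * p) = \<pi>A f"
  obtains c where "has_ind e f q c"
proof -
  have "fred (mat_on (ideal_sum R N)) e f q p"
    using assms by (simp add: fred_def \<pi>A_eq_iff[symmetric])
  from has_ind_power[OF this] show ?thesis by (rule that)
qed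

lemma R_sub: "mat_on R \<subseteq> mat_on (ideal_sum R N)"
  by (rule mat_on_mono[OF ideal_sum_upper(1)[OF rm(3) N_ideal]])

text \<open>\<open>has_ind_idempotents\<close> gives the exponent 2J+1, and each application of
  \<open>odd_power_step\<close> lowers it by two. The trace needed there is \<open>T_R2\<close>:
  even powers of the difference with exponent at least 2n have coefficients in R^(2n), and the
  difference itself lies over R.\<close>

lemma idempotent_ind:
  assumes ee: "e * e \<approx> e" and ff: "f * f \<approx> f" and near: "e - f \<in> mat_on R"
  shows "has_ind e f (f * e) (t ((e - f) ^ (2 * n + 1)))"
proof -
  let ?d = "e - f"
  \<comment> \<open>For n = 0 this is the whole ring, in accordance with the convention of
    \<open>ideal_pow_plus\<close>; it then contains the zeroth power of the difference.\<close>
  define X where "X = {x :: 'm imat. \<forall>i j. entry (alg_part x) i j \<in> ideal_pow_plus R (2 * n)}"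
  note Rr = ring_idealD[OF ring_ideal_mat_on[OF rm(3)]]
  have tr: "t (x * y) = t (y * x)" if "x \<in> X" "y \<in> mat_on R" for x y
    unfolding t_def
  proof (rule additive_map.mtrace_commute[OF additive_T that(2)])
    show "entry (alg_part x) i j \<in> ideal_pow_plus R (2 * n)" for i j using that(1) by (simp add: X_def)
  qed (rule T_R2)
  have X: "?d ^ (2 * i) * w \<in> X" "w * ?d ^ (2 * i) \<in> X" if "n \<le> i" for i w
  proof -
    have "?d ^ (2 * i) * w \<in> X \<and> w * ?d ^ (2 * i) \<in> X"
    proof (cases "n = 0")
      case True
      then show ?thesis by (simp add: X_def ideal_pow_plus_def)
    next
      case False
      have "?d ^ (2 * i) \<in> mat_on (ideal_pow R (2 * n))"
        using mat_on_power[OF rm(3) near, of "2 * i - 1"] False \<open>n \<le> i\<close>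
          mat_on_pow_le[OF rm(3), of "2 * n" "2 * i"] by simp
      then have "?d ^ (2 * i) * w \<in> mat_on (ideal_pow R (2 * n))" "w * ?d ^ (2 * i) \<in> mat_on (ideal_pow R (2 * n))"
        by (intro ring_idealD(5,6)[OF ring_ideal_mat_on[OF alg_ideal_pow[OF rm(3)]]]; simp)+
      then show ?thesis using False by (auto simp: X_def mat_on_def ideal_pow_plus_def)
    qed
    then show "?d ^ (2 * i) * w \<in> X" "w * ?d ^ (2 * i) \<in> X" by auto
  qed
  have "t (?d ^ (2 * (n + k) + 1)) = t (?d ^ (2 * n + 1))" for k
  proof (induction k)
    case (Suc k)
    have "t (?d ^ (2 * (n + k) + 3)) = t (?d ^ (2 * (n + k) + 1))"
      by (rule odd_power_step[OF ee ff tr X(1) X(2)]) (auto intro: Rr(5,6) near)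
    then show ?case using Suc by (simp add: eval_nat_numeral)
  qed simp
  \<comment> \<open>As J exceeds n, this reaches exactly the exponent 2J+1.\<close>
  from this[of "J - n"] have "t (?d ^ (2 * J + 1)) = t (?d ^ (2 * n + 1))" by (simp add: J_def)
  with has_ind_idempotents[OF ee ff] near R_sub show ?thesis by auto
qed

text \<open>Two routes from \<open>b\<close> to the scalar idempotent of \<open>aB\<close> are
  compared: one through \<open>a\<close>, by a lift of the equivalence, the other through the scalar
  idempotent of \<open>bB\<close>, by the scalar part of the equivalence. Both equivalences have
  index 0, being isomorphisms over E, and the routes agree over A, where every matrix coming from B
  reduces to its scalar part.\<close>

lemma mvn_invariance:
  assumes aB: "aB = uB * vB" "aB * aB = aB" and bB: "bB = vB * uB" "bB * bB = bB"
    and a: "a * a \<approx> a" "\<pi>E a = \<iota>E aB" "a - sM aB \<in> mat_on R"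
    and b: "b * b \<approx> b" "\<pi>E b = \<iota>E bB" "b - sM bB \<in> mat_on R"
  shows "t ((a - sM aB) ^ (2 * n + 1)) = t ((b - sM bB) ^ (2 * n + 1))"
proof -
  obtain u v where u: "\<pi>E u = \<iota>E uB" and v: "\<pi>E v = \<iota>E vB" using \<pi>E_surj by metis
  let ?s = "\<lambda>w. imat_map (\<lambda>_. 0) w :: 'a imat"
  have absorb: "aB * uB = uB * bB" "vB * aB = bB * vB" by (simp_all add: aB(1) bB(1) mult.assoc)
  have absorb': "aB * (uB * x) = uB * (bB * x)" "vB * (aB * x) = bB * (vB * x)" "aB * (aB * x) = aB * x"
    "bB * (bB * x) = bB * x" "uB * (vB * x) = aB * x" "vB * (uB * x) = bB * x" for x
    using absorb aB bB by (metis mult.assoc)+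
  have "uB * (bB * x) = aB * (uB * x)" "bB * (vB * x) = vB * (aB * x)" for x
    by (simp_all only: absorb')
  then have iso: "aB * (uB * (bB * (bB * (vB * aB)))) = aB" "bB * (vB * (aB * (aB * (uB * bB)))) = bB"
    by (simp only: absorb'(3,5) aB(2), simp only: absorb' bB(2))
  have idem: "a * (a * w) \<approx> a * w" "b * (b * w) \<approx> b * w" for w
    using approx_mult_r[OF a(1), of w] approx_mult_r[OF b(1), of w] by (simp_all add: mult.assoc)
  have "has_ind b a (a * u * b) 0"
  proof (rule has_ind_iso_mod_N[where p = "b * v * a"])
    show "b * b \<approx> b" "a * a \<approx> a" by fact+
    show "a * (a * u * b) \<approx> a * u * b" "b * (b * v * a) \<approx> b * v * a"
      using idem by (simp_all add: mult.assoc)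
    show "a * u * b * b \<approx> a * u * b" "b * v * a * a \<approx> b * v * a"
      using approx_mult_l[OF b(1), of "a * u"] approx_mult_l[OF a(1), of "b * v"] by (simp_all add: mult.assoc)
    show "\<pi>E (b * v * a * (a * u * b)) = \<pi>E b" "\<pi>E (a * u * b * (b * v * a)) = \<pi>E a"
      using iso by (simp_all add: \<pi>E_hom a(2) b(2) u v mult.assoc flip: \<iota>E_hom(3))
  qed
  moreover have inda: "has_ind a (sM aB) (sM aB * a) (t ((a - sM aB) ^ (2 * n + 1)))"
    by (rule idempotent_ind[OF a(1) _ a(3)]) (simp add: aB(2) flip: sM_hom(3))
  ultimately have 1: "has_ind b (sM aB) (sM aB * a * (a * u * b)) (0 + t ((a - sM aB) ^ (2 * n + 1)))"
    by (rule has_ind_comp)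
  have "has_ind (sM bB) (sM aB) (sM (aB * uB * bB)) 0"
    by (rule has_ind_iso_mod_N[where p = "sM (bB * vB * aB)"])
      (simp_all only: sM_hom(3)[symmetric] mult.assoc absorb'(3,4) aB(2) bB(2) iso[unfolded absorb'(3,4)] approx_refl)
  moreover have "has_ind b (sM bB) (sM bB * b) (t ((b - sM bB) ^ (2 * n + 1)))"
    by (rule idempotent_ind[OF b(1) _ b(3)]) (simp add: bB(2) flip: sM_hom(3))
  ultimately
  have 2: "has_ind b (sM aB) (sM (aB * uB * bB) * (sM bB * b)) (t ((b - sM bB) ^ (2 * n + 1)) + 0)"
    by (rule has_ind_comp[rotated])
  have A: "\<pi>A a = ?s aB" "\<pi>A b = ?s bB" "\<pi>A u = ?s uB"
    by (simp_all add: \<pi>A_\<pi>E a(2) b(2) u ea_\<iota>E)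
  have "has_ind b (sM aB) (sM (aB * uB * bB) * (sM bB * b)) (0 + t ((a - sM aB) ^ (2 * n + 1)))"
  proof (rule has_ind_perturb_\<pi>A[OF 1 has_indD(3)[OF 2] has_indD(4)[OF 2]])
    have "aB * (aB * (aB * (uB * bB))) = aB * (uB * (bB * (bB * bB)))"
      using bB(2) by (simp add: absorb')
    then show "\<pi>A (sM aB * a * (a * u * b)) = \<pi>A (sM (aB * uB * bB) * (sM bB * b))"
      by (simp add: \<pi>A_hom \<pi>A_sM A mult.assoc flip: imat_map_hom(3)[OF alg_hom_zero])
  qed
  then show ?thesis using has_ind_unique[OF 2] by simp
qed

text \<open>Adding the identity on the complement 1 - p changes neither remainder modulo
  \<open>Z\<close>, since the cross terms cancel.\<close>

lemma has_ind_stabilize: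
  assumes "has_ind p p w c"
  shows "has_ind 1 1 (1 - p + w) c"
proof -
  obtain q where fr: "fred (mat_on SI) p p w q" and c: "c = t (p - q * w) - t (p - w * q)"
    using assms by (auto simp: has_ind_def)
  have pp: "p * p \<approx> p" and pw: "p * w \<approx> w" "w * p \<approx> w" "p * q \<approx> q" "q * p \<approx> q"
    using fr by (auto simp: fred_def)
  have 1: "1 - (1 - p + x) * (1 - p + y) \<approx> p - x * y" if "p * y \<approx> y" "x * p \<approx> x" for x y
  proof -
    have "1 - (1 - p + x) * (1 - p + y) = p + (p - p * p) - (y - p * y) - (x - x * p) - x * y"
      by (simp add: algebra_simps)
    also have "\<dots> \<approx> p + (p - p) - (y - y) - (x - x) - x * y"
      by (intro approx_diff approx_add approx_refl pp that)
    finally show ?thesis by simp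
  qed
  note qw = 1[OF pw(1) pw(4)] and wq = 1[OF pw(3) pw(2)]
  have "fred (mat_on SI) 1 1 (1 - p + w) (1 - p + q)"
    using fr approx_in[OF qw S Z_sub] approx_in[OF wq S Z_sub] by (simp add: fred_def)
  then show ?thesis
    unfolding has_ind_def c using T_approx[OF qw] T_approx[OF wq] by auto
qed


text \<open>The index character of invertible matrices over A: the index of any lift to M,
  independent of the lift because two lifts differ by a matrix over R + N.\<close>

definition chi :: "'a imat \<Rightarrow> complex"
  where "chi v = (THE c. \<exists>q. \<pi>A q = v \<and> has_ind 1 1 q c)"

lemma chi_eq:
  assumes "has_ind 1 1 q c"
  shows "chi (\<pi>A q) = c"
  unfolding chi_def
proof (rule the_equality)
  show "\<exists>q'. \<pi>A q' = \<pi>A q \<and> has_ind 1 1 q' c" using assms by blast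
  fix c' assume "\<exists>q'. \<pi>A q' = \<pi>A q \<and> has_ind 1 1 q' c'"
  then obtain q' where q': "\<pi>A q' = \<pi>A q" "has_ind 1 1 q' c'" by blast
  have "has_ind 1 1 q' c" by (rule has_ind_perturb_\<pi>A[OF assms]) (simp_all add: q'(1))
  with q'(2) show "c' = c" by (rule has_ind_unique)
qed

lemma ex_chi:
  assumes "v * w = 1" "w * v = 1"
  obtains q where "\<pi>A q = v" "has_ind 1 1 q (chi v)"
proof -
  obtain q p where qp: "\<pi>A q = v" "\<pi>A p = w" using \<pi>A_surj by metis
  obtain c where c: "has_ind 1 1 q c"
    by (rule ex_has_ind[of 1 1 q p]) (use assms qp in \<open>simp_all add: \<pi>A_hom\<close>)
  with chi_eq[OF c] qp show ?thesis using that by blast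
qed

lemma chi_mult:
  assumes "v * v' = 1" "v' * v = 1" "w * w' = 1" "w' * w = 1"
  shows "chi (v * w) = chi v + chi w"
proof -
  obtain q where q: "\<pi>A q = v" "has_ind 1 1 q (chi v)" using ex_chi[OF assms(1,2)] .
  obtain r where r: "\<pi>A r = w" "has_ind 1 1 r (chi w)" using ex_chi[OF assms(3,4)] .
  from chi_eq[OF has_ind_comp[OF r(2) q(2)]] show ?thesis by (simp add: \<pi>A_hom q r)
qed

lemma chi_GL_image:
  assumes "v \<in> GL_image" "w \<in> GL_image"
  shows "chi (v * w) = chi v + chi w"
proof -
  obtain v' where "v * v' = 1" "v' * v = 1" by (rule GL_image_inverse[OF assms(1)])
  moreover obtain w' where "w * w' = 1" "w' * w = 1" by (rule GL_image_inverse[OF assms(2)])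
  ultimately show ?thesis by (rule chi_mult)
qed

lemma \<pi>A_of_mat_one: "\<pi>A (of_mat (1\<^sub>m l)) = of_mat (1\<^sub>m l)"
  unfolding \<pi>A_def by (simp add: imat_map_of_mat[OF ea_me] map_mat_unitz(4)[OF ea_me])

text \<open>The homomorphism \<open>s\<close> sends the ideal of the tensor algebra into R + N, so
  for k at least \<open>J\<close> the image of \<open>Y k\<close> is a parametrix modulo
  \<open>SI\<close> of the image of \<open>X k\<close>.\<close>

lemma odd_pairing:
  assumes s: "alg_hom s" "\<And>u. ea (me (s u)) = tensor_mult u"
    and lift: "invertible_lift l g X Y" and g: "g \<in> carrier_mat l l" and k: "J \<le> k"
  shows "t (imat_map s (of_mat (Y k)) * imat_map s (of_mat (X k))) -
    t (imat_map s (of_mat (X k)) * imat_map s (of_mat (Y k))) = - chi (stabilize g)"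
proof -
  let ?x = "imat_map s (of_mat (X k))" and ?y = "imat_map s (of_mat (Y k))" and ?I = "of_mat (1\<^sub>m l) :: 'm imat"
  have X: "X k \<in> carrier_mat l l" and Y: "Y k \<in> carrier_mat l l"
    and XY: "mat_in (ideal_pow J_tensor k) (X k * Y k - 1\<^sub>m l)" "mat_in (ideal_pow J_tensor k) (Y k * X k - 1\<^sub>m l)"
    and mX: "map_mat (unitz_map tensor_mult) (X k) = g"
  proof -
    obtain k' where "k = Suc k'" using k by (cases k) (auto simp: J_def)
    then show "map_mat (unitz_map tensor_mult) (X k) = g"
      using lift by (simp add: invertible_lift_def Let_def)
  qed (use lift in \<open>simp_all add: invertible_lift_def Let_def pro_mat_def\<close>)
  have one: "(1\<^sub>m l :: 'a tensor unitz mat) \<in> carrier_mat l l" by simp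
  have s_one: "imat_map s (of_mat (1\<^sub>m l)) = ?I" by (simp add: imat_map_of_mat[OF s(1)] map_mat_unitz(4)[OF s(1)])
  have abs: "?I * ?x = ?x" "?x * ?I = ?x" "?I * ?y = ?y" "?y * ?I = ?y" "?I * ?I = ?I"
    using of_mat_one_absorb[OF X] of_mat_one_absorb[OF Y] of_mat_one_absorb[OF one]
    by (simp_all add: s_one flip: imat_map_hom(3)[OF s(1)] s_one)
  have "s ` J_tensor \<subseteq> ideal_sum R N"
    using s(2) kernel_RN by (auto simp: J_tensor_def)
  then have sJ: "s ` ideal_pow J_tensor k \<subseteq> SI"
    using alg_hom_ideal_pow[OF s(1) _ RN_ideal, of J_tensor k] ideal_pow_antimono[OF RN_ideal k] ideal_pow_SI by blast
  have zero: "0 \<in> ideal_pow J_tensor k" by (rule alg_idealD(4)[OF alg_ideal_pow[OF alg_ideal_J_tensor]])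
  have c: "X k * Y k \<in> carrier_mat l l" "Y k * X k \<in> carrier_mat l l"
    by (rule mult_carrier_mat[OF X Y], rule mult_carrier_mat[OF Y X])
  have "imat_map s (of_mat (X k * Y k - 1\<^sub>m l)) \<in> mat_on SI" "imat_map s (of_mat (Y k * X k - 1\<^sub>m l)) \<in> mat_on SI"
    using XY imat_map_mat_on[OF s(1) _ sJ] by (simp_all add: mat_in_iff[OF zero])
  then have "?x * ?y - ?I \<in> mat_on SI" "?y * ?x - ?I \<in> mat_on SI"
    by (simp_all add: of_mat_diff[OF c(1) one] of_mat_diff[OF c(2) one] of_mat_mult[OF X Y] of_mat_mult[OF Y X]
        imat_map_hom[OF s(1)] s_one)
  then have "- (?x * ?y - ?I) \<in> mat_on SI" "- (?y * ?x - ?I) \<in> mat_on SI"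
    by (blast intro: ring_idealD(4)[OF S])+
  then have "fred (mat_on SI) ?I ?I ?x ?y" by (simp add: fred_def abs)
  then have "has_ind ?I ?I ?x (t (?I - ?y * ?x) - t (?I - ?x * ?y))" by (auto simp: has_ind_def)
  \<comment> \<open>The traces of the unit block cancel, and T(1 - yx) - T(1 - xy) becomes minus the
    trace of the commutator of y and x.\<close>
  from chi_eq[OF has_ind_stabilize[OF this]]
  have "chi (\<pi>A (1 - ?I + ?x)) = t (?x * ?y) - t (?y * ?x)" by (simp add: T_diff)
  moreover have "\<pi>A ?x = of_mat g"
  proof -
    have comp: "(ea \<circ> me) \<circ> s = tensor_mult" using s(2) by auto
    show ?thesis
      unfolding \<pi>A_def using imat_map_comp[OF ea_me s(1), unfolded comp, OF alg_hom_tensor_mult]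
      by (simp add: imat_map_of_mat[OF alg_hom_tensor_mult] mX)
  qed
  then have "\<pi>A (1 - ?I + ?x) = stabilize g"
    by (simp add: \<pi>A_hom \<pi>A_of_mat_one stabilize_eq[OF g])
  ultimately show ?thesis by simp
qed

lemma of_mat_corner:
  assumes "a \<in> carrier_mat l l" "b \<in> carrier_mat l l"
  shows "of_mat (p_mat l (l + l)) * of_mat (four_block_mat a (0\<^sub>m l l) (0\<^sub>m l l) b) * of_mat (p_mat l (l + l)) = of_mat a"
proof -
  let ?D = "four_block_mat a (0\<^sub>m l l) (0\<^sub>m l l) b" and ?p = "p_mat l (l + l)"
  have c: "?D \<in> carrier_mat (l + l) (l + l)" using assms by (intro four_block_carrier_mat)
  have "?p * ?D * ?p = four_block_mat a (0\<^sub>m l l) (0\<^sub>m l l) (0\<^sub>m l l)"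
    unfolding p_mat_four_block using assms
    by (subst mult_four_block_mat[of _ l l _ l _ l _ _ l _ l], auto)+
  moreover have "of_mat (four_block_mat a (0\<^sub>m l l) (0\<^sub>m l l) (0\<^sub>m l l)) = of_mat a"
    using assms by (intro imat_eqI) (auto simp: of_mat_parts)
  moreover have "of_mat (?p * ?D * ?p) = of_mat ?p * of_mat ?D * of_mat ?p"
    by (simp add: of_mat_mult[OF mult_carrier_mat[OF p_mat_carrier c] p_mat_carrier] of_mat_mult[OF p_mat_carrier c])
  ultimately show ?thesis by simp
qed

text \<open>The trace is the index of px, regarded as a map from \<open>x\<close> to
  \<open>p\<close>. Up to an isomorphism over E this is the corner of the inverse of G, which lifts
  the inverse of g; hence the minus sign.\<close>

lemma index_pairing:
  assumes g: "g \<in> carrier_mat l l" "g' \<in> carrier_mat l l" "g * g' = 1\<^sub>m l" "g' * g = 1\<^sub>m l"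
    and G: "G \<in> carrier_mat (l + l) (l + l)" "G' \<in> carrier_mat (l + l) (l + l)" "inverts_mat G G'"
    and mapG: "map_mat (unitz_map ea) G = four_block_mat g (0\<^sub>m l l) (0\<^sub>m l l) g'"
    and e: "map_mat (unitz_map be) e = G' * p_mat l (l + l) * G"
    and x: "x * x \<approx> x" "\<pi>E x = \<iota>E (of_mat e)" "x - of_mat (p_mat l (l + l)) \<in> mat_on R"
  shows "t ((x - of_mat (p_mat l (l + l))) ^ (2 * n + 1)) = - chi (stabilize g)"
proof -
  define p :: "'m imat" where "p = of_mat (p_mat l (l + l))"
  define pE :: "'e imat" where "pE = of_mat (p_mat l (l + l))"
  define \<Gamma> where "\<Gamma> = of_mat G"
  define \<Gamma>' where "\<Gamma>' = of_mat G'"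
  define eE where "eE = \<Gamma>' * pE * \<Gamma>"
  have pE: "\<pi>E p = pE" by (simp add: \<pi>E_def p_def pE_def imat_map_of_mat[OF me(1)] map_mat_p_mat[OF me(1)])
  have pp: "p * p = p" and ppE: "pE * pE = pE"
    by (simp_all add: p_def pE_def p_mat_idempotent flip: of_mat_mult[OF p_mat_carrier p_mat_carrier])
  have xE: "\<pi>E x = eE"
    unfolding x(2) \<iota>E_def imat_map_of_mat[OF be(1)] e eE_def \<Gamma>_def \<Gamma>'_def pE_def
    by (simp add: of_mat_mult[OF mult_carrier_mat[OF G(2) p_mat_carrier] G(1)] of_mat_mult[OF G(2) p_mat_carrier])
  have \<Gamma>\<Gamma>': "pE * (\<Gamma> * \<Gamma>') = pE"
  proof -
    have "G * G' = 1\<^sub>m (l + l)" using G by (simp add: inverts_mat_def)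
    then have "\<Gamma> * \<Gamma>' = of_mat (1\<^sub>m (l + l))" by (simp add: \<Gamma>_def \<Gamma>'_def flip: of_mat_mult[OF G(1,2)])
    then show ?thesis by (simp add: pE_def of_mat_one_absorb[OF p_mat_carrier])
  qed
  have \<Gamma>\<Gamma>'2: "pE * (\<Gamma> * (\<Gamma>' * y)) = pE * y" "pE * (pE * y) = pE * y" for y
    using \<Gamma>\<Gamma>' ppE by (simp_all flip: mult.assoc)
  obtain h h' where h: "\<pi>E h = \<Gamma>" "\<pi>E h' = \<Gamma>'" using \<pi>E_surj by metis
  have xx: "x * (x * y) \<approx> x * y" for y using approx_mult_r[OF x(1), of y] by (simp add: mult.assoc)
  have pp2: "p * (p * y) = p * y" for y using pp by (simp flip: mult.assoc)
  \<comment> \<open>Over E this is G as a map from the image of the conjugated idempotent to that of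
    p_N, with inverse induced by the inverse of G.\<close>
  have iso: "has_ind x p (p * h * x) 0"
  proof (rule has_ind_iso_mod_N[where p = "x * h' * p"])
    show "p * h * x * x \<approx> p * h * x" using approx_mult_l[OF x(1), of "p * h"] by (simp add: mult.assoc)
    show "x * (x * h' * p) \<approx> x * h' * p" using xx by (simp add: mult.assoc)
    show "\<pi>E (x * h' * p * (p * h * x)) = \<pi>E x" "\<pi>E (p * h * x * (x * h' * p)) = \<pi>E p"
      by (simp_all add: \<pi>E_hom xE pE h eE_def mult.assoc \<Gamma>\<Gamma>' \<Gamma>\<Gamma>'2 ppE)
  qed (use x in \<open>simp_all add: pp pp2 mult.assoc\<close>)
  have cornerA: "imat_map ea (pE * \<Gamma> * pE) = of_mat g" "imat_map ea (pE * \<Gamma>' * pE) = of_mat g'"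
  proof -
    have mapG': "map_mat (unitz_map ea) G' = four_block_mat g' (0\<^sub>m l l) (0\<^sub>m l l) g"
      by (rule map_index_inverse[OF ea(1) G g(1,2,4,3) mapG])
    show "imat_map ea (pE * \<Gamma> * pE) = of_mat g" "imat_map ea (pE * \<Gamma>' * pE) = of_mat g'"
      by (simp_all add: imat_map_hom[OF ea(1)] pE_def \<Gamma>_def \<Gamma>'_def imat_map_of_mat[OF ea(1)] mapG mapG'
          map_mat_p_mat[OF ea(1)] of_mat_corner[OF g(1,2)] of_mat_corner[OF g(2,1)])
  qed
  \<comment> \<open>The upper left corners of the lifts of G and of its inverse; over A they become
    g and its inverse.\<close>
  let ?w = "p * h * p" and ?w' = "p * h' * p"
  have A: "\<pi>A ?w = of_mat g" "\<pi>A ?w' = of_mat g'" "\<pi>A p = of_mat (1\<^sub>m l)"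
    using cornerA by (simp_all add: \<pi>A_\<pi>E \<pi>E_hom pE h) (simp add: pE_def imat_map_of_mat[OF ea(1)]
        map_mat_p_mat[OF ea(1)] of_mat_p_mat map_mat_unitz(4)[OF ea(1)])
  have gg: "of_mat g * of_mat g' = of_mat (1\<^sub>m l)" "of_mat g' * of_mat g = of_mat (1\<^sub>m l)"
    by (simp_all add: g flip: of_mat_mult[OF g(1,2)] of_mat_mult[OF g(2,1)])
  have wp: "p * ?w \<approx> ?w" "?w * p \<approx> ?w" "p * ?w' \<approx> ?w'" "?w' * p \<approx> ?w'" "p * p \<approx> p"
    by (simp_all add: pp pp2 mult.assoc)
  have ww: "\<pi>A (?w * ?w') = \<pi>A p" "\<pi>A (?w' * ?w) = \<pi>A p" by (simp_all add: \<pi>A_hom(3)[of ?w ?w'] \<pi>A_hom(3)[of ?w' ?w] A gg)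
  obtain c where c: "has_ind p p ?w c"
    by (rule ex_has_ind[OF wp(5,5,1,2,3,4) ww(2,1)])
  obtain c' where c': "has_ind p p ?w' c'"
    by (rule ex_has_ind[OF wp(5,5,3,4,1,2) ww(1,2)])
  have "has_ind p p p 0"
    by (rule has_ind_near_one[OF wp(5,5,5)]) (simp add: ring_idealD(1)[OF I])
  moreover have "has_ind p p p (c + c')"
    by (rule has_ind_perturb_\<pi>A[OF has_ind_comp[OF c c'] wp(5,5)]) (rule ww)
  ultimately have cc': "c + c' = 0" using has_ind_unique by blast
  have "has_ind x p (p * x) (t ((x - p) ^ (2 * n + 1)))"
    by (rule idempotent_ind[OF x(1) wp(5)]) (use x(3) in \<open>simp add: p_def\<close>)
  \<comment> \<open>With e the conjugate of p by G, the composite over E is p G' p G e = p e e = p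
    e, which is also the image of px.\<close>
  moreover have "has_ind x p (p * x) (0 + c')"
  proof (rule has_ind_perturb_\<pi>A[OF has_ind_comp[OF iso c']])
    show "p * (p * x) \<approx> p * x" "p * x * x \<approx> p * x"
      using approx_mult_l[OF x(1), of p] by (simp_all add: pp2 mult.assoc)
    show "\<pi>A (?w' * (p * h * x)) = \<pi>A (p * x)"
      by (rule \<pi>E_eq_imp_\<pi>A_eq) (simp add: \<pi>E_hom xE pE h eE_def mult.assoc \<Gamma>\<Gamma>' \<Gamma>\<Gamma>'2 ppE)
  qed
  ultimately have "t ((x - p) ^ (2 * n + 1)) = c'" using has_ind_unique by fastforce
  moreover have "chi (stabilize g) = c"
    using chi_eq[OF has_ind_stabilize[OF c]] by (simp add: \<pi>A_hom(1,2,5) A stabilize_eq[OF g(1)])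
  ultimately show ?thesis using cc' by (simp add: p_def add_eq_0_iff)
qed

end

section \<open>Invariance under equivalence of idempotents\<close>

definition dsum :: "'x::zero mat \<Rightarrow> 'x mat \<Rightarrow> 'x mat"
  where "dsum A B = four_block_mat A (0\<^sub>m (dim_row A) (dim_col B)) (0\<^sub>m (dim_row B) (dim_col A)) B"

lemma diag_block_dsum: "diag_block_mat [A, B, C] = dsum A (dsum B C)"
proof -
  have "diag_block_mat [B, C] = dsum B C"
    by (simp only: diag_block_mat.simps(2)[of B "[C]"] diag_block_mat_singleton Let_def dsum_def)
  then show ?thesis
    by (simp only: diag_block_mat.simps(2)[of A "[B, C]"] Let_def dsum_def)
qed

lemma dsum_carrier [intro]: "A \<in> carrier_mat a a \<Longrightarrow> B \<in> carrier_mat b b \<Longrightarrow> dsum A B \<in> carrier_mat (a + b) (a + b)"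
  unfolding dsum_def by (rule four_block_carrier_mat)

lemma map_dsum: "f 0 = 0 \<Longrightarrow> map_mat f (dsum A B) = dsum (map_mat f A) (map_mat f B)"
  by (rule eq_matI) (auto simp: dsum_def)

lemma dsum_mult:
  fixes A B :: "'x::semiring_1 mat"
  assumes "A \<in> carrier_mat a a" "A' \<in> carrier_mat a a" "B \<in> carrier_mat b b" "B' \<in> carrier_mat b b"
  shows "dsum A B * dsum A' B' = dsum (A * A') (B * B')"
  unfolding dsum_def using assms by (subst mult_four_block_mat[of _ a a _ b _ b _ _ a _ b]) auto

lemma dsum_diff:
  fixes A B :: "'x::group_add mat"
  assumes "A \<in> carrier_mat a a" "A' \<in> carrier_mat a a" "B \<in> carrier_mat b b" "B' \<in> carrier_mat b b"
  shows "dsum A B - dsum A' B' = dsum (A - A') (B - B')"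
  by (rule eq_matI) (use assms in \<open>auto simp: dsum_def\<close>)

lemma dsum_power:
  fixes A B :: "'x::semiring_1 mat"
  assumes "A \<in> carrier_mat a a" "B \<in> carrier_mat b b"
  shows "dsum A B ^\<^sub>m k = dsum (A ^\<^sub>m k) (B ^\<^sub>m k)"
  using pow_four_block_mat[OF assms, of k] assms pow_carrier_mat[OF assms(1), of k] pow_carrier_mat[OF assms(2), of k]
  by (simp add: dsum_def)

lemma of_mat_dsum_mat_on:
  assumes "0 \<in> C" "of_mat A \<in> mat_on C" "of_mat B \<in> mat_on C"
  shows "of_mat (dsum A B) \<in> mat_on C"
proof -
  have A: "A $$ (i, j) \<in> of_alg ` C" if "i < dim_row A" "j < dim_col A" for i j
    using assms(2) that of_mat_parts(1)[of A i j] by (simp add: mat_on_def) metis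
  have B: "B $$ (i, j) \<in> of_alg ` C" if "i < dim_row B" "j < dim_col B" for i j
    using assms(3) that of_mat_parts(1)[of B i j] by (simp add: mat_on_def) metis
  have "(0 :: 'a unitz) \<in> of_alg ` C" using assms(1) by (simp add: of_alg_image_iff unitz_simps)
  then show ?thesis
    using A B by (auto simp: mat_on_def of_mat_parts dsum_def)
qed

lemma mtrace_dsum:
  assumes "A \<in> carrier_mat a a" "B \<in> carrier_mat b b" "T 0 = 0"
  shows "mtrace T (of_mat (dsum A B)) = mtrace T (of_mat A) + mtrace T (of_mat B)"
proof -
  have split: "(\<Sum>i<a + b. h i) = (\<Sum>i<a. h i) + (\<Sum>i<b. h (a + i))" for h :: "nat \<Rightarrow> 'b"
    by (induction b) (simp_all add: add.assoc)
  show ?thesis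
    using assms mtrace_of_mat[of "dsum A B" "a + b" T] mtrace_of_mat[of A a T] mtrace_of_mat[of B b T]
    by (simp add: split dsum_carrier) (simp add: dsum_def)
qed

lemma imat_map_zero:
  assumes "alg_hom f"
  shows "imat_map (\<lambda>_. 0) (imat_map f w) = imat_map (\<lambda>_. 0) w" "imat_map f (imat_map (\<lambda>_. 0) v) = imat_map (\<lambda>_. 0) v"
  by (rule imat_eqI; simp add: alg_part_imat_map[OF assms] alg_part_imat_map[OF alg_hom_zero] unitz_map_def
      alg_homD(4)[OF assms])+

context lifted_extension
begin

lemma sM_cong: "w - w' \<in> mat_on UNIV \<Longrightarrow> sM w = sM w'"
  unfolding sM_def using imat_map_eq_iff[OF alg_hom_zero, of w w'] by simp

lemma sM_of_mat: "sM (of_mat X) = of_mat (map_mat (unitz_map (\<lambda>_. 0)) X)"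
  unfolding sM_def by (rule imat_map_of_mat[OF alg_hom_zero])

lemma sM_of_mat_p_mat:
  assumes "e \<in> carrier_mat k k" "mat_in UNIV (e - p_mat l k)"
  shows "sM (of_mat e) = of_mat (p_mat l k)"
proof -
  have "sM (of_mat e) = sM (of_mat (p_mat l k))"
    using assms by (intro sM_cong) (simp add: mat_in_iff of_mat_diff[OF assms(1) p_mat_carrier])
  also have "\<dots> = of_mat (p_mat l k)" by (simp add: sM_of_mat map_mat_p_mat[OF alg_hom_zero])
  finally show ?thesis .
qed

end

context renormalized
begin

text \<open>A single stage of an \<open>idempotent_lift\<close>, transported to M. One stage is
  enough, since \<open>T\<close> does not see matrices over N^K.\<close>

definition lifts :: "nat \<Rightarrow> 'b unitz mat \<Rightarrow> 'm unitz mat \<Rightarrow> bool"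
  where "lifts k e X \<longleftrightarrow> e \<in> carrier_mat k k \<and> X \<in> carrier_mat k k \<and> of_mat X * of_mat X \<approx> of_mat X \<and>
    \<pi>E (of_mat X) = \<iota>E (of_mat e) \<and> of_mat X - sM (of_mat e) \<in> mat_on R"

text \<open>The subtracted idempotent is the scalar part of \<open>e\<close> and not some
  \<open>p_mat\<close>, because the complement in the relation defining K_0 is an arbitrary
  idempotent.\<close>

definition pairing :: "'b unitz mat \<Rightarrow> 'm unitz mat \<Rightarrow> complex"
  where "pairing e X = t ((of_mat X - sM (of_mat e)) ^ (2 * n + 1))"

lemma lifts_dsum:
  assumes "lifts k e X" "lifts l f Y"
  shows "lifts (k + l) (dsum e f) (dsum X Y)" "pairing (dsum e f) (dsum X Y) = pairing e X + pairing f Y"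
proof -
  let ?s = "map_mat (unitz_map (\<lambda>_. 0)) :: 'b unitz mat \<Rightarrow> 'm unitz mat"
  have c: "e \<in> carrier_mat k k" "X \<in> carrier_mat k k" "f \<in> carrier_mat l l" "Y \<in> carrier_mat l l"
    using assms by (auto simp: lifts_def)
  have s_dsum: "?s (dsum e f) = dsum (?s e) (?s f)" by (rule map_dsum) (simp add: unitz_map_hom[OF alg_hom_zero])
  have sc: "?s e \<in> carrier_mat k k" "?s f \<in> carrier_mat l l" using c by auto
  have dc: "X - ?s e \<in> carrier_mat k k" "Y - ?s f \<in> carrier_mat l l" using c sc by (auto intro: minus_carrier_mat)
  have diff: "of_mat (dsum X Y) - sM (of_mat (dsum e f)) = of_mat (dsum (X - ?s e) (Y - ?s f))"
    by (simp add: sM_of_mat s_dsum dsum_diff[OF c(2) sc(1) c(4) sc(2)]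
        flip: of_mat_diff[OF dsum_carrier[OF c(2,4)] dsum_carrier[OF sc]])
  have d: "of_mat X - sM (of_mat e) = of_mat (X - ?s e)" "of_mat Y - sM (of_mat f) = of_mat (Y - ?s f)"
    by (simp_all add: sM_of_mat of_mat_diff[OF c(2) sc(1)] of_mat_diff[OF c(4) sc(2)])
  have "of_mat (dsum X Y) * of_mat (dsum X Y) \<approx> of_mat (dsum X Y)"
  proof -
    have sq: "X * X \<in> carrier_mat k k" "Y * Y \<in> carrier_mat l l" using c by auto
    have "of_mat (dsum X Y) * of_mat (dsum X Y) - of_mat (dsum X Y) = of_mat (dsum (X * X - X) (Y * Y - Y))"
      by (simp add: dsum_mult[OF c(2,2,4,4)] dsum_diff[OF sq(1) c(2) sq(2) c(4), symmetric]
          of_mat_diff[OF dsum_carrier[OF sq] dsum_carrier[OF c(2,4)]]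
          flip: of_mat_mult[OF dsum_carrier[OF c(2,4)] dsum_carrier[OF c(2,4)]])
    also have "\<dots> \<in> mat_on (ideal_pow N K)"
      using assms alg_idealD(4)[OF alg_ideal_pow[OF N_ideal]]
      by (intro of_mat_dsum_mat_on)
        (simp_all add: lifts_def approx_def of_mat_diff[OF sq(1) c(2)] of_mat_diff[OF sq(2) c(4)]
          of_mat_mult[OF c(2,2)] of_mat_mult[OF c(4,4)])
    finally show ?thesis by (simp add: approx_def)
  qed
  moreover have "\<pi>E (of_mat (dsum X Y)) = \<iota>E (of_mat (dsum e f))"
  proof -
    have "map_mat (unitz_map me) X = map_mat (unitz_map be) e" "map_mat (unitz_map me) Y = map_mat (unitz_map be) f"
      using assms c
      by (auto intro!: of_mat_inject simp: lifts_def \<pi>E_def \<iota>E_def imat_map_of_mat[OF me(1)] imat_map_of_mat[OF be(1)])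
    then show ?thesis
      by (simp add: \<pi>E_def \<iota>E_def imat_map_of_mat[OF me(1)] imat_map_of_mat[OF be(1)] map_dsum
          unitz_map_hom[OF me(1)] unitz_map_hom[OF be(1)])
  qed
  moreover have "of_mat (dsum X Y) - sM (of_mat (dsum e f)) \<in> mat_on R"
    unfolding diff using assms alg_idealD(4)[OF rm(3)]
    by (intro of_mat_dsum_mat_on) (simp_all add: lifts_def d)
  ultimately show "lifts (k + l) (dsum e f) (dsum X Y)" using c by (auto simp: lifts_def)
  have "pairing (dsum e f) (dsum X Y) = t (of_mat (dsum (X - ?s e) (Y - ?s f) ^\<^sub>m (Suc (2 * n))))"
    by (simp only: pairing_def diff of_mat_power[OF dsum_carrier[OF dc]] Suc_eq_plus1[symmetric])
  also have "\<dots> = t (of_mat ((X - ?s e) ^\<^sub>m (Suc (2 * n)))) + t (of_mat ((Y - ?s f) ^\<^sub>m (Suc (2 * n))))"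
    unfolding dsum_power[OF dc] t_def
    by (rule mtrace_dsum[OF pow_carrier_mat[OF dc(1)] pow_carrier_mat[OF dc(2)]]) (rule clinear_functionalD(3)[OF T_lin])
  also have "\<dots> = pairing e X + pairing f Y"
    by (simp only: pairing_def d of_mat_power[OF dc(1)] of_mat_power[OF dc(2)] Suc_eq_plus1[symmetric])
  finally show "pairing (dsum e f) (dsum X Y) = pairing e X + pairing f Y" .
qed

lemma lifts_p_mat:
  assumes "l \<le> k"
  shows "lifts k (p_mat l k) (p_mat l k)" "pairing (p_mat l k) (p_mat l k) = 0"
proof -
  have s: "sM (of_mat (p_mat l k)) = of_mat (p_mat l k)" by (simp add: sM_of_mat map_mat_p_mat[OF alg_hom_zero])
  show "lifts k (p_mat l k) (p_mat l k)"
    unfolding lifts_def s \<pi>E_def \<iota>E_def imat_map_of_mat[OF me(1)] imat_map_of_mat[OF be(1)]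
      map_mat_p_mat[OF me(1)] map_mat_p_mat[OF be(1)]
    by (simp add: p_mat_carrier p_mat_idempotent[OF assms] ring_idealD(1)[OF ring_ideal_mat_on[OF rm(3)]]
        flip: of_mat_mult[OF p_mat_carrier p_mat_carrier])
  show "pairing (p_mat l k) (p_mat l k) = 0" by (simp add: pairing_def s T_zero)
qed

lemma idempotent_lift_lifts:
  assumes X: "idempotent_lift rm rb N k e X" and e: "e \<in> carrier_mat k k" and i: "K \<le> i"
  shows "lifts k e (map_mat (unitz_map rm) (X i))"
proof -
  obtain i' where i': "i = Suc i'" using i K_pos by (cases i) auto
  define I where "I = rm -` ideal_pow N i"
  have Xc: "X i \<in> carrier_mat k k" and sq: "mat_in I (X i * X i - X i)" and mX: "map_mat (unitz_map rb) (X i) = e"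
    using X by (auto simp: idempotent_lift_def pro_mat_def Let_def i' I_def simp del: ideal_pow.simps)
  have zero: "0 \<in> I" by (simp add: I_def alg_homD(4)[OF rm(1)] alg_idealD(4)[OF alg_ideal_pow[OF N_ideal]])
  have XX: "X i * X i \<in> carrier_mat k k" using Xc by auto
  let ?x = "imat_map rm (of_mat (X i))"
  have eq: "of_mat (map_mat (unitz_map rm) (X i)) = ?x" by (simp add: imat_map_of_mat[OF rm(1)])
  have "imat_map rm (of_mat (X i * X i - X i)) \<in> mat_on (ideal_pow N i)"
    using sq[unfolded mat_in_iff[OF zero]] by (intro imat_map_mat_on[OF rm(1), of _ I]) (auto simp: I_def)
  then have "?x * ?x - ?x \<in> mat_on (ideal_pow N i)"
    by (simp add: of_mat_diff[OF XX Xc] of_mat_mult[OF Xc Xc] imat_map_hom[OF rm(1)])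
  then have "?x * ?x \<approx> ?x"
    using mat_on_pow_le[OF N_ideal i] by (simp add: approx_def)
  moreover have "\<pi>E ?x = \<iota>E (of_mat e)"
  proof -
    have comp: "me \<circ> rm = be \<circ> rb" using square by auto
    have "\<pi>E ?x = imat_map (me \<circ> rm) (of_mat (X i))"
      unfolding \<pi>E_def by (rule imat_map_comp[OF me(1) rm(1) alg_hom_comp[OF rm(1) me(1)]])
    also have "\<dots> = \<iota>E (imat_map rb (of_mat (X i)))"
      unfolding \<iota>E_def comp by (rule imat_map_comp[OF be(1) rb(1) alg_hom_comp[OF rb(1) be(1)], symmetric])
    finally show ?thesis by (simp add: imat_map_of_mat[OF rb(1)] mX)
  qed
  moreover have "?x - sM (of_mat e) \<in> mat_on R"
  proof -
    \<comment> \<open>The map \<open>rb\<close> preserves scalar parts, so \<open>X i\<close> and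
      \<open>e\<close> have the same scalar matrix; what is left after subtracting it has entries
      coming from R.\<close>
    have 1: "imat_map (\<lambda>_. 0) (of_mat (X i)) = (imat_map (\<lambda>_::'b. 0::'r) (of_mat e))"
      by (simp add: imat_map_zero(1)[OF rb(1), of "of_mat (X i)", symmetric] imat_map_of_mat[OF rb(1)] mX)
    have "imat_map rm (imat_map (\<lambda>_::'b. 0::'r) (of_mat e)) = sM (of_mat e)"
      unfolding sM_def by (rule imat_map_zero(2)[OF rm(1)])
    then have "?x - sM (of_mat e) = imat_map rm (of_mat (X i) - imat_map (\<lambda>_::'r. 0::'r) (of_mat (X i)))"
      by (simp add: 1 imat_map_hom[OF rm(1)])
    also have "\<dots> \<in> mat_on R"
    proof (rule imat_map_mat_on[OF rm(1)])
      show "of_mat (X i) - imat_map (\<lambda>_::'r. 0::'r) (of_mat (X i)) \<in> mat_on UNIV"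
        by (auto simp: mat_on_def unitz_simps entry_simps alg_part_imat_map[OF alg_hom_zero] of_alg_image_iff
            unitz_map_def)
    qed simp
    finally show ?thesis .
  qed
  ultimately show ?thesis using Xc e by (simp add: lifts_def eq)
qed

lemma even_trace_pairing:
  assumes Xc: "X \<in> carrier_mat k k" and e: "e \<in> carrier_mat k k" "mat_in UNIV (e - p_mat l k)"
  shows "even_trace (T \<circ> rm) ((X - p_mat l k) ^\<^sub>m (2 * n + 1)) = pairing e (map_mat (unitz_map rm) X)"
proof -
  have c: "X - p_mat l k \<in> carrier_mat k k" using Xc p_mat_carrier by (intro minus_carrier_mat)
  have T0: "T 0 = 0" by (rule clinear_functionalD(3)[OF T_lin])
  have "even_trace (T \<circ> rm) ((X - p_mat l k) ^\<^sub>m (2 * n + 1)) = mtrace (T \<circ> rm) (of_mat ((X - p_mat l k) ^\<^sub>m (2 * n + 1)))"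
    by (rule even_trace_of_mat[OF pow_carrier_mat[OF c]]) (simp add: alg_homD(4)[OF rm(1)] T0)
  also have "\<dots> = t (imat_map rm (of_mat ((X - p_mat l k) ^\<^sub>m Suc (2 * n))))"
    by (simp add: mtrace_imat_map[where T = T, OF rm(1) T0] t_def)
  also have "\<dots> = t ((of_mat (map_mat (unitz_map rm) X) - of_mat (p_mat l k)) ^ (2 * n + 1))"
    unfolding of_mat_power[OF c] imat_map_hom(6)[OF rm(1)] of_mat_diff[OF Xc p_mat_carrier] imat_map_hom(2)[OF rm(1)]
      imat_map_of_mat[OF rm(1)] map_mat_p_mat[OF rm(1)] by simp
  finally show ?thesis by (simp add: pairing_def sM_of_mat_p_mat[OF e])
qed

text \<open>The relation yields an equivalence between e0 + p1 + h and e1 + p0 + h as block sums.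
  The pairing is additive, invariant under equivalence and zero on the standard projections, and the
  contribution of \<open>h\<close> cancels; for this \<open>h\<close> needs some lift, which is what
  the last hypothesis provides.\<close>

lemma K0_invariance:
  assumes rel: "((e\<^sub>0, p_mat l\<^sub>0 k\<^sub>0), (e\<^sub>1, p_mat l\<^sub>1 k\<^sub>1)) \<in> K0_rel" and l: "l\<^sub>0 \<le> k\<^sub>0" "l\<^sub>1 \<le> k\<^sub>1"
    and X: "lifts k\<^sub>0 e\<^sub>0 X\<^sub>0" "lifts k\<^sub>1 e\<^sub>1 X\<^sub>1"
    and ex: "\<And>k h. h \<in> carrier_mat k k \<Longrightarrow> h * h = h \<Longrightarrow> \<exists>H. lifts k h H"
  shows "pairing e\<^sub>0 X\<^sub>0 = pairing e\<^sub>1 X\<^sub>1"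
proof -
  obtain h where idem: "e\<^sub>0 \<in> idempotents" "e\<^sub>1 \<in> idempotents" "h \<in> idempotents"
    and mvn: "mvn_equiv (diag_block_mat [e\<^sub>0, p_mat l\<^sub>1 k\<^sub>1, h]) (diag_block_mat [e\<^sub>1, p_mat l\<^sub>0 k\<^sub>0, h])"
    using rel by (auto simp: K0_rel_def simp del: diag_block_mat.simps)
  define k where "k = dim_row h"
  have hc: "h \<in> carrier_mat k k" and hh: "h * h = h" using idem(3) by (auto simp: idempotents_def k_def)
  have ec: "e\<^sub>0 \<in> carrier_mat k\<^sub>0 k\<^sub>0" "e\<^sub>1 \<in> carrier_mat k\<^sub>1 k\<^sub>1" "e\<^sub>0 * e\<^sub>0 = e\<^sub>0" "e\<^sub>1 * e\<^sub>1 = e\<^sub>1"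
    using X idem by (auto simp: lifts_def idempotents_def)
  obtain H where H: "lifts k h H" using ex[OF hc hh] by blast
  let ?A = "dsum e\<^sub>0 (dsum (p_mat l\<^sub>1 k\<^sub>1) h)" and ?B = "dsum e\<^sub>1 (dsum (p_mat l\<^sub>0 k\<^sub>0) h)"
  let ?XA = "dsum X\<^sub>0 (dsum (p_mat l\<^sub>1 k\<^sub>1) H)" and ?XB = "dsum X\<^sub>1 (dsum (p_mat l\<^sub>0 k\<^sub>0) H)"
  note LA' = lifts_dsum[OF lifts_p_mat(1)[OF l(2)] H] and LB' = lifts_dsum[OF lifts_p_mat(1)[OF l(1)] H]
  note LA = lifts_dsum[OF X(1) LA'(1)] and LB = lifts_dsum[OF X(2) LB'(1)]
  have Ac: "?A \<in> carrier_mat (k\<^sub>0 + (k\<^sub>1 + k)) (k\<^sub>0 + (k\<^sub>1 + k))" and Bc: "?B \<in> carrier_mat (k\<^sub>1 + (k\<^sub>0 + k)) (k\<^sub>1 + (k\<^sub>0 + k))"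
    using LA(1) LB(1) by (auto simp: lifts_def)
  obtain u v where u: "u \<in> carrier_mat (k\<^sub>0 + (k\<^sub>1 + k)) (k\<^sub>1 + (k\<^sub>0 + k))"
    and v: "v \<in> carrier_mat (k\<^sub>1 + (k\<^sub>0 + k)) (k\<^sub>0 + (k\<^sub>1 + k))" and uv: "u * v = ?A" "v * u = ?B"
    using mvn Ac Bc unfolding mvn_equiv_def diag_block_dsum by auto
  have AA: "?A * ?A = ?A" "?B * ?B = ?B"
  proof -
    note pc = p_mat_carrier[where 'a = 'b]
    show "?A * ?A = ?A"
      unfolding dsum_mult[OF ec(1,1) dsum_carrier[OF pc hc] dsum_carrier[OF pc hc]] dsum_mult[OF pc pc hc hc]
        ec(3) hh p_mat_idempotent[OF l(2)] ..
    show "?B * ?B = ?B"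
      unfolding dsum_mult[OF ec(2,2) dsum_carrier[OF pc hc] dsum_carrier[OF pc hc]] dsum_mult[OF pc pc hc hc]
        ec(4) hh p_mat_idempotent[OF l(1)] ..
  qed
  have "pairing ?A ?XA = pairing ?B ?XB"
    unfolding pairing_def
  proof (rule mvn_invariance[where uB = "of_mat u" and vB = "of_mat v"])
    show "of_mat ?A = of_mat u * of_mat v" by (simp add: uv flip: of_mat_mult[OF u v])
    show "of_mat ?B = of_mat v * of_mat u" by (simp add: uv flip: of_mat_mult[OF v u])
    show "of_mat ?A * of_mat ?A = of_mat ?A" by (simp add: AA flip: of_mat_mult[OF Ac Ac])
    show "of_mat ?B * of_mat ?B = of_mat ?B" by (simp add: AA flip: of_mat_mult[OF Bc Bc])
  qed (use LA(1) LB(1) in \<open>auto simp: lifts_def\<close>)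
  then show ?thesis
    by (simp add: LA(2) LB(2) LA'(2) LB'(2) lifts_p_mat(2)[OF l(1)] lifts_p_mat(2)[OF l(2)])
qed

end

section \<open>Cocycles and their renormalizations\<close>

lemma lifting_lifted_extension:
  assumes "lifting jn nq rm mp be ea jr rb nm me qp pa"
  shows "lifted_extension be ea rm rb me (range nm)"
proof -
  have e: "extension rm mp" "extension be ea" "extension jr rb" "extension nm me" and sq: "me \<circ> rm = be \<circ> rb"
    using assms by (auto simp: lifting_def)
  show ?thesis
    using extension_ideal[OF e(1)] extension_ideal[OF e(3)] extension_ideal[OF e(4)] e(2) fun_cong[OF sq]
    by unfold_locales auto
qed

lemma even_cocycle_mono:
  assumes "alg_ideal R" "m \<le> m'" "even_cocycle R F m \<tau>"
  shows "even_cocycle R F m' \<tau>"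
  using assms(3) F_even_antimono[OF assms(1,2)] F_odd_antimono[OF assms(1,2)]
  unfolding even_cocycle_def cochain_def by (meson IntD1 IntD2 IntI subsetD)

text \<open>\<open>E_star\<close> admits cocycles over any step of the filtration, the even pairing
  only those of degree 4n+1; restriction to a deeper step keeps the class and the same comparison
  data.\<close>

lemma represents_mono:
  assumes ea: "alg_hom ea" and R: "alg_ideal R" and m: "m \<le> m'" and rep: "represents be ea R N me m \<tau> \<beta>"
  shows "represents be ea R N me m' \<tau> \<beta>"
proof -
  have L: "alg_ideal (T_ker ea)" by (rule alg_ideal_T_ker[OF ea])
  obtain \<rho> \<psi> \<theta> where r: "1 \<le> m" "even_cocycle R N m \<tau>" "\<beta> \<in> HP0" "classifying_hom ea R me \<rho>"
    "even_cocycle (T_ker ea) J_tensor 1 \<psi>" "cochain (F_odd (T_ker ea) m) (F_odd J_tensor) \<theta>"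
    "\<forall>x\<in>F_even (T_ker ea) m. \<tau> (\<rho> x) - \<psi> x = \<theta> (nat_d x)" "(\<lambda>t. \<psi> (tensor_map be t)) \<in> \<beta>"
    using rep unfolding represents_def by blast
  have "cochain (F_odd (T_ker ea) m') (F_odd J_tensor) \<theta>"
    using r(6) F_odd_antimono[OF L m] unfolding cochain_def by (meson IntD1 IntD2 IntI subsetD)
  moreover have "\<forall>x\<in>F_even (T_ker ea) m'. \<tau> (\<rho> x) - \<psi> x = \<theta> (nat_d x)"
    using r(7) F_even_antimono[OF L m] by blast
  moreover have "1 \<le> m'" using r(1) m by simp
  ultimately show ?thesis
    using r(3,4,5,8) even_cocycle_mono[OF R m r(2)] unfolding represents_def by blast
qed

lemma F_even_odd_degree: "F_even R (4 * n + 1) = ideal_pow R (2 * n + 1)"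
proof -
  have "(4 * n + 1) div 2 = 2 * n" by simp
  then show ?thesis by (simp add: F_even_def Let_def del: ideal_pow.simps)
qed

lemma F_odd_odd_degree:
  "F_odd R (4 * n + 1) = cvec.span (nat_forms_on (ideal_pow_plus R (2 * n + 1)) UNIV \<union> nat_forms_on (ideal_pow_plus R (2 * n)) R)"
proof -
  have "(4 * n + 1) div 2 = 2 * n" by simp
  then show ?thesis by (simp add: F_odd_def Let_def)
qed

context lifted_extension
begin

lemma ex_renormalization:
  assumes "even_cocycle R N m \<tau>"
  obtains T where "renormalization R N m \<tau> T"
proof -
  have "cochain (F_even R m) (F_even N) \<tau>" using assms by (simp add: even_cocycle_def)
  then obtain T where "cochain UNIV (F_even N) T" "\<And>x. x \<in> F_even R m \<Longrightarrow> T x = \<tau> x"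
    by (rule extend_cochain[OF _ subspace_F_even[OF rm(3)] subspace_F_even[OF N_ideal]]) (rule that)
  then show ?thesis by (intro that[of T]) (simp add: renormalization_def)
qed

text \<open>If u dy lies in F^(4n+1) and both products of u and y in R^(2n+1), where
  \<open>T\<close> and \<open>\<tau>\<close> agree, then T([u, y]) is \<open>\<tau>\<close> of the
  boundary of u dy and vanishes. Coefficients in R^(2n+1), respectively coefficients in R^(2n) with
  y in R, give the two trace identities.\<close>

lemma renormalized_intro:
  assumes co: "even_cocycle R N (4 * n + 1) \<tau>" and ren: "renormalization R N (4 * n + 1) \<tau> T"
  obtains K where "renormalized be ea rm rb me N n K T"
proof -
  obtain k where T: "clinear T" and k: "\<And>x. x \<in> F_even N k \<Longrightarrow> T x = 0"
    using ren by (auto simp: renormalization_def cochain_UNIV)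
  have T\<tau>: "T x = \<tau> x" if "x \<in> ideal_pow R (2 * n + 1)" for x
    using ren that unfolding renormalization_def F_even_odd_degree by blast
  have \<tau>b: "\<tau> (b_bar \<omega>) = 0" if "\<omega> \<in> F_odd R (4 * n + 1)" for \<omega>
    using co that unfolding even_cocycle_def by blast
  note P = alg_idealD[OF alg_ideal_pow[OF rm(3)]]
  have tr: "T (alg_part (u * of_alg y)) = T (alg_part (of_alg y * u))"
    if "nat_form u y \<in> F_odd R (4 * n + 1)" "alg_part u * y \<in> ideal_pow R (2 * n + 1)"
      "y * alg_part u \<in> ideal_pow R (2 * n + 1)" for u y
  proof -
    have "T (alg_part u * y - y * alg_part u) = \<tau> (b_bar (nat_form u y))"
      using that(2,3) by (simp only: b_bar_form) (rule T\<tau>, rule P(6))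
    then show ?thesis using \<tau>b[OF that(1)] by (simp add: unitz_simps clinear_functionalD[OF T])
  qed
  \<comment> \<open>The power N^(k+1) lies in the k-th step of the filtration, on which
    \<open>T\<close> vanishes.\<close>
  have "renormalized be ea rm rb me N n (Suc k) T"
  proof (intro renormalized.intro renormalized_axioms.intro lifted_extension_axioms)
    show "clinear T" by fact
    show "T x = 0" if "x \<in> ideal_pow N (Suc k)" for x
      using that ideal_pow_F_even[OF N_ideal] k by blast
    show "T (x * y) = T (y * x)" if "x \<in> ideal_pow R (2 * n + 1)" for x y
    proof -
      have "nat_form (of_alg x) y \<in> F_odd R (4 * n + 1)"
        unfolding F_odd_odd_degree using that
        by (intro cvec.span_base UnI1) (auto simp: nat_forms_on_def ideal_pow_plus_def simp del: ideal_pow.simps intro!: cvec.span_base)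
      from tr[OF this] show ?thesis using P(2,3)[OF that] by (simp add: unitz_simps del: ideal_pow.simps)
    qed
    show "T (alg_part (u * of_alg y)) = T (alg_part (of_alg y * u))"
      if u: "u \<in> ideal_pow_plus R (2 * n)" and y: "y \<in> R" for u y
    proof (rule tr)
      show "nat_form u y \<in> F_odd R (4 * n + 1)"
        unfolding F_odd_odd_degree using u y
        by (intro cvec.span_base UnI2) (auto simp: nat_forms_on_def intro!: cvec.span_base)
      have a: "alg_part u \<in> ideal_pow R (2 * n)" using u by (auto simp: ideal_pow_plus_def unitz_simps split: if_splits)
      show "alg_part u * y \<in> ideal_pow R (2 * n + 1)"
        using ideal_pow_mult[OF rm(3) a, of y 1] y by simp
      show "y * alg_part u \<in> ideal_pow R (2 * n + 1)"
        using ideal_pow_mult[OF rm(3) _ a, of y 1] y by simp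
    qed
  qed simp
  then show ?thesis by (rule that)
qed

text \<open>On T B the classifying homomorphism takes values in R and therefore factors through the
  injection \<open>rm\<close>; the factor lifts the multiplication of T B, so that it carries
  idempotent lifts over T B to idempotent lifts over R.\<close>

lemma ex_tensor_hom:
  assumes \<rho>: "classifying_hom ea R me \<rho>"
  obtains \<zeta> where "alg_hom \<zeta>" "\<And>u. rm (\<zeta> u) = \<rho> (tensor_map be u)" "\<And>u. rb (\<zeta> u) = tensor_mult u"
proof -
  have be': "clinear be" and ea': "clinear ea" using be(1) ea(1) by (auto simp: alg_hom_def)
  have "tensor_map be u \<in> T_ker ea" for u
    by (simp add: T_ker_def tensor_map_comp_zero[OF be' ea' ea_be])
  then have ran: "\<rho> (tensor_map be u) \<in> R" for u using \<rho> by (auto simp: classifying_hom_def)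
  define \<zeta> where "\<zeta> u = inv_into UNIV rm (\<rho> (tensor_map be u))" for u
  have \<zeta>: "rm (\<zeta> u) = \<rho> (tensor_map be u)" for u unfolding \<zeta>_def by (rule f_inv_into_f[OF ran])
  have h: "alg_hom (\<rho> \<circ> tensor_map be)"
    using \<rho> by (intro alg_hom_comp tensor_map(1) be') (simp add: classifying_hom_def)
  have inj: "rm x = rm y \<Longrightarrow> x = y" for x y using rm(2) by (simp add: inj_eq)
  have "alg_hom \<zeta>"
    unfolding alg_hom_def
  proof (intro conjI allI, unfold_locales)
    fix x y c
    show "\<zeta> (x + y) = \<zeta> x + \<zeta> y" "\<zeta> (c *\<^sub>C x) = c *\<^sub>C \<zeta> x" "\<zeta> (x * y) = \<zeta> x * \<zeta> y"
      by (rule inj, use alg_homD[OF h] in \<open>simp add: \<zeta> alg_homD[OF rm(1)]\<close>)+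
  qed
  moreover have "rb (\<zeta> u) = tensor_mult u" for u
  proof -
    have "be (rb (\<zeta> u)) = me (\<rho> (tensor_map be u))" by (simp add: \<zeta> flip: square)
    also have "\<dots> = be (tensor_mult u)"
      using \<rho> by (simp add: classifying_hom_def tensor_mult_map[OF be(1)])
    finally show ?thesis using be(2) by (simp add: inj_eq)
  qed
  ultimately show ?thesis by (intro that[of \<zeta>] \<zeta>)
qed

text \<open>Continuity of the homomorphism: following \<open>me\<close> after \<open>rm\<close>
  through the square shows that the ideal of T B is sent into N, hence its powers into the powers of
  N.\<close>

lemma idempotent_lift_tensor:
  assumes \<rho>: "classifying_hom ea R me \<rho>"
    and \<zeta>: "alg_hom \<zeta>" "\<And>u. rm (\<zeta> u) = \<rho> (tensor_map be u)" "\<And>u. rb (\<zeta> u) = tensor_mult u"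
    and Y: "pro_mat (ideal_pow J_tensor) k Y" "\<And>i. mat_in (ideal_pow J_tensor i) (Y i * Y i - Y i)"
      "\<And>i. map_mat (unitz_map tensor_mult) (Y i) = e"
  shows "idempotent_lift rm rb N k e (\<lambda>i. map_mat (unitz_map \<zeta>) (Y i))"
proof -
  have Yc: "Y i \<in> carrier_mat k k" for i using Y(1) by (simp add: pro_mat_def)
  have zeroJ: "0 \<in> ideal_pow J_tensor i" for i by (rule alg_idealD(4)[OF alg_ideal_pow[OF alg_ideal_J_tensor]])
  have zero: "0 \<in> rm -` ideal_pow N i" for i by (simp add: alg_homD(4)[OF rm(1)] alg_idealD(4)[OF alg_ideal_pow[OF N_ideal]])
  have h: "alg_hom (rm \<circ> \<zeta>)" by (rule alg_hom_comp[OF \<zeta>(1) rm(1)])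
  have "(rm \<circ> \<zeta>) ` J_tensor \<subseteq> N"
    by (auto simp: N_eq square \<zeta>(3) J_tensor_def alg_homD(4)[OF be(1)])
  from alg_hom_ideal_pow[OF h this N_ideal]
  have sub: "\<zeta> ` ideal_pow J_tensor i \<subseteq> rm -` ideal_pow N i" for i by auto
  have tr: "mat_in (rm -` ideal_pow N i) (map_mat (unitz_map \<zeta>) W)" if "mat_in (ideal_pow J_tensor i) W" for W i
    using imat_map_mat_on[OF \<zeta>(1) _ sub] that
    by (simp add: mat_in_iff[OF zeroJ] mat_in_iff[OF zero] flip: imat_map_of_mat[OF \<zeta>(1)])
  have YY: "Y i * Y i \<in> carrier_mat k k" for i using Yc[of i] by auto
  show ?thesis
    unfolding idempotent_lift_def Let_def pro_mat_def
  proof (intro conjI allI)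
    fix i
    show "map_mat (unitz_map \<zeta>) (Y i) \<in> carrier_mat k k" using Yc[of i] by simp
    show "mat_in (rm -` ideal_pow N i) (map_mat (unitz_map \<zeta>) (Y (Suc i)) - map_mat (unitz_map \<zeta>) (Y i))"
      using tr[of i "Y (Suc i) - Y i"] Y(1) by (simp add: pro_mat_def map_mat_unitz(3)[OF \<zeta>(1) Yc Yc])
    show "mat_in (rm -` ideal_pow N i)
        (map_mat (unitz_map \<zeta>) (Y i) * map_mat (unitz_map \<zeta>) (Y i) - map_mat (unitz_map \<zeta>) (Y i))"
      using tr[OF Y(2), of i] by (simp add: map_mat_unitz(3)[OF \<zeta>(1) YY Yc] map_mat_unitz(1)[OF \<zeta>(1) Yc Yc])
    show "map_mat (unitz_map rb) (map_mat (unitz_map \<zeta>) (Y (Suc i))) = e"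
      unfolding Y(3)[of "Suc i", symmetric] using \<zeta>(3) by (intro eq_matI) (auto simp: unitz_map_def)
  qed
qed

end

section \<open>Comparison over the tensor algebra\<close>

text \<open>The two sides differ by the trace of an exact cochain on the first power of the
  difference of idempotents, where \<open>mtrace_nat_d_vanish\<close> applies as soon as i reaches
  m+2.\<close>

lemma even_trace_cohomologous:
  assumes h: "cochain UNIV (F_odd J_tensor) h" and fg: "\<And>x. f x - g x = h (nat_d x)"
    and f0: "f 0 = 0" "g 0 = 0" and l: "l \<le> k"
    and Y: "\<And>i. Y i \<in> carrier_mat k k" "\<And>i. mat_in (ideal_pow J_tensor i) (Y i * Y i - Y i)"
  shows "\<forall>\<^sub>F i in sequentially. even_trace f (Y i - p_mat l k) = even_trace g (Y i - p_mat l k)"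
proof -
  obtain m where lin: "clinear h" and m: "\<And>\<omega>. \<omega> \<in> F_odd J_tensor m \<Longrightarrow> h \<omega> = 0"
    using h by (auto simp: cochain_UNIV)
  have zeroJ: "0 \<in> ideal_pow J_tensor i" for i by (rule alg_idealD(4)[OF alg_ideal_pow[OF alg_ideal_J_tensor]])
  have "even_trace f (Y i - p_mat l k) = even_trace g (Y i - p_mat l k)" if "Suc (Suc m) \<le> i" for i
  proof -
    have YY: "Y i * Y i \<in> carrier_mat k k" using Y(1)[of i] by auto
    have c: "Y i - p_mat l k \<in> carrier_mat k k" using p_mat_carrier by (rule minus_carrier_mat)
    let ?e = "of_mat (Y i)" and ?p = "of_mat (p_mat l k)"
    have "?e * ?e - ?e \<in> mat_on (ideal_pow J_tensor i)"
      using Y(2)[of i] by (simp add: mat_in_iff[OF zeroJ] of_mat_diff[OF YY Y(1)] of_mat_mult[OF Y(1) Y(1)])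
    then have e: "?e * ?e - ?e \<in> mat_on (ideal_pow J_tensor (Suc (Suc m)))"
      by (rule mat_on_pow_le[OF alg_ideal_J_tensor that])
    have p: "?p * ?p = ?p" "alg_part (entry (alg_part ?p) i j) = 0" for i j
      by (simp add: p_mat_idempotent[OF l] flip: of_mat_mult[OF p_mat_carrier p_mat_carrier])
        (simp add: of_mat_parts p_mat_def unitz_simps)
    have "mtrace (\<lambda>a. h (nat_d a)) ((?e - ?p) ^ (2 * 0 + 1)) = 0"
      by (rule mtrace_nat_d_vanish[OF lin alg_ideal_J_tensor m e p])
    then have "mtrace (\<lambda>a. f a - g a) (?e - ?p) = 0" by (simp add: fg)
    moreover have "mtrace (\<lambda>a. f a - g a) w = mtrace f w - mtrace g w" for w
      by (simp add: mtrace_def sum_subtractf)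
    ultimately show ?thesis
      by (simp add: even_trace_of_mat[OF c] f0 of_mat_diff[OF Y(1) p_mat_carrier])
  qed
  then show ?thesis by (auto simp: eventually_sequentially)
qed

lemma HP0_even_trace:
  assumes \<beta>: "\<beta> \<in> HP0" "f \<in> \<beta>" "g \<in> \<beta>" and l: "l \<le> k"
    and Y: "\<And>i. Y i \<in> carrier_mat k k" "\<And>i. mat_in (ideal_pow J_tensor i) (Y i * Y i - Y i)"
  shows "\<forall>\<^sub>F i in sequentially. even_trace f (Y i - p_mat l k) = even_trace g (Y i - p_mat l k)"
proof -
  obtain f0 where "\<beta> = HP0_rel `` {f0}" using \<beta>(1) by (auto simp: HP0_def quotient_def)
  then have rel: "(f0, f) \<in> HP0_rel" "(f0, g) \<in> HP0_rel" using \<beta> by auto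
  have zero: "u 0 = 0" if "u \<in> HP0_cocycles" for u :: "'a tensor \<Rightarrow> complex"
    using that by (simp add: HP0_cocycles_def cochain_UNIV clinear_functionalD)
  have "\<forall>\<^sub>F i in sequentially. even_trace f0 (Y i - p_mat l k) = even_trace u (Y i - p_mat l k)"
    if u: "(f0, u) \<in> HP0_rel" for u
  proof -
    obtain h where h: "cochain UNIV (F_odd J_tensor) h" "\<And>x. f0 x - u x = h (nat_d x)"
      and fu: "f0 \<in> HP0_cocycles" "u \<in> HP0_cocycles"
      using u by (auto simp: HP0_rel_def)
    show ?thesis
      by (rule even_trace_cohomologous[where f = f0 and g = u, OF h zero[OF fu(1)] zero[OF fu(2)] l Y])
  qed
  from eventually_conj[OF this[OF rel(1)] this[OF rel(2)]] show ?thesis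
    by (rule eventually_mono) metis
qed

lemma mtrace_cong:
  assumes "w \<in> mat_on A" "\<And>a. a \<in> A \<Longrightarrow> f a = g a"
  shows "mtrace f w = mtrace g w"
  unfolding mtrace_def using assms by (intro sum.cong refl) (auto simp: mat_on_def of_alg_image_iff)

context renormalized
begin

text \<open>The idempotent is moved from T B to T E, where its difference from \<open>p_mat\<close>
  lies over the ideal \<open>L\<close>. There the pull-back of \<open>T\<close> is a cocycle over
  F^1 plus an exact cochain: the exact part vanishes, and the cocycle is a trace between
  \<open>L\<close> and all of T E, for which the exponent drops from 2n+1 to 1. Restricted to T B it
  belongs to the class, like \<open>f\<close>.\<close>

lemma tensor_comparison:
  assumes rep: "represents be ea R N me (4 * n + 1) \<tau> \<beta>" and ren: "renormalization R N (4 * n + 1) \<tau> T"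
    and f: "f \<in> \<beta>" and l: "l \<le> k" and e: "e \<in> carrier_mat k k" "mat_in UNIV (e - p_mat l k)"
    and Y: "pro_mat (ideal_pow J_tensor) k Y" "\<And>i. mat_in (ideal_pow J_tensor i) (Y i * Y i - Y i)"
      "\<And>i. map_mat (unitz_map tensor_mult) (Y i) = e"
  obtains X where "idempotent_lift rm rb N k e X"
    "\<forall>\<^sub>F i in sequentially. pairing e (map_mat (unitz_map rm) (X i)) = even_trace f (Y i - p_mat l k)"
proof -
  define L where "L = T_ker ea"
  have L: "alg_ideal L" unfolding L_def by (rule alg_ideal_T_ker[OF ea(1)])
  note JJ = alg_ideal_J_tensor
  obtain \<rho> \<psi> \<theta> where r: "\<beta> \<in> HP0" "classifying_hom ea R me \<rho>"
    "even_cocycle L J_tensor 1 \<psi>" "cochain (F_odd L (4 * n + 1)) (F_odd J_tensor) \<theta>"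
    "\<forall>x\<in>F_even L (4 * n + 1). \<tau> (\<rho> x) - \<psi> x = \<theta> (nat_d x)" "(\<lambda>t. \<psi> (tensor_map be t)) \<in> \<beta>"
    using rep unfolding represents_def L_def by blast
  obtain \<zeta> where \<zeta>: "alg_hom \<zeta>" "\<And>u. rm (\<zeta> u) = \<rho> (tensor_map be u)" "\<And>u. rb (\<zeta> u) = tensor_mult u"
    by (rule ex_tensor_hom[OF r(2)]) (rule that)
  define X where "X i = map_mat (unitz_map \<zeta>) (Y i)" for i
  have X: "idempotent_lift rm rb N k e X"
    unfolding X_def by (rule idempotent_lift_tensor[OF r(2) \<zeta> Y])
  have be': "clinear be" and ea': "clinear ea" using be(1) ea(1) by (auto simp: alg_hom_def)
  define i where "i = tensor_map be"
  have i: "alg_hom i" unfolding i_def by (rule tensor_map(1)[OF be'])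
  have iL: "i u \<in> L" for u by (simp add: i_def L_def T_ker_def tensor_map_comp_zero[OF be' ea' ea_be])
  have \<rho>: "alg_hom \<rho>" "\<rho> ` L \<subseteq> R" using r(2) by (auto simp: classifying_hom_def L_def)
  have Feven1: "F_even L 1 = L" by (simp add: F_even_def Let_def)
  \<comment> \<open>The given cochains are meaningful only on steps of the filtration; linear
    extensions to all of T E make the matrix traces additive.\<close>
  obtain \<psi>' where \<psi>': "cochain UNIV (F_even J_tensor) \<psi>'" "\<And>x. x \<in> L \<Longrightarrow> \<psi>' x = \<psi> x"
  proof -
    have "cochain L (F_even J_tensor) \<psi>" using r(3) unfolding even_cocycle_def Feven1 by blast
    then show ?thesis by (rule extend_cochain[OF _ alg_idealD(1)[OF L] subspace_F_even[OF JJ]]) (rule that)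
  qed
  obtain \<theta>' where \<theta>': "cochain UNIV (F_odd J_tensor) \<theta>'" "\<And>x. x \<in> F_odd L (4 * n + 1) \<Longrightarrow> \<theta>' x = \<theta> x"
    by (rule extend_cochain[OF r(4) subspace_F_odd subspace_F_odd]) (rule that)
  obtain a where \<psi>_lin: "clinear \<psi>'" and a: "\<And>x. x \<in> F_even J_tensor a \<Longrightarrow> \<psi>' x = 0"
    using \<psi>'(1) by (auto simp: cochain_UNIV)
  obtain b where \<theta>_lin: "clinear \<theta>'" and b: "\<And>x. x \<in> F_odd J_tensor b \<Longrightarrow> \<theta>' x = 0"
    using \<theta>'(1) by (auto simp: cochain_UNIV)
  have T\<rho>: "T (\<rho> x) = \<psi>' x + \<theta>' (nat_d x)" if x: "x \<in> ideal_pow L (2 * n + 1)" for x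
  proof -
    have "\<rho> x \<in> ideal_pow R (2 * n + 1)" using alg_hom_ideal_pow[OF \<rho> rm(3)] x by blast
    then have "T (\<rho> x) = \<tau> (\<rho> x)" using ren unfolding renormalization_def F_even_odd_degree by blast
    moreover have "\<tau> (\<rho> x) - \<psi> x = \<theta> (nat_d x)" using r(5) x unfolding F_even_odd_degree by blast
    moreover have "x \<in> L" using ideal_pow_antimono[OF L, of 1 "2 * n + 1"] x by auto
    moreover have "nat_d x \<in> F_odd L (4 * n + 1)"
    proof -
      have "nat_form 1 x \<in> nat_forms_on (ideal_pow_plus L (0 + 2 * n)) L"
        using x by (intro nat_form_ideal_pow[OF L]) (simp_all add: ideal_pow_plus_def del: ideal_pow.simps)
      then show ?thesis unfolding F_odd_odd_degree nat_d_def d_form_def by (intro cvec.span_base) simp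
    qed
    ultimately show ?thesis using \<psi>'(2) \<theta>'(2) by (simp add: algebra_simps)
  qed
  have Yc: "Y j \<in> carrier_mat k k" for j using Y(1) by (simp add: pro_mat_def)
  have zeroJ: "0 \<in> ideal_pow J_tensor j" for j by (rule alg_idealD(4)[OF alg_ideal_pow[OF JJ]])
  have iJ: "i ` J_tensor \<subseteq> J_tensor"
    by (auto simp: i_def J_tensor_def tensor_mult_map[OF be(1)] alg_homD(4)[OF be(1)])
  \<comment> \<open>The bound puts the idempotency defect into the (a+1)-st power, where the
    extended trace vanishes, and into the (b+2)-nd, as needed for the exact part.\<close>
  have "pairing e (map_mat (unitz_map rm) (X j)) = even_trace (\<lambda>t. \<psi> (tensor_map be t)) (Y j - p_mat l k)"
    if j: "Suc a + Suc (Suc b) \<le> j" for j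
  proof -
    let ?p = "of_mat (p_mat l k) :: 'e tensor imat"
    let ?E = "imat_map i (of_mat (Y j))"
    have c: "Y j - p_mat l k \<in> carrier_mat k k" using p_mat_carrier by (rule minus_carrier_mat)
    have p: "?p * ?p = ?p" "alg_part (entry (alg_part ?p) s s') = 0" for s s'
      by (simp add: p_mat_idempotent[OF l] flip: of_mat_mult[OF p_mat_carrier p_mat_carrier])
        (simp add: of_mat_parts p_mat_def unitz_simps)
    have D: "?E - ?p = imat_map i (of_mat (Y j - p_mat l k))"
      by (simp add: of_mat_diff[OF Yc p_mat_carrier] imat_map_hom[OF i] imat_map_of_mat[OF i] map_mat_p_mat[OF i])
    have YU: "of_mat (Y j - p_mat l k) \<in> mat_on UNIV"
    proof -
      have "imat_map tensor_mult (of_mat (Y j - p_mat l k)) = of_mat (e - p_mat l k)"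
        by (simp add: of_mat_diff[OF Yc p_mat_carrier] of_mat_diff[OF e(1) p_mat_carrier] imat_map_hom[OF alg_hom_tensor_mult]
            imat_map_of_mat[OF alg_hom_tensor_mult] map_mat_p_mat[OF alg_hom_tensor_mult] Y(3))
      then have "imat_map tensor_mult (of_mat (Y j - p_mat l k)) \<in> mat_on UNIV"
        using e(2) by (simp add: mat_in_iff)
      then show ?thesis by (simp add: imat_map_mat_on_UNIV[OF alg_hom_tensor_mult])
    qed
    have DL: "?E - ?p \<in> mat_on L"
      unfolding D by (rule imat_map_mat_on[OF i YU]) (use iL in auto)
    have DLn: "(?E - ?p) ^ (2 * n + 1) \<in> mat_on (ideal_pow L (2 * n + 1))"
      using mat_on_power[OF L DL, of "2 * n"] by simp
    have EE: "?E * ?E - ?E \<in> mat_on (ideal_pow J_tensor j)"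
    proof -
      have YY: "Y j * Y j \<in> carrier_mat k k" using Yc[of j] by auto
      have "imat_map i (of_mat (Y j * Y j - Y j)) \<in> mat_on (ideal_pow J_tensor j)"
        using Y(2)[of j] alg_hom_ideal_pow[OF i iJ JJ, of j]
        by (intro imat_map_mat_on[OF i, of _ "ideal_pow J_tensor j"]) (simp_all add: mat_in_iff[OF zeroJ])
      then show ?thesis
        by (simp add: of_mat_diff[OF YY Yc] of_mat_mult[OF Yc Yc] imat_map_hom[OF i])
    qed
    have E_a: "?E * ?E - ?E \<in> mat_on (ideal_pow J_tensor (Suc a))"
      by (rule mat_on_pow_le[OF JJ _ EE]) (use j in simp)
    have E_b: "?E * ?E - ?E \<in> mat_on (ideal_pow J_tensor (Suc (Suc b)))"
      by (rule mat_on_pow_le[OF JJ _ EE]) (use j in simp)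
    have "of_mat (map_mat (unitz_map rm) (X j)) = imat_map (rm \<circ> \<zeta>) (of_mat (Y j))"
      using imat_map_comp[OF rm(1) \<zeta>(1) alg_hom_comp[OF \<zeta>(1) rm(1)], of "of_mat (Y j)"]
      by (simp add: X_def imat_map_of_mat[OF rm(1)] imat_map_of_mat[OF \<zeta>(1)])
    also have "rm \<circ> \<zeta> = \<rho> \<circ> i" using \<zeta>(2) by (auto simp: i_def)
    also have "imat_map (\<rho> \<circ> i) (of_mat (Y j)) = imat_map \<rho> ?E"
      by (rule imat_map_comp[OF \<rho>(1) i alg_hom_comp[OF i \<rho>(1)], symmetric])
    finally have "of_mat (map_mat (unitz_map rm) (X j)) - of_mat (p_mat l k) = imat_map \<rho> (?E - ?p)"
      by (simp add: imat_map_hom[OF \<rho>(1)] imat_map_of_mat[OF \<rho>(1)] map_mat_p_mat[OF \<rho>(1)])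
    then have "pairing e (map_mat (unitz_map rm) (X j)) = mtrace T (imat_map \<rho> ((?E - ?p) ^ (2 * n + 1)))"
      by (simp only: pairing_def sM_of_mat_p_mat[OF e] t_def imat_map_hom(6)[OF \<rho>(1)])
    also have "\<dots> = mtrace (T \<circ> \<rho>) ((?E - ?p) ^ (2 * n + 1))"
      by (rule mtrace_imat_map[OF \<rho>(1)]) (rule clinear_functionalD(3)[OF T_lin])
    also have "\<dots> = mtrace (\<lambda>x. \<psi>' x + \<theta>' (nat_d x)) ((?E - ?p) ^ (2 * n + 1))"
      by (rule mtrace_cong[OF DLn]) (simp add: T\<rho> del: ideal_pow.simps)
    also have "\<dots> = mtrace \<psi>' ((?E - ?p) ^ (2 * n + 1)) + mtrace (\<lambda>x. \<theta>' (nat_d x)) ((?E - ?p) ^ (2 * n + 1))"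
      by (simp only: mtrace_def sum.distrib)
    also have "mtrace (\<lambda>x. \<theta>' (nat_d x)) ((?E - ?p) ^ (2 * n + 1)) = 0"
      by (rule mtrace_nat_d_vanish[OF \<theta>_lin JJ b E_b p])
    \<comment> \<open>The telescoping of odd powers once more, now in T E.\<close>
    also have "mtrace \<psi>' ((?E - ?p) ^ (2 * n + 1)) = mtrace \<psi>' (?E - ?p)"
    proof -
      interpret P: additive_map \<psi>' by unfold_locales (rule clinear_functionalD(1)[OF \<psi>_lin])
      let ?Z = "mat_on (ideal_pow J_tensor (Suc a)) :: 'e tensor imat set"
      note Zr = ring_idealD[OF ring_ideal_mat_on[OF alg_ideal_pow[OF JJ], of "Suc a"]]
      have Zv: "mtrace \<psi>' z = 0" if "z \<in> ?Z" for z
        by (rule P.mtrace_vanish[OF that]) (use ideal_pow_F_even[OF JJ] a in blast)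
      \<comment> \<open>With all three ideals equal the trace axiom is trivial, as both sides vanish
        there; the genuine trace property enters \<open>odd_power_step\<close> through
        \<open>tr\<close>.\<close>
      interpret Q: index_setting "mtrace \<psi>'" ?Z ?Z ?Z 1
        by unfold_locales (auto simp: P.mtrace_add Zv Zr(5,6) ring_ideal_mat_on alg_ideal_pow JJ simp del: ideal_pow.simps)
      have tr: "mtrace \<psi>' (x * y) = mtrace \<psi>' (y * x)" if y: "y \<in> mat_on L" for x y
      proof (rule P.mtrace_commute[OF y UNIV_I])
        fix c d assume d: "d \<in> L"
        have "nat_form c d \<in> F_odd L 1"
          using d by (auto simp: F_odd_def Let_def nat_forms_on_def ideal_pow_plus_def intro!: cvec.span_base)
        then have "\<psi> (alg_part c * d - d * alg_part c) = 0"
          using r(3) by (auto simp: even_cocycle_def simp flip: b_bar_form)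
        then have "\<psi>' (alg_part c * d - d * alg_part c) = 0"
          using \<psi>'(2) alg_idealD(2,3,6)[OF L] d by simp
        then show "\<psi>' (alg_part (c * of_alg d)) = \<psi>' (alg_part (of_alg d * c))"
          by (simp add: unitz_simps clinear_functionalD[OF \<psi>_lin])
      qed
      note Lr = ring_idealD[OF ring_ideal_mat_on[OF L]]
      have "mtrace \<psi>' ((?E - ?p) ^ (2 * s + 1)) = mtrace \<psi>' (?E - ?p)" for s
      proof (induction s)
        case (Suc s)
        have "mtrace \<psi>' ((?E - ?p) ^ (2 * s + 3)) = mtrace \<psi>' ((?E - ?p) ^ (2 * s + 1))"
          by (rule Q.odd_power_step[where X = UNIV and Y = "mat_on L"])
            (use E_a p tr Lr(5,6) DL in \<open>auto simp: Q.approx_def Zr(1) simp del: ideal_pow.simps\<close>)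
        then show ?case using Suc by (simp add: eval_nat_numeral)
      qed simp
      then show ?thesis .
    qed
    also have "\<dots> = mtrace \<psi> (?E - ?p)" by (rule mtrace_cong[OF DL \<psi>'(2)])
    also have "\<dots> = mtrace (\<psi> \<circ> i) (of_mat (Y j - p_mat l k))"
    proof -
      have "\<psi> 0 = 0" using \<psi>'(2)[OF alg_idealD(4)[OF L]] clinear_functionalD(3)[OF \<psi>_lin] by simp
      then show ?thesis unfolding D by (rule mtrace_imat_map[OF i])
    qed
    also have "\<dots> = even_trace (\<lambda>t. \<psi> (tensor_map be t)) (Y j - p_mat l k)"
    proof -
      have "\<psi> (i 0) = 0" using \<psi>'(2)[OF alg_idealD(4)[OF L]] clinear_functionalD(3)[OF \<psi>_lin] by (simp add: alg_homD(4)[OF i])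
      then show ?thesis by (subst even_trace_of_mat[OF c]) (simp_all add: i_def o_def)
    qed
    finally show ?thesis by simp
  qed
  then have "\<forall>\<^sub>F j in sequentially. pairing e (map_mat (unitz_map rm) (X j)) = even_trace (\<lambda>t. \<psi> (tensor_map be t)) (Y j - p_mat l k)"
    by (auto simp: eventually_sequentially)
  from eventually_conj[OF this HP0_even_trace[OF r(1) r(6) f l Yc Y(2)]]
  have "\<forall>\<^sub>F j in sequentially. pairing e (map_mat (unitz_map rm) (X j)) = even_trace f (Y j - p_mat l k)"
    by (rule eventually_mono) simp
  with X show ?thesis by (rule that)
qed

end

section \<open>The index theorem\<close>

definition index_data where
  "index_data be ea l g g' Q P G' e \<longleftrightarrow>
    g' \<in> carrier_mat l l \<and> inverts_mat g g' \<and> inverts_mat g' g \<and>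
    Q \<in> carrier_mat l l \<and> map_mat (unitz_map ea) Q = g \<and>
    P \<in> carrier_mat l l \<and> map_mat (unitz_map ea) P = g' \<and>
    G' \<in> carrier_mat (l + l) (l + l) \<and> inverts_mat (index_matrix l Q P) G' \<and> inverts_mat G' (index_matrix l Q P) \<and>
    e \<in> carrier_mat (l + l) (l + l) \<and>
    map_mat (unitz_map be) e = G' * p_mat l (l + l) * index_matrix l Q P"

lemma Ind_eq:
  "Ind be ea \<kappa> = \<Union>{K0_rel `` {(e, p_mat l (l + l))} | l g g' Q P G' e.
    g \<in> \<Union>\<kappa> \<and> g \<in> GL l \<and> index_data be ea l g g' Q P G' e}"
  unfolding Ind_def index_data_def index_matrix_def by (rule arg_cong[of _ _ Union]) blast

lemma K0_rel_refl:
  assumes "e \<in> idempotents" "f \<in> idempotents"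
  shows "((e, f), (e, f)) \<in> K0_rel"
proof -
  have z: "(0\<^sub>m 0 0 :: 'a mat) \<in> idempotents" by (simp add: idempotents_def)
  have c: "e \<in> carrier_mat (dim_row e) (dim_row e)" "f \<in> carrier_mat (dim_row f) (dim_row f)"
    "(0\<^sub>m 0 0 :: 'a mat) \<in> carrier_mat 0 0"
    using assms by (auto simp: idempotents_def)
  have "dsum e (dsum f (0\<^sub>m 0 0)) * dsum e (dsum f (0\<^sub>m 0 0)) = dsum e (dsum f (0\<^sub>m 0 0))"
    using assms unfolding dsum_mult[OF c(1,1) dsum_carrier[OF c(2,3)] dsum_carrier[OF c(2,3)]]
      dsum_mult[OF c(2,2,3,3)] by (simp add: idempotents_def)
  then have "mvn_equiv (diag_block_mat [e, f, 0\<^sub>m 0 0]) (diag_block_mat [e, f, 0\<^sub>m 0 0])"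
    unfolding mvn_equiv_def diag_block_dsum using dsum_carrier[OF c(1) dsum_carrier[OF c(2,3)]] by auto
  then show ?thesis using assms z by (auto simp: K0_rel_def simp del: diag_block_mat.simps)
qed

text \<open>For a boundary cochain the pairing with Y dX is the trace of the commutator of Y and
  X.\<close>

lemma odd_trace_b_bar:
  assumes F: "clinear F" and \<phi>: "\<And>\<omega>. \<phi> \<omega> = F (b_bar \<omega>)"
    and Y: "Y \<in> carrier_mat k k" and X: "X \<in> carrier_mat k k"
  shows "odd_trace \<phi> Y X = mtrace F (of_mat Y * of_mat X) - mtrace F (of_mat X * of_mat Y)"
proof -
  note Fs = clinear_functionalD[OF F]
  have prod: "mtrace F (of_mat A * of_mat B) = (\<Sum>i<k. \<Sum>j<k. F (alg_part (A $$ (i, j) * B $$ (j, i))))"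
    if A: "A \<in> carrier_mat k k" and B: "B \<in> carrier_mat k k" for A B
  proof -
    have "mtrace F (of_mat A * of_mat B) = mtrace F (of_mat (A * B))" by (simp add: of_mat_mult[OF A B])
    also have "\<dots> = (\<Sum>i<k. F (alg_part ((A * B) $$ (i, i))))"
      by (rule mtrace_of_mat[where T = F, OF mult_carrier_mat[OF A B] Fs(3)])
    also have "\<dots> = (\<Sum>i<k. \<Sum>j<k. F (alg_part (A $$ (i, j) * B $$ (j, i))))"
      using A B by (intro sum.cong refl) (simp add: scalar_prod_def alg_part_sum Fs atLeast0LessThan)
    finally show ?thesis .
  qed
  have "odd_trace \<phi> Y X = (\<Sum>i<k. \<Sum>j<k. F (alg_part (Y $$ (i, j) * X $$ (j, i))) - F (alg_part (X $$ (j, i) * Y $$ (i, j))))"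
    unfolding odd_trace_def using X Y
    by (intro sum.cong) (auto simp: \<phi> b_bar_form unitz_simps Fs intro!: sum.cong)
  also have "\<dots> = (\<Sum>i<k. \<Sum>j<k. F (alg_part (Y $$ (i, j) * X $$ (j, i)))) -
      (\<Sum>i<k. \<Sum>j<k. F (alg_part (X $$ (j, i) * Y $$ (i, j))))"
    by (simp add: sum_subtractf)
  also have "(\<Sum>i<k. \<Sum>j<k. F (alg_part (X $$ (j, i) * Y $$ (i, j)))) =
      (\<Sum>j<k. \<Sum>i<k. F (alg_part (X $$ (j, i) * Y $$ (i, j))))"
    by (rule sum.swap)
  finally show ?thesis by (simp add: prod[OF Y X] prod[OF X Y])
qed

text \<open>The difference is the trace of a commutator of X and Y, and both products are the unit
  modulo a power of the ideal killed by \<open>h\<close>.\<close>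

lemma HP1_odd_trace:
  assumes rel: "(\<phi>, \<phi>') \<in> HP1_rel" and lift: "invertible_lift k g X Y"
  shows "\<forall>\<^sub>F i in sequentially. odd_trace \<phi> (Y i) (X i) = odd_trace \<phi>' (Y i) (X i)"
proof -
  obtain h m where h: "clinear h" and m: "\<And>x. x \<in> F_even J_tensor m \<Longrightarrow> h x = 0"
    and diff: "\<And>\<omega>. \<phi> \<omega> - \<phi>' \<omega> = h (b_bar \<omega>)"
    using rel by (auto simp: HP1_rel_def cochain_UNIV)
  have zeroJ: "0 \<in> ideal_pow J_tensor i" for i by (rule alg_idealD(4)[OF alg_ideal_pow[OF alg_ideal_J_tensor]])
  interpret additive_map h by unfold_locales (rule clinear_functionalD(1)[OF h])
  have "odd_trace \<phi> (Y i) (X i) = odd_trace \<phi>' (Y i) (X i)" if i: "Suc m \<le> i" for i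
  proof -
    have X: "X i \<in> carrier_mat k k" and Y: "Y i \<in> carrier_mat k k"
      and XY: "mat_in (ideal_pow J_tensor i) (X i * Y i - 1\<^sub>m k)" "mat_in (ideal_pow J_tensor i) (Y i * X i - 1\<^sub>m k)"
      using lift by (simp_all add: invertible_lift_def Let_def pro_mat_def)
    have one: "(1\<^sub>m k :: 'a tensor unitz mat) \<in> carrier_mat k k" by simp
    have J0: "h x = 0" if "x \<in> ideal_pow J_tensor i" for x
      using that m ideal_pow_F_even[OF alg_ideal_J_tensor, of m] ideal_pow_antimono[OF alg_ideal_J_tensor i] by blast
    have "mtrace h (of_mat (X i) * of_mat (Y i) - of_mat (1\<^sub>m k)) = 0" "mtrace h (of_mat (Y i) * of_mat (X i) - of_mat (1\<^sub>m k)) = 0"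
      using XY by (auto intro!: mtrace_vanish[OF _ J0] simp: mat_in_iff[OF zeroJ] of_mat_diff[OF mult_carrier_mat[OF X Y] one]
          of_mat_diff[OF mult_carrier_mat[OF Y X] one] of_mat_mult[OF X Y] of_mat_mult[OF Y X])
    then have "mtrace h (of_mat (X i) * of_mat (Y i)) = mtrace h (of_mat (Y i) * of_mat (X i))"
      using mtrace_add[of "of_mat (X i) * of_mat (Y i) - of_mat (1\<^sub>m k)" "of_mat (1\<^sub>m k)"]
        mtrace_add[of "of_mat (Y i) * of_mat (X i) - of_mat (1\<^sub>m k)" "of_mat (1\<^sub>m k)"] by simp
    then have "odd_trace (\<lambda>\<omega>. h (b_bar \<omega>)) (Y i) (X i) = 0"
      by (subst odd_trace_b_bar[OF h refl Y X]) simp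
    moreover have "odd_trace (\<lambda>\<omega>. h (b_bar \<omega>)) (Y i) (X i) = odd_trace \<phi> (Y i) (X i) - odd_trace \<phi>' (Y i) (X i)"
      by (simp add: odd_trace_def sum_subtractf flip: diff)
    ultimately show ?thesis by simp
  qed
  then show ?thesis by (auto simp: eventually_sequentially)
qed

context lifted_extension
begin

lemma index_data_facts:
  assumes g: "g \<in> GL l" and dat: "index_data be ea l g g' Q P G' e"
  shows "g \<in> carrier_mat l l" "g' \<in> carrier_mat l l" "g * g' = 1\<^sub>m l" "g' * g = 1\<^sub>m l"
    "index_matrix l Q P \<in> carrier_mat (l + l) (l + l)"
    "map_mat (unitz_map ea) (index_matrix l Q P) = four_block_mat g (0\<^sub>m l l) (0\<^sub>m l l) g'"
    "e * e = e" "mat_in UNIV (e - p_mat l (l + l))"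
proof -
  let ?G = "index_matrix l Q P"
  have d: "g' \<in> carrier_mat l l" "inverts_mat g g'" "inverts_mat g' g"
    "Q \<in> carrier_mat l l" "map_mat (unitz_map ea) Q = g" "P \<in> carrier_mat l l" "map_mat (unitz_map ea) P = g'"
    "G' \<in> carrier_mat (l + l) (l + l)" "inverts_mat ?G G'" "inverts_mat G' ?G" "e \<in> carrier_mat (l + l) (l + l)"
    "map_mat (unitz_map be) e = G' * p_mat l (l + l) * ?G"
    using dat by (auto simp: index_data_def)
  show gc: "g \<in> carrier_mat l l" by (rule GL_carrier[OF g])
  show g'c: "g' \<in> carrier_mat l l" by fact
  show gg: "g * g' = 1\<^sub>m l" "g' * g = 1\<^sub>m l" using d(2,3) gc g'c by (auto simp: inverts_mat_def)
  show G: "?G \<in> carrier_mat (l + l) (l + l)"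
    unfolding index_matrix_def using d(4,6) by (intro four_block_carrier_mat) auto
  show mG: "map_mat (unitz_map ea) ?G = four_block_mat g (0\<^sub>m l l) (0\<^sub>m l l) g'"
    by (rule map_index_matrix[OF ea(1) d(4-7) gg])
  let ?p = "p_mat l (l + l) :: 'e unitz mat"
  have pc: "?p \<in> carrier_mat (l + l) (l + l)" by (rule p_mat_carrier)
  have G'G: "?G * G' = 1\<^sub>m (l + l)" using d(9) G by (simp add: inverts_mat_def)
  define \<Gamma> \<Gamma>' p where "\<Gamma> = of_mat ?G" and "\<Gamma>' = of_mat G'" and "p = of_mat ?p"
  have \<Gamma>: "\<Gamma> * \<Gamma>' = of_mat (1\<^sub>m (l + l))" "p * of_mat (1\<^sub>m (l + l)) = p" "p * p = p"
    by (simp_all add: \<Gamma>_def \<Gamma>'_def p_def G'G of_mat_one_absorb[OF pc] p_mat_idempotent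
        flip: of_mat_mult[OF G d(8)] of_mat_mult[OF pc pc])
  have \<Gamma>2: "p * (\<Gamma> * (\<Gamma>' * y)) = p * y" "p * (p * y) = p * y" for y
    using \<Gamma> by (simp_all flip: mult.assoc)
  have be_e: "imat_map be (of_mat e) = \<Gamma>' * p * \<Gamma>"
    unfolding imat_map_of_mat[OF be(1)] d(12) \<Gamma>_def \<Gamma>'_def p_def
    by (simp add: of_mat_mult[OF mult_carrier_mat[OF d(8) pc] G] of_mat_mult[OF d(8) pc])
  have be_inj: "X = Y" if "imat_map be (of_mat X) = imat_map be (of_mat Y)" "X \<in> carrier_mat m m" "Y \<in> carrier_mat m m" for X Y m
  proof -
    have "map_mat (unitz_map be) X = map_mat (unitz_map be) Y"
      using that by (intro of_mat_inject[of _ m m]) (simp_all add: imat_map_of_mat[OF be(1)])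
    then have "unitz_map be (X $$ (i, j)) = unitz_map be (Y $$ (i, j))" if "i < m" "j < m" for i j
      using that \<open>X \<in> _\<close> \<open>Y \<in> _\<close> by (metis carrier_matD index_map_mat(1))
    then show ?thesis
      using that(2,3) be(2) by (intro eq_matI) (auto simp: unitz_map_def inj_eq intro: unitz_eqI)
  qed
  show "e * e = e"
  proof (rule be_inj)
    show "imat_map be (of_mat (e * e)) = imat_map be (of_mat e)"
      by (simp add: of_mat_mult[OF d(11,11)] imat_map_hom[OF be(1)] be_e mult.assoc \<Gamma>2)
  qed (use d(11) in auto)
  \<comment> \<open>Scalar parts are preserved by both maps, so that \<open>e\<close> has the scalar
    part of p_N is visible over A, where the difference vanishes.\<close>
  have "imat_map ea (imat_map be (of_mat (e - p_mat l (l + l)))) = 0"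
    using map_index_idempotent[OF ea(1) G d(8,9) gc g'c gg(2,1) mG]
    by (simp add: of_mat_diff[OF d(11) p_mat_carrier] imat_map_hom[OF be(1)] imat_map_hom[OF ea(1)]
        imat_map_of_mat[OF be(1)] imat_map_of_mat[OF ea(1)] map_mat_p_mat[OF be(1)] map_mat_p_mat[OF ea(1)] d(12))
  then have "imat_map ea (imat_map be (of_mat (e - p_mat l (l + l)))) \<in> mat_on UNIV"
    using ring_idealD(1)[OF ring_ideal_mat_on[OF alg_ideal_UNIV]] by simp
  then show "mat_in UNIV (e - p_mat l (l + l))"
    by (simp add: imat_map_mat_on_UNIV[OF ea(1)] imat_map_mat_on_UNIV[OF be(1)] mat_in_iff)
qed

lemma splitting_hom:
  assumes "clinear \<sigma>" "\<And>a. ea (me (\<sigma> a)) = a"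
  shows "alg_hom (tensor_ext \<sigma>)" "ea (me (tensor_ext \<sigma> u)) = tensor_mult u"
proof -
  show h: "alg_hom (tensor_ext \<sigma>)" by (rule alg_hom_tensor_ext[OF assms(1)])
  have "((ea \<circ> me) \<circ> tensor_ext \<sigma>) u = tensor_mult u"
    by (rule alg_hom_tensor_eq[OF alg_hom_comp[OF h ea_me] alg_hom_tensor_mult])
      (simp add: tensor_ext_of[OF assms(1)] assms(2) tensor_mult_of)
  then show "ea (me (tensor_ext \<sigma> u)) = tensor_mult u" by simp
qed

lemma boundary_cochain_eq:
  assumes "clinear \<sigma>" "\<And>a. ea (me (\<sigma> a)) = a"
  shows "boundary_cochain \<sigma> T = (\<lambda>\<omega>. T (tensor_ext \<sigma> (b_bar \<omega>)))"
  by (simp add: fun_eq_iff boundary_cochain_def b_bar_X_odd_map[OF splitting_hom(1)[OF assms]])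

end

context renormalized
begin

lemma pairing_index:
  assumes g: "g \<in> GL l" and dat: "index_data be ea l g g' Q P G' e" and X: "lifts (l + l) e X"
  shows "pairing e X = - chi (stabilize g)"
proof -
  note F = index_data_facts[OF g dat]
  have ec: "e \<in> carrier_mat (l + l) (l + l)" using dat by (simp add: index_data_def)
  have s: "sM (of_mat e) = of_mat (p_mat l (l + l))" by (rule sM_of_mat_p_mat[OF ec F(8)])
  show ?thesis
    unfolding pairing_def s
    by (rule index_pairing[OF F(1-5) _ _ F(6)]) (use dat X in \<open>auto simp: index_data_def lifts_def s\<close>)
qed

lemma boundary_odd_trace:
  assumes s: "alg_hom s" "\<And>u. ea (me (s u)) = tensor_mult u"
    and lift: "invertible_lift l g X Y" and g: "g \<in> carrier_mat l l" and k: "J \<le> k"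
  shows "odd_trace (\<lambda>\<omega>. T (s (b_bar \<omega>))) (Y k) (X k) = - chi (stabilize g)"
proof -
  have X: "X k \<in> carrier_mat l l" and Y: "Y k \<in> carrier_mat l l"
    using lift by (simp_all add: invertible_lift_def Let_def pro_mat_def)
  have "clinear s" using s(1) by (simp add: alg_hom_def)
  then have lin: "clinear (T \<circ> s)" using T_lin by (rule Vector_Spaces.linear_compose)
  have T0: "T 0 = 0" by (rule clinear_functionalD(3)[OF T_lin])
  have "odd_trace (\<lambda>\<omega>. T (s (b_bar \<omega>))) (Y k) (X k) =
      mtrace (T \<circ> s) (of_mat (Y k) * of_mat (X k)) - mtrace (T \<circ> s) (of_mat (X k) * of_mat (Y k))"
    by (rule odd_trace_b_bar[OF lin _ Y X]) simp
  also have "\<dots> = - chi (stabilize g)"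
    using odd_pairing[OF s lift g k]
    by (simp add: t_def mtrace_imat_map[where T = T, OF s(1) T0, symmetric] imat_map_hom(3)[OF s(1)])
  finally show ?thesis .
qed

text \<open>In degree 2J the coefficient of a form lies in the \<open>J\<close>-th power of the
  ideal and is sent into \<open>SI\<close>, on which \<open>T\<close> is a trace; hence the cochain
  vanishes on that step.\<close>

lemma boundary_cocycle:
  assumes s: "alg_hom s" "\<And>u. ea (me (s u)) = tensor_mult u"
  shows "(\<lambda>\<omega>. T (s (b_bar \<omega>))) \<in> HP1_cocycles"
proof -
  have s': "clinear s" using s(1) by (simp add: alg_hom_def)
  have "clinear (T \<circ> (s \<circ> b_bar))"
    by (rule Vector_Spaces.linear_compose[OF Vector_Spaces.linear_compose[OF clinear_b_bar s'] T_lin])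
  then have lin: "clinear (\<lambda>\<omega>. T (s (b_bar \<omega>)))" by (simp add: o_def)
  have "s ` J_tensor \<subseteq> ideal_sum R N"
    using s(2) kernel_RN by (auto simp: J_tensor_def)
  then have sJ: "s ` ideal_pow J_tensor J \<subseteq> SI"
    using alg_hom_ideal_pow[OF s(1) _ RN_ideal, of J_tensor J] ideal_pow_SI by blast
  have vanish: "T (s (b_bar \<omega>)) = 0" if "\<omega> \<in> F_odd J_tensor (2 * J)" for \<omega>
  proof -
    have "\<omega> \<in> cvec.span {nat_form x y | x y. x \<in> ideal_pow_plus J_tensor J \<and> y \<in> UNIV}"
      using that by (simp add: F_odd_def Let_def nat_forms_on_def)
    moreover have "J \<noteq> 0" using J_pos by simp
    ultimately have "T (s (b_bar \<omega>)) = 0"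
    proof (induction rule: cvec.span_induct_alt)
      case base
      show ?case by (rule clinear_functionalD(3)[OF lin])
    next
      case (step c x w)
      then obtain u v where x: "x = nat_form (of_alg u) v" "u \<in> ideal_pow J_tensor J"
        by (auto simp: ideal_pow_plus_def)
      have "T (s u * s v) = T (s v * s u)" using x(2) sJ by (intro T_SI) auto
      then have "T (s (b_bar x)) = 0"
        by (simp add: x b_bar_form unitz_simps alg_homD[OF s(1)] clinear_functionalD[OF T_lin])
      then show ?case using step by (simp add: clinear_functionalD[OF lin])
    qed
    then show ?thesis .
  qed
  show ?thesis
    unfolding HP1_cocycles_def cochain_UNIV
    using lin vanish by (auto simp: b_bar_nat_d alg_homD(4)[OF s(1)] clinear_functionalD(3)[OF T_lin])
qed

text \<open>The class in K_0 may come from another matrix representing the same class of K_1 and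
  from another idempotent; \<open>additive_on_K1\<close> and \<open>K0_invariance\<close> remove
  these two ambiguities.\<close>

lemma even_pairing_value:
  assumes ren: "renormalization R N (4 * n + 1) \<tau> T" and \<kappa>: "\<kappa> \<in> carrier K1" "g \<in> \<Union>\<kappa>"
    and ex_lift: "\<And>k h. h \<in> carrier_mat k k \<Longrightarrow> h * h = h \<Longrightarrow> \<exists>X. idempotent_lift rm rb N k h X"
    and X: "idempotent_lift rm rb N k e X" and e: "e \<in> carrier_mat k k" "mat_in UNIV (e - p_mat l k)"
    and l: "l \<le> k" and Ind: "(e, p_mat l k) \<in> Ind be ea \<kappa>"
  shows "\<forall>\<^sub>F i in sequentially. even_trace (\<tau> \<circ> rm) ((X i - p_mat l k) ^\<^sub>m (2 * n + 1)) = - chi (stabilize g)"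
proof -
  obtain l\<^sub>1 g\<^sub>1 g' Q P G' e\<^sub>1 where rel: "((e\<^sub>1, p_mat l\<^sub>1 (l\<^sub>1 + l\<^sub>1)), (e, p_mat l k)) \<in> K0_rel"
    and g1: "g\<^sub>1 \<in> \<Union>\<kappa>" "g\<^sub>1 \<in> GL l\<^sub>1" and dat: "index_data be ea l\<^sub>1 g\<^sub>1 g' Q P G' e\<^sub>1"
    using Ind unfolding Ind_eq by blast
  have e1: "e\<^sub>1 \<in> carrier_mat (l\<^sub>1 + l\<^sub>1) (l\<^sub>1 + l\<^sub>1)" using dat by (simp add: index_data_def)
  have ex: "\<exists>H. lifts k h H" if "h \<in> carrier_mat k k" "h * h = h" for k h
    using ex_lift[OF that] idempotent_lift_lifts[OF _ that(1) order_refl] by blast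
  obtain X\<^sub>1 where X1: "lifts (l\<^sub>1 + l\<^sub>1) e\<^sub>1 X\<^sub>1" using ex[OF e1 index_data_facts(7)[OF g1(2) dat]] by blast
  have "pairing e\<^sub>1 X\<^sub>1 = - chi (stabilize g)"
    using pairing_index[OF g1(2) dat X1] additive_on_K1[OF chi_GL_image \<kappa>(1) g1(1) \<kappa>(2)] by simp
  then have val: "pairing e X' = - chi (stabilize g)" if "lifts k e X'" for X'
    using K0_invariance[OF rel _ l X1 that ex] by simp
  have "even_trace (\<tau> \<circ> rm) ((X i - p_mat l k) ^\<^sub>m (2 * n + 1)) = - chi (stabilize g)" if i: "K \<le> i" for i
  proof -
    obtain i' where i': "i = Suc i'" using i K_pos by (cases i) auto
    have Xc: "X i \<in> carrier_mat k k" and mX: "map_mat (unitz_map rb) (X i) = e"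
      using X by (auto simp: idempotent_lift_def pro_mat_def Let_def i')
    have c: "X i - p_mat l k \<in> carrier_mat k k" using p_mat_carrier by (rule minus_carrier_mat)
    have "imat_map rb (of_mat (X i - p_mat l k)) = of_mat (e - p_mat l k)"
      by (simp add: of_mat_diff[OF Xc p_mat_carrier] of_mat_diff[OF e(1) p_mat_carrier] imat_map_hom[OF rb(1)]
          imat_map_of_mat[OF rb(1)] map_mat_p_mat[OF rb(1)] mX)
    then have "of_mat (X i - p_mat l k) \<in> mat_on UNIV"
      using e(2) by (simp add: mat_in_iff flip: imat_map_mat_on_UNIV[OF rb(1)])
    from mat_on_power[OF alg_ideal_UNIV this, of "2 * n"]
    \<comment> \<open>The cocycle agrees with \<open>T\<close> only on R^(2n+1), so the entries of
      the power must be recognized as sums of (2n+1)-fold products.\<close>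
    have w: "of_mat ((X i - p_mat l k) ^\<^sub>m Suc (2 * n)) \<in> mat_on (ideal_pow UNIV (Suc (2 * n)))"
      by (simp only: of_mat_power[OF c])
    have eq: "(T \<circ> rm) a = (\<tau> \<circ> rm) a" if "a \<in> ideal_pow UNIV (Suc (2 * n))" for a
    proof -
      have "rm a \<in> ideal_pow R (2 * n + 1)"
        using alg_hom_ideal_pow[OF rm(1) _ rm(3), of UNIV "Suc (2 * n)"] that by (auto simp del: ideal_pow.simps)
      then show ?thesis using ren unfolding renormalization_def F_even_odd_degree o_def by blast
    qed
    have T0: "(T \<circ> rm) 0 = 0" by (simp add: alg_homD(4)[OF rm(1)] clinear_functionalD(3)[OF T_lin])
    moreover have "(T \<circ> rm) 0 = (\<tau> \<circ> rm) 0" by (rule eq[OF alg_idealD(4)[OF alg_ideal_pow[OF alg_ideal_UNIV]]])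
    ultimately have \<tau>0: "(\<tau> \<circ> rm) 0 = 0" by simp
    have "even_trace (\<tau> \<circ> rm) ((X i - p_mat l k) ^\<^sub>m Suc (2 * n)) = even_trace (T \<circ> rm) ((X i - p_mat l k) ^\<^sub>m Suc (2 * n))"
      unfolding even_trace_of_mat[where T = "T \<circ> rm", OF pow_carrier_mat[OF c] T0]
        even_trace_of_mat[where T = "\<tau> \<circ> rm", OF pow_carrier_mat[OF c] \<tau>0]
      by (rule mtrace_cong[OF w eq, symmetric])
    then show ?thesis
      using even_trace_pairing[OF Xc e] val[OF idempotent_lift_lifts[OF X e(1) i]] by simp
  qed
  then show ?thesis by (auto simp: eventually_sequentially)
qed

lemma odd_pairing_value:
  assumes \<sigma>: "clinear \<sigma>" "\<And>a. ea (me (\<sigma> a)) = a" and rel: "(boundary_cochain \<sigma> T, \<phi>) \<in> HP1_rel"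
    and \<kappa>: "\<kappa> \<in> carrier K1" "g \<in> \<Union>\<kappa>" "h \<in> \<Union>\<kappa>" and h: "h \<in> GL k" and lift: "invertible_lift k h X Y"
  shows "\<forall>\<^sub>F i in sequentially. odd_trace \<phi> (Y i) (X i) = - chi (stabilize g)"
proof -
  note s = splitting_hom[OF \<sigma>]
  have "odd_trace (boundary_cochain \<sigma> T) (Y i) (X i) = - chi (stabilize g)" if "J \<le> i" for i
    using boundary_odd_trace[OF s lift GL_carrier[OF h] that] additive_on_K1[OF chi_GL_image \<kappa>]
    by (simp add: boundary_cochain_eq[OF \<sigma>])
  then have "\<forall>\<^sub>F i in sequentially. odd_trace (boundary_cochain \<sigma> T) (Y i) (X i) = - chi (stabilize g)"
    by (auto simp: eventually_sequentially)
  from eventually_conj[OF this HP1_odd_trace[OF rel lift]] show ?thesis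
    by (rule eventually_mono) metis
qed

lemma tensor_value:
  assumes rep: "represents be ea R N me (4 * n + 1) \<tau> \<beta>" and ren: "renormalization R N (4 * n + 1) \<tau> T"
    and f: "f \<in> \<beta>" and g: "g \<in> GL l" and dat: "index_data be ea l g g' Q P G' e"
    and Y: "pro_mat (ideal_pow J_tensor) (l + l) Y" "\<And>i. mat_in (ideal_pow J_tensor i) (Y i * Y i - Y i)"
      "\<And>i. map_mat (unitz_map tensor_mult) (Y i) = e"
  shows "\<forall>\<^sub>F i in sequentially. even_trace f (Y i - p_mat l (l + l)) = - chi (stabilize g)"
proof -
  have ec: "e \<in> carrier_mat (l + l) (l + l)" using dat by (simp add: index_data_def)
  have l: "l \<le> l + l" by simp
  obtain X where X: "idempotent_lift rm rb N (l + l) e X"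
    and ev: "\<forall>\<^sub>F i in sequentially. pairing e (map_mat (unitz_map rm) (X i)) = even_trace f (Y i - p_mat l (l + l))"
    by (rule tensor_comparison[OF rep ren f l ec index_data_facts(8)[OF g dat] Y])
  have "\<forall>\<^sub>F i in sequentially. pairing e (map_mat (unitz_map rm) (X i)) = - chi (stabilize g)"
    using pairing_index[OF g dat idempotent_lift_lifts[OF X ec]] by (auto simp: eventually_sequentially)
  from eventually_conj[OF ev this] show ?thesis by (rule eventually_mono) metis
qed

end

lemma eventually_const_unique:
  assumes "\<forall>\<^sub>F i in sequentially. u i = (a::'c)" "\<forall>\<^sub>F i in sequentially. u i = b"
  shows "a = b"
proof -
  have "\<forall>\<^sub>F i in sequentially. a = b" using eventually_conj[OF assms] by (rule eventually_mono) metis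
  then show ?thesis by simp
qed

lemma ex_splitting:
  assumes "alg_hom p" "surj p"
  obtains \<sigma> where "clinear \<sigma>" "\<And>a. p (\<sigma> a) = a"
proof -
  have "clinear p" using assms(1) by (simp add: alg_hom_def)
  from cpair.linear_surjective_right_inverse[OF this assms(2)]
  obtain \<sigma> where "clinear \<sigma>" "p \<circ> \<sigma> = id" by blast
  then show ?thesis using that by (metis comp_apply id_apply)
qed

lemma the_elem_eqI:
  assumes "x \<in> A" "\<And>y. y \<in> A \<Longrightarrow> y = x"
  shows "the_elem A = x"
proof -
  have "A = {x}" using assms by blast
  then show ?thesis by simp
qed

theorem theorem4p3:
  fixes jn :: "'j::complex_alg \<Rightarrow> 'n::complex_alg" and nq :: "'n \<Rightarrow> 'q::complex_alg"
    and rm :: "'r::complex_alg \<Rightarrow> 'm::complex_alg" and mp :: "'m \<Rightarrow> 'p::complex_alg"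
    and be :: "'b::complex_alg \<Rightarrow> 'e::complex_alg" and ea :: "'e \<Rightarrow> 'a::complex_alg"
    and jr :: "'j \<Rightarrow> 'r" and rb :: "'r \<Rightarrow> 'b"
    and nm :: "'n \<Rightarrow> 'm" and me :: "'m \<Rightarrow> 'e"
    and qp :: "'q \<Rightarrow> 'p" and pa :: "'p \<Rightarrow> 'a"
    and n :: nat and \<tau> :: "'m \<Rightarrow> complex"
    and \<beta> :: "('b tensor \<Rightarrow> complex) set" and \<kappa> :: "'a unitz mat set set"
  assumes "lifting jn nq rm mp be ea jr rb nm me qp pa"
    and "even_cocycle (range rm) (range nm) (4 * n + 1) \<tau>"
    and "represents be ea (range rm) (range nm) me (4 * n + 1) \<tau> \<beta>"
    and "\<kappa> \<in> carrier K1"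
  shows "HP0_K0_pairing be ea rm rb (range nm) me \<beta> (Ind be ea \<kappa>) =
    csqrt (2 * complex_of_real pi * \<i>) *
      HP1_K1_pairing (E_star be ea (range rm) (range nm) me \<beta>) \<kappa>"
proof -
  interpret lifted_extension be ea rm rb me "range nm"
    by (rule lifting_lifted_extension[OF assms(1)])
  let ?N = "range nm"
  let ?rep = "\<lambda>n \<tau>. represents be ea R ?N me (4 * n + 1) \<tau> \<beta>"
  note rep = assms(3) and \<kappa> = assms(4)
  obtain f where f: "f \<in> \<beta>" using rep unfolding represents_def by blast
  obtain \<rho> where \<rho>: "classifying_hom ea R me \<rho>" using rep unfolding represents_def by blast
  obtain l g where g: "g \<in> \<Union>\<kappa>" "g \<in> GL l" using ex_in_K1_class[OF \<kappa>] .
  obtain g' Q P G' e where dat: "index_data be ea l g g' Q P G' e"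
    by (rule ex_Ind_data[OF ext g(2,1)]) (auto simp: index_data_def intro: that)
  note F = index_data_facts[OF g(2) dat]
  have ec: "e \<in> carrier_mat (l + l) (l + l)" using dat by (simp add: index_data_def)
  have ex_Y: "\<exists>Y. pro_mat (ideal_pow J_tensor) k Y \<and> (\<forall>i. mat_in (ideal_pow J_tensor i) (Y i * Y i - Y i)) \<and>
    (\<forall>i. map_mat (unitz_map tensor_mult) (Y i) = h)" if "h \<in> carrier_mat k k" "h * h = h" for h :: "'b unitz mat" and k
    by (rule ex_idempotent_lift[OF alg_hom_tensor_mult surj_tensor_mult that]) (auto simp: J_tensor_def)
  obtain Y where Y: "pro_mat (ideal_pow J_tensor) (l + l) Y" "\<And>i. mat_in (ideal_pow J_tensor i) (Y i * Y i - Y i)"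
    "\<And>i. map_mat (unitz_map tensor_mult) (Y i) = e"
    using ex_Y[OF ec F(7)] by blast
  obtain \<zeta> where \<zeta>: "alg_hom \<zeta>" "\<And>u. rm (\<zeta> u) = \<rho> (tensor_map be u)" "\<And>u. rb (\<zeta> u) = tensor_mult u"
    by (rule ex_tensor_hom[OF \<rho>]) (rule that)
  have ex_lift: "\<exists>X. idempotent_lift rm rb ?N k h X" if "h \<in> carrier_mat k k" "h * h = h" for h k
    using ex_Y[OF that] idempotent_lift_tensor[OF \<rho> \<zeta>] by metis
  \<comment> \<open>Four properties of one choice of degree, cocycle and renormalization, sharing
    the number \<open>v\<close>. The first one involves none of these three, only the fixed
    \<open>f\<close> and \<open>Y\<close>, and so forces \<open>v\<close> to be the same for all
    choices.\<close>
  define common_value where "common_value n \<tau> T v \<longleftrightarrow>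
      (\<forall>\<^sub>F i in sequentially. even_trace f (Y i - p_mat l (l + l)) = v) \<and>
      (\<forall>k e l X. idempotent_lift rm rb ?N k e X \<longrightarrow> e \<in> carrier_mat k k \<longrightarrow> mat_in UNIV (e - p_mat l k) \<longrightarrow>
        l \<le> k \<longrightarrow> (e, p_mat l k) \<in> Ind be ea \<kappa> \<longrightarrow>
        (\<forall>\<^sub>F i in sequentially. even_trace (\<tau> \<circ> rm) ((X i - p_mat l k) ^\<^sub>m (2 * n + 1)) = v)) \<and>
      (\<forall>\<sigma> \<phi> h k X Y. clinear \<sigma> \<longrightarrow> (\<forall>a. ea (me (\<sigma> a)) = a) \<longrightarrow> (boundary_cochain \<sigma> T, \<phi>) \<in> HP1_rel \<longrightarrow>
        h \<in> \<Union>\<kappa> \<longrightarrow> h \<in> GL k \<longrightarrow> invertible_lift k h X Y \<longrightarrow>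
        (\<forall>\<^sub>F i in sequentially. odd_trace \<phi> (Y i) (X i) = v)) \<and>
      (\<forall>\<sigma>. clinear \<sigma> \<longrightarrow> (\<forall>a. ea (me (\<sigma> a)) = a) \<longrightarrow> boundary_cochain \<sigma> T \<in> HP1_cocycles)"
    for n \<tau> T v
  have key: "\<exists>v. common_value n \<tau> T v"
    if rep: "?rep n \<tau>" and ren: "renormalization R ?N (4 * n + 1) \<tau> T" for n \<tau> T
  proof -
    have "even_cocycle R ?N (4 * n + 1) \<tau>" using rep by (simp add: represents_def)
    then obtain K where "renormalized be ea rm rb me ?N n K T" by (rule renormalized_intro[OF _ ren])
    then interpret S: renormalized be ea rm rb me ?N n K T .
    show ?thesis
      unfolding common_value_def
    proof (intro exI[of _ "- S.chi (stabilize g)"] conjI allI impI)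
      show "\<forall>\<^sub>F i in sequentially. even_trace f (Y i - p_mat l (l + l)) = - S.chi (stabilize g)"
        by (rule S.tensor_value[OF rep ren f g(2) dat Y])
    next
      fix k e l X
      assume A: "idempotent_lift rm rb ?N k e X" "e \<in> carrier_mat k k" "mat_in UNIV (e - p_mat l k)" "l \<le> k"
        "(e, p_mat l k) \<in> Ind be ea \<kappa>"
      show "\<forall>\<^sub>F i in sequentially. even_trace (\<tau> \<circ> rm) ((X i - p_mat l k) ^\<^sub>m (2 * n + 1)) = - S.chi (stabilize g)"
        by (rule S.even_pairing_value[OF ren \<kappa> g(1) _ A]) (erule (1) ex_lift)
    next
      fix \<sigma> \<phi> h k X Y
      assume "clinear \<sigma>" "\<forall>a. ea (me (\<sigma> a)) = a" "(boundary_cochain \<sigma> T, \<phi>) \<in> HP1_rel" "h \<in> \<Union>\<kappa>" "h \<in> GL k"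
        "invertible_lift k h X Y"
      then show "\<forall>\<^sub>F i in sequentially. odd_trace \<phi> (Y i) (X i) = - S.chi (stabilize g)"
        using S.odd_pairing_value[OF _ _ _ \<kappa> g(1)] by blast
    next
      fix \<sigma> assume \<sigma>: "clinear \<sigma>" "\<forall>a. ea (me (\<sigma> a)) = a"
      then show "boundary_cochain \<sigma> T \<in> HP1_cocycles"
        using S.boundary_cocycle[OF splitting_hom] boundary_cochain_eq by simp
    qed
  qed
  obtain T where ren: "renormalization R ?N (4 * n + 1) \<tau> T" by (rule ex_renormalization[OF assms(2)])
  obtain v where "common_value n \<tau> T v" using key[OF rep ren] ..
  note v = this[unfolded common_value_def, THEN conjunct1]
    and even = this[unfolded common_value_def, THEN conjunct2, THEN conjunct1, rule_format]
    and odd = this[unfolded common_value_def, THEN conjunct2, THEN conjunct2, THEN conjunct1, rule_format]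
    and cocycle = this[unfolded common_value_def, THEN conjunct2, THEN conjunct2, THEN conjunct2, rule_format]
  have "HP0_K0_pairing be ea rm rb ?N me \<beta> (Ind be ea \<kappa>) = v"
    unfolding HP0_K0_pairing_def
  proof (rule the_elem_eqI)
    have idem: "e \<in> idempotents" "p_mat l (l + l) \<in> (idempotents :: 'b unitz mat set)"
      using ec F(7) by (auto simp: idempotents_def p_mat_idempotent carrier_matD[OF p_mat_carrier])
    have "(e, p_mat l (l + l)) \<in> K0_rel `` {(e, p_mat l (l + l))}" using K0_rel_refl[OF idem] by blast
    then have Ind: "(e, p_mat l (l + l)) \<in> Ind be ea \<kappa>" unfolding Ind_eq using g dat by blast
    obtain X where X: "idempotent_lift rm rb ?N (l + l) e X" using ex_lift[OF ec F(7)] by blast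
    have l: "l \<le> l + l" by simp
    have "\<forall>\<^sub>F i in sequentially. v = even_trace (\<tau> \<circ> rm) ((X i - p_mat l (l + l)) ^\<^sub>m (2 * n + 1))"
      using even[OF X ec F(8) l Ind] by (rule eventually_mono) simp
    then show "v \<in> {c. \<exists>n \<tau> l K e X. ?rep n \<tau> \<and> l \<le> K \<and> e \<in> carrier_mat K K \<and> e * e = e \<and> mat_in UNIV (e - p_mat l K) \<and>
        (e, p_mat l K) \<in> Ind be ea \<kappa> \<and> idempotent_lift rm rb ?N K e X \<and>
        (\<forall>\<^sub>F k in sequentially. c = even_trace (\<tau> \<circ> rm) ((X k - p_mat l K) ^\<^sub>m (2 * n + 1)))}"
      using rep l ec F(7,8) Ind X by blast
  next
    fix c assume "c \<in> {c. \<exists>n \<tau> l K e X. ?rep n \<tau> \<and> l \<le> K \<and> e \<in> carrier_mat K K \<and> e * e = e \<and> mat_in UNIV (e - p_mat l K) \<and>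
        (e, p_mat l K) \<in> Ind be ea \<kappa> \<and> idempotent_lift rm rb ?N K e X \<and>
        (\<forall>\<^sub>F k in sequentially. c = even_trace (\<tau> \<circ> rm) ((X k - p_mat l K) ^\<^sub>m (2 * n + 1)))}"
    then obtain n' \<tau>' l' k' e' X' where c: "?rep n' \<tau>'" "l' \<le> k'" "e' \<in> carrier_mat k' k'" "mat_in UNIV (e' - p_mat l' k')"
      "(e', p_mat l' k') \<in> Ind be ea \<kappa>" "idempotent_lift rm rb ?N k' e' X'"
      "\<forall>\<^sub>F k in sequentially. c = even_trace (\<tau>' \<circ> rm) ((X' k - p_mat l' k') ^\<^sub>m (2 * n' + 1))"
      by blast
    have "even_cocycle R ?N (4 * n' + 1) \<tau>'" using c(1) by (simp add: represents_def)
    then obtain T' where ren': "renormalization R ?N (4 * n' + 1) \<tau>' T'" by (rule ex_renormalization)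
    obtain v' where V: "common_value n' \<tau>' T' v'" using key[OF c(1) ren'] ..
    note v' = V[unfolded common_value_def, THEN conjunct1]
    have "\<forall>\<^sub>F k in sequentially. even_trace (\<tau>' \<circ> rm) ((X' k - p_mat l' k') ^\<^sub>m (2 * n' + 1)) = v'"
      by (rule V[unfolded common_value_def, THEN conjunct2, THEN conjunct1, rule_format, OF c(6,3,4,2,5)])
    moreover have "\<forall>\<^sub>F k in sequentially. even_trace (\<tau>' \<circ> rm) ((X' k - p_mat l' k') ^\<^sub>m (2 * n' + 1)) = c"
      using c(7) by (rule eventually_mono) simp
    ultimately have "v' = c" by (rule eventually_const_unique)
    moreover have "v' = v" by (rule eventually_const_unique[OF v' v])
    ultimately show "c = v" by simp
  qed
  moreover have "HP1_K1_pairing (E_star be ea R ?N me \<beta>) \<kappa> = 1 / csqrt (2 * complex_of_real pi * \<i>) * v"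
    unfolding HP1_K1_pairing_def
  proof (rule the_elem_eqI)
    obtain \<sigma> where \<sigma>: "clinear \<sigma>" "\<forall>a. ea (me (\<sigma> a)) = a"
    proof -
      have "surj (ea \<circ> me)" using me(2) ea(2) by (rule comp_surj)
      from ex_splitting[OF ea_me this] show ?thesis using that by (metis comp_apply)
    qed
    have \<sigma>2: "ea (me (\<sigma> a)) = a" for a using \<sigma>(2) by blast
    have refl: "(boundary_cochain \<sigma> T, boundary_cochain \<sigma> T) \<in> HP1_rel"
      using cocycle[OF \<sigma>(1) \<sigma>2] by (auto simp: HP1_rel_def cochain_def intro!: exI[of _ "\<lambda>_. 0"])
    then have mem: "boundary_cochain \<sigma> T \<in> E_star be ea R ?N me \<beta>"
      unfolding E_star_def using rep ren \<sigma> by blast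
    obtain X Y' where XY: "pro_mat (ideal_pow J_tensor) l (\<lambda>_. X)" "pro_mat (ideal_pow J_tensor) l Y'"
      "mat_in UNIV (X - 1\<^sub>m l)" "\<And>k. mat_in UNIV (Y' k - 1\<^sub>m l)"
      "\<And>k. mat_in (ideal_pow J_tensor k) (X * Y' k - 1\<^sub>m l)" "\<And>k. mat_in (ideal_pow J_tensor k) (Y' k * X - 1\<^sub>m l)"
      "map_mat (unitz_map tensor_mult) X = g"
    proof -
      have "mat_in UNIV (g - 1\<^sub>m l)" using g(2) by (simp add: GL_def)
      from ex_invertible_lift[OF alg_hom_tensor_mult surj_tensor_mult F(1-4) this, folded J_tensor_def]
      show ?thesis using that by blast
    qed
    then have lift: "invertible_lift l g (\<lambda>_. X) Y'" by (simp add: invertible_lift_def Let_def)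
    have "\<forall>\<^sub>F k in sequentially. 1 / csqrt (2 * complex_of_real pi * \<i>) * v =
        1 / csqrt (2 * complex_of_real pi * \<i>) * odd_trace (boundary_cochain \<sigma> T) (Y' k) X"
      using odd[OF \<sigma>(1) \<sigma>2 refl g lift] by (rule eventually_mono) simp
    then show "1 / csqrt (2 * complex_of_real pi * \<i>) * v \<in> {c. \<exists>\<phi> K g X Y. \<phi> \<in> E_star be ea R ?N me \<beta> \<and> g \<in> \<Union>\<kappa> \<and> g \<in> GL K \<and>
        invertible_lift K g X Y \<and>
        (\<forall>\<^sub>F k in sequentially. c = 1 / csqrt (2 * complex_of_real pi * \<i>) * odd_trace \<phi> (Y k) (X k))}"
      using mem g lift by blast
  next
    fix c assume "c \<in> {c. \<exists>\<phi> K g X Y. \<phi> \<in> E_star be ea R ?N me \<beta> \<and> g \<in> \<Union>\<kappa> \<and> g \<in> GL K \<and>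
        invertible_lift K g X Y \<and>
        (\<forall>\<^sub>F k in sequentially. c = 1 / csqrt (2 * complex_of_real pi * \<i>) * odd_trace \<phi> (Y k) (X k))}"
    then obtain \<phi> k h X' Y' where c: "\<phi> \<in> E_star be ea R ?N me \<beta>" "h \<in> \<Union>\<kappa>" "h \<in> GL k" "invertible_lift k h X' Y'"
      "\<forall>\<^sub>F i in sequentially. c = 1 / csqrt (2 * complex_of_real pi * \<i>) * odd_trace \<phi> (Y' i) (X' i)"
      by blast
    obtain m \<tau>' T' \<sigma> where m: "represents be ea R ?N me m \<tau>' \<beta>" "renormalization R ?N m \<tau>' T'" "clinear \<sigma>"
      "\<forall>a. ea (me (\<sigma> a)) = a" "(boundary_cochain \<sigma> T', \<phi>) \<in> HP1_rel"
      using c(1) unfolding E_star_def by blast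
    \<comment> \<open>A cocycle of arbitrary degree m is restricted to degree 4m+1, the form
      required by \<open>key\<close>; its renormalization is unchanged.\<close>
    have le: "m \<le> 4 * m + 1" by simp
    have rep': "?rep m \<tau>'" by (rule represents_mono[OF ea(1) rm(3) le m(1)])
    have ren': "renormalization R ?N (4 * m + 1) \<tau>' T'"
      using m(2) F_even_antimono[OF rm(3) le] unfolding renormalization_def by blast
    obtain v' where V: "common_value m \<tau>' T' v'" using key[OF rep' ren'] ..
    note v' = V[unfolded common_value_def, THEN conjunct1]
    have o: "\<forall>\<^sub>F i in sequentially. odd_trace \<phi> (Y' i) (X' i) = v'"
      using V m(3-5) c(2-4) unfolding common_value_def by blast
    have "v' = v" by (rule eventually_const_unique[OF v' v])
    then have "\<forall>\<^sub>F i in sequentially. 1 / csqrt (2 * complex_of_real pi * \<i>) * odd_trace \<phi> (Y' i) (X' i) =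
        1 / csqrt (2 * complex_of_real pi * \<i>) * v"
      using o by (auto elim: eventually_mono)
    moreover have "\<forall>\<^sub>F i in sequentially. 1 / csqrt (2 * complex_of_real pi * \<i>) * odd_trace \<phi> (Y' i) (X' i) = c"
      using c(5) by (rule eventually_mono) simp
    ultimately show "c = 1 / csqrt (2 * complex_of_real pi * \<i>) * v"
      by (rule eventually_const_unique[symmetric])
  qed
  moreover have "csqrt (2 * complex_of_real pi * \<i>) \<noteq> 0" by simp
  ultimately show ?thesis by simp
qed

end
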